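(* Let $R$ be a commutative ring with $6\in R^*$, let $B$ be a Brown algebra over $R$ containing $j\in B^-$ with $j^2=\mu1_B$, $\mu\in R^*$, and set $L=L(B)$, $Q=Q(B,j)$, $\mathbf{G}=\mathbf{Aut}(L)$. Under the action of $\mathbf{G}$ on $\mathbf{Y}^L$ given by $\phi\cdot(x,y)=(\phi(x),\phi(y))$, the stabilizer of $(1_+,\mu^{-1}1_-)$ is $\mathbf{Inv}(Q)$.
   Context: Conventions. All rings are commutative, associative and unital; $R$ is a ring with $6\in R^*$. An $R$-ring is a commutative associative unital $R$-algebra; for an $R$-module $M$ and an $R$-ring $S$, $M_S=M\otimes_RS$. For an $R$-algebra $C$, $\mathbf{Aut}(C)$ is the affine $R$-group scheme $S\mapsto\mathrm{Aut}(C_S)$ (ungraded automorphisms). Brown algebras. The split Albert algebra over $R$ is the module of tuples $(\alpha_1,\alpha_2,\alpha_3;c_1,c_2,c_3)$ with $\alpha_i\in R$ and $c_i$ in the split octonion algebra (norm $n$, polar form $n(c,d)=n(c+d)-n(c)-n(d)$, conjugation $c\mapsto\bar c$), with adjoint $x^\#=(\alpha_j\alpha_l-n(c_i);\ \overline{c_jc_l}-\alpha_ic_i)_{i}$ for $(i,j,l)$ running over the cyclic permutations of $(1,2,3)$, cross product $x\times y=(x+y)^\#-x^\#-y^\#$ and bilinear trace $T(x,y)=\sum_i\alpha_i\beta_i+\sum_i n(c_i,d_i)$ for $y=(\beta_i;d_i)$. With $A$ the split Albert algebra, the split Brown algebra over $R$ is $\begin{pmatrix}R&A\\ A&R\end{pmatrix}$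 with product $\begin{pmatrix}r_1&a_1\\ a_2&r_2\end{pmatrix}\begin{pmatrix}r_1'&a_1'\\ a_2'&r_2'\end{pmatrix}=\begin{pmatrix}r_1r_1'+T(a_1,a_2')&r_1a_1'+r_2'a_1+a_2\times a_2'\\ r_2a_2'+r_1'a_2+a_1\times a_1'&r_2r_2'+T(a_2,a_1')\end{pmatrix}$ and involution $\begin{pmatrix}r_1&a_1\\ a_2&r_2\end{pmatrix}^*=\begin{pmatrix}r_2&a_1\\ a_2&r_1\end{pmatrix}$. A Brown algebra over $R$ is an $R$-algebra with involution, projective of constant rank 56, which becomes isomorphic (as algebra with involution) to the split one over some faithfully flat $R$-ring. Put $V_{x,y}z=(xy^* )z+(zy^* )x-(zx^* )y$ and $B^-=\{x\in B: x^*=-x\}$. Products of two elements of $B^-$ lie in $R1_B$, identified with $R$. TKK-construction. $L(B)=\bigoplus_{i=-2}^{2}L_i$ with $L_{\pm2}$ copies of $B^-$, $L_{\pm1}$ copies of $B$, and $L_0$ the $R$-span of all $V_{x,y}$, $x,y\in B$ (a Lie algebra under the commutator). The bracket is the antisymmetric bilinear map extending the commutator on $L_0$ with ($x_\pm,y_\pm,z_\pm\in L_{\pm1}$, $s_\pm,t_\pm\in L_{\pm2}$): $[V_{x,y},z_+]=V_{x,y}z_+$, $[V_{x,y},z_-]=-V_{y,x}z_-$, $[V_{x,y},s_+]=(s_+y)x^*+x(y^*s_+)$, $[V_{x,y},s_-]=-(s_-x)y^*-y(x^*s_-)$, $[x_\pm,y_\pm]=x_\pm y_\pm^*-y_\pm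 x_\pm^*\in L_{\pm2}$, $[x_+,y_-]=V_{x_+,y_-}$, $[s_+,t_-]=V_{s_+t_-,1}$, $[s_+,x_-]=s_+x_-\in L_1$, $[s_-,x_+]=s_-x_+\in L_{-1}$; brackets landing in degrees of absolute value $>2$ are $0$. It is a $\mathbb{Z}$-graded Lie algebra. Write $1_+$ (resp. $1_-$) for $j$ viewed in $L_2$ (resp. $L_{-2}$). Triple system and embedding. $b_j(x,y)=(xy^*-yx^* )j\in R$ and $t_j(x,y,z)=2V_{x,jy}z-b_j(y,z)x-b_j(y,x)z-b_j(x,z)y$; $Q(B,j)=(B,b_j,t_j)$. $\mathbf{Inv}(Q)(S)$ is the group of $\phi\in\mathrm{GL}(B_S)$ with $b_j(\phi x,\phi y)=b_j(x,y)$ and $\phi t_j(x,y,z)=t_j(\phi x,\phi y,\phi z)$ for all $x,y,z\in B_S$. Every such $\phi$ is an autotopy of $B_S$ (there is a linear bijection $\widehat\phi$ with $\phi V_{x,y}=V_{\phi(x),\widehat\phi(y)}\phi$ for all $x,y$), and restriction to $L_1=B$ is an isomorphism from the group scheme of graded automorphisms of $L(B)$ to the group scheme $\mathbf{Str}(B)$ of autotopies; via the inverse of this isomorphism, $\mathbf{Inv}(Q)\subseteq\mathbf{Str}(B)$ is regarded as a subgroup of $\mathbf{G}$. Extremal elements. For an $R$-ring $S$, $x\in L_S$ is unimodular if $\alpha(x)=1$ for some linear form $\alpha$ on $L_S$; it is extremal if it is unimodular and $[x,[x,y]]\in Sx$ for all $y\in L_S$; then $r_x(y)\in S$ is the unique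 scalar with $[x,[x,y]]=r_x(y)x$. $\mathbf{Y}^L(S)$ is the set of pairs $(x,y)$ of extremal elements of $L_S$ with $r_x(y)=-2$. *)

theory Defs
  imports "HOL-Algebra.Module" "HOL-Algebra.QuotRing" "HOL-Algebra.Group_Action"
begin

section \<open>Linear algebra over a commutative ring\<close>

text \<open>Throughout, non-associative algebras are represented by the record type \<open>module\<close>: the
  field \<open>mult\<close> is the (possibly non-associative) product. An \<open>R\<close>-ring is an \<open>S\<close> with
  \<open>algebra R S\<close>.\<close>

definition lin_maps ::
  "('r, 'w) ring_scheme \<Rightarrow> ('r, 'm, 'x) module_scheme \<Rightarrow> ('r, 'n, 'y) module_scheme \<Rightarrow> ('m \<Rightarrow> 'n) set"
  where "lin_maps R M N = {f \<in> carrier M \<rightarrow> carrier N.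
      (\<forall>x\<in>carrier M. \<forall>y\<in>carrier M. f (x \<oplus>\<^bsub>M\<^esub> y) = f x \<oplus>\<^bsub>N\<^esub> f y) \<and>
      (\<forall>r\<in>carrier R. \<forall>x\<in>carrier M. f (r \<odot>\<^bsub>M\<^esub> x) = r \<odot>\<^bsub>N\<^esub> f x)}"

definition lin_forms :: "('r, 'w) ring_scheme \<Rightarrow> ('r, 'm, 'x) module_scheme \<Rightarrow> ('m \<Rightarrow> 'r) set"
  where "lin_forms R M = {f \<in> carrier M \<rightarrow> carrier R.
      (\<forall>x\<in>carrier M. \<forall>y\<in>carrier M. f (x \<oplus>\<^bsub>M\<^esub> y) = f x \<oplus>\<^bsub>R\<^esub> f y) \<and>
      (\<forall>r\<in>carrier R. \<forall>x\<in>carrier M. f (r \<odot>\<^bsub>M\<^esub> x) = r \<otimes>\<^bsub>R\<^esub> f x)}"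

definition lin_span :: "('r, 'w) ring_scheme \<Rightarrow> ('r, 'm, 'x) module_scheme \<Rightarrow> 'm set \<Rightarrow> 'm set"
  where "lin_span R M X = \<Inter>{N. submodule N R M \<and> X \<subseteq> N}"

definition free_of_rank :: "('r, 'w) ring_scheme \<Rightarrow> ('r, 'm, 'x) module_scheme \<Rightarrow> nat \<Rightarrow> bool"
  where "free_of_rank R M n \<longleftrightarrow> (\<exists>e \<in> {..<n} \<rightarrow> carrier M. \<forall>x\<in>carrier M.
      \<exists>!c. c \<in> {..<n} \<rightarrow>\<^sub>E carrier R \<and> x = (\<Oplus>\<^bsub>M\<^esub>i\<in>{..<n}. c i \<odot>\<^bsub>M\<^esub> e i))"

text \<open>Finitely generated projective: a direct summand of a free module of finite rank. The type
  of \<open>F\<close> can hold the free modules of every finite rank over \<open>R\<close>.\<close>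

definition fg_projective :: "('r, 'w) ring_scheme \<Rightarrow> ('r, 'm, 'x) module_scheme \<Rightarrow> bool"
  where "fg_projective R M \<longleftrightarrow> module R M \<and>
      (\<exists>n (F :: ('r, nat \<Rightarrow> 'r) module). module R F \<and> free_of_rank R F n \<and>
        (\<exists>i \<in> lin_maps R M F. \<exists>p \<in> lin_maps R F M. \<forall>x\<in>carrier M. p (i x) = x))"


section \<open>Base change\<close>

definition single :: "('s, 'w) ring_scheme \<Rightarrow> 'm \<Rightarrow> 's \<Rightarrow> 'm \<Rightarrow> 's"
  where "single S m s = (\<lambda>k. if k = m then s else \<zero>\<^bsub>S\<^esub>)"

text \<open>The free \<open>S\<close>-module on the set \<open>carrier M\<close>, with the product of \<open>M\<close> extended bilinearly.\<close>

definition formal_combs ::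
  "('s, 'w) ring_scheme \<Rightarrow> ('r, 'm, 'x) module_scheme \<Rightarrow> ('s, 'm \<Rightarrow> 's) module"
  where "formal_combs S M =
    \<lparr>carrier = {f. range f \<subseteq> carrier S \<and> {m. f m \<noteq> \<zero>\<^bsub>S\<^esub>} \<subseteq> carrier M \<and> finite {m. f m \<noteq> \<zero>\<^bsub>S\<^esub>}},
     mult = (\<lambda>f g k. \<Oplus>\<^bsub>S\<^esub>p\<in>{(a, b). f a \<noteq> \<zero>\<^bsub>S\<^esub> \<and> g b \<noteq> \<zero>\<^bsub>S\<^esub> \<and> a \<otimes>\<^bsub>M\<^esub> b = k}. f (fst p) \<otimes>\<^bsub>S\<^esub> g (snd p)),
     one = single S \<one>\<^bsub>M\<^esub> \<one>\<^bsub>S\<^esub>,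
     zero = (\<lambda>_. \<zero>\<^bsub>S\<^esub>),
     add = (\<lambda>f g m. f m \<oplus>\<^bsub>S\<^esub> g m),
     smult = (\<lambda>s f m. s \<otimes>\<^bsub>S\<^esub> f m)\<rparr>"

definition tensor_relations ::
  "('r, 'w) ring_scheme \<Rightarrow> ('r, 's, 'z) module_scheme \<Rightarrow> ('r, 'm, 'x) module_scheme \<Rightarrow> ('m \<Rightarrow> 's) set"
  where "tensor_relations R S M = lin_span S (formal_combs S M)
    ({single S (m \<oplus>\<^bsub>M\<^esub> m') \<one>\<^bsub>S\<^esub> \<ominus>\<^bsub>formal_combs S M\<^esub> single S m \<one>\<^bsub>S\<^esub> \<ominus>\<^bsub>formal_combs S M\<^esub> single S m' \<one>\<^bsub>S\<^esub> | m m'.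
        m \<in> carrier M \<and> m' \<in> carrier M} \<union>
     {single S (r \<odot>\<^bsub>M\<^esub> m) \<one>\<^bsub>S\<^esub> \<ominus>\<^bsub>formal_combs S M\<^esub> single S m (r \<odot>\<^bsub>S\<^esub> \<one>\<^bsub>S\<^esub>) | r m.
        r \<in> carrier R \<and> m \<in> carrier M})"

text \<open>\<open>base_change R S M\<close> is the \<open>S\<close>-algebra \<open>M \<otimes>\<^sub>R S\<close>, the quotient of \<open>formal_combs S M\<close> by
  \<open>tensor_relations R S M\<close>; an element is a coset.\<close>

definition base_change ::
  "('r, 'w) ring_scheme \<Rightarrow> ('r, 's, 'z) module_scheme \<Rightarrow> ('r, 'm, 'x) module_scheme \<Rightarrow>
    ('s, ('m \<Rightarrow> 's) set) module"
  where "base_change R S M = (let F = formal_combs S M; N = tensor_relations R S M in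
    \<lparr>carrier = a_rcosets\<^bsub>F\<^esub> N,
     mult = rcoset_mult F N,
     one = N +>\<^bsub>F\<^esub> \<one>\<^bsub>F\<^esub>,
     zero = N,
     add = set_add F,
     smult = (\<lambda>s X. \<Union>f\<in>X. N +>\<^bsub>F\<^esub> (s \<odot>\<^bsub>F\<^esub> f))\<rparr>)"

definition tensor ::
  "('r, 'w) ring_scheme \<Rightarrow> ('r, 's, 'z) module_scheme \<Rightarrow> ('r, 'm, 'x) module_scheme \<Rightarrow>
    'm \<Rightarrow> 's \<Rightarrow> ('m \<Rightarrow> 's) set"
  where "tensor R S M m s = tensor_relations R S M +>\<^bsub>formal_combs S M\<^esub> single S m s"

text \<open>The map \<open>f \<otimes> id\<close> from \<open>M \<otimes>\<^sub>R S\<close> to \<open>M' \<otimes>\<^sub>R S\<close>, for linear \<open>f\<close>.\<close>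

definition base_map ::
  "('r, 'w) ring_scheme \<Rightarrow> ('r, 's, 'z) module_scheme \<Rightarrow> ('r, 'm, 'x) module_scheme \<Rightarrow>
    ('r, 'n, 'y) module_scheme \<Rightarrow> ('m \<Rightarrow> 'n) \<Rightarrow> ('m \<Rightarrow> 's) set \<Rightarrow> ('n \<Rightarrow> 's) set"
  where "base_map R S M M' f X = (\<Union>g\<in>X. tensor_relations R S M' +>\<^bsub>formal_combs S M'\<^esub>
      (\<lambda>k. \<Oplus>\<^bsub>S\<^esub>m\<in>{m. g m \<noteq> \<zero>\<^bsub>S\<^esub> \<and> f m = k}. g m))"

definition exact_at ::
  "('r, 'm, 'x) module_scheme \<Rightarrow> ('r, 'n, 'y) module_scheme \<Rightarrow> ('r, 'p, 'z) module_scheme \<Rightarrow>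
    ('m \<Rightarrow> 'n) \<Rightarrow> ('n \<Rightarrow> 'p) \<Rightarrow> bool"
  where "exact_at M N P f g \<longleftrightarrow> f ` carrier M = {x \<in> carrier N. g x = \<zero>\<^bsub>P\<^esub>}"

text \<open>Faithful flatness: a sequence \<open>M \<rightarrow> N \<rightarrow> P\<close> is exact iff its base change is. As one cannot
  quantify over types, the modules range over those on the type \<open>(nat \<Rightarrow> 'r) set\<close>; up to
  isomorphism this includes all quotients of \<open>R\<^sup>n\<close> (take cosets) and all ideals of \<open>R\<close>, which
  suffice to test faithful flatness.\<close>

definition faithfully_flat :: "('r, 'w) ring_scheme \<Rightarrow> ('r, 's, 'z) module_scheme \<Rightarrow> bool"
  where "faithfully_flat R S \<longleftrightarrow>
    (\<forall>(M :: ('r, (nat \<Rightarrow> 'r) set) module) (N :: ('r, (nat \<Rightarrow> 'r) set) module)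
      (P :: ('r, (nat \<Rightarrow> 'r) set) module) f g.
      module R M \<and> module R N \<and> module R P \<and> f \<in> lin_maps R M N \<and> g \<in> lin_maps R N P \<longrightarrow>
      (exact_at M N P f g \<longleftrightarrow>
       exact_at (base_change R S M) (base_change R S N) (base_change R S P)
         (base_map R S M N f) (base_map R S N P g)))"

definition fraction :: "('r, 'w) ring_scheme \<Rightarrow> 'r set \<Rightarrow> 'r \<Rightarrow> 'r \<Rightarrow> ('r \<times> 'r) set"
  where "fraction R P a s = {(b, t). b \<in> carrier R \<and> t \<in> carrier R - P \<and>
      (\<exists>u \<in> carrier R - P. u \<otimes>\<^bsub>R\<^esub> (a \<otimes>\<^bsub>R\<^esub> t \<ominus>\<^bsub>R\<^esub> b \<otimes>\<^bsub>R\<^esub> s) = \<zero>\<^bsub>R\<^esub>)}"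

text \<open>The localization of \<open>R\<close> at the prime ideal \<open>P\<close>, as an \<open>R\<close>-ring.\<close>

definition localization :: "('r, 'w) ring_scheme \<Rightarrow> 'r set \<Rightarrow> ('r, ('r \<times> 'r) set) module"
  where "localization R P =
    \<lparr>carrier = {fraction R P a s | a s. a \<in> carrier R \<and> s \<in> carrier R - P},
     mult = (\<lambda>X Y. \<Union>(a, s)\<in>X. \<Union>(b, t)\<in>Y. fraction R P (a \<otimes>\<^bsub>R\<^esub> b) (s \<otimes>\<^bsub>R\<^esub> t)),
     one = fraction R P \<one>\<^bsub>R\<^esub> \<one>\<^bsub>R\<^esub>,
     zero = fraction R P \<zero>\<^bsub>R\<^esub> \<one>\<^bsub>R\<^esub>,
     add = (\<lambda>X Y. \<Union>(a, s)\<in>X. \<Union>(b, t)\<in>Y. fraction R P (a \<otimes>\<^bsub>R\<^esub> t \<oplus>\<^bsub>R\<^esub> b \<otimes>\<^bsub>R\<^esub> s) (s \<otimes>\<^bsub>R\<^esub> t)),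
     smult = (\<lambda>r X. \<Union>(a, s)\<in>X. fraction R P (r \<otimes>\<^bsub>R\<^esub> a) s)\<rparr>"

definition constant_rank :: "('r, 'w) ring_scheme \<Rightarrow> ('r, 'm, 'x) module_scheme \<Rightarrow> nat \<Rightarrow> bool"
  where "constant_rank R M n \<longleftrightarrow> (\<forall>P. primeideal P R \<longrightarrow>
      free_of_rank (localization R P) (base_change R (localization R P) M) n)"


section \<open>Algebras with involution\<close>

record ('r, 'b) inv_algebra = "('r, 'b) module" +
  invol :: "'b \<Rightarrow> 'b"

definition algebra_with_involution :: "('r, 'w) ring_scheme \<Rightarrow> ('r, 'b) inv_algebra \<Rightarrow> bool"
  where "algebra_with_involution R B \<longleftrightarrow> module R B \<and>
    (\<forall>x\<in>carrier B. (\<lambda>y. x \<otimes>\<^bsub>B\<^esub> y) \<in> lin_maps R B B \<and> (\<lambda>y. y \<otimes>\<^bsub>B\<^esub> x) \<in> lin_maps R B B) \<and>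
    \<one>\<^bsub>B\<^esub> \<in> carrier B \<and>
    (\<forall>x\<in>carrier B. \<one>\<^bsub>B\<^esub> \<otimes>\<^bsub>B\<^esub> x = x \<and> x \<otimes>\<^bsub>B\<^esub> \<one>\<^bsub>B\<^esub> = x) \<and>
    invol B \<in> lin_maps R B B \<and>
    (\<forall>x\<in>carrier B. invol B (invol B x) = x) \<and>
    (\<forall>x\<in>carrier B. \<forall>y\<in>carrier B. invol B (x \<otimes>\<^bsub>B\<^esub> y) = invol B y \<otimes>\<^bsub>B\<^esub> invol B x)"

definition inv_base_change ::
  "('r, 'w) ring_scheme \<Rightarrow> ('r, 's, 'z) module_scheme \<Rightarrow> ('r, 'b) inv_algebra \<Rightarrow>
    ('s, ('b \<Rightarrow> 's) set) inv_algebra"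
  where "inv_base_change R S B =
    module.extend (base_change R S B) (inv_algebra.fields (base_map R S B B (invol B)))"

definition inv_algebra_isomorphic ::
  "('r, 'w) ring_scheme \<Rightarrow> ('r, 'b) inv_algebra \<Rightarrow> ('r, 'c) inv_algebra \<Rightarrow> bool"
  where "inv_algebra_isomorphic R B C \<longleftrightarrow> (\<exists>h \<in> lin_maps R B C.
      bij_betw h (carrier B) (carrier C) \<and>
      h \<one>\<^bsub>B\<^esub> = \<one>\<^bsub>C\<^esub> \<and>
      (\<forall>x\<in>carrier B. \<forall>y\<in>carrier B. h (x \<otimes>\<^bsub>B\<^esub> y) = h x \<otimes>\<^bsub>C\<^esub> h y) \<and>
      (\<forall>x\<in>carrier B. h (invol B x) = invol C (h x)))"

definition skew :: "('r, 'b) inv_algebra \<Rightarrow> 'b set"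
  where "skew B = {x \<in> carrier B. invol B x = \<ominus>\<^bsub>B\<^esub> x}"


section \<open>The split Brown algebra\<close>

type_synonym 'r vec = "'r \<times> 'r \<times> 'r"

fun vec_map2 :: "('r \<Rightarrow> 'r \<Rightarrow> 'r) \<Rightarrow> 'r vec \<Rightarrow> 'r vec \<Rightarrow> 'r vec"
  where "vec_map2 f (a, b, c) (a', b', c') = (f a a', f b b', f c c')"

fun vec_smult :: "('r, 'w) ring_scheme \<Rightarrow> 'r \<Rightarrow> 'r vec \<Rightarrow> 'r vec"
  where "vec_smult R r (a, b, c) = (r \<otimes>\<^bsub>R\<^esub> a, r \<otimes>\<^bsub>R\<^esub> b, r \<otimes>\<^bsub>R\<^esub> c)"

fun vec_dot :: "('r, 'w) ring_scheme \<Rightarrow> 'r vec \<Rightarrow> 'r vec \<Rightarrow> 'r"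
  where "vec_dot R (a, b, c) (a', b', c') = a \<otimes>\<^bsub>R\<^esub> a' \<oplus>\<^bsub>R\<^esub> b \<otimes>\<^bsub>R\<^esub> b' \<oplus>\<^bsub>R\<^esub> c \<otimes>\<^bsub>R\<^esub> c'"

fun vec_cross :: "('r, 'w) ring_scheme \<Rightarrow> 'r vec \<Rightarrow> 'r vec \<Rightarrow> 'r vec"
  where "vec_cross R (a, b, c) (a', b', c') =
    (b \<otimes>\<^bsub>R\<^esub> c' \<ominus>\<^bsub>R\<^esub> c \<otimes>\<^bsub>R\<^esub> b', c \<otimes>\<^bsub>R\<^esub> a' \<ominus>\<^bsub>R\<^esub> a \<otimes>\<^bsub>R\<^esub> c', a \<otimes>\<^bsub>R\<^esub> b' \<ominus>\<^bsub>R\<^esub> b \<otimes>\<^bsub>R\<^esub> a')"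

text \<open>The split octonions as Zorn vector matrices; \<open>(a, u, v, b)\<close> stands for the matrix with
  diagonal entries \<open>a\<close>, \<open>b\<close> and off-diagonal entries \<open>u\<close> (top right), \<open>v\<close> (bottom left).\<close>

type_synonym 'r zorn = "'r \<times> 'r vec \<times> 'r vec \<times> 'r"

fun zorn_add :: "('r, 'w) ring_scheme \<Rightarrow> 'r zorn \<Rightarrow> 'r zorn \<Rightarrow> 'r zorn"
  where "zorn_add R (a, u, v, b) (a', u', v', b') =
    (a \<oplus>\<^bsub>R\<^esub> a', vec_map2 (add R) u u', vec_map2 (add R) v v', b \<oplus>\<^bsub>R\<^esub> b')"

fun zorn_diff :: "('r, 'w) ring_scheme \<Rightarrow> 'r zorn \<Rightarrow> 'r zorn \<Rightarrow> 'r zorn"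
  where "zorn_diff R (a, u, v, b) (a', u', v', b') =
    (a \<ominus>\<^bsub>R\<^esub> a', vec_map2 (a_minus R) u u', vec_map2 (a_minus R) v v', b \<ominus>\<^bsub>R\<^esub> b')"

fun zorn_smult :: "('r, 'w) ring_scheme \<Rightarrow> 'r \<Rightarrow> 'r zorn \<Rightarrow> 'r zorn"
  where "zorn_smult R r (a, u, v, b) = (r \<otimes>\<^bsub>R\<^esub> a, vec_smult R r u, vec_smult R r v, r \<otimes>\<^bsub>R\<^esub> b)"

fun zorn_mult :: "('r, 'w) ring_scheme \<Rightarrow> 'r zorn \<Rightarrow> 'r zorn \<Rightarrow> 'r zorn"
  where "zorn_mult R (a, u, v, b) (a', u', v', b') =
    (a \<otimes>\<^bsub>R\<^esub> a' \<oplus>\<^bsub>R\<^esub> vec_dot R u v',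
     vec_map2 (a_minus R) (vec_map2 (add R) (vec_smult R a u') (vec_smult R b' u)) (vec_cross R v v'),
     vec_map2 (add R) (vec_map2 (add R) (vec_smult R a' v) (vec_smult R b v')) (vec_cross R u u'),
     b \<otimes>\<^bsub>R\<^esub> b' \<oplus>\<^bsub>R\<^esub> vec_dot R v u')"

fun zorn_conj :: "('r, 'w) ring_scheme \<Rightarrow> 'r zorn \<Rightarrow> 'r zorn"
  where "zorn_conj R (a, u, v, b) =
    (b, vec_smult R (\<ominus>\<^bsub>R\<^esub> \<one>\<^bsub>R\<^esub>) u, vec_smult R (\<ominus>\<^bsub>R\<^esub> \<one>\<^bsub>R\<^esub>) v, a)"

fun zorn_norm :: "('r, 'w) ring_scheme \<Rightarrow> 'r zorn \<Rightarrow> 'r"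
  where "zorn_norm R (a, u, v, b) = a \<otimes>\<^bsub>R\<^esub> b \<ominus>\<^bsub>R\<^esub> vec_dot R u v"

definition zorn_polar :: "('r, 'w) ring_scheme \<Rightarrow> 'r zorn \<Rightarrow> 'r zorn \<Rightarrow> 'r"
  where "zorn_polar R c d = zorn_norm R (zorn_add R c d) \<ominus>\<^bsub>R\<^esub> zorn_norm R c \<ominus>\<^bsub>R\<^esub> zorn_norm R d"

type_synonym 'r albert = "('r \<times> 'r \<times> 'r) \<times> ('r zorn \<times> 'r zorn \<times> 'r zorn)"

fun albert_add :: "('r, 'w) ring_scheme \<Rightarrow> 'r albert \<Rightarrow> 'r albert \<Rightarrow> 'r albert"
  where "albert_add R ((x1, x2, x3), (c1, c2, c3)) ((y1, y2, y3), (d1, d2, d3)) =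
    ((x1 \<oplus>\<^bsub>R\<^esub> y1, x2 \<oplus>\<^bsub>R\<^esub> y2, x3 \<oplus>\<^bsub>R\<^esub> y3), (zorn_add R c1 d1, zorn_add R c2 d2, zorn_add R c3 d3))"

fun albert_diff :: "('r, 'w) ring_scheme \<Rightarrow> 'r albert \<Rightarrow> 'r albert \<Rightarrow> 'r albert"
  where "albert_diff R ((x1, x2, x3), (c1, c2, c3)) ((y1, y2, y3), (d1, d2, d3)) =
    ((x1 \<ominus>\<^bsub>R\<^esub> y1, x2 \<ominus>\<^bsub>R\<^esub> y2, x3 \<ominus>\<^bsub>R\<^esub> y3), (zorn_diff R c1 d1, zorn_diff R c2 d2, zorn_diff R c3 d3))"

fun albert_smult :: "('r, 'w) ring_scheme \<Rightarrow> 'r \<Rightarrow> 'r albert \<Rightarrow> 'r albert"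
  where "albert_smult R r ((x1, x2, x3), (c1, c2, c3)) =
    ((r \<otimes>\<^bsub>R\<^esub> x1, r \<otimes>\<^bsub>R\<^esub> x2, r \<otimes>\<^bsub>R\<^esub> x3), (zorn_smult R r c1, zorn_smult R r c2, zorn_smult R r c3))"

fun albert_adjoint :: "('r, 'w) ring_scheme \<Rightarrow> 'r albert \<Rightarrow> 'r albert"
  where "albert_adjoint R ((x1, x2, x3), (c1, c2, c3)) =
    ((x2 \<otimes>\<^bsub>R\<^esub> x3 \<ominus>\<^bsub>R\<^esub> zorn_norm R c1, x3 \<otimes>\<^bsub>R\<^esub> x1 \<ominus>\<^bsub>R\<^esub> zorn_norm R c2, x1 \<otimes>\<^bsub>R\<^esub> x2 \<ominus>\<^bsub>R\<^esub> zorn_norm R c3),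
     (zorn_diff R (zorn_conj R (zorn_mult R c2 c3)) (zorn_smult R x1 c1),
      zorn_diff R (zorn_conj R (zorn_mult R c3 c1)) (zorn_smult R x2 c2),
      zorn_diff R (zorn_conj R (zorn_mult R c1 c2)) (zorn_smult R x3 c3)))"

definition albert_cross :: "('r, 'w) ring_scheme \<Rightarrow> 'r albert \<Rightarrow> 'r albert \<Rightarrow> 'r albert"
  where "albert_cross R x y = albert_diff R
    (albert_diff R (albert_adjoint R (albert_add R x y)) (albert_adjoint R x)) (albert_adjoint R y)"

fun albert_trace :: "('r, 'w) ring_scheme \<Rightarrow> 'r albert \<Rightarrow> 'r albert \<Rightarrow> 'r"
  where "albert_trace R ((x1, x2, x3), (c1, c2, c3)) ((y1, y2, y3), (d1, d2, d3)) =
    (x1 \<otimes>\<^bsub>R\<^esub> y1 \<oplus>\<^bsub>R\<^esub> x2 \<otimes>\<^bsub>R\<^esub> y2 \<oplus>\<^bsub>R\<^esub> x3 \<otimes>\<^bsub>R\<^esub> y3) \<oplus>\<^bsub>R\<^esub>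
    (zorn_polar R c1 d1 \<oplus>\<^bsub>R\<^esub> zorn_polar R c2 d2 \<oplus>\<^bsub>R\<^esub> zorn_polar R c3 d3)"

definition vec_carrier :: "('r, 'w) ring_scheme \<Rightarrow> 'r vec set"
  where "vec_carrier R = carrier R \<times> carrier R \<times> carrier R"

definition zorn_carrier :: "('r, 'w) ring_scheme \<Rightarrow> 'r zorn set"
  where "zorn_carrier R = carrier R \<times> vec_carrier R \<times> vec_carrier R \<times> carrier R"

definition albert_carrier :: "('r, 'w) ring_scheme \<Rightarrow> 'r albert set"
  where "albert_carrier R = vec_carrier R \<times> (zorn_carrier R \<times> zorn_carrier R \<times> zorn_carrier R)"

definition albert_zero :: "('r, 'w) ring_scheme \<Rightarrow> 'r albert"
  where "albert_zero R = (let o3 = (\<zero>\<^bsub>R\<^esub>, \<zero>\<^bsub>R\<^esub>, \<zero>\<^bsub>R\<^esub>); z = (\<zero>\<^bsub>R\<^esub>, o3, o3, \<zero>\<^bsub>R\<^esub>) in (o3, (z, z, z)))"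

text \<open>\<open>(r1, a1, a2, r2)\<close> stands for the matrix with rows \<open>r1 a1\<close> and \<open>a2 r2\<close>.\<close>

type_synonym 'r brown = "'r \<times> 'r albert \<times> 'r albert \<times> 'r"

fun brown_add :: "('r, 'w) ring_scheme \<Rightarrow> 'r brown \<Rightarrow> 'r brown \<Rightarrow> 'r brown"
  where "brown_add R (r1, a1, a2, r2) (s1, b1, b2, s2) =
    (r1 \<oplus>\<^bsub>R\<^esub> s1, albert_add R a1 b1, albert_add R a2 b2, r2 \<oplus>\<^bsub>R\<^esub> s2)"

fun brown_smult :: "('r, 'w) ring_scheme \<Rightarrow> 'r \<Rightarrow> 'r brown \<Rightarrow> 'r brown"
  where "brown_smult R r (r1, a1, a2, r2) =
    (r \<otimes>\<^bsub>R\<^esub> r1, albert_smult R r a1, albert_smult R r a2, r \<otimes>\<^bsub>R\<^esub> r2)"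

fun brown_mult :: "('r, 'w) ring_scheme \<Rightarrow> 'r brown \<Rightarrow> 'r brown \<Rightarrow> 'r brown"
  where "brown_mult R (r1, a1, a2, r2) (s1, b1, b2, s2) =
    (r1 \<otimes>\<^bsub>R\<^esub> s1 \<oplus>\<^bsub>R\<^esub> albert_trace R a1 b2,
     albert_add R (albert_add R (albert_smult R r1 b1) (albert_smult R s2 a1)) (albert_cross R a2 b2),
     albert_add R (albert_add R (albert_smult R r2 b2) (albert_smult R s1 a2)) (albert_cross R a1 b1),
     r2 \<otimes>\<^bsub>R\<^esub> s2 \<oplus>\<^bsub>R\<^esub> albert_trace R a2 b1)"

fun brown_invol :: "'r brown \<Rightarrow> 'r brown"
  where "brown_invol (r1, a1, a2, r2) = (r2, a1, a2, r1)"

definition split_brown :: "('r, 'w) ring_scheme \<Rightarrow> ('r, 'r brown) inv_algebra"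
  where "split_brown R =
    \<lparr>carrier = carrier R \<times> albert_carrier R \<times> albert_carrier R \<times> carrier R,
     mult = brown_mult R,
     one = (\<one>\<^bsub>R\<^esub>, albert_zero R, albert_zero R, \<one>\<^bsub>R\<^esub>),
     zero = (\<zero>\<^bsub>R\<^esub>, albert_zero R, albert_zero R, \<zero>\<^bsub>R\<^esub>),
     add = brown_add R,
     smult = brown_smult R,
     invol = brown_invol\<rparr>"


section \<open>Brown algebras\<close>

text \<open>The type of the splitting ring is passed as an argument, since one cannot quantify over it
  existentially. A theorem assuming \<open>brown_algebra TYPE('t) R B\<close> for a type variable \<open>'t\<close> covers
  splitting rings of every type.\<close>

definition brown_algebra :: "'t itself \<Rightarrow> ('r, 'w) ring_scheme \<Rightarrow> ('r, 'b) inv_algebra \<Rightarrow> bool"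
  where "brown_algebra T R B \<longleftrightarrow>
    algebra_with_involution R B \<and> fg_projective R B \<and> constant_rank R B 56 \<and>
    (\<exists>S :: ('r, 't) module. algebra R S \<and> faithfully_flat R S \<and>
      inv_algebra_isomorphic S (inv_base_change R S B) (split_brown S))"

definition V_op :: "('r, 'b) inv_algebra \<Rightarrow> 'b \<Rightarrow> 'b \<Rightarrow> 'b \<Rightarrow> 'b"
  where "V_op B x y = (\<lambda>z\<in>carrier B.
    ((x \<otimes>\<^bsub>B\<^esub> invol B y) \<otimes>\<^bsub>B\<^esub> z) \<oplus>\<^bsub>B\<^esub> ((z \<otimes>\<^bsub>B\<^esub> invol B y) \<otimes>\<^bsub>B\<^esub> x) \<ominus>\<^bsub>B\<^esub> ((z \<otimes>\<^bsub>B\<^esub> invol B x) \<otimes>\<^bsub>B\<^esub> y))"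


section \<open>The TKK construction\<close>

definition end_lie ::
  "('r, 'w) ring_scheme \<Rightarrow> ('r, 'm, 'x) module_scheme \<Rightarrow> ('r, 'm \<Rightarrow> 'm) module"
  where "end_lie R M =
    \<lparr>carrier = lin_maps R M M \<inter> extensional (carrier M),
     mult = (\<lambda>D E. \<lambda>z\<in>carrier M. D (E z) \<ominus>\<^bsub>M\<^esub> E (D z)),
     one = (\<lambda>z\<in>carrier M. z),
     zero = (\<lambda>z\<in>carrier M. \<zero>\<^bsub>M\<^esub>),
     add = (\<lambda>D E. \<lambda>z\<in>carrier M. D z \<oplus>\<^bsub>M\<^esub> E z),
     smult = (\<lambda>r D. \<lambda>z\<in>carrier M. r \<odot>\<^bsub>M\<^esub> D z)\<rparr>"

definition V_span :: "('r, 'w) ring_scheme \<Rightarrow> ('r, 'b) inv_algebra \<Rightarrow> ('b \<Rightarrow> 'b) set"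
  where "V_span R B = lin_span R (end_lie R B) {V_op B x y | x y. x \<in> carrier B \<and> y \<in> carrier B}"

text \<open>An element of \<open>L(B)\<close> is the tuple of its components of degree -2, -1, 0, 1, 2. The field
  \<open>one\<close> has no meaning for a Lie algebra and is set to 0.\<close>

type_synonym 'b tkk = "'b \<times> 'b \<times> ('b \<Rightarrow> 'b) \<times> 'b \<times> 'b"

definition tkk_zero :: "('r, 'w) ring_scheme \<Rightarrow> ('r, 'b) inv_algebra \<Rightarrow> 'b tkk"
  where "tkk_zero R B = (\<zero>\<^bsub>B\<^esub>, \<zero>\<^bsub>B\<^esub>, \<zero>\<^bsub>end_lie R B\<^esub>, \<zero>\<^bsub>B\<^esub>, \<zero>\<^bsub>B\<^esub>)"

definition tkk_with ::
  "('r, 'w) ring_scheme \<Rightarrow> ('r, 'b) inv_algebra \<Rightarrow> ('b tkk \<Rightarrow> 'b tkk \<Rightarrow> 'b tkk) \<Rightarrow> ('r, 'b tkk) module"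
  where "tkk_with R B \<beta> =
    \<lparr>carrier = skew B \<times> carrier B \<times> V_span R B \<times> carrier B \<times> skew B,
     mult = \<beta>,
     one = tkk_zero R B,
     zero = tkk_zero R B,
     add = (\<lambda>(s, x, D, y, t) (s', x', D', y', t').
       (s \<oplus>\<^bsub>B\<^esub> s', x \<oplus>\<^bsub>B\<^esub> x', D \<oplus>\<^bsub>end_lie R B\<^esub> D', y \<oplus>\<^bsub>B\<^esub> y', t \<oplus>\<^bsub>B\<^esub> t')),
     smult = (\<lambda>r (s, x, D, y, t).
       (r \<odot>\<^bsub>B\<^esub> s, r \<odot>\<^bsub>B\<^esub> x, r \<odot>\<^bsub>end_lie R B\<^esub> D, r \<odot>\<^bsub>B\<^esub> y, r \<odot>\<^bsub>B\<^esub> t))\<rparr>"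

definition in_m2 :: "('r, 'w) ring_scheme \<Rightarrow> ('r, 'b) inv_algebra \<Rightarrow> 'b \<Rightarrow> 'b tkk"
  where "in_m2 R B s = (s, \<zero>\<^bsub>B\<^esub>, \<zero>\<^bsub>end_lie R B\<^esub>, \<zero>\<^bsub>B\<^esub>, \<zero>\<^bsub>B\<^esub>)"

definition in_m1 :: "('r, 'w) ring_scheme \<Rightarrow> ('r, 'b) inv_algebra \<Rightarrow> 'b \<Rightarrow> 'b tkk"
  where "in_m1 R B x = (\<zero>\<^bsub>B\<^esub>, x, \<zero>\<^bsub>end_lie R B\<^esub>, \<zero>\<^bsub>B\<^esub>, \<zero>\<^bsub>B\<^esub>)"

definition in_0 :: "('r, 'w) ring_scheme \<Rightarrow> ('r, 'b) inv_algebra \<Rightarrow> ('b \<Rightarrow> 'b) \<Rightarrow> 'b tkk"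
  where "in_0 R B D = (\<zero>\<^bsub>B\<^esub>, \<zero>\<^bsub>B\<^esub>, D, \<zero>\<^bsub>B\<^esub>, \<zero>\<^bsub>B\<^esub>)"

definition in_p1 :: "('r, 'w) ring_scheme \<Rightarrow> ('r, 'b) inv_algebra \<Rightarrow> 'b \<Rightarrow> 'b tkk"
  where "in_p1 R B x = (\<zero>\<^bsub>B\<^esub>, \<zero>\<^bsub>B\<^esub>, \<zero>\<^bsub>end_lie R B\<^esub>, x, \<zero>\<^bsub>B\<^esub>)"

definition in_p2 :: "('r, 'w) ring_scheme \<Rightarrow> ('r, 'b) inv_algebra \<Rightarrow> 'b \<Rightarrow> 'b tkk"
  where "in_p2 R B s = (\<zero>\<^bsub>B\<^esub>, \<zero>\<^bsub>B\<^esub>, \<zero>\<^bsub>end_lie R B\<^esub>, \<zero>\<^bsub>B\<^esub>, s)"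

definition tkk_bracket ::
  "('r, 'w) ring_scheme \<Rightarrow> ('r, 'b) inv_algebra \<Rightarrow> ('b tkk \<Rightarrow> 'b tkk \<Rightarrow> 'b tkk) \<Rightarrow> bool"
  where "tkk_bracket R B \<beta> \<longleftrightarrow>
    (let L = tkk_with R B \<beta> in
      \<beta> \<in> extensional (carrier L) \<and>
      (\<forall>u\<in>carrier L. \<beta> u \<in> lin_maps R L L \<inter> extensional (carrier L)) \<and>
      (\<forall>u\<in>carrier L. \<forall>v\<in>carrier L. \<beta> u v = \<ominus>\<^bsub>L\<^esub> \<beta> v u)) \<and>
    (\<forall>D\<in>V_span R B. \<forall>E\<in>V_span R B. \<beta> (in_0 R B D) (in_0 R B E) = in_0 R B (D \<otimes>\<^bsub>end_lie R B\<^esub> E)) \<and>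
    (\<forall>x\<in>carrier B. \<forall>y\<in>carrier B.
      (\<forall>z\<in>carrier B.
        \<beta> (in_0 R B (V_op B x y)) (in_p1 R B z) = in_p1 R B (V_op B x y z) \<and>
        \<beta> (in_0 R B (V_op B x y)) (in_m1 R B z) = in_m1 R B (\<ominus>\<^bsub>B\<^esub> V_op B y x z)) \<and>
      (\<forall>s\<in>skew B.
        \<beta> (in_0 R B (V_op B x y)) (in_p2 R B s) = in_p2 R B
          ((s \<otimes>\<^bsub>B\<^esub> y) \<otimes>\<^bsub>B\<^esub> invol B x \<oplus>\<^bsub>B\<^esub> x \<otimes>\<^bsub>B\<^esub> (invol B y \<otimes>\<^bsub>B\<^esub> s)) \<and>
        \<beta> (in_0 R B (V_op B x y)) (in_m2 R B s) = in_m2 R B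
          (\<ominus>\<^bsub>B\<^esub> ((s \<otimes>\<^bsub>B\<^esub> x) \<otimes>\<^bsub>B\<^esub> invol B y) \<ominus>\<^bsub>B\<^esub> y \<otimes>\<^bsub>B\<^esub> (invol B x \<otimes>\<^bsub>B\<^esub> s))) \<and>
      \<beta> (in_p1 R B x) (in_p1 R B y) = in_p2 R B (x \<otimes>\<^bsub>B\<^esub> invol B y \<ominus>\<^bsub>B\<^esub> y \<otimes>\<^bsub>B\<^esub> invol B x) \<and>
      \<beta> (in_m1 R B x) (in_m1 R B y) = in_m2 R B (x \<otimes>\<^bsub>B\<^esub> invol B y \<ominus>\<^bsub>B\<^esub> y \<otimes>\<^bsub>B\<^esub> invol B x) \<and>
      \<beta> (in_p1 R B x) (in_m1 R B y) = in_0 R B (V_op B x y)) \<and>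
    (\<forall>s\<in>skew B. \<forall>t\<in>skew B.
      \<beta> (in_p2 R B s) (in_m2 R B t) = in_0 R B (V_op B (s \<otimes>\<^bsub>B\<^esub> t) \<one>\<^bsub>B\<^esub>) \<and>
      \<beta> (in_p2 R B s) (in_p2 R B t) = tkk_zero R B \<and>
      \<beta> (in_m2 R B s) (in_m2 R B t) = tkk_zero R B) \<and>
    (\<forall>s\<in>skew B. \<forall>x\<in>carrier B.
      \<beta> (in_p2 R B s) (in_m1 R B x) = in_p1 R B (s \<otimes>\<^bsub>B\<^esub> x) \<and>
      \<beta> (in_m2 R B s) (in_p1 R B x) = in_m1 R B (s \<otimes>\<^bsub>B\<^esub> x) \<and>
      \<beta> (in_p2 R B s) (in_p1 R B x) = tkk_zero R B \<and>
      \<beta> (in_m2 R B s) (in_m1 R B x) = tkk_zero R B)"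

definition tkk :: "('r, 'w) ring_scheme \<Rightarrow> ('r, 'b) inv_algebra \<Rightarrow> ('r, 'b tkk) module"
  where "tkk R B = tkk_with R B (THE \<beta>. tkk_bracket R B \<beta>)"


section \<open>Automorphisms and extremal elements\<close>

definition lin_autos :: "('s, 'w) ring_scheme \<Rightarrow> ('s, 'm, 'x) module_scheme \<Rightarrow> ('m \<Rightarrow> 'm) set"
  where "lin_autos S M =
    {f \<in> lin_maps S M M \<inter> extensional (carrier M). bij_betw f (carrier M) (carrier M)}"

definition aut_group ::
  "('s, 'w) ring_scheme \<Rightarrow> ('s, 'm, 'x) module_scheme \<Rightarrow> ('m \<Rightarrow> 'm) monoid"
  where "aut_group S C =
    \<lparr>carrier = {f \<in> lin_autos S C.
       \<forall>x\<in>carrier C. \<forall>y\<in>carrier C. f (x \<otimes>\<^bsub>C\<^esub> y) = f x \<otimes>\<^bsub>C\<^esub> f y},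
     mult = compose (carrier C),
     one = (\<lambda>x\<in>carrier C. x)\<rparr>"

definition extremal :: "('s, 'w) ring_scheme \<Rightarrow> ('s, 'm, 'x) module_scheme \<Rightarrow> 'm \<Rightarrow> bool"
  where "extremal S C x \<longleftrightarrow> x \<in> carrier C \<and> (\<exists>\<alpha>\<in>lin_forms S C. \<alpha> x = \<one>\<^bsub>S\<^esub>) \<and>
    (\<forall>y\<in>carrier C. \<exists>r\<in>carrier S. x \<otimes>\<^bsub>C\<^esub> (x \<otimes>\<^bsub>C\<^esub> y) = r \<odot>\<^bsub>C\<^esub> x)"

definition extremal_form ::
  "('s, 'w) ring_scheme \<Rightarrow> ('s, 'm, 'x) module_scheme \<Rightarrow> 'm \<Rightarrow> 'm \<Rightarrow> 's"
  where "extremal_form S C x y = (THE r. r \<in> carrier S \<and> x \<otimes>\<^bsub>C\<^esub> (x \<otimes>\<^bsub>C\<^esub> y) = r \<odot>\<^bsub>C\<^esub> x)"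

definition extremal_pairs ::
  "('s, 'w) ring_scheme \<Rightarrow> ('s, 'm, 'x) module_scheme \<Rightarrow> ('m \<times> 'm) set"
  where "extremal_pairs S C = {(x, y). extremal S C x \<and> extremal S C y \<and>
    extremal_form S C x y = \<ominus>\<^bsub>S\<^esub> ([(2::nat)] \<cdot>\<^bsub>S\<^esub> \<one>\<^bsub>S\<^esub>)}"

definition pair_action ::
  "('s, 'w) ring_scheme \<Rightarrow> ('s, 'm, 'x) module_scheme \<Rightarrow> ('m \<Rightarrow> 'm) \<Rightarrow> 'm \<times> 'm \<Rightarrow> 'm \<times> 'm"
  where "pair_action S C f = (\<lambda>p\<in>extremal_pairs S C. (f (fst p), f (snd p)))"


section \<open>The triple system and its automorphisms\<close>

text \<open>The scalar \<open>r\<close> with \<open>r 1 = (x y\<^sup>* - y x\<^sup>*) j\<close>.\<close>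

definition b_form :: "('s, 'w) ring_scheme \<Rightarrow> ('s, 'b) inv_algebra \<Rightarrow> 'b \<Rightarrow> 'b \<Rightarrow> 'b \<Rightarrow> 's"
  where "b_form S B j x y = (THE r. r \<in> carrier S \<and>
    r \<odot>\<^bsub>B\<^esub> \<one>\<^bsub>B\<^esub> = (x \<otimes>\<^bsub>B\<^esub> invol B y \<ominus>\<^bsub>B\<^esub> y \<otimes>\<^bsub>B\<^esub> invol B x) \<otimes>\<^bsub>B\<^esub> j)"

definition t_prod :: "('s, 'w) ring_scheme \<Rightarrow> ('s, 'b) inv_algebra \<Rightarrow> 'b \<Rightarrow> 'b \<Rightarrow> 'b \<Rightarrow> 'b \<Rightarrow> 'b"
  where "t_prod S B j x y z = [(2::nat)] \<cdot>\<^bsub>B\<^esub> V_op B x (j \<otimes>\<^bsub>B\<^esub> y) z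
    \<ominus>\<^bsub>B\<^esub> b_form S B j y z \<odot>\<^bsub>B\<^esub> x \<ominus>\<^bsub>B\<^esub> b_form S B j y x \<odot>\<^bsub>B\<^esub> z \<ominus>\<^bsub>B\<^esub> b_form S B j x z \<odot>\<^bsub>B\<^esub> y"

definition inv_triple :: "('s, 'w) ring_scheme \<Rightarrow> ('s, 'b) inv_algebra \<Rightarrow> 'b \<Rightarrow> ('b \<Rightarrow> 'b) set"
  where "inv_triple S B j = {f \<in> lin_autos S B.
    (\<forall>x\<in>carrier B. \<forall>y\<in>carrier B. b_form S B j (f x) (f y) = b_form S B j x y) \<and>
    (\<forall>x\<in>carrier B. \<forall>y\<in>carrier B. \<forall>z\<in>carrier B.
      f (t_prod S B j x y z) = t_prod S B j (f x) (f y) (f z))}"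

text \<open>The homogeneous components of \<open>L(B) \<otimes>\<^sub>R S\<close> are the images of the \<open>L\<^sub>i \<otimes>\<^sub>R S\<close>.\<close>

definition tkk_components ::
  "('r, 'w) ring_scheme \<Rightarrow> ('r, 's, 'z) module_scheme \<Rightarrow> ('r, 'b) inv_algebra \<Rightarrow>
    ('b tkk \<Rightarrow> 's) set set set"
  where "tkk_components R S B =
    (\<lambda>X. lin_span S (base_change R S (tkk R B)) ((\<lambda>u. tensor R S (tkk R B) u \<one>\<^bsub>S\<^esub>) ` X)) `
    {in_m2 R B ` skew B, in_m1 R B ` carrier B, in_0 R B ` V_span R B,
     in_p1 R B ` carrier B, in_p2 R B ` skew B}"

definition graded_auts ::
  "('r, 'w) ring_scheme \<Rightarrow> ('r, 's, 'z) module_scheme \<Rightarrow> ('r, 'b) inv_algebra \<Rightarrow>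
    (('b tkk \<Rightarrow> 's) set \<Rightarrow> ('b tkk \<Rightarrow> 's) set) set"
  where "graded_auts R S B = {f \<in> carrier (aut_group S (base_change R S (tkk R B))).
    \<forall>X\<in>tkk_components R S B. f ` X = X}"

text \<open>Restriction of an automorphism of \<open>L(B) \<otimes>\<^sub>R S\<close> to the component of degree 1, the latter being
  identified with \<open>B \<otimes>\<^sub>R S\<close>; it is a bijection from the graded automorphisms to the autotopies of
  \<open>B \<otimes>\<^sub>R S\<close>, with inverse \<open>from_L1\<close>.\<close>

definition restrict_L1 ::
  "('r, 'w) ring_scheme \<Rightarrow> ('r, 's, 'z) module_scheme \<Rightarrow> ('r, 'b) inv_algebra \<Rightarrow>
    (('b tkk \<Rightarrow> 's) set \<Rightarrow> ('b tkk \<Rightarrow> 's) set) \<Rightarrow> ('b \<Rightarrow> 's) set \<Rightarrow> ('b \<Rightarrow> 's) set"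
  where "restrict_L1 R S B f = (let i = base_map R S B (tkk R B) (in_p1 R B);
      C = carrier (inv_base_change R S B) in (\<lambda>x\<in>C. inv_into C i (f (i x))))"

definition from_L1 ::
  "('r, 'w) ring_scheme \<Rightarrow> ('r, 's, 'z) module_scheme \<Rightarrow> ('r, 'b) inv_algebra \<Rightarrow>
    (('b \<Rightarrow> 's) set \<Rightarrow> ('b \<Rightarrow> 's) set) \<Rightarrow> ('b tkk \<Rightarrow> 's) set \<Rightarrow> ('b tkk \<Rightarrow> 's) set"
  where "from_L1 R S B = inv_into (graded_auts R S B) (restrict_L1 R S B)"

end

theory Submission
  imports Defs "HOL-Library.Product_Plus"
begin

text \<open>Identities of the split Brown algebra are proved over commutative rings given by a type class,
  where the adjoint identity of the Albert algebra is reduced to polynomial identities over \<open>int\<close>, and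
  are carried to an arbitrary Brown algebra by faithfully flat descent. In particular
  \<open>B\<^sup>- = R j\<close>, and the \<open>V\<^bsub>x,y\<^esub>\<close> satisfy a Casimir identity
  \<open>\<Sum> V\<^bsub>D e, e'\<^esub> = 12 D + 8 \<delta>(D) id\<close> for dual bases \<open>e\<close>, \<open>e'\<close>.

  An automorphism of \<open>L\<^sub>S\<close> fixing \<open>1\<^sub>+\<close> and \<open>\<mu>\<^sup>-\<^sup>1 1\<^sub>-\<close> fixes their bracket \<open>\<zeta> = V\<^bsub>1,1\<^esub>\<close>, whose eigenspaces are
  the homogeneous components because 6 is invertible; so it is graded, and its restriction to \<open>L\<^sub>1\<close> preserves
  \<open>b\<^sub>j\<close> (from \<open>[x\<^sub>+, y\<^sub>+]\<close>) and \<open>t\<^sub>j\<close> (from \<open>[[x\<^sub>+, [j\<^sub>-, y\<^sub>+]], z\<^sub>+]\<close>). Conversely an isometry of the triple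
  system is extended to \<open>L\<^sub>1 \<oplus> L\<^sub>-\<^sub>1\<close> and to \<open>L\<^sub>0\<close>, where the Casimir identity expresses every element
  through brackets \<open>[x\<^sub>+, y\<^sub>-]\<close> by a formula, so that no relation between these has to be checked.\<close>

text \<open>The obstacle is the degree-zero part \<open>L_0\<close>, known only as a span of
  operators. Rules given on the generators \<open>V_op B x y\<close> need not be consistent, so the
  action of an operator on degrees 2, -2 and -1 must first be computed from the operator itself;
  only then does the bracket exist. After base change the degree-zero part is not shown to act
  faithfully on \<open>B_S\<close>, so an equality in it cannot be tested on vectors: it is proved
  over \<open>R\<close>, where operators are functions, and then tensored. The splitting ring
  \<open>T\<close> and the test ring \<open>S\<close> are unrelated; \<open>T\<close> only proves
  identities over \<open>R\<close>, and \<open>S\<close> only receives them.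

  In the Lie algebra the Casimir identity reads \<Sum> [[D, e_+], e'_-] = 12 D + 8 \<delta>(D)
  \<zeta>. Once 12 is invertible it recovers D from its brackets with degrees 1 and 2. The constant
  12 is 1 + 1 + 10, where 10 is the contraction \<Sum> (e_i \<times> c) \<times> e'_i = 10 c in the
  Albert algebra; the 8 appears only for the diagonal operators, which alone contribute to
  \<delta>.\<close>

text \<open>At this record the record-based definitions of the split algebras become type-class
  polynomials, which \<open>algebra_simps\<close> normalises.\<close>

definition class_ring :: "'a::comm_ring_1 ring"
 where "class_ring = \<lparr>carrier = UNIV, monoid.mult = (*), one = 1, zero = 0, add = (+)\<rparr>"

lemma class_ring_simps [simp]:
 "carrier class_ring = UNIV"
 "x \<otimes>\<^bsub>class_ring\<^esub> y = x * y"
 "\<one>\<^bsub>class_ring\<^esub> = 1"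
 "\<zero>\<^bsub>class_ring\<^esub> = 0"
 "x \<oplus>\<^bsub>class_ring\<^esub> y = x + y"
 by (simp_all add: class_ring_def)

lemma cring_class_ring: "cring (class_ring :: 'a::comm_ring_1 ring)"
proof (rule cringI)
 show "abelian_group (class_ring :: 'a ring)"
 proof (rule abelian_groupI)
  fix x :: 'a
  show "\<exists>y\<in>carrier class_ring. y \<oplus>\<^bsub>class_ring\<^esub> x = \<zero>\<^bsub>class_ring\<^esub>"
   by (simp add: eq_neg_iff_add_eq_0[symmetric])
 qed (simp_all add: algebra_simps)
 show "comm_monoid (class_ring :: 'a ring)"
  by (rule comm_monoidI) (simp_all add: algebra_simps)
qed (simp_all add: algebra_simps)

interpretation class_ring: cring class_ring by (rule cring_class_ring)

lemma class_ring_a_inv [simp]: "\<ominus>\<^bsub>class_ring\<^esub> x = - x"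
 using class_ring.minus_equality[of "-x" x] by simp

lemma class_ring_a_minus [simp]: "x \<ominus>\<^bsub>class_ring\<^esub> y = x - y"
 by (simp add: a_minus_def)

section \<open>The split Albert algebra over a type-class ring\<close>

abbreviation cross :: "'a::comm_ring_1 albert => 'a albert => 'a albert"
 where "cross \<equiv> albert_cross class_ring"
abbreviation trace :: "'a::comm_ring_1 albert => 'a albert => 'a"
 where "trace \<equiv> albert_trace class_ring"
abbreviation scl :: "'a::comm_ring_1 => 'a albert => 'a albert"
 where "scl \<equiv> albert_smult class_ring"
abbreviation zmul :: "'a::comm_ring_1 zorn => 'a zorn => 'a zorn"
 where "zmul \<equiv> zorn_mult class_ring"
abbreviation zbar :: "'a::comm_ring_1 zorn => 'a zorn"
 where "zbar \<equiv> zorn_conj class_ring"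
abbreviation zpol :: "'a::comm_ring_1 zorn => 'a zorn => 'a"
 where "zpol \<equiv> zorn_polar class_ring"
abbreviation zscl :: "'a::comm_ring_1 => 'a zorn => 'a zorn"
 where "zscl \<equiv> zorn_smult class_ring"

lemma zorn_polar_simp [simp]: "zorn_polar class_ring (a, (u1,u2,u3), (v1,v2,v3), b) (a', (u1',u2',u3'), (v1',v2',v3'), b') =
 a * b' + a' * b - (u1 * v1' + u2 * v2' + u3 * v3') - (u1' * v1 + u2' * v2 + u3' * v3)"
 by (simp add: zorn_polar_def algebra_simps)

text \<open>The quadratic terms of the polarised adjoint cancel once and for all here, so that later
  normalisations start from a bilinear formula and never expand \<open>albert_adjoint\<close> at a
  sum.\<close>

lemma cross_simp [simp]: "cross ((x1, x2, x3), (a1, a2, a3)) ((y1, y2, y3), (b1, b2, b3)) =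
 ((x2 * y3 + x3 * y2 - zpol a1 b1, x3 * y1 + x1 * y3 - zpol a2 b2, x1 * y2 + x2 * y1 - zpol a3 b3),
  (zbar (zmul a2 b3 + zmul b2 a3) - zscl x1 b1 - zscl y1 a1,
  zbar (zmul a3 b1 + zmul b3 a1) - zscl x2 b2 - zscl y2 a2,
  zbar (zmul a1 b2 + zmul b1 a2) - zscl x3 b3 - zscl y3 a3))"
 by (cases a1; cases a2; cases a3; cases b1; cases b2; cases b3)
  (simp add: albert_cross_def split_paired_all algebra_simps)


lemma zorn_cases:
 obtains a u1 u2 u3 v1 v2 v3 b where "(x :: 'a zorn) = (a, (u1, u2, u3), (v1, v2, v3), b)"
 by (cases x) auto

lemma albert_cases:
 obtains x1 x2 x3 c1 c2 c3 where "(x :: 'a albert) = ((x1, x2, x3), (c1, c2, c3))"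
 by (cases x) auto


lemma zorn_zero_simps [simp]:
 "zmul 0 c = 0" "zmul c 0 = 0" "zbar 0 = 0" "zpol 0 c = 0" "zpol c 0 = 0" "zscl r 0 = 0" "zscl 0 c = 0"
 by (cases c rule: zorn_cases; simp add: zero_prod_def)+

lemma zpol_add [simp]: "zpol (x + y) z = zpol x z + zpol y z" "zpol z (x + y) = zpol z x + zpol z y"
 by (cases x rule: zorn_cases; cases y rule: zorn_cases; cases z rule: zorn_cases; simp add: algebra_simps)+

lemma zpol_diff [simp]: "zpol (x - y) z = zpol x z - zpol y z" "zpol z (x - y) = zpol z x - zpol z y"
 by (cases x rule: zorn_cases; cases y rule: zorn_cases; cases z rule: zorn_cases; simp add: algebra_simps)+

lemma zpol_scl [simp]: "zpol (zscl r x) y = r * zpol x y" "zpol x (zscl r y) = r * zpol x y"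
 by (cases x rule: zorn_cases; cases y rule: zorn_cases; simp add: algebra_simps)+

lemma zpol_commute: "zpol x y = zpol y x"
 by (cases x rule: zorn_cases; cases y rule: zorn_cases; simp add: algebra_simps)

lemma zmul_add: "zmul (x + y) z = zmul x z + zmul y z" "zmul z (x + y) = zmul z x + zmul z y"
 by (cases x rule: zorn_cases; cases y rule: zorn_cases; cases z rule: zorn_cases; simp add: algebra_simps)+

lemma zmul_scl: "zmul (zscl r x) y = zscl r (zmul x y)" "zmul x (zscl r y) = zscl r (zmul x y)"
 by (cases x rule: zorn_cases; cases y rule: zorn_cases; simp add: algebra_simps)+

lemma zbar_linear: "zbar (x + y) = zbar x + zbar y" "zbar (zscl r x) = zscl r (zbar x)"
 by (cases x rule: zorn_cases; cases y rule: zorn_cases; simp add: algebra_simps)+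

lemma zscl_linear: "zscl r (x + y) = zscl r x + zscl r y" "zscl r (x - y) = zscl r x - zscl r y"
  "zscl (r + s) x = zscl r x + zscl s x" "zscl r (zscl s x) = zscl (r * s) x"
 by (cases x rule: zorn_cases; cases y rule: zorn_cases; simp add: algebra_simps)+

text \<open>Pairing the conjugate of xy with z gives the trace of (xy)z, and this trace is invariant
  under cyclic permutation although the octonions are not associative.\<close>

lemma zpol_cyclic: "zpol (zbar (zmul x y)) z = zpol x (zbar (zmul y z))"
 by (cases x rule: zorn_cases; cases y rule: zorn_cases; cases z rule: zorn_cases) (simp add: algebra_simps)

lemma scl_linear:
 "scl r (x + y) = scl r x + scl r y" "scl (r + s) x = scl r x + scl s x" "scl r (scl s x) = scl (r * s) x"
 by (cases x rule: albert_cases; cases y rule: albert_cases; simp add: zscl_linear algebra_simps)+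

lemma scl_one [simp]: "scl 1 x = x"
proof -
 have "zscl 1 c = c" for c :: "'a zorn"
  by (cases c rule: zorn_cases) simp
 then show ?thesis
  by (cases x rule: albert_cases) simp
qed

lemma scl_zero [simp]: "scl 0 x = 0" "scl r 0 = 0"
 using scl_linear(2)[of 0 0 x] scl_linear(1)[of r 0 0] by simp_all

lemma scl_minus: "scl (- r) x = - scl r x" "scl r (- x) = - scl r x"
 using scl_linear(2)[of r "- r" x] scl_linear(1)[of r x "- x"]
 by (simp_all add: eq_neg_iff_add_eq_0 add.commute)

lemma scl_diff: "scl r (x - y) = scl r x - scl r y" "scl (r - s) x = scl r x - scl s x"
 using scl_linear(1)[of r x "- y"] scl_linear(2)[of r "- s" x] by (simp_all add: scl_minus)

lemma scl_minus_one: "- x = scl (- 1) x"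
 by (simp add: scl_minus)

lemma albert_eq_zero: "(0 :: 'a::comm_ring_1 albert) = ((0, 0, 0), (0, 0, 0))"
 by (simp add: zero_prod_def)

lemma cross_commute: "cross x y = cross y x"
 by (cases x rule: albert_cases; cases y rule: albert_cases) (simp add: zpol_commute algebra_simps)

lemma cross_add: "cross (x + y) z = cross x z + cross y z" "cross z (x + y) = cross z x + cross z y"
 by (cases x rule: albert_cases; cases y rule: albert_cases; cases z rule: albert_cases;
   simp add: zmul_add zbar_linear zscl_linear algebra_simps)+

lemma cross_scl: "cross (scl r x) y = scl r (cross x y)" "cross x (scl r y) = scl r (cross x y)"
 by (cases x rule: albert_cases; cases y rule: albert_cases;
   simp add: zmul_scl zbar_linear zscl_linear algebra_simps)+

lemma trace_commute: "trace x y = trace y x"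
 by (cases x rule: albert_cases; cases y rule: albert_cases) (simp add: zpol_commute algebra_simps)

lemma trace_add: "trace (x + y) z = trace x z + trace y z" "trace z (x + y) = trace z x + trace z y"
 by (cases x rule: albert_cases; cases y rule: albert_cases; cases z rule: albert_cases; simp add: algebra_simps)+

lemma trace_scl: "trace (scl r x) y = r * trace x y" "trace x (scl r y) = r * trace x y"
 by (cases x rule: albert_cases; cases y rule: albert_cases; simp add: algebra_simps)+

lemma cross_minus: "cross (- x) y = - cross x y" "cross x (- y) = - cross x y"
 using cross_scl[where r = "-1" and x = x and y = y] by (simp_all add: scl_minus)

lemma cross_diff: "cross (x - y) z = cross x z - cross y z" "cross z (x - y) = cross z x - cross z y"
 using cross_add[of x "- y" z] cross_add[of z x "- y"] by (simp_all add: cross_minus)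

lemma cross_zero [simp]: "cross 0 x = 0" "cross x 0 = 0"
 using cross_scl(1)[where r = 0 and x = 0 and y = x] cross_scl(2)[where r = 0 and x = x and y = 0] by simp_all

lemma trace_minus: "trace (- x) y = - trace x y" "trace x (- y) = - trace x y"
 using trace_scl[where r = "-1" and x = x and y = y] by (simp_all add: scl_minus)

lemma trace_diff: "trace (x - y) z = trace x z - trace y z" "trace z (x - y) = trace z x - trace z y"
 using trace_add[of x "- y" z] trace_add[of z x "- y"] by (simp_all add: trace_minus)

lemma trace_zero [simp]: "trace 0 x = 0" "trace x 0 = 0"
 using trace_scl(1)[where r = 0 and x = 0 and y = x] trace_scl(2)[where r = 0 and x = x and y = 0] by simp_all

text \<open>Both sides are the full polarisation of the cubic norm, a symmetric trilinear form. The
  diagonal terms agree by inspection, the octonion terms by \<open>zpol_cyclic\<close>; the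
  instances of \<open>rot\<close> and \<open>zpol_commute\<close> only bring them to one normal
  form.\<close>

lemma trace_assoc: "trace (cross a b) c = trace a (cross b c)"
proof (cases a rule: albert_cases; cases b rule: albert_cases; cases c rule: albert_cases)
 fix x1 x2 x3 :: 'a and a1 a2 a3 and y1 y2 y3 :: 'a and b1 b2 b3 and z1 z2 z3 :: 'a and c1 c2 c3
 assume [simp]: "a = ((x1, x2, x3), a1, a2, a3)" "b = ((y1, y2, y3), b1, b2, b3)" "c = ((z1, z2, z3), c1, c2, c3)"
 have cyc: "zpol (zbar (zmul x y)) z = zpol x (zbar (zmul y z))" 
   "zpol (zbar (zmul y x)) z = zpol x (zbar (zmul z y))" for x y z :: "'a zorn"
  by (metis zpol_commute zpol_cyclic)+
 have rot: "zpol x (zbar (zmul y z)) = zpol y (zbar (zmul z x))" for x y z :: "'a zorn"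
  by (metis zpol_commute zpol_cyclic)
 show ?thesis
  by (simp add: zmul_add zbar_linear cyc rot[of b1] rot[of b2] rot[of b3] zpol_commute[of c1] zpol_commute[of c2] zpol_commute[of c3] zpol_commute[of b1 a1] zpol_commute[of b2 a2] zpol_commute[of b3 a3] algebra_simps)
qed

section \<open>The linearised adjoint identity\<close>

text \<open>The difference of the two sides of the full linearisation, in x, of x \<times> (x^#
  \<times> b) = N(x) b + T(x, b) x^#. Being multilinear in a, c, d, b, unlike the cubic identity, it
  vanishes as soon as it vanishes on generators.\<close>

definition jordan_defect :: "'a::comm_ring_1 albert => 'a albert => 'a albert => 'a albert => 'a albert"
 where "jordan_defect a c d b =
  cross a (cross (cross c d) b) + cross c (cross (cross d a) b) + cross d (cross (cross a c) b) -
  (scl (trace (cross c d) a) b + scl (trace a b) (cross c d) + scl (trace c b) (cross d a) + scl (trace d b) (cross a c))"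

text \<open>Together with the next lemma this gives full symmetry in the first three arguments,
  which cuts the block cases from 64 to 20.\<close>

lemma jordan_defect_swap12: "jordan_defect a c d b = jordan_defect c a d b"
proof -
 have "trace (cross d a) c = trace (cross c d) a"
  by (metis trace_assoc trace_commute)
 then show ?thesis
  unfolding jordan_defect_def cross_commute[of a d] cross_commute[of d c] cross_commute[of c a]
  by (simp add: add_ac)
qed

lemma jordan_defect_swap23: "jordan_defect a c d b = jordan_defect a d c b"
 unfolding jordan_defect_def cross_commute[of c a] cross_commute[of a d] cross_commute[of d c] by (simp add: add_ac)

lemma jordan_defect_add:
 "jordan_defect (a + a') c d b = jordan_defect a c d b + jordan_defect a' c d b"
 "jordan_defect a c d (b + b') = jordan_defect a c d b + jordan_defect a c d b'"
 unfolding jordan_defect_def by (simp_all add: cross_add trace_add scl_linear algebra_simps)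

lemma jordan_defect_scl:
 "jordan_defect (scl r a) c d b = scl r (jordan_defect a c d b)"
 "jordan_defect a c d (scl r b) = scl r (jordan_defect a c d b)"
 unfolding jordan_defect_def by (simp_all add: cross_scl trace_scl scl_linear scl_diff mult.commute[of _ r])

definition diag_elt :: "'a::comm_ring_1 \<times> 'a \<times> 'a => 'a albert" where "diag_elt v = (v, (0, 0, 0))"
definition off1 :: "'a::comm_ring_1 zorn => 'a albert" where "off1 c = ((0, 0, 0), (c, 0, 0))"
definition off2 :: "'a::comm_ring_1 zorn => 'a albert" where "off2 c = ((0, 0, 0), (0, c, 0))"
definition off3 :: "'a::comm_ring_1 zorn => 'a albert" where "off3 c = ((0, 0, 0), (0, 0, c))"

lemmas off_defs = diag_elt_def off1_def off2_def off3_def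

lemma albert_decompose: "((x1, x2, x3), (c1, c2, c3)) = diag_elt (x1, x2, x3) + off1 c1 + off2 c2 + off3 c3"
 by (simp add: off_defs)

lemma albert_cases_full:
 obtains x1 x2 x3 c1 c2 c3 c4 c5 c6 c7 c8 d1 d2 d3 d4 d5 d6 d7 d8 e1 e2 e3 e4 e5 e6 e7 e8
 where "(x :: 'a albert) = ((x1, x2, x3), ((c1,(c2,c3,c4),(c5,c6,c7),c8), (d1,(d2,d3,d4),(d5,d6,d7),d8), (e1,(e2,e3,e4),(e5,e6,e7),e8)))"
 by (cases x) auto

context
 fixes p1 p2 p3 p4 p5 p6 p7 p8 q1 q2 q3 q4 q5 q6 q7 q8 r1 r2 r3 r4 r5 r6 r7 r8 x1 x2 x3
  c1 c2 c3 c4 c5 c6 c7 c8 d1 d2 d3 d4 d5 d6 d7 d8 e1 e2 e3 e4 e5 e6 e7 e8 :: int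
begin

abbreviation (input) "vecP0 \<equiv> diag_elt (p1,p2,p3)"
abbreviation (input) "vecP1 \<equiv> off1 (p1,(p2,p3,p4),(p5,p6,p7),p8)"
abbreviation (input) "vecP2 \<equiv> off2 (p1,(p2,p3,p4),(p5,p6,p7),p8)"
abbreviation (input) "vecP3 \<equiv> off3 (p1,(p2,p3,p4),(p5,p6,p7),p8)"
abbreviation (input) "vecQ0 \<equiv> diag_elt (q1,q2,q3)"
abbreviation (input) "vecQ1 \<equiv> off1 (q1,(q2,q3,q4),(q5,q6,q7),q8)"
abbreviation (input) "vecQ2 \<equiv> off2 (q1,(q2,q3,q4),(q5,q6,q7),q8)"
abbreviation (input) "vecQ3 \<equiv> off3 (q1,(q2,q3,q4),(q5,q6,q7),q8)"
abbreviation (input) "vecR0 \<equiv> diag_elt (r1,r2,r3)"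
abbreviation (input) "vecR1 \<equiv> off1 (r1,(r2,r3,r4),(r5,r6,r7),r8)"
abbreviation (input) "vecR2 \<equiv> off2 (r1,(r2,r3,r4),(r5,r6,r7),r8)"
abbreviation (input) "vecR3 \<equiv> off3 (r1,(r2,r3,r4),(r5,r6,r7),r8)"
abbreviation (input) "vecX \<equiv> ((x1,x2,x3),((c1,(c2,c3,c4),(c5,c6,c7),c8),(d1,(d2,d3,d4),(d5,d6,d7),d8),(e1,(e2,e3,e4),(e5,e6,e7),e8)))"

text \<open>The digits name the blocks of the three symmetric arguments: 0 for the diagonal, 1 to 3
  for the octonion slots. By symmetry the nondecreasing triples suffice. The last argument stays
  general; confining the others to one block each keeps the polynomials small enough for Groebner
  bases.\<close>

lemma jordan_coords_000: "jordan_defect vecP0 vecQ0 vecR0 vecX = 0"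
 by (simp add: jordan_defect_def off_defs zero_prod_def, ((intro conjI)?, Groebner_Basis.algebra+)?)
lemma jordan_coords_001: "jordan_defect vecP0 vecQ0 vecR1 vecX = 0"
 by (simp add: jordan_defect_def off_defs zero_prod_def, ((intro conjI)?, Groebner_Basis.algebra+)?)
lemma jordan_coords_002: "jordan_defect vecP0 vecQ0 vecR2 vecX = 0"
 by (simp add: jordan_defect_def off_defs zero_prod_def, ((intro conjI)?, Groebner_Basis.algebra+)?)
lemma jordan_coords_003: "jordan_defect vecP0 vecQ0 vecR3 vecX = 0"
 by (simp add: jordan_defect_def off_defs zero_prod_def, ((intro conjI)?, Groebner_Basis.algebra+)?)
lemma jordan_coords_011: "jordan_defect vecP0 vecQ1 vecR1 vecX = 0"
 by (simp add: jordan_defect_def off_defs zero_prod_def, ((intro conjI)?, Groebner_Basis.algebra+)?)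
lemma jordan_coords_012: "jordan_defect vecP0 vecQ1 vecR2 vecX = 0"
 by (simp add: jordan_defect_def off_defs zero_prod_def, ((intro conjI)?, Groebner_Basis.algebra+)?)
lemma jordan_coords_013: "jordan_defect vecP0 vecQ1 vecR3 vecX = 0"
 by (simp add: jordan_defect_def off_defs zero_prod_def, ((intro conjI)?, Groebner_Basis.algebra+)?)
lemma jordan_coords_022: "jordan_defect vecP0 vecQ2 vecR2 vecX = 0"
 by (simp add: jordan_defect_def off_defs zero_prod_def, ((intro conjI)?, Groebner_Basis.algebra+)?)
lemma jordan_coords_023: "jordan_defect vecP0 vecQ2 vecR3 vecX = 0"
 by (simp add: jordan_defect_def off_defs zero_prod_def, ((intro conjI)?, Groebner_Basis.algebra+)?)
lemma jordan_coords_033: "jordan_defect vecP0 vecQ3 vecR3 vecX = 0"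
 by (simp add: jordan_defect_def off_defs zero_prod_def, ((intro conjI)?, Groebner_Basis.algebra+)?)
lemma jordan_coords_111: "jordan_defect vecP1 vecQ1 vecR1 vecX = 0"
 by (simp add: jordan_defect_def off_defs zero_prod_def, ((intro conjI)?, Groebner_Basis.algebra+)?)
lemma jordan_coords_112: "jordan_defect vecP1 vecQ1 vecR2 vecX = 0"
 by (simp add: jordan_defect_def off_defs zero_prod_def, ((intro conjI)?, Groebner_Basis.algebra+)?)
lemma jordan_coords_113: "jordan_defect vecP1 vecQ1 vecR3 vecX = 0"
 by (simp add: jordan_defect_def off_defs zero_prod_def, ((intro conjI)?, Groebner_Basis.algebra+)?)
lemma jordan_coords_122: "jordan_defect vecP1 vecQ2 vecR2 vecX = 0"
 by (simp add: jordan_defect_def off_defs zero_prod_def, ((intro conjI)?, Groebner_Basis.algebra+)?)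
lemma jordan_coords_123: "jordan_defect vecP1 vecQ2 vecR3 vecX = 0"
 by (simp add: jordan_defect_def off_defs zero_prod_def, ((intro conjI)?, Groebner_Basis.algebra+)?)
lemma jordan_coords_133: "jordan_defect vecP1 vecQ3 vecR3 vecX = 0"
 by (simp add: jordan_defect_def off_defs zero_prod_def, ((intro conjI)?, Groebner_Basis.algebra+)?)
lemma jordan_coords_222: "jordan_defect vecP2 vecQ2 vecR2 vecX = 0"
 by (simp add: jordan_defect_def off_defs zero_prod_def, ((intro conjI)?, Groebner_Basis.algebra+)?)
lemma jordan_coords_223: "jordan_defect vecP2 vecQ2 vecR3 vecX = 0"
 by (simp add: jordan_defect_def off_defs zero_prod_def, ((intro conjI)?, Groebner_Basis.algebra+)?)
lemma jordan_coords_233: "jordan_defect vecP2 vecQ3 vecR3 vecX = 0"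
 by (simp add: jordan_defect_def off_defs zero_prod_def, ((intro conjI)?, Groebner_Basis.algebra+)?)
lemma jordan_coords_333: "jordan_defect vecP3 vecQ3 vecR3 vecX = 0"
 by (simp add: jordan_defect_def off_defs zero_prod_def, ((intro conjI)?, Groebner_Basis.algebra+)?)

end

lemma jordan_int_000: "jordan_defect (diag_elt p) (diag_elt q) (diag_elt r) b = (0 :: int albert)"
 by (cases p; cases q; cases r; cases b rule: albert_cases_full; hypsubst; rule jordan_coords_000)
lemma jordan_int_001: "jordan_defect (diag_elt p) (diag_elt q) (off1 r) b = (0 :: int albert)"
 by (cases p; cases q; cases r rule: zorn_cases; cases b rule: albert_cases_full; hypsubst; rule jordan_coords_001)
lemma jordan_int_002: "jordan_defect (diag_elt p) (diag_elt q) (off2 r) b = (0 :: int albert)"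
 by (cases p; cases q; cases r rule: zorn_cases; cases b rule: albert_cases_full; hypsubst; rule jordan_coords_002)
lemma jordan_int_003: "jordan_defect (diag_elt p) (diag_elt q) (off3 r) b = (0 :: int albert)"
 by (cases p; cases q; cases r rule: zorn_cases; cases b rule: albert_cases_full; hypsubst; rule jordan_coords_003)
lemma jordan_int_011: "jordan_defect (diag_elt p) (off1 q) (off1 r) b = (0 :: int albert)"
 by (cases p; cases q rule: zorn_cases; cases r rule: zorn_cases; cases b rule: albert_cases_full; hypsubst; rule jordan_coords_011)
lemma jordan_int_012: "jordan_defect (diag_elt p) (off1 q) (off2 r) b = (0 :: int albert)"
 by (cases p; cases q rule: zorn_cases; cases r rule: zorn_cases; cases b rule: albert_cases_full; hypsubst; rule jordan_coords_012)
lemma jordan_int_013: "jordan_defect (diag_elt p) (off1 q) (off3 r) b = (0 :: int albert)"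
 by (cases p; cases q rule: zorn_cases; cases r rule: zorn_cases; cases b rule: albert_cases_full; hypsubst; rule jordan_coords_013)
lemma jordan_int_022: "jordan_defect (diag_elt p) (off2 q) (off2 r) b = (0 :: int albert)"
 by (cases p; cases q rule: zorn_cases; cases r rule: zorn_cases; cases b rule: albert_cases_full; hypsubst; rule jordan_coords_022)
lemma jordan_int_023: "jordan_defect (diag_elt p) (off2 q) (off3 r) b = (0 :: int albert)"
 by (cases p; cases q rule: zorn_cases; cases r rule: zorn_cases; cases b rule: albert_cases_full; hypsubst; rule jordan_coords_023)
lemma jordan_int_033: "jordan_defect (diag_elt p) (off3 q) (off3 r) b = (0 :: int albert)"
 by (cases p; cases q rule: zorn_cases; cases r rule: zorn_cases; cases b rule: albert_cases_full; hypsubst; rule jordan_coords_033)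
lemma jordan_int_111: "jordan_defect (off1 p) (off1 q) (off1 r) b = (0 :: int albert)"
 by (cases p rule: zorn_cases; cases q rule: zorn_cases; cases r rule: zorn_cases; cases b rule: albert_cases_full; hypsubst; rule jordan_coords_111)
lemma jordan_int_112: "jordan_defect (off1 p) (off1 q) (off2 r) b = (0 :: int albert)"
 by (cases p rule: zorn_cases; cases q rule: zorn_cases; cases r rule: zorn_cases; cases b rule: albert_cases_full; hypsubst; rule jordan_coords_112)
lemma jordan_int_113: "jordan_defect (off1 p) (off1 q) (off3 r) b = (0 :: int albert)"
 by (cases p rule: zorn_cases; cases q rule: zorn_cases; cases r rule: zorn_cases; cases b rule: albert_cases_full; hypsubst; rule jordan_coords_113)
lemma jordan_int_122: "jordan_defect (off1 p) (off2 q) (off2 r) b = (0 :: int albert)"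
 by (cases p rule: zorn_cases; cases q rule: zorn_cases; cases r rule: zorn_cases; cases b rule: albert_cases_full; hypsubst; rule jordan_coords_122)
lemma jordan_int_123: "jordan_defect (off1 p) (off2 q) (off3 r) b = (0 :: int albert)"
 by (cases p rule: zorn_cases; cases q rule: zorn_cases; cases r rule: zorn_cases; cases b rule: albert_cases_full; hypsubst; rule jordan_coords_123)
lemma jordan_int_133: "jordan_defect (off1 p) (off3 q) (off3 r) b = (0 :: int albert)"
 by (cases p rule: zorn_cases; cases q rule: zorn_cases; cases r rule: zorn_cases; cases b rule: albert_cases_full; hypsubst; rule jordan_coords_133)
lemma jordan_int_222: "jordan_defect (off2 p) (off2 q) (off2 r) b = (0 :: int albert)"
 by (cases p rule: zorn_cases; cases q rule: zorn_cases; cases r rule: zorn_cases; cases b rule: albert_cases_full; hypsubst; rule jordan_coords_222)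
lemma jordan_int_223: "jordan_defect (off2 p) (off2 q) (off3 r) b = (0 :: int albert)"
 by (cases p rule: zorn_cases; cases q rule: zorn_cases; cases r rule: zorn_cases; cases b rule: albert_cases_full; hypsubst; rule jordan_coords_223)
lemma jordan_int_233: "jordan_defect (off2 p) (off3 q) (off3 r) b = (0 :: int albert)"
 by (cases p rule: zorn_cases; cases q rule: zorn_cases; cases r rule: zorn_cases; cases b rule: albert_cases_full; hypsubst; rule jordan_coords_233)
lemma jordan_int_333: "jordan_defect (off3 p) (off3 q) (off3 r) b = (0 :: int albert)"
 by (cases p rule: zorn_cases; cases q rule: zorn_cases; cases r rule: zorn_cases; cases b rule: albert_cases_full; hypsubst; rule jordan_coords_333)

lemmas jordan_int = jordan_int_000 jordan_int_001 jordan_int_002 jordan_int_003 jordan_int_011 jordan_int_012 jordan_int_013 jordan_int_022 jordan_int_023 jordan_int_033 jordan_int_111 jordan_int_112 jordan_int_113 jordan_int_122 jordan_int_123 jordan_int_133 jordan_int_222 jordan_int_223 jordan_int_233 jordan_int_333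

text \<open>The six permutations of the symmetric arguments, so that every ordered triple of blocks
  is matched by some rewrite rule.\<close>

lemmas jordan_int_perms =
 jordan_int
 jordan_int[THEN trans[OF jordan_defect_swap12]]
 jordan_int[THEN trans[OF jordan_defect_swap23]]
 jordan_int[THEN trans[OF jordan_defect_swap12], THEN trans[OF jordan_defect_swap23]]
 jordan_int[THEN trans[OF jordan_defect_swap23], THEN trans[OF jordan_defect_swap12]]
 jordan_int[THEN trans[OF jordan_defect_swap12], THEN trans[OF jordan_defect_swap23], THEN trans[OF jordan_defect_swap12]]

text \<open>The vanishing is spread over one argument at a time: the last one first, then each
  symmetric argument after the swaps have moved it to the front, so linearity is used in two slots
  only. Generation by \<open>X\<close> and \<open>Y\<close> enters as an induction principle, which
  both applications provide directly.\<close>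

lemma jordan_defect_additive_induct:
 fixes X Y :: "'a::comm_ring_1 albert set" and a c d b :: "'a albert"
 assumes "!!a c d b. a : X ==> c : X ==> d : X ==> b : Y ==> jordan_defect a c d b = 0"
  and X: "!!Q x. \<lbrakk>!!x. x : X ==> Q x; !!x y. Q x ==> Q y ==> Q (x + y); !!r x. Q x ==> Q (scl r x)\<rbrakk> \<Longrightarrow> Q x"
  and Y: "!!Q x. \<lbrakk>!!x. x : Y ==> Q x; !!x y. Q x ==> Q y ==> Q (x + y); !!r x. Q x ==> Q (scl r x)\<rbrakk> \<Longrightarrow> Q x"
 shows "jordan_defect a c d b = 0"
proof -
 have 1: "jordan_defect a c d b = 0" if "a : X" "c : X" "d : X" for a c d b
  by (rule Y[of "%b. jordan_defect a c d b = 0"])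
   (simp_all add: assms(1)[OF that] jordan_defect_add jordan_defect_scl)
 have 2: "jordan_defect a c d b = 0" if "c : X" "d : X" for a c d b :: "'a albert"
  by (rule X[of "%a. jordan_defect a c d b = 0"])
   (simp_all add: 1[OF _ that] jordan_defect_add jordan_defect_scl)
 have 3: "jordan_defect c a d b = 0" if "d : X" for a c d b :: "'a albert"
  by (rule X[of "%c. jordan_defect c a d b = 0"])
   (simp_all add: 2[OF _ that, THEN trans[OF jordan_defect_swap12]] jordan_defect_add jordan_defect_scl)
 show ?thesis
  by (rule X[of "%a. jordan_defect a c d b = 0"])
   (simp_all add: 3[THEN trans[OF jordan_defect_swap23], THEN trans[OF jordan_defect_swap12]] jordan_defect_add jordan_defect_scl)
qed

lemma jordan_defect_int: "jordan_defect a c d b = (0 :: int albert)"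
proof (rule jordan_defect_additive_induct)
 fix a c d b :: "int albert"
 define Ty :: "int albert set" where "Ty = range diag_elt \<union> range off1 \<union> range off2 \<union> range off3"
 assume "a : range diag_elt \<union> range off1 \<union> range off2 \<union> range off3"
  "c : range diag_elt \<union> range off1 \<union> range off2 \<union> range off3"
  "d : range diag_elt \<union> range off1 \<union> range off2 \<union> range off3" "b : UNIV"
 then show "jordan_defect a c d b = 0"
  by (elim UnE rangeE; simp only: jordan_int_perms)
next
 fix Q :: "int albert => bool" and x
 assume Q: "!!x. x : range diag_elt \<union> range off1 \<union> range off2 \<union> range off3 ==> Q x"
  "!!x y. Q x ==> Q y ==> Q (x + y)"
 have "Q (diag_elt v + off1 c + off2 c' + off3 c'')" for v c c' c''
  by (intro Q) simp_all
 then show "Q x"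
  by (cases x rule: albert_cases) (simp only: albert_decompose)
qed auto

fun zorn_map :: "('a => 'b) => 'a zorn => 'b zorn"
 where "zorn_map h (a, (u1, u2, u3), (v1, v2, v3), b) = (h a, (h u1, h u2, h u3), (h v1, h v2, h v3), h b)"

fun albert_map :: "('a => 'b) => 'a albert => 'b albert"
 where "albert_map h ((x1, x2, x3), (c1, c2, c3)) = ((h x1, h x2, h x3), (zorn_map h c1, zorn_map h c2, zorn_map h c3))"

text \<open>All operations are polynomials with integer coefficients and hence commute with
  \<open>of_int\<close>.\<close>

lemma albert_map_of_int:
 fixes x y :: "int albert"
 defines "h \<equiv> albert_map (of_int :: int => 'a::comm_ring_1)"
 shows "cross (h x) (h y) = h (cross x y)" "trace (h x) (h y) = of_int (trace x y)"
  "h x + h y = h (x + y)" "h x - h y = h (x - y)" "scl (of_int r) (h x) = h (scl r x)" "h 0 = 0"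
proof -
 define z where "z = zorn_map (of_int :: int => 'a)"
 have z: "zmul (z c) (z d) = z (zmul c d)" "zbar (z c) = z (zbar c)" "zpol (z c) (z d) = of_int (zpol c d)"
  "z c + z d = z (c + d)" "z c - z d = z (c - d)" "zscl (of_int k) (z c) = z (zscl k c)" for c d k
  by (cases c rule: zorn_cases; cases d rule: zorn_cases; simp add: z_def)+
 show "cross (h x) (h y) = h (cross x y)" "trace (h x) (h y) = of_int (trace x y)"
  "h x + h y = h (x + y)" "h x - h y = h (x - y)" "scl (of_int r) (h x) = h (scl r x)"
  by (cases x rule: albert_cases; cases y rule: albert_cases; simp add: h_def z z_def[symmetric])+
 show "h 0 = 0"
  by (simp add: h_def zero_prod_def)
qed

text \<open>The defect is multilinear, so its vanishing over \<open>int\<close> implies its vanishing over every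
 commutative ring.\<close>

theorem jordan_defect_zero: "jordan_defect a c d b = (0 :: 'a::comm_ring_1 albert)"
proof (rule jordan_defect_additive_induct)
 fix a c d b :: "'a albert"
 let ?h = "albert_map (of_int :: int => 'a)"
 assume "a : range ?h" "c : range ?h" "d : range ?h" "b : range ?h"
 then obtain a' c' d' b' where "a = ?h a'" "c = ?h c'" "d = ?h d'" "b = ?h b'"
  by auto
 then have "jordan_defect a c d b = ?h (jordan_defect a' c' d' b')"
  by (simp only: jordan_defect_def albert_map_of_int)
 then show "jordan_defect a c d b = 0"
  by (simp only: jordan_defect_int albert_map_of_int)
next
 \<comment> \<open>The images of the integral coordinate vectors span the Albert algebra over any
   ring; \<open>z\<close> below expands an octonion in the eight matrix units.\<close>
 have *: "Q x" if Z: "!!x. x : range (albert_map of_int) ==> Q x"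
  "!!x y. Q x ==> Q y ==> Q (x + y)" "!!r x. Q x ==> Q (scl r x)" for Q :: "'a albert => bool" and x
 proof (cases x rule: albert_cases)
  case (1 x1 x2 x3 c1 c2 c3)
  have I: "Q (scl r (albert_map of_int e))" for r e
   by (intro Z) simp
  have D: "Q (diag_elt (x1, x2, x3))" for x1 x2 x3
  proof -
   have "diag_elt (x1, x2, x3) = scl x1 (albert_map of_int ((1,0,0),0)) + scl x2 (albert_map of_int ((0,1,0),0))
     + scl x3 (albert_map of_int ((0,0,1),0))"
    by (simp add: off_defs zero_prod_def)
   then show ?thesis by (simp only:) (intro Z(2) I)
  qed
  have z: "c = zscl a (zorn_map of_int (1, 0, 0, 0)) + zscl b (zorn_map of_int (0, 0, 0, 1))
    + zscl u1 (zorn_map of_int (0, (1, 0, 0), 0, 0)) + zscl u2 (zorn_map of_int (0, (0, 1, 0), 0, 0)) + zscl u3 (zorn_map of_int (0, (0, 0, 1), 0, 0))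
    + zscl v1 (zorn_map of_int (0, 0, (1, 0, 0), 0)) + zscl v2 (zorn_map of_int (0, 0, (0, 1, 0), 0)) + zscl v3 (zorn_map of_int (0, 0, (0, 0, 1), 0))"
   if "c = (a, (u1, u2, u3), (v1, v2, v3), b)" for c and a b u1 u2 u3 v1 v2 v3 :: 'a
   using that by (simp add: zero_prod_def)
  have off_lin: "off1 (c + d) = off1 c + off1 d" "off2 (c + d) = off2 c + off2 d" "off3 (c + d) = off3 c + off3 d"
   "off1 (zscl r c) = scl r (off1 c)" "off2 (zscl r c) = scl r (off2 c)" "off3 (zscl r c) = scl r (off3 c)"
   "off1 (zorn_map of_int e) = albert_map of_int (off1 e)"
   "off2 (zorn_map of_int e) = albert_map of_int (off2 e)"
   "off3 (zorn_map of_int e) = albert_map of_int (off3 e)" for c d e and r :: 'a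
   by (simp_all add: off_defs zero_prod_def)
  have "Q (off1 c)" "Q (off2 c)" "Q (off3 c)" for c
   by (cases c rule: zorn_cases; drule z; simp only: off_lin; intro Z(2) I)+
  then show ?thesis
   unfolding 1 albert_decompose by (intro Z(2) D)
 qed
 fix Q :: "'a albert => bool" and x
 assume "!!x. x : range (albert_map of_int) ==> Q x"
  "!!x y. Q x ==> Q y ==> Q (x + y)" "!!r x. Q x ==> Q (scl r x)"
 then show "Q x" "Q x" by (rule *; blast)+
qed

section \<open>The operators \<open>Vb\<close> on the split Brown algebra and their derivation
  rules\<close>

abbreviation bmul :: "'a::comm_ring_1 brown => 'a brown => 'a brown"
 where "bmul \<equiv> brown_mult class_ring"
abbreviation bscl :: "'a::comm_ring_1 => 'a brown => 'a brown"
 where "bscl \<equiv> brown_smult class_ring"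

definition Vb :: "'a::comm_ring_1 brown => 'a brown => 'a brown => 'a brown"
 where "Vb x y z = bmul (bmul x (brown_invol y)) z + bmul (bmul z (brown_invol y)) x - bmul (bmul z (brown_invol x)) y"

text \<open>The operators \<open>Vb x y\<close> span a Lie algebra of type E7 enlarged by the
  scalars. It is 3-graded with outer parts \<open>phi f\<close> and \<open>psi e\<close>, each a
  copy of the Albert algebra, and middle part spanned by their commutators \<open>jop\<close> and
  the diagonal operators \<open>kap1\<close> and \<open>kap2\<close>, whose sum is the
  identity.\<close>

fun phi :: "'a::comm_ring_1 albert => 'a brown => 'a brown"
 where "phi f (r, a, b, s) = (0, cross f b, scl r f, trace f a)"

fun psi :: "'a::comm_ring_1 albert => 'a brown => 'a brown"
 where "psi e (r, a, b, s) = (trace e b, scl s e, cross e a, 0)"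

fun kap1 :: "'a::comm_ring_1 brown => 'a brown"
 where "kap1 (r, a, b, s) = (r + r, 0, b, - s)"

fun kap2 :: "'a::comm_ring_1 brown => 'a brown"
 where "kap2 (r, a, b, s) = (- r, a, 0, s + s)"

lemma albert_add_class [simp]: "albert_add class_ring x y = x + y"
 by (cases x rule: albert_cases_full; cases y rule: albert_cases_full) simp

lemma albert_diff_class [simp]: "albert_diff class_ring x y = x - y"
 by (cases x rule: albert_cases_full; cases y rule: albert_cases_full) simp

lemma brown_cases: obtains r a b s where "(x :: 'a brown) = (r, a, b, s)"
 by (cases x)

definition tri :: "'a::comm_ring_1 albert => 'a albert => 'a albert => 'a"
 where "tri a b c = trace a (cross b c)"

lemma trace_cross: "trace a (cross b c) = tri a b c" "trace (cross b c) a = tri b c a"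
 by (simp_all add: tri_def trace_assoc)

lemma tri_commute: "tri a b c = tri b a c" "tri a b c = tri a c b"
 unfolding tri_def by (metis trace_assoc cross_commute)+

lemma tri_linear:
 "tri (a + b) c d = tri a c d + tri b c d" "tri c (a + b) d = tri c a d + tri c b d" "tri c d (a + b) = tri c d a + tri c d b"
 "tri (a - b) c d = tri a c d - tri b c d" "tri c (a - b) d = tri c a d - tri c b d" "tri c d (a - b) = tri c d a - tri c d b"
 "tri (- b) c d = - tri b c d" "tri c (- b) d = - tri c b d" "tri c d (- b) = - tri c d b"
 "tri (scl r b) c d = r * tri b c d" "tri c (scl r b) d = r * tri c b d" "tri c d (scl r b) = r * tri c d b"
 by (simp_all add: tri_def cross_add cross_scl cross_diff cross_minus trace_add trace_scl trace_diff trace_minus)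

lemma tri_cross: "tri (cross c d) a b = tri (cross a b) c d"
 by (metis tri_commute tri_def trace_assoc trace_commute)

lemmas albert_simps = cross_add cross_scl cross_diff cross_minus trace_add trace_scl trace_diff trace_minus
 scl_linear scl_diff scl_minus trace_cross tri_linear

lemmas albert_comm = cross_commute trace_commute tri_commute


lemma bscl_linear:
 "bscl r (x + y) = bscl r x + bscl r y" "bscl (r + s) x = bscl r x + bscl s x"
 "bscl r (bscl s x) = bscl (r * s) x" "bscl r (x - y) = bscl r x - bscl r y"
 "bscl (r - s) x = bscl r x - bscl s x" "bscl (- r) x = - bscl r x" "bscl r (- x) = - bscl r x"
 by (cases x rule: brown_cases; cases y rule: brown_cases; simp add: scl_linear scl_diff scl_minus algebra_simps)+

lemma brown_zero: "(0 :: 'a::comm_ring_1 brown) = (0, 0, 0, 0)"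
 by (simp add: zero_prod_def)

lemma bscl_simps [simp]: "bscl 1 x = x" "bscl 0 x = 0" "bscl r 0 = 0"
 by (cases x rule: brown_cases; simp add: brown_zero)+

definition jop :: "'a::comm_ring_1 albert => 'a albert => 'a brown => 'a brown"
 where "jop f e z = phi f (psi e z) - psi e (phi f z)"

lemma jop_simp [simp]: "jop f e (r, a, b, s) =
 (- (r * trace e f), cross f (cross e a) - scl (trace f a) e, scl (trace e b) f - cross e (cross f b), s * trace e f)"
 by (simp add: jop_def albert_simps albert_comm)

lemma phi_linear [simp]:
 "phi f (x + y) = phi f x + phi f y" "phi f (x - y) = phi f x - phi f y" "phi f (- x) = - phi f x"
 "phi f (bscl r x) = bscl r (phi f x)"
 by (cases x rule: brown_cases; cases y rule: brown_cases; simp add: albert_simps mult.commute algebra_simps)+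

lemma phi_left_linear:
 "phi (f + g) x = phi f x + phi g x" "phi (f - g) x = phi f x - phi g x" "phi (- f) x = - phi f x"
 "phi (scl r f) x = bscl r (phi f x)"
 by (cases x rule: brown_cases; simp add: albert_simps mult.commute algebra_simps)+

lemma psi_left_linear:
 "psi (f + g) x = psi f x + psi g x" "psi (f - g) x = psi f x - psi g x" "psi (- f) x = - psi f x"
 "psi (scl r f) x = bscl r (psi f x)"
 by (cases x rule: brown_cases; simp add: albert_simps mult.commute algebra_simps)+

lemma jop_left_linear:
 "jop (f + g) e x = jop f e x + jop g e x" "jop (f - g) e x = jop f e x - jop g e x"
 "jop (- f) e x = - jop f e x" "jop (scl r f) e x = bscl r (jop f e x)"
 "jop e (f + g) x = jop e f x + jop e g x" "jop e (f - g) x = jop e f x - jop e g x"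
 "jop e (- f) x = - jop e f x" "jop e (scl r f) x = bscl r (jop e f x)"
 by (cases x rule: brown_cases; simp add: albert_simps algebra_simps)+

text \<open>Reduces every later statement about \<open>Vb\<close> to these five kinds of operators.
  Interchanging x and y keeps the coefficients of \<open>phi\<close> and \<open>psi\<close>,
  exchanges those of \<open>kap1\<close> and \<open>kap2\<close> and negates the \<open>jop\<close>
  part; this rule produces the signs in the derivation lemmas below.\<close>

lemma Vb_decompose:
 "Vb (r, a, b, s) (r', a', b', s') z =
  bscl (r * s' + trace b a') (kap1 z) + bscl (s * r' + trace a b') (kap2 z) +
  phi (scl s b' + scl s' b + cross a a') z + psi (scl r a' + scl r' a + cross b b') z +
  jop b a' z - jop b' a z"
 by (cases z rule: brown_cases)
  (simp add: Vb_def albert_simps albert_comm algebra_simps)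

lemma scl_two: "scl (r * 2) f = scl r f + scl r f"
 by (simp add: scl_linear(2)[symmetric] mult.commute)

lemma phi_kap: "phi f (kap1 z) = kap1 (phi f z) + phi f z" "phi f (kap2 z) = kap2 (phi f z) - phi f z"
 by (cases z rule: brown_cases, simp add: scl_two albert_simps algebra_simps)
   (cases z rule: brown_cases, simp add: scl_two albert_simps algebra_simps)

lemma phi_phi: "phi f (phi g z) = phi g (phi f z)"
 by (cases z rule: brown_cases) (simp add: albert_simps albert_comm)

lemma jordan_identity:
 "cross a (cross (cross c d) b) + cross c (cross (cross d a) b) + cross d (cross (cross a c) b) =
  scl (trace a (cross c d)) b + scl (trace a b) (cross c d) + scl (trace c b) (cross d a) + scl (trace d b) (cross a c)"
 using jordan_defect_zero[of a c d b] by (simp add: jordan_defect_def trace_commute[of a])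

text \<open>Up to sign, each coordinate of x is its trace against one basis vector, so the basis
  vectors serve as test elements.\<close>

lemma trace_nondegenerate:
 assumes "!!w. trace x w = trace y w"
 shows "x = y"
proof (cases x rule: albert_cases_full; cases y rule: albert_cases_full)
 fix x1 x2 x3 c1 c2 c3 c4 c5 c6 c7 c8 d1 d2 d3 d4 d5 d6 d7 d8 e1 e2 e3 e4 e5 e6 e7 e8 :: 'a
  and y1 y2 y3 c1' c2' c3' c4' c5' c6' c7' c8' d1' d2' d3' d4' d5' d6' d7' d8' e1' e2' e3' e4' e5' e6' e7' e8' :: 'a
 assume x: "x = ((x1, x2, x3), ((c1,(c2,c3,c4),(c5,c6,c7),c8), (d1,(d2,d3,d4),(d5,d6,d7),d8), (e1,(e2,e3,e4),(e5,e6,e7),e8)))"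
  and y: "y = ((y1, y2, y3), ((c1',(c2',c3',c4'),(c5',c6',c7'),c8'), (d1',(d2',d3',d4'),(d5',d6',d7'),d8'), (e1',(e2',e3',e4'),(e5',e6',e7'),e8')))"
 have u: "zpol (a,(b,c,d),(e,f,g),h) (1,(0,0,0),(0,0,0),0) = h" "zpol (a,(b,c,d),(e,f,g),h) (0,(0,0,0),(0,0,0),1) = a"
  "zpol (a,(b,c,d),(e,f,g),h) (0,(1,0,0),(0,0,0),0) = - e" "zpol (a,(b,c,d),(e,f,g),h) (0,(0,1,0),(0,0,0),0) = - f"
  "zpol (a,(b,c,d),(e,f,g),h) (0,(0,0,1),(0,0,0),0) = - g" "zpol (a,(b,c,d),(e,f,g),h) (0,(0,0,0),(1,0,0),0) = - b"
  "zpol (a,(b,c,d),(e,f,g),h) (0,(0,0,0),(0,1,0),0) = - c" "zpol (a,(b,c,d),(e,f,g),h) (0,(0,0,0),(0,0,1),0) = - d"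
  for a b c d e f g h :: 'a
  by simp_all
 have "x1 = y1" "x2 = y2" "x3 = y3"
  using assms[of "((1,0,0),(0,0,0))"] assms[of "((0,1,0),(0,0,0))"] assms[of "((0,0,1),(0,0,0))"] by (simp_all add: x y del: zorn_polar_simp)
 moreover have "c1 = c1'" "c2 = c2'" "c3 = c3'" "c4 = c4'" "c5 = c5'" "c6 = c6'" "c7 = c7'" "c8 = c8'"
  using assms[of "((0,0,0),((0,(0,0,0),(0,0,0),1),0,0))"] assms[of "((0,0,0),((0,(0,0,0),(1,0,0),0),0,0))"]
   assms[of "((0,0,0),((0,(0,0,0),(0,1,0),0),0,0))"] assms[of "((0,0,0),((0,(0,0,0),(0,0,1),0),0,0))"]
   assms[of "((0,0,0),((0,(1,0,0),(0,0,0),0),0,0))"] assms[of "((0,0,0),((0,(0,1,0),(0,0,0),0),0,0))"]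
   assms[of "((0,0,0),((0,(0,0,1),(0,0,0),0),0,0))"] assms[of "((0,0,0),((1,(0,0,0),(0,0,0),0),0,0))"]
  by (simp_all add: x y u del: zorn_polar_simp)
 moreover have "d1 = d1'" "d2 = d2'" "d3 = d3'" "d4 = d4'" "d5 = d5'" "d6 = d6'" "d7 = d7'" "d8 = d8'"
  using assms[of "((0,0,0),(0,(0,(0,0,0),(0,0,0),1),0))"] assms[of "((0,0,0),(0,(0,(0,0,0),(1,0,0),0),0))"]
   assms[of "((0,0,0),(0,(0,(0,0,0),(0,1,0),0),0))"] assms[of "((0,0,0),(0,(0,(0,0,0),(0,0,1),0),0))"]
   assms[of "((0,0,0),(0,(0,(1,0,0),(0,0,0),0),0))"] assms[of "((0,0,0),(0,(0,(0,1,0),(0,0,0),0),0))"]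
   assms[of "((0,0,0),(0,(0,(0,0,1),(0,0,0),0),0))"] assms[of "((0,0,0),(0,(1,(0,0,0),(0,0,0),0),0))"]
  by (simp_all add: x y u del: zorn_polar_simp)
 moreover have "e1 = e1'" "e2 = e2'" "e3 = e3'" "e4 = e4'" "e5 = e5'" "e6 = e6'" "e7 = e7'" "e8 = e8'"
  using assms[of "((0,0,0),(0,0,(0,(0,0,0),(0,0,0),1)))"] assms[of "((0,0,0),(0,0,(0,(0,0,0),(1,0,0),0)))"]
   assms[of "((0,0,0),(0,0,(0,(0,0,0),(0,1,0),0)))"] assms[of "((0,0,0),(0,0,(0,(0,0,0),(0,0,1),0)))"]
   assms[of "((0,0,0),(0,0,(0,(1,0,0),(0,0,0),0)))"] assms[of "((0,0,0),(0,0,(0,(0,1,0),(0,0,0),0)))"]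
   assms[of "((0,0,0),(0,0,(0,(0,0,1),(0,0,0),0)))"] assms[of "((0,0,0),(0,0,(1,(0,0,0),(0,0,0),0)))"]
  by (simp_all add: x y u del: zorn_polar_simp)
 ultimately show ?thesis
  by (simp add: x y)
qed

text \<open>The linearisation of the adjoint identity: paired with \<open>w\<close>, the left-hand side is the trace of
 \<open>b\<close> and the left-hand side of the previous identity.\<close>

lemma adjoint_identity:
 "cross (cross b c) (cross d e) + cross (cross b d) (cross c e) + cross (cross b e) (cross c d) =
  scl (tri b c d) e + scl (tri b c e) d + scl (tri b d e) c + scl (tri c d e) b" (is "?l = ?r")
proof (rule trace_nondegenerate)
 fix w
 have "trace ?l w = trace b (cross c (cross (cross d e) w) + cross d (cross (cross e c) w) + cross e (cross (cross c d) w))"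
  by (simp only: trace_add trace_assoc cross_commute[of e c])
 then show "trace ?l w = trace ?r w"
  by (simp only: jordan_identity) (simp add: albert_simps albert_comm algebra_simps)
qed

text \<open>The commutator of \<open>phi f\<close> with \<open>jop b a\<close> is again of the form
  \<open>phi\<close>, with parameter minus the Jordan triple product {b, a, f}. On the second Albert
  component the claim is \<open>jordan_identity\<close>.\<close>

lemma phi_jop: "phi f (jop b a z) = jop b a (phi f z) + phi (cross a (cross b f) - scl (trace a b) f - scl (trace a f) b) z"
proof (cases z rule: brown_cases)
 case (1 t c d u)
 show ?thesis
  using jordan_identity[of b d f a] tri_cross[of b f a c]
  by (simp add: 1 albert_simps albert_comm algebra_simps)
qed

text \<open>Here both cubic identities enter: on the first Albert component the sum is governed by
  \<open>jordan_identity\<close>, on the second by \<open>adjoint_identity\<close>. It handles the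
  one term of \<open>phi_derives\<close> that is trilinear in Albert elements.\<close>

lemma jop_sum: "jop f (cross b c) z + jop b (cross c f) z + jop c (cross f b) z = bscl (trace f (cross b c)) (kap2 z - kap1 z)"
proof (cases z rule: brown_cases)
 case (1 t p q u)
 show ?thesis
  using jordan_identity[of f b c p] adjoint_identity[of f b c q]
  by (simp add: 1 albert_simps albert_comm algebra_simps)
qed

text \<open>An infinitesimal autotopy: the second variable moves by the negative of the operator
  obtained from the interchange rule of \<open>Vb_decompose\<close>, which sends
  \<open>phi f\<close> to itself. After decomposing \<open>Vb x y\<close>, everything is moved past
  \<open>phi f\<close>, and \<open>jop_sum\<close> closes the remaining term.\<close>

lemma phi_derives: "phi f (Vb x y z) = Vb (phi f x) y z - Vb x (phi f y) z + Vb x y (phi f z)"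
proof (cases x rule: brown_cases; cases y rule: brown_cases)
 fix r a b s r' a' b' s'
 assume [simp]: "x = (r, a, b, s)" "y = (r', a', b', s')"
 have j: "phi f (psi e z) = psi e (phi f z) + jop f e z" for e
  by (simp add: jop_def)
 show ?thesis
  using jop_sum[of f b b' z]
  by (simp add: Vb_decompose phi_kap phi_phi[of f] j phi_jop phi_left_linear psi_left_linear jop_left_linear albert_simps bscl_linear
   albert_comm algebra_simps)
qed

lemma tri_zero [simp]: "tri a b 0 = 0" "tri a 0 b = 0" "tri 0 a b = 0"
 by (simp_all add: tri_def)

lemma jop_zero [simp]: "jop 0 e z = 0" "jop e 0 z = 0"
 using jop_left_linear(4)[of 0 0 e z] jop_left_linear(8)[of e 0 0 z] by simp_all

lemma bscl_two: "bscl (r * 2) f = bscl r f + bscl r f"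
 by (simp add: bscl_linear(2)[symmetric] mult.commute)

text \<open>The automorphism that exchanges the diagonal entries and the two Albert entries. It
  turns \<open>phi\<close> into \<open>psi\<close> and \<open>kap1\<close> into \<open>kap2\<close>,
  so each derivation rule is computed only once.\<close>

fun swapb :: "'a brown => 'a brown" where "swapb (r, a, b, s) = (s, b, a, r)"

lemma swapb_swapb [simp]: "swapb (swapb x) = x"
 by (cases x rule: brown_cases) simp

lemma swapb_linear: "swapb (x + y) = swapb x + swapb y" "swapb (x - y) = swapb x - swapb y" "swapb (- x) = - swapb x"
  "swapb (bscl r x) = bscl r (swapb x)"
 by (cases x rule: brown_cases; cases y rule: brown_cases; simp)+

lemma swapb_bmul: "swapb (bmul x y) = bmul (swapb x) (swapb y)"
 by (cases x rule: brown_cases; cases y rule: brown_cases; simp)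

lemma swapb_Vb: "swapb (Vb x y z) = Vb (swapb x) (swapb y) (swapb z)"
proof -
 have "swapb (brown_invol x) = brown_invol (swapb x)" for x :: "'a brown"
  by (cases x rule: brown_cases) simp
 then show ?thesis
  by (simp add: Vb_def swapb_linear swapb_bmul)
qed

lemma psi_swapb: "psi e (swapb z) = swapb (phi e z)" "kap2 (swapb z) = swapb (kap1 z)"
 by (cases z rule: brown_cases; simp)+

lemma psi_derives: "psi f (Vb x y z) = Vb (psi f x) y z - Vb x (psi f y) z + Vb x y (psi f z)"
 using arg_cong[OF phi_derives[of f "swapb x" "swapb y" "swapb z"], of swapb]
  psi_swapb(1)[of f "swapb x"] psi_swapb(1)[of f "swapb y"] psi_swapb(1)[of f "swapb z"] psi_swapb(1)[of f "swapb (Vb x y z)"]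
 by (simp add: swapb_linear swapb_Vb)

lemma kap_commutes:
 "kap1 (phi f z) = phi f (kap1 z) - phi f z" "kap1 (psi f z) = psi f (kap1 z) + psi f z"
 "kap1 (kap2 z) = kap2 (kap1 z)" "kap1 (jop f e z) = jop f e (kap1 z)"
 by ((cases z rule: brown_cases, simp add: scl_two albert_simps algebra_simps)[1])+

lemma kap_linear:
 "kap1 (x + y) = kap1 x + kap1 y" "kap1 (x - y) = kap1 x - kap1 y" "kap1 (- x) = - kap1 x" "kap1 (bscl r x) = bscl r (kap1 x)"
 "kap2 (x + y) = kap2 x + kap2 y" "kap2 (x - y) = kap2 x - kap2 y" "kap2 (- x) = - kap2 x" "kap2 (bscl r x) = bscl r (kap2 x)"
 by ((cases x rule: brown_cases, cases y rule: brown_cases, simp add: algebra_simps)[1])+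

lemma psi_linear [simp]:
 "psi f (x + y) = psi f x + psi f y" "psi f (x - y) = psi f x - psi f y" "psi f (- x) = - psi f x"
 "psi f (bscl r x) = bscl r (psi f x)"
 by ((cases x rule: brown_cases, cases y rule: brown_cases, simp add: albert_simps algebra_simps)[1])+

text \<open>The middle term carries \<open>kap2\<close> because interchanging x and y in
  \<open>Vb_decompose\<close> exchanges \<open>kap1\<close> and \<open>kap2\<close>.\<close>

lemma kap1_derives: "kap1 (Vb x y z) = Vb (kap1 x) y z - Vb x (kap2 y) z + Vb x y (kap1 z)"
proof (cases x rule: brown_cases; cases y rule: brown_cases)
 fix r a b s r' a' b' s'
 assume [simp]: "x = (r, a, b, s)" "y = (r', a', b', s')"
 show ?thesis
  by (simp add: Vb_decompose kap_linear kap_commutes bscl_two phi_left_linear psi_left_linear jop_left_linear albert_simps bscl_linear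
   albert_comm algebra_simps)
qed

lemma kap2_derives: "kap2 (Vb x y z) = Vb (kap2 x) y z - Vb x (kap1 y) z + Vb x y (kap2 z)"
proof -
 have k: "kap1 (swapb z) = swapb (kap2 z)" for z :: "'a brown"
  by (cases z rule: brown_cases) simp
 show ?thesis
  using arg_cong[OF kap1_derives[of "swapb x" "swapb y" "swapb z"], of swapb] psi_swapb(2)[of "swapb (Vb x y z)"]
  by (simp add: swapb_linear swapb_Vb k psi_swapb)
qed

lemma bmul_linear:
 "bmul (x + y) z = bmul x z + bmul y z" "bmul z (x + y) = bmul z x + bmul z y"
 "bmul (bscl r x) z = bscl r (bmul x z)" "bmul z (bscl r x) = bscl r (bmul z x)"
 by ((cases x rule: brown_cases, cases y rule: brown_cases, cases z rule: brown_cases, simp add: albert_simps algebra_simps)[1])+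

lemma brown_invol_linear: "brown_invol (x + y) = brown_invol x + brown_invol y" "brown_invol (bscl r x) = bscl r (brown_invol x)"
 by ((cases x rule: brown_cases, cases y rule: brown_cases, simp)[1])+

lemma Vb_linear:
 "Vb (x + x') y z = Vb x y z + Vb x' y z" "Vb x (y + y') z = Vb x y z + Vb x y' z" "Vb x y (z + z') = Vb x y z + Vb x y z'"
 "Vb (bscl r x) y z = bscl r (Vb x y z)" "Vb x (bscl r y) z = bscl r (Vb x y z)" "Vb x y (bscl r z) = bscl r (Vb x y z)"
 by (simp_all add: Vb_def bmul_linear brown_invol_linear bscl_linear algebra_simps)

lemma brown_uminus: "- x = bscl (- 1) (x :: 'a::comm_ring_1 brown)"
 by (simp add: bscl_linear)

lemma Vb_minus: "Vb (- x) y z = - Vb x y z" "Vb x (- y) z = - Vb x y z" "Vb x y (- z) = - Vb x y z"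
 unfolding brown_uminus by (simp_all add: Vb_linear)

lemma Vb_diff: "Vb (x - x') y z = Vb x y z - Vb x' y z" "Vb x (y - y') z = Vb x y z - Vb x y' z" "Vb x y (z - z') = Vb x y z - Vb x y z'"
 using Vb_linear(1)[of x "- x'" y z] Vb_linear(2)[of x y "- y'" z] Vb_linear(3)[of x y z "- z'"] by (simp_all add: Vb_minus)

text \<open>The commutator of two earlier rules. On the second variable their minus signs cancel,
  whence the plus sign.\<close>

lemma jop_derives: "jop f e (Vb x y z) = Vb (jop f e x) y z + Vb x (jop f e y) z + Vb x y (jop f e z)"
 by (simp add: jop_def phi_derives psi_derives Vb_diff)

text \<open>Allison's identity for structurable algebras. Only the outer operator
  \<open>Vb x y\<close> is decomposed; each of its pieces has a derivation rule, so z, w and u are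
  never expanded into coordinates.\<close>

theorem Vb_structurable:
 "Vb x y (Vb z w u) = Vb (Vb x y z) w u - Vb z (Vb y x w) u + Vb z w (Vb x y u)"
proof (cases x rule: brown_cases; cases y rule: brown_cases)
 fix r a b s r' a' b' s'
 assume [simp]: "x = (r, a, b, s)" "y = (r', a', b', s')"
 have c: "cross a' a = cross a a'" "cross b' b = cross b b'" "trace b' a = trace a b'" "trace a' b = trace b a'"
  by (simp_all add: albert_comm)
 show ?thesis
  by (simp add: Vb_decompose[of r a b s] Vb_decompose[of r' a' b' s'] c Vb_linear Vb_diff
    kap1_derives[of z w u] kap2_derives[of z w u] phi_derives[of _ z w u] psi_derives[of _ z w u] jop_derives[of _ _ z w u]
    bscl_linear phi_left_linear psi_left_linear algebra_simps)
qed

section \<open>The symplectic form and the action on degree two\<close>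

text \<open>Left multiplication by the standard skew element \<open>skewb 1\<close>.\<close>

fun flipb :: "'a::comm_ring_1 brown => 'a brown" where "flipb (r, a, b, s) = (r, a, - b, - s)"

text \<open>The scalar by which \<open>Vb x y\<close> acts on the skew elements in degree two, as
  \<open>delta_eq\<close> shows. It equals \<open>sform (flipb y) x\<close>, the form in which it
  reappears as \<open>beta (j \<otimes> y) x\<close>.\<close>

fun delta :: "'a::comm_ring_1 brown => 'a brown => 'a"
 where "delta (r, a, b, s) (r', a', b', s') = r * s' + s * r' + trace a b' + trace b a'"

fun sform :: "'a::comm_ring_1 brown => 'a brown => 'a"
 where "sform (r, a, b, s) (r', a', b', s') = r * s' - s * r' + trace a b' - trace b a'"

definition skewb :: "'a::comm_ring_1 => 'a brown" where "skewb t = (t, 0, 0, - t)"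

lemma delta_commute: "delta x y = delta y x"
 by (cases x rule: brown_cases; cases y rule: brown_cases; simp add: albert_comm algebra_simps)

lemma sform_eq: "bmul x (brown_invol y) - bmul y (brown_invol x) = skewb (sform x y)"
 by (cases x rule: brown_cases; cases y rule: brown_cases; simp add: skewb_def albert_comm algebra_simps)

lemma skewb_bmul: "bmul (skewb t) x = bscl t (flipb x)"
 by (cases x rule: brown_cases; simp add: skewb_def scl_minus)

lemma delta_eq: "bmul (bmul (skewb t) y) (brown_invol x) + bmul x (bmul (brown_invol y) (skewb t)) = skewb (t * delta x y)"
 by (cases x rule: brown_cases; cases y rule: brown_cases; simp add: skewb_def albert_simps albert_comm algebra_simps)

lemma flip_ops: "flipb (phi f z) = - phi f (flipb z)" "flipb (psi f z) = - psi f (flipb z)" "flipb (kap1 z) = kap1 (flipb z)" "flipb (kap2 z) = kap2 (flipb z)"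
 "flipb (jop f e z) = jop f e (flipb z)" "kap1 z + kap2 z = z"
 by ((cases z rule: brown_cases, simp add: albert_simps)[1])+

lemma flipb_linear: "flipb (x + y) = flipb x + flipb y" "flipb (x - y) = flipb x - flipb y" "flipb (bscl r x) = bscl r (flipb x)"
 by ((cases x rule: brown_cases, cases y rule: brown_cases, simp add: scl_minus)[1])+

text \<open>\<open>phi\<close> and \<open>psi\<close> anticommute with \<open>flipb\<close>, while
  \<open>jop\<close> commutes with it but changes sign when x and y are interchanged; all these
  terms cancel. The diagonal operators are left, with equal coefficients and sum the
  identity.\<close>

lemma Vb_flip: "Vb y x (flipb z) + flipb (Vb x y z) = bscl (delta x y) (flipb z)"
proof (cases x rule: brown_cases; cases y rule: brown_cases)
 fix r a b s r' a' b' s'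
 assume [simp]: "x = (r, a, b, s)" "y = (r', a', b', s')"
 have c: "cross a' a = cross a a'" "cross b' b = cross b b'" "trace b' a = trace a b'" "trace a' b = trace b a'"
  by (simp_all add: albert_comm)
 have k: "bscl t (flipb z) = bscl t (kap1 (flipb z)) + bscl t (kap2 (flipb z))" for t
  by (simp add: bscl_linear(1)[symmetric] flip_ops)
 show ?thesis
  unfolding k
  by (simp add: Vb_decompose c flipb_linear flip_ops bscl_linear phi_left_linear psi_left_linear algebra_simps)
qed

text \<open>With s = \<open>skewb t\<close>, the bracket of s and 1 in degree one is 2s. The
  left-hand side is the Leibniz rule for D = \<open>Vb x y\<close> on this bracket, so it is twice
  the degree-two action. Thus delta depends only on the values of D at two vectors, which is what
  makes the action on degree two well defined for arbitrary elements of the span.\<close>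

lemma Vb_delta:
 "Vb x y (skewb t) - brown_invol (Vb x y (skewb t)) + bmul (skewb t) (brown_invol (Vb x y (1, 0, 0, 1))) +
  bmul (Vb x y (1, 0, 0, 1)) (skewb t) = skewb (t * delta x y + t * delta x y)"
 by (cases x rule: brown_cases; cases y rule: brown_cases; simp add: Vb_decompose skewb_def albert_simps albert_comm algebra_simps)

section \<open>The Casimir identity of the split Brown algebra\<close>

definition alb :: "nat => 'a::comm_ring_1 albert"
 where "alb i = [
  diag_elt (1, 0, 0),
  diag_elt (0, 1, 0),
  diag_elt (0, 0, 1),
  off1 (1, (0, 0, 0), (0, 0, 0), 0),
  off1 (0, (1, 0, 0), (0, 0, 0), 0),
  off1 (0, (0, 1, 0), (0, 0, 0), 0),
  off1 (0, (0, 0, 1), (0, 0, 0), 0),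
  off1 (0, (0, 0, 0), (1, 0, 0), 0),
  off1 (0, (0, 0, 0), (0, 1, 0), 0),
  off1 (0, (0, 0, 0), (0, 0, 1), 0),
  off1 (0, (0, 0, 0), (0, 0, 0), 1),
  off2 (1, (0, 0, 0), (0, 0, 0), 0),
  off2 (0, (1, 0, 0), (0, 0, 0), 0),
  off2 (0, (0, 1, 0), (0, 0, 0), 0),
  off2 (0, (0, 0, 1), (0, 0, 0), 0),
  off2 (0, (0, 0, 0), (1, 0, 0), 0),
  off2 (0, (0, 0, 0), (0, 1, 0), 0),
  off2 (0, (0, 0, 0), (0, 0, 1), 0),
  off2 (0, (0, 0, 0), (0, 0, 0), 1),
  off3 (1, (0, 0, 0), (0, 0, 0), 0),
  off3 (0, (1, 0, 0), (0, 0, 0), 0),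
  off3 (0, (0, 1, 0), (0, 0, 0), 0),
  off3 (0, (0, 0, 1), (0, 0, 0), 0),
  off3 (0, (0, 0, 0), (1, 0, 0), 0),
  off3 (0, (0, 0, 0), (0, 1, 0), 0),
  off3 (0, (0, 0, 0), (0, 0, 1), 0),
  off3 (0, (0, 0, 0), (0, 0, 0), 1)] ! i"

text \<open>The basis dual to \<open>alb\<close> with respect to the trace form.\<close>

definition dalb :: "nat => 'a::comm_ring_1 albert"
 where "dalb i = [
  diag_elt (1, 0, 0),
  diag_elt (0, 1, 0),
  diag_elt (0, 0, 1),
  off1 (0, (0, 0, 0), (0, 0, 0), 1),
  off1 (0, (0, 0, 0), (- 1, 0, 0), 0),
  off1 (0, (0, 0, 0), (0, - 1, 0), 0),
  off1 (0, (0, 0, 0), (0, 0, - 1), 0),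
  off1 (0, (- 1, 0, 0), (0, 0, 0), 0),
  off1 (0, (0, - 1, 0), (0, 0, 0), 0),
  off1 (0, (0, 0, - 1), (0, 0, 0), 0),
  off1 (1, (0, 0, 0), (0, 0, 0), 0),
  off2 (0, (0, 0, 0), (0, 0, 0), 1),
  off2 (0, (0, 0, 0), (- 1, 0, 0), 0),
  off2 (0, (0, 0, 0), (0, - 1, 0), 0),
  off2 (0, (0, 0, 0), (0, 0, - 1), 0),
  off2 (0, (- 1, 0, 0), (0, 0, 0), 0),
  off2 (0, (0, - 1, 0), (0, 0, 0), 0),
  off2 (0, (0, 0, - 1), (0, 0, 0), 0),
  off2 (1, (0, 0, 0), (0, 0, 0), 0),
  off3 (0, (0, 0, 0), (0, 0, 0), 1),
  off3 (0, (0, 0, 0), (- 1, 0, 0), 0),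
  off3 (0, (0, 0, 0), (0, - 1, 0), 0),
  off3 (0, (0, 0, 0), (0, 0, - 1), 0),
  off3 (0, (- 1, 0, 0), (0, 0, 0), 0),
  off3 (0, (0, - 1, 0), (0, 0, 0), 0),
  off3 (0, (0, 0, - 1), (0, 0, 0), 0),
  off3 (1, (0, 0, 0), (0, 0, 0), 0)] ! i"


lemma less_27: "{..<27::nat} = {0,1,2,3,4,5,6,7,8,9,10,11,12,13,14,15,16,17,18,19,20,21,22,23,24,25,26}"
 unfolding set_eq_iff by (simp, presburger)

lemma sum_27: "(\<Sum>i<27::nat. f i) = f 0 + f 1 + f 2 + f 3 + f 4 + f 5 + f 6 + f 7 + f 8 + f 9 + f 10 + f 11 + f 12 + f 13 +
 f 14 + f 15 + f 16 + f 17 + f 18 + f 19 + f 20 + f 21 + f 22 + f 23 + f 24 + f 25 + (f 26 :: 'a::ab_group_add)"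
 unfolding less_27 by (simp add: add_ac)

lemma alb_trace: "(\<Sum>i<27. trace (alb i) (dalb i)) = (27 :: 'a::comm_ring_1)"
 by (simp add: sum_27 dalb_def alb_def off_defs zero_prod_def)

lemma alb_expand: "(\<Sum>i<27. scl (trace x (dalb i)) (alb i)) = x"
 apply (cases x rule: albert_cases_full) 
 apply (simp add: sum_27 dalb_def alb_def off_defs zero_prod_def)
 done

text \<open>The source of the numerical constants: 10 is the main part of the 12 in
  \<open>cas_phi\<close> and, diminished by 1, gives the 9 in \<open>jop_contract\<close>.\<close>

lemma alb_contract: "(\<Sum>i<27. cross (cross (alb i) c) (dalb i)) = scl 10 c"
 apply (cases c rule: albert_cases_full)
 apply (simp add: sum_27 dalb_def alb_def off_defs zero_prod_def)
 done

lemma alb_expand': "(\<Sum>i<27. scl (trace x (alb i)) (dalb i)) = x"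
 by (cases x rule: albert_cases_full) (simp add: sum_27 dalb_def alb_def off_defs zero_prod_def)

lemma alb_contract': "(\<Sum>i<27. cross (cross (dalb i) c) (alb i)) = scl 10 c"
 by (cases c rule: albert_cases_full) (simp add: sum_27 dalb_def alb_def off_defs zero_prod_def)

lemma albert_sum:
 "phi (sum f A) z = (\<Sum>i\<in>A. phi (f i) z)" "psi (sum f A) z = (\<Sum>i\<in>A. psi (f i) z)"
 "jop (sum f A) e z = (\<Sum>i\<in>A. jop (f i) e z)" "jop e (sum f A) z = (\<Sum>i\<in>A. jop e (f i) z)"
 "trace (sum f A) e = (\<Sum>i\<in>A. trace (f i) e)" "trace e (sum f A) = (\<Sum>i\<in>A. trace e (f i))"
 "cross e (sum f A) = (\<Sum>i\<in>A. cross e (f i))"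
proof -
 have p: "phi 0 z = 0" "psi 0 z = 0"
  using phi_left_linear(4)[of 0 0 z] psi_left_linear(4)[of 0 0 z] by simp_all
 show "phi (sum f A) z = (\<Sum>i\<in>A. phi (f i) z)" "psi (sum f A) z = (\<Sum>i\<in>A. psi (f i) z)"
  "jop (sum f A) e z = (\<Sum>i\<in>A. jop (f i) e z)" "jop e (sum f A) z = (\<Sum>i\<in>A. jop e (f i) z)"
  "trace (sum f A) e = (\<Sum>i\<in>A. trace (f i) e)" "trace e (sum f A) = (\<Sum>i\<in>A. trace e (f i))"
  "cross e (sum f A) = (\<Sum>i\<in>A. cross e (f i))"
  by (induction A rule: infinite_finite_induct;
    simp add: p phi_left_linear psi_left_linear jop_left_linear trace_add cross_add)+
qed

lemma bscl_sum: "bscl (sum f A) z = (\<Sum>i\<in>A. bscl (f i) z)"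
 by (induction A rule: infinite_finite_induct) (simp_all add: bscl_linear)

definition ea :: "'a::comm_ring_1 albert => 'a brown" where "ea a = (0, a, 0, 0)"
definition eb :: "'a::comm_ring_1 albert => 'a brown" where "eb b = (0, 0, b, 0)"
definition er :: "'a::comm_ring_1 brown" where "er = (1, 0, 0, 0)"
definition es :: "'a::comm_ring_1 brown" where "es = (0, 0, 0, 1)"

text \<open>The sum over the pairs \<open>(e, w)\<close> of a basis vector and the vector \<open>w\<close> for which
 \<open>flipb w\<close> represents the coordinate of \<open>e\<close> with respect to \<open>sform\<close>, up to sign.\<close>

definition basis_sum :: "('a::comm_ring_1 brown => 'a brown => 'v::comm_monoid_add) => 'v"
 where "basis_sum F = F er es + F es er + (\<Sum>i<27. F (ea (alb i)) (eb (dalb i))) + (\<Sum>i<27. F (eb (alb i)) (ea (dalb i)))"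

lemma basis_ops:
 "phi f er = eb f" "phi f es = 0" "phi f (ea a) = bscl (trace f a) es" "phi f (eb a) = ea (cross f a)"
 "psi f es = ea f" "psi f er = 0" "psi f (eb a) = bscl (trace f a) er" "psi f (ea a) = eb (cross f a)"
 "kap1 er = bscl 2 er" "kap1 es = - es" "kap1 (ea a) = 0" "kap1 (eb a) = eb a"
 "kap2 er = - er" "kap2 es = bscl 2 es" "kap2 (ea a) = ea a" "kap2 (eb a) = 0"
 by (simp_all add: er_def es_def ea_def eb_def brown_zero)

lemma basis_Vb:
 "Vb er es z = kap1 z" "Vb es er z = kap2 z"
 "Vb (ea a) (eb b) z = bscl (trace a b) (kap2 z) - jop b a z"
 "Vb (eb b) (ea a) z = bscl (trace b a) (kap1 z) + jop b a z"
 "Vb (eb b) es z = phi b z" "Vb es (eb b) z = phi b z" "Vb (ea a) (ea b) z = phi (cross a b) z"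
 "Vb (ea b) er z = psi b z" "Vb er (ea b) z = psi b z" "Vb (eb a) (eb b) z = psi (cross a b) z"
proof -
 have p: "phi 0 z = 0" "psi 0 z = 0"
  using phi_left_linear(4)[of 0 0 z] psi_left_linear(4)[of 0 0 z] by simp_all
 show "Vb er es z = kap1 z" "Vb es er z = kap2 z"
 "Vb (ea a) (eb b) z = bscl (trace a b) (kap2 z) - jop b a z"
 "Vb (eb b) (ea a) z = bscl (trace b a) (kap1 z) + jop b a z"
 "Vb (eb b) es z = phi b z" "Vb es (eb b) z = phi b z" "Vb (ea a) (ea b) z = phi (cross a b) z"
 "Vb (ea b) er z = psi b z" "Vb er (ea b) z = psi b z" "Vb (eb a) (eb b) z = psi (cross a b) z"
  by (simp_all add: er_def es_def ea_def eb_def Vb_decompose p)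
qed

lemma Vb_zero [simp]: "Vb 0 y z = 0" "Vb x 0 z = 0" "Vb x y 0 = 0"
 using Vb_linear(4)[of 0 0 y z] Vb_linear(5)[of x 0 0 z] Vb_linear(6)[of x y 0 0] by simp_all

text \<open>12 = 1 + 1 + 10: the pair (\<open>er\<close>, \<open>es\<close>) contributes
  \<open>phi f\<close>, the pairs starting in \<open>ea\<close> contribute \<open>phi f\<close>
  again by expanding f in the dual basis, the pairs starting in \<open>eb\<close> contribute the
  contraction 10 \<open>phi f\<close>, and (\<open>es\<close>, \<open>er\<close>) contributes
  0.\<close>

lemma cas_phi: "basis_sum (%u w. Vb (phi f u) w z) = bscl 12 (phi f z)"
proof -
 have "(\<Sum>i<27. phi (scl (trace f (alb i)) (dalb i)) z) = phi f z"
  by (simp only: albert_sum(1)[symmetric] alb_expand')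
 moreover have "(\<Sum>i<27. phi (cross (cross f (alb i)) (dalb i)) z) = bscl 10 (phi f z)"
  by (simp only: albert_sum(1)[symmetric] cross_commute[of f] alb_contract phi_left_linear)
 ultimately show ?thesis
  using bscl_linear(2)[of 10 2 "phi f z"] bscl_two[of 1 "phi f z"]
  by (simp add: basis_sum_def basis_ops basis_Vb Vb_linear phi_left_linear)
qed

lemma cas_psi: "basis_sum (%u w. Vb (psi f u) w z) = bscl 12 (psi f z)"
proof -
 have "(\<Sum>i<27. psi (scl (trace f (alb i)) (dalb i)) z) = psi f z"
  by (simp only: albert_sum(2)[symmetric] alb_expand')
 moreover have "(\<Sum>i<27. psi (cross (cross f (alb i)) (dalb i)) z) = bscl 10 (psi f z)"
  by (simp only: albert_sum(2)[symmetric] cross_commute[of f] alb_contract psi_left_linear)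
 ultimately show ?thesis
  using bscl_linear(2)[of 10 2 "psi f z"] bscl_two[of 1 "psi f z"]
  by (simp add: basis_sum_def basis_ops basis_Vb Vb_linear psi_left_linear algebra_simps)
qed

lemma basis_sum_linear:
 "basis_sum (%u w. F u w + G u w) = basis_sum F + (basis_sum G :: 'a::comm_ring_1 brown)"
 "basis_sum (%u w. F u w - G u w) = basis_sum F - (basis_sum G :: 'a::comm_ring_1 brown)"
 "basis_sum (%u w. bscl r (F u w)) = bscl r (basis_sum F)"
proof -
 have "bscl r (sum f A) = (\<Sum>i\<in>A. bscl r (f i))" for f :: "nat => 'a brown" and A
  by (induction A rule: infinite_finite_induct) (simp_all add: bscl_linear)
 then show "basis_sum (%u w. bscl r (F u w)) = bscl r (basis_sum F)"
  by (simp add: basis_sum_def bscl_linear)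
qed (simp_all add: basis_sum_def sum.distrib sum_subtractf algebra_simps)

lemma ops_zero [simp]: "phi f 0 = 0" "psi f 0 = 0"
 using phi_linear(4)[of f 0 0] psi_linear(4)[of f 0 0] by simp_all

lemma phi_sum: "phi f (sum g A) = (\<Sum>i\<in>A. phi f (g i))"
 by (induction A rule: infinite_finite_induct) simp_all

lemma basis_sum_phi: "phi f (basis_sum F) = basis_sum (%u w. phi f (F u w))"
 by (simp add: basis_sum_def phi_sum)

text \<open>The element \<Sum> \<open>alb i\<close> \<otimes> \<open>dalb i\<close> is the canonical
  tensor of the trace form, so a map that is self-adjoint for the trace may be moved from one factor
  to the other. The proof expands \<open>cross f (alb i)\<close> in the basis and exchanges the two
  sums.\<close>

lemma alb_self_adjoint:
 assumes F: "!!a a' b. F (a + a') b = F a b + F a' b" "!!a b b'. F a (b + b') = F a b + F a b'"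
  "!!r a b. F (scl r a) b = bscl r (F a b)" "!!r a b. F a (scl r b) = bscl r (F a b)"
 shows "(\<Sum>i<27. F (cross f (alb i)) (dalb i)) = (\<Sum>i<27. F (alb i) (cross f (dalb i)))"
proof -
 have z: "F 0 b = 0" "F a 0 = 0" for a b
  using F(3)[of 0 0 b] F(4)[of a 0 0] by simp_all
 have s: "F (sum g A) b = (\<Sum>i\<in>A. F (g i) b)" "F b (sum g A) = (\<Sum>i\<in>A. F b (g i))" for g :: "nat => _" and A b
  by (induction A rule: infinite_finite_induct) (simp_all add: F z)
 have adj: "trace (cross f a) b = trace (cross f b) a" for a b :: "'a albert"
  by (metis trace_assoc trace_commute cross_commute)
 have "(\<Sum>i<27. F (cross f (alb i)) (dalb i)) =
   (\<Sum>i<27. F (\<Sum>k<27. scl (trace (cross f (alb i)) (dalb k)) (alb k)) (dalb i))"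
  by (simp only: alb_expand)
 also have "\<dots> = (\<Sum>i<27. \<Sum>k<27. F (alb k) (scl (trace (cross f (dalb k)) (alb i)) (dalb i)))"
  by (simp only: s F adj)
 also have "\<dots> = (\<Sum>k<27. \<Sum>i<27. F (alb k) (scl (trace (cross f (dalb k)) (alb i)) (dalb i)))"
  by (rule sum.swap)
 also have "\<dots> = (\<Sum>k<27. F (alb k) (\<Sum>i<27. scl (trace (cross f (dalb k)) (alb i)) (dalb i)))"
  by (simp only: s)
 finally show ?thesis
  by (simp only: alb_expand')
qed

text \<open>The pairs of \<open>basis_sum\<close> are dual with respect to \<open>delta\<close>, and
  \<open>phi f\<close> is self-adjoint for \<open>delta\<close>. The two scalar basis vectors are
  exchanged with the expansion of f, the rest is \<open>alb_self_adjoint\<close>.\<close>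

lemma basis_sum_phi_shift:
 assumes F: "!!a a' b. F (a + a') b = F a b + F a' b" "!!a b b'. F a (b + b') = F a b + F a b'"
  "!!r a b. F (bscl r a) b = bscl r (F a b)" "!!r a b. F a (bscl r b) = bscl r (F a b)"
 shows "basis_sum (%u w. F (phi f u) w) = basis_sum (%u w. F u (phi f w))"
proof -
 have z: "F 0 b = 0" "F a 0 = 0" for a b
  using F(3)[of 0 0 b] F(4)[of a 0 0] by simp_all
 have e: "ea (a + b) = ea a + ea b" "eb (a + b) = eb a + eb b" "ea (scl r a) = bscl r (ea a)" "eb (scl r a) = bscl r (eb a)" for a b and r :: 'a
  by (simp_all add: ea_def eb_def)
 have s: "F b (sum g A) = (\<Sum>i\<in>A. F b (g i))" "F (sum g A) b = (\<Sum>i\<in>A. F (g i) b)"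
   "eb (sum h A) = (\<Sum>i\<in>A. eb (h i))" for g :: "nat => 'a brown" and h :: "nat => 'a albert" and A b
  using z by (induction A rule: infinite_finite_induct; simp add: F e; simp add: eb_def brown_zero)+
 have 1: "(\<Sum>i<27. F (ea (cross f (alb i))) (ea (dalb i))) = (\<Sum>i<27. F (ea (alb i)) (ea (cross f (dalb i))))"
  by (rule alb_self_adjoint) (simp_all add: e F)
 have "(\<Sum>i<27. F es (bscl (trace f (alb i)) (eb (dalb i)))) = F es (eb f)"
  by (simp only: s[symmetric] e[symmetric] alb_expand')
 moreover have "(\<Sum>i<27. F (bscl (trace f (dalb i)) (eb (alb i))) es) = F (eb f) es"
  by (simp only: s[symmetric] e[symmetric] alb_expand)
 ultimately show ?thesis
  using 1 by (simp add: basis_sum_def basis_ops F z algebra_simps)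
qed

text \<open>Derived from \<open>cas_psi\<close> instead of being computed: \<open>phi f\<close> is
  applied to the identity for \<open>psi e\<close>, distributed by \<open>phi_derives\<close>, and
  moved across the canonical tensor in the middle term; the last term is \<open>cas_psi\<close> at
  \<open>phi f z\<close>.\<close>

lemma cas_jop: "basis_sum (%u w. Vb (jop f e u) w z) = bscl 12 (jop f e z)"
proof -
 have "phi f (basis_sum (%u w. Vb (psi e u) w z)) =
   basis_sum (%u w. Vb (phi f (psi e u)) w z) - basis_sum (%u w. Vb (psi e u) (phi f w) z) + basis_sum (%u w. Vb (psi e u) w (phi f z))"
  by (simp only: basis_sum_phi phi_derives basis_sum_linear)
 moreover have "basis_sum (%u w. Vb (psi e u) (phi f w) z) = basis_sum (%u w. Vb (psi e (phi f u)) w z)"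
  by (rule basis_sum_phi_shift[symmetric]) (simp_all add: Vb_linear)
 ultimately have "basis_sum (%u w. Vb (phi f (psi e u)) w z) - basis_sum (%u w. Vb (psi e (phi f u)) w z)
   = bscl 12 (phi f (psi e z) - psi e (phi f z))"
  by (simp add: cas_psi bscl_linear algebra_simps)
 then show ?thesis
  by (simp add: jop_def Vb_diff basis_sum_linear)
qed

text \<open>On the Albert components 9 = 10 - 1, contraction minus expansion. On the scalar
  components the trace 27 equals 9 times 3, and \<open>kap2 - kap1\<close> acts there by -3 and
  3.\<close>

lemma jop_contract:
 "(\<Sum>i<27. jop (alb i) (dalb i) z) = bscl 9 (kap2 z - kap1 z)"
 "(\<Sum>i<27. jop (dalb i) (alb i) z) = bscl 9 (kap2 z - kap1 z)"
proof -
 have "(\<Sum>i<27. jop (alb i) (dalb i) z) = bscl 9 (kap2 z - kap1 z) \<and> (\<Sum>i<27. jop (dalb i) (alb i) z) = bscl 9 (kap2 z - kap1 z)"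
 proof (cases z rule: brown_cases)
 case (1 r a b s)
 have split: "(\<Sum>i\<in>A. (f i, g i, h i, k i)) = ((\<Sum>i\<in>A. f i, \<Sum>i\<in>A. g i, \<Sum>i\<in>A. h i, \<Sum>i\<in>A. k i) :: 'a brown)"
  for f g h k and A :: "nat set"
  by (induction A rule: infinite_finite_induct) (simp_all add: brown_zero)
 have tr: "(\<Sum>i<27. trace (dalb i) (alb i)) = (27 :: 'a)" "(\<Sum>i<27. trace (alb i) (dalb i)) = (27 :: 'a)"
  by (simp_all add: alb_trace trace_commute[of "dalb _"])
 have con: "(\<Sum>i<27. cross (alb i) (cross (dalb i) c)) = scl 10 c" "(\<Sum>i<27. cross (dalb i) (cross (alb i) c)) = scl 10 c" for c :: "'a albert"
  using alb_contract[of c] alb_contract'[of c] by (simp_all add: cross_commute)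
 have ex: "(\<Sum>i<27. scl (trace (alb i) c) (dalb i)) = c" "(\<Sum>i<27. scl (trace (dalb i) c) (alb i)) = c" for c :: "'a albert"
  using alb_expand[of c] alb_expand'[of c] by (simp_all add: trace_commute)
 have nine: "scl 10 c - c = scl 9 c" "c - scl 10 c = - scl 9 c" for c :: "'a albert"
  using scl_linear(2)[of 9 1 c] by simp_all
 have ring: "- (r * 27) = 9 * (- r - (r + r))" "s * 27 = 9 * (s + s + s)"
  by simp_all
 show ?thesis
  unfolding 1 jop_simp split
  by (simp add: sum_subtractf sum_negf sum_distrib_left[symmetric] tr con ex nine scl_minus)
 qed
 then show "(\<Sum>i<27. jop (alb i) (dalb i) z) = bscl 9 (kap2 z - kap1 z)" "(\<Sum>i<27. jop (dalb i) (alb i) z) = bscl 9 (kap2 z - kap1 z)"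
  by simp_all
qed

text \<open>The pairs contribute 2 \<open>kap1\<close> from (\<open>er\<close>, \<open>es\<close>),
  minus \<open>kap2\<close> from (\<open>es\<close>, \<open>er\<close>), and 27 \<open>kap1\<close>
  + 9 (\<open>kap2\<close> - \<open>kap1\<close>) from those starting in \<open>eb\<close>. The
  total 20 \<open>kap1\<close> + 8 \<open>kap2\<close> is 12 \<open>kap1\<close> plus 8 times the
  identity.\<close>

lemma cas_kap1: "basis_sum (%u w. Vb (kap1 u) w z) = bscl 12 (kap1 z) + bscl 8 z"
proof -
 have "bscl 8 z = bscl 8 (kap1 z) + bscl 8 (kap2 z)"
  by (simp add: bscl_linear(1)[symmetric] flip_ops)
 moreover have "bscl 29 (kap1 z) = bscl 2 (kap1 z) + bscl 27 (kap1 z)" "bscl 29 (kap1 z) = bscl 12 (kap1 z) + bscl 8 (kap1 z) + bscl 9 (kap1 z)"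
  "bscl 9 (kap2 z) = bscl 8 (kap2 z) + kap2 z"
  using bscl_linear(2)[of 8 1 "kap2 z"] by (simp_all add: bscl_linear(2)[symmetric])
 ultimately show ?thesis
  by (simp add: basis_sum_def basis_ops basis_Vb Vb_linear Vb_minus sum.distrib bscl_sum[symmetric] alb_trace jop_contract bscl_linear algebra_simps)
qed

lemma cas_kap2: "basis_sum (%u w. Vb (kap2 u) w z) = bscl 12 (kap2 z) + bscl 8 z"
proof -
 have "bscl 8 z = bscl 8 (kap1 z) + bscl 8 (kap2 z)"
  by (simp add: bscl_linear(1)[symmetric] flip_ops)
 moreover have "bscl 29 (kap2 z) = bscl 2 (kap2 z) + bscl 27 (kap2 z)" "bscl 29 (kap2 z) = bscl 12 (kap2 z) + bscl 8 (kap2 z) + bscl 9 (kap2 z)"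
  "bscl 9 (kap1 z) = bscl 8 (kap1 z) + kap1 z"
  using bscl_linear(2)[of 8 1 "kap1 z"] by (simp_all add: bscl_linear(2)[symmetric])
 ultimately show ?thesis
  by (simp add: basis_sum_def basis_ops basis_Vb Vb_linear Vb_minus sum.distrib sum_subtractf bscl_sum[symmetric] alb_trace jop_contract bscl_linear algebra_simps)
qed

text \<open>By \<open>Vb_decompose\<close>, \<open>delta x y\<close> is the sum of the coefficients
  of \<open>kap1\<close> and \<open>kap2\<close>, the only pieces whose Casimir sum contains a
  multiple of z itself.\<close>

theorem casimir: "basis_sum (%u w. Vb (Vb x y u) w z) = bscl 12 (Vb x y z) + bscl (8 * delta x y) z"
proof (cases x rule: brown_cases; cases y rule: brown_cases)
 fix r a b s r' a' b' s'
 assume [simp]: "x = (r, a, b, s)" "y = (r', a', b', s')"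
 show ?thesis
  by (simp add: Vb_decompose[of r a b s] Vb_linear Vb_diff basis_sum_linear cas_phi cas_psi cas_jop cas_kap1 cas_kap2
   phi_left_linear[symmetric] psi_left_linear[symmetric] bscl_linear algebra_simps)
qed

section \<open>Transfer of the identities to ring records\<close>

text \<open>The product of all commutative rings on a type, so that identities of \<^class>\<open>comm_ring_1\<close>
 hold in every commutative ring record. The factor \<open>int\<close> only ensures \<open>0 \<noteq> 1\<close>.\<close>

typedef (overloaded) ('r, 'w) all_rings =
 "{p :: (('r, 'w) ring_scheme => 'r) \<times> int. \<forall>R. if cring R then fst p R : carrier R else fst p R = undefined}"
 by (rule exI[of _ "(%R. if cring R then \<zero>\<^bsub>R\<^esub> else undefined, 0)"]) (auto intro: cring.cring_simprules)

definition ring_comp :: "('r, 'w) ring_scheme => ('r, 'w) all_rings => 'r"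
 where "ring_comp R u = fst (Rep_all_rings u) R"

definition int_part :: "('r, 'w) all_rings => int"
 where "int_part u = snd (Rep_all_rings u)"

definition of_comps :: "(('r, 'w) ring_scheme => 'r) => int => ('r, 'w) all_rings"
 where "of_comps f n = Abs_all_rings (%R. if cring R then f R else undefined, n)"

lemma comp_closed: "cring R ==> ring_comp R u : carrier R"
 using Rep_all_rings[of u] by (auto simp: ring_comp_def split: if_splits)

lemma of_comps:
 assumes "!!R. cring R ==> f R : carrier R"
 shows "cring R ==> ring_comp R (of_comps f n) = f R" "int_part (of_comps f n) = n"
 using assms unfolding ring_comp_def int_part_def of_comps_def by (subst Abs_all_rings_inverse; simp)+

lemma all_rings_eqI:
 assumes "!!R. cring R ==> ring_comp R u = ring_comp R v" "int_part u = int_part v"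
 shows "u = v"
proof -
 have "fst (Rep_all_rings u) R = fst (Rep_all_rings v) R" for R
  using assms(1)[of R] Rep_all_rings[of u] Rep_all_rings[of v] by (cases "cring R") (auto simp: ring_comp_def)
 then show ?thesis
  using assms(2) by (simp add: Rep_all_rings_inject[symmetric] prod_eq_iff fun_eq_iff int_part_def)
qed

instantiation all_rings :: (type, type) "{zero, one, plus, times, uminus, minus}"
begin

definition "0 = of_comps (%R. \<zero>\<^bsub>R\<^esub>) 0"
definition "1 = of_comps (%R. \<one>\<^bsub>R\<^esub>) 1"
definition "u + v = of_comps (%R. ring_comp R u \<oplus>\<^bsub>R\<^esub> ring_comp R v) (int_part u + int_part v)"
definition "u * v = of_comps (%R. ring_comp R u \<otimes>\<^bsub>R\<^esub> ring_comp R v) (int_part u * int_part v)"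
definition "- u = of_comps (%R. \<ominus>\<^bsub>R\<^esub> ring_comp R u) (- int_part u)"
definition "u - v = of_comps (%R. ring_comp R u \<ominus>\<^bsub>R\<^esub> ring_comp R v) (int_part u - int_part v)"
instance ..

end

lemma comp_ring_hom:
 assumes "cring R"
 shows "ring_comp R (u + v) = ring_comp R u \<oplus>\<^bsub>R\<^esub> ring_comp R v" "ring_comp R (u * v) = ring_comp R u \<otimes>\<^bsub>R\<^esub> ring_comp R v"
  "ring_comp R 0 = \<zero>\<^bsub>R\<^esub>" "ring_comp R 1 = \<one>\<^bsub>R\<^esub>" "ring_comp R (- u) = \<ominus>\<^bsub>R\<^esub> ring_comp R u" "ring_comp R (u - v) = ring_comp R u \<ominus>\<^bsub>R\<^esub> ring_comp R v"
 unfolding zero_all_rings_def one_all_rings_def plus_all_rings_def times_all_rings_def uminus_all_rings_def minus_all_rings_def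
 by (rule of_comps; use assms in \<open>auto simp: comp_closed cring.cring_simprules(1-6)
    ring.ring_simprules(1) abelian_group.a_inv_closed abelian_group.minus_closed cring.axioms(1) ring.is_abelian_group\<close>)+

lemma int_part_hom:
 "int_part (u + v) = int_part u + int_part v" "int_part (u * v) = int_part u * int_part v"
 "int_part 0 = 0" "int_part 1 = 1" "int_part (- u) = - int_part u" "int_part (u - v) = int_part u - int_part v"
 unfolding zero_all_rings_def one_all_rings_def plus_all_rings_def times_all_rings_def uminus_all_rings_def minus_all_rings_def
 by (rule of_comps; auto simp: comp_closed cring.cring_simprules(1-6)
    abelian_group.minus_closed cring.axioms(1) ring.is_abelian_group)+

instance all_rings :: (type, type) comm_ring_1
proof
 fix a b c :: "('a, 'b) all_rings"
 note comp = comp_ring_hom comp_closed int_part_hom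
 show "a * b * c = a * (b * c)" "a * b = b * a" "1 * a = a" "a + b + c = a + (b + c)" "a + b = b + a" "0 + a = a"
  "- a + a = 0" "a - b = a + - b" "(a + b) * c = a * c + b * c"
 proof (rule_tac [!] all_rings_eqI, simp_all only: comp)
  fix R :: "('a, 'b) ring_scheme" assume R: "cring R"
  then interpret cring R .
  note [simp] = comp_closed[OF R]
  let ?a = "ring_comp R a" and ?b = "ring_comp R b" and ?c = "ring_comp R c"
  show "?a \<otimes>\<^bsub>R\<^esub> ?b \<otimes>\<^bsub>R\<^esub> ?c = ?a \<otimes>\<^bsub>R\<^esub> (?b \<otimes>\<^bsub>R\<^esub> ?c)" "?a \<otimes>\<^bsub>R\<^esub> ?b = ?b \<otimes>\<^bsub>R\<^esub> ?a"
   "\<one>\<^bsub>R\<^esub> \<otimes>\<^bsub>R\<^esub> ?a = ?a" "?a \<oplus>\<^bsub>R\<^esub> ?b \<oplus>\<^bsub>R\<^esub> ?c = ?a \<oplus>\<^bsub>R\<^esub> (?b \<oplus>\<^bsub>R\<^esub> ?c)" "?a \<oplus>\<^bsub>R\<^esub> ?b = ?b \<oplus>\<^bsub>R\<^esub> ?a"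
   "\<zero>\<^bsub>R\<^esub> \<oplus>\<^bsub>R\<^esub> ?a = ?a" "\<ominus>\<^bsub>R\<^esub> ?a \<oplus>\<^bsub>R\<^esub> ?a = \<zero>\<^bsub>R\<^esub>" "?a \<ominus>\<^bsub>R\<^esub> ?b = ?a \<oplus>\<^bsub>R\<^esub> \<ominus>\<^bsub>R\<^esub> ?b"
   "(?a \<oplus>\<^bsub>R\<^esub> ?b) \<otimes>\<^bsub>R\<^esub> ?c = ?a \<otimes>\<^bsub>R\<^esub> ?c \<oplus>\<^bsub>R\<^esub> ?b \<otimes>\<^bsub>R\<^esub> ?c"
   by (simp_all only: m_assoc a_assoc l_neg l_distr minus_eq l_one l_zero comp_closed[OF R]) (simp_all add: m_comm a_comm)
 qed (simp_all add: distrib_right)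
 show "(0 :: ('a, 'b) all_rings) \<noteq> 1"
  by (metis int_part_hom(3,4) zero_neq_one)
qed

text \<open>Elements of a given record lift to the product, with zero in the other components. Hence
  an identity proved for the class can be instantiated at lifts and projected back.\<close>

lemma comp_surj:
 assumes "cring R" "x : carrier R"
 obtains u where "x = ring_comp R u"
proof
 show "x = ring_comp R (of_comps (%T. if T = R then x else \<zero>\<^bsub>T\<^esub>) 0)"
  using assms by (subst of_comps) (auto intro: cring.cring_simprules)
qed

definition brown_map :: "('a => 'b) => 'a brown => 'b brown"
 where "brown_map h = (%(r, a, b, s). (h r, albert_map h a, albert_map h b, h s))"

abbreviation brown_comp :: "('r, 'w) ring_scheme => ('r, 'w) all_rings brown => 'r brown"
 where "brown_comp R \<equiv> brown_map (ring_comp R)"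

lemma split_brown_simps [simp]:
 "carrier (split_brown R) = carrier R \<times> albert_carrier R \<times> albert_carrier R \<times> carrier R"
 "mult (split_brown R) = brown_mult R" "one (split_brown R) = (\<one>\<^bsub>R\<^esub>, albert_zero R, albert_zero R, \<one>\<^bsub>R\<^esub>)"
 "zero (split_brown R) = (\<zero>\<^bsub>R\<^esub>, albert_zero R, albert_zero R, \<zero>\<^bsub>R\<^esub>)"
 "add (split_brown R) = brown_add R" "smult (split_brown R) = brown_smult R" "invol (split_brown R) = brown_invol"
 by (simp_all add: split_brown_def)

locale split_transfer =
 fixes R :: "('r, 'w) ring_scheme" (structure)
 assumes cring: "cring R"
begin

text \<open>Oriented so that record operations are absorbed under \<open>ring_comp\<close>: an
  equation between record terms becomes an equation between images of class terms, to which class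
  identities apply.\<close>

lemmas hom = comp_ring_hom[OF cring, symmetric] comp_closed[OF cring]

lemma zorn_hom:
 fixes x y :: "('r, 'w) all_rings zorn"
 shows "zorn_add R (zorn_map (ring_comp R) x) (zorn_map (ring_comp R) y) = zorn_map (ring_comp R) (x + y)"
 "zorn_diff R (zorn_map (ring_comp R) x) (zorn_map (ring_comp R) y) = zorn_map (ring_comp R) (x - y)"
 "zorn_mult R (zorn_map (ring_comp R) x) (zorn_map (ring_comp R) y) = zorn_map (ring_comp R) (zmul x y)"
 "zorn_smult R (ring_comp R r) (zorn_map (ring_comp R) y) = zorn_map (ring_comp R) (zscl r y)"
 "zorn_conj R (zorn_map (ring_comp R) y) = zorn_map (ring_comp R) (zbar y)"
 "zorn_norm R (zorn_map (ring_comp R) y) = ring_comp R (zorn_norm class_ring y)"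
 by ((cases x rule: zorn_cases, cases y rule: zorn_cases, simp add: hom)[1])+

lemma zorn_polar_hom: "zorn_polar R (zorn_map (ring_comp R) x) (zorn_map (ring_comp R) y) = ring_comp R (zpol x y)"
proof -
 have "zorn_add class_ring x y = x + y"
  by (cases x rule: zorn_cases; cases y rule: zorn_cases; simp)
 then show ?thesis
  unfolding zorn_polar_def by (simp add: zorn_hom hom)
qed

lemma albert_hom:
 fixes x y :: "('r, 'w) all_rings albert"
 shows "albert_add R (albert_map (ring_comp R) x) (albert_map (ring_comp R) y) = albert_map (ring_comp R) (x + y)"
 "albert_diff R (albert_map (ring_comp R) x) (albert_map (ring_comp R) y) = albert_map (ring_comp R) (x - y)"
 "albert_smult R (ring_comp R r) (albert_map (ring_comp R) y) = albert_map (ring_comp R) (scl r y)"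
 "albert_trace R (albert_map (ring_comp R) x) (albert_map (ring_comp R) y) = ring_comp R (trace x y)"
 by ((cases x rule: albert_cases, cases y rule: albert_cases, simp add: zorn_hom zorn_polar_hom hom)[1])+

lemma albert_adjoint_hom: "albert_adjoint R (albert_map (ring_comp R) x) = albert_map (ring_comp R) (albert_adjoint class_ring x)"
proof -
 have d: "zorn_diff class_ring c e = c - e" for c e :: "('r, 'w) all_rings zorn"
  by (cases c rule: zorn_cases; cases e rule: zorn_cases; simp)
 show ?thesis
  by (cases x rule: albert_cases) (simp add: zorn_hom hom d)
qed

lemma albert_cross_hom: "albert_cross R (albert_map (ring_comp R) x) (albert_map (ring_comp R) y) = albert_map (ring_comp R) (cross x y)"
 by (simp add: albert_cross_def albert_hom albert_adjoint_hom)

lemma albert_zero_hom: "albert_zero R = albert_map (ring_comp R) 0"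
 by (simp add: albert_zero_def albert_eq_zero hom zero_prod_def Let_def)

lemma brown_hom:
 "brown_add R (brown_comp R x) (brown_comp R y) = brown_comp R (x + y)"
 "brown_mult R (brown_comp R x) (brown_comp R y) = brown_comp R (bmul x y)"
 "brown_smult R (ring_comp R r) (brown_comp R y) = brown_comp R (bscl r y)"
 "brown_invol (brown_comp R y) = brown_comp R (brown_invol y)"
 by ((cases x rule: brown_cases, cases y rule: brown_cases, simp add: brown_map_def albert_hom albert_cross_hom hom)[1])+

lemma brown_const_hom: "zero (split_brown R) = brown_comp R 0" "one (split_brown R) = brown_comp R (1, 0, 0, 1)"
 by (simp_all add: brown_map_def brown_zero albert_zero_hom hom)

lemma brown_closed: "brown_comp R x : carrier (split_brown R)"
proof -
 have z: "zorn_map (ring_comp R) c : zorn_carrier R" for c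
  by (cases c rule: zorn_cases) (simp add: zorn_carrier_def vec_carrier_def hom)
 have "albert_map (ring_comp R) c : albert_carrier R" for c
  by (cases c rule: albert_cases) (simp add: albert_carrier_def vec_carrier_def hom z)
 then show ?thesis
  by (cases x rule: brown_cases) (simp add: brown_map_def hom)
qed

lemma brown_surj:
 assumes "x : carrier (split_brown R)"
 obtains x' where "x = brown_comp R x'"
proof -
 have v: "\<exists>a b c. v = (ring_comp R a, ring_comp R b, ring_comp R c)" if "v : vec_carrier R" for v
  using that by (cases v) (auto simp: vec_carrier_def elim!: comp_surj[OF cring])
 have z: "\<exists>c'. c = zorn_map (ring_comp R) c'" if "c : zorn_carrier R" for c
 proof (cases c)
  case (fields a u w b)
  then obtain a' b' where "a = ring_comp R a'" "b = ring_comp R b'"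
   using \<open>c : zorn_carrier R\<close> by (auto simp: zorn_carrier_def elim!: comp_surj[OF cring])
  moreover obtain u1 u2 u3 w1 w2 w3 where "u = (ring_comp R u1, ring_comp R u2, ring_comp R u3)" "w = (ring_comp R w1, ring_comp R w2, ring_comp R w3)"
   using \<open>c : zorn_carrier R\<close> v[of u] v[of w] fields by (auto simp: zorn_carrier_def)
  ultimately show ?thesis
   by (intro exI[of _ "(a', (u1, u2, u3), (w1, w2, w3), b')"]) (simp add: fields)
 qed
 have al: "\<exists>c'. c = albert_map (ring_comp R) c'" if c: "c : albert_carrier R" for c
 proof -
  obtain p q where fields: "c = (p, q)" by (cases c)
  obtain x1 x2 x3 where "p = (ring_comp R x1, ring_comp R x2, ring_comp R x3)"
   using c v[of p] fields by (auto simp: albert_carrier_def)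
  moreover obtain q1 q2 q3 where q: "q = (q1, q2, q3)" by (cases q)
  then have "q1 : zorn_carrier R" "q2 : zorn_carrier R" "q3 : zorn_carrier R"
   using c fields by (auto simp: albert_carrier_def)
  then obtain c1 c2 c3 where "q = (zorn_map (ring_comp R) c1, zorn_map (ring_comp R) c2, zorn_map (ring_comp R) c3)"
   using z[of q1] z[of q2] z[of q3] q by auto
  ultimately show ?thesis
   by (intro exI[of _ "((x1, x2, x3), (c1, c2, c3))"]) (simp add: fields)
 qed
 obtain r a b s where x: "x = (r, a, b, s)" by (cases x)
 obtain r' s' where "r = ring_comp R r'" "s = ring_comp R s'"
  using assms x by (auto elim!: comp_surj[OF cring])
 moreover obtain a' b' where "a = albert_map (ring_comp R) a'" "b = albert_map (ring_comp R) b'"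
  using assms x al[of a] al[of b] by auto
 ultimately have "x = brown_comp R (r', a', b', s')"
  by (simp add: x brown_map_def)
 then show thesis ..
qed

lemma split_brown_module: "module R (split_brown R)"
proof (rule moduleI)
 show "abelian_group (split_brown R)"
 proof (rule abelian_groupI)
  fix x assume "x : carrier (split_brown R)"
  then obtain x' where "x = brown_comp R x'" by (rule brown_surj)
  then show "\<exists>y\<in>carrier (split_brown R). y \<oplus>\<^bsub>split_brown R\<^esub> x = \<zero>\<^bsub>split_brown R\<^esub>"
   by (intro bexI[of _ "brown_comp R (- x')"]) (simp_all only: split_brown_simps(5) brown_hom brown_const_hom brown_closed, simp)
 qed (auto simp only: split_brown_simps(5) brown_hom brown_const_hom brown_closed add_ac add_0_left elim!: brown_surj)
qed (rule cring, auto simp only: split_brown_simps(5,6) brown_hom brown_const_hom brown_closed hom bscl_linear bscl_simps elim!: brown_surj comp_surj[OF cring])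

lemma brown_minus_hom: "\<ominus>\<^bsub>split_brown R\<^esub> brown_comp R x = brown_comp R (- x)"
 "brown_comp R x \<ominus>\<^bsub>split_brown R\<^esub> brown_comp R y = brown_comp R (x - y)"
proof -
 interpret module R "split_brown R" by (rule split_brown_module)
 show *: "\<ominus>\<^bsub>split_brown R\<^esub> brown_comp R x = brown_comp R (- x)" for x
  by (rule M.minus_equality) (simp_all only: split_brown_simps(5) brown_hom brown_const_hom brown_closed, simp)
 show "brown_comp R x \<ominus>\<^bsub>split_brown R\<^esub> brown_comp R y = brown_comp R (x - y)"
  unfolding a_minus_def * by (simp only: split_brown_simps(5) brown_hom) simp
qed

lemma V_op_hom: "V_op (split_brown R) (brown_comp R x) (brown_comp R y) (brown_comp R z) = brown_comp R (Vb x y z)"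
proof -
 have "brown_comp R z : carrier (split_brown R)" by (rule brown_closed)
 then show ?thesis
  unfolding V_op_def Vb_def
  by (simp only: restrict_apply if_True split_brown_simps(2,5,7) brown_hom brown_minus_hom)
qed

end

section \<open>Linear maps and spans\<close>

lemma lin_mapsI:
 assumes "!!x. x : carrier M ==> f x : carrier N"
  "!!x y. x : carrier M ==> y : carrier M ==> f (x \<oplus>\<^bsub>M\<^esub> y) = f x \<oplus>\<^bsub>N\<^esub> f y"
  "!!r x. r : carrier R ==> x : carrier M ==> f (r \<odot>\<^bsub>M\<^esub> x) = r \<odot>\<^bsub>N\<^esub> f x"
 shows "f : lin_maps R M N"
 using assms by (auto simp: lin_maps_def)

lemma lin_mapsD:
 assumes "f : lin_maps R M N"
 shows "x : carrier M ==> f x : carrier N"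
  "x : carrier M ==> y : carrier M ==> f (x \<oplus>\<^bsub>M\<^esub> y) = f x \<oplus>\<^bsub>N\<^esub> f y"
  "r : carrier R ==> x : carrier M ==> f (r \<odot>\<^bsub>M\<^esub> x) = r \<odot>\<^bsub>N\<^esub> f x"
 using assms by (auto simp: lin_maps_def)

lemma lin_maps_comp: "f : lin_maps R M N ==> g : lin_maps R N P ==> (%x. g (f x)) : lin_maps R M P"
 by (auto simp: lin_maps_def Pi_iff)

lemma lin_maps_cong: "f : lin_maps R M N ==> module R M ==> (!!x. x : carrier M ==> f x = g x) ==> g : lin_maps R M N"
 unfolding lin_maps_def using module.smult_closed[of R M] abelian_monoid.a_closed[of M]
  abelian_group.axioms(1)[of M] module.axioms(2)[of R M] by (auto simp: Pi_iff) 

lemma module_neg_smult: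
 assumes "module R M" "x : carrier M"
 shows "\<ominus>\<^bsub>M\<^esub> x = (\<ominus>\<^bsub>R\<^esub> \<one>\<^bsub>R\<^esub>) \<odot>\<^bsub>M\<^esub> x"
proof -
 interpret module R M by fact
 show ?thesis using assms smult_l_minus[of "\<one>\<^bsub>R\<^esub>" x] by simp
qed

lemma lin_maps_minus:
 assumes "module R M" "module R N" "f : lin_maps R M N" "x : carrier M"
 shows "f (\<ominus>\<^bsub>M\<^esub> x) = \<ominus>\<^bsub>N\<^esub> f x"
proof -
 interpret module R M by fact
 show ?thesis
  using assms by (simp add: module_neg_smult[of R M] module_neg_smult[of R N] lin_mapsD)
qed

lemma lin_maps_diff:
 assumes "module R M" "module R N" "f : lin_maps R M N" "x : carrier M" "y : carrier M"
 shows "f (x \<ominus>\<^bsub>M\<^esub> y) = f x \<ominus>\<^bsub>N\<^esub> f y"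
proof -
 interpret module R M by fact
 show ?thesis
  using assms by (simp add: a_minus_def lin_maps_minus lin_mapsD)
qed

lemma lin_maps_zero:
 assumes "module R M" "module R N" "f : lin_maps R M N"
 shows "f \<zero>\<^bsub>M\<^esub> = \<zero>\<^bsub>N\<^esub>"
proof -
 interpret M: module R M by fact
 interpret N: module R N by fact
 have "f (\<zero>\<^bsub>R\<^esub> \<odot>\<^bsub>M\<^esub> \<zero>\<^bsub>M\<^esub>) = \<zero>\<^bsub>R\<^esub> \<odot>\<^bsub>N\<^esub> f \<zero>\<^bsub>M\<^esub>"
  by (rule lin_mapsD(3)[OF assms(3)]) simp_all
 then show ?thesis
  using lin_mapsD(1)[OF assms(3) M.zero_closed] by simp
qed

lemma (in abelian_group) eq_if_minus_zero: "x \<ominus> y = \<zero> ==> x : carrier G ==> y : carrier G ==> x = y"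
 using minus_equality[of x "\<ominus> y"] by (simp add: a_minus_def)

lemma (in abelian_group) sum_minus_both:
 "a : carrier G ==> b : carrier G ==> a \<oplus> b \<ominus> a \<ominus> b = \<zero>"
 by (simp add: a_minus_def a_assoc a_lcomm[of b "\<ominus> a"] r_neg)

lemma submodule_facts:
 assumes "module R M" "submodule N R M"
 shows "N \<subseteq> carrier M" "\<zero>\<^bsub>M\<^esub> : N" "x : N ==> y : N ==> x \<oplus>\<^bsub>M\<^esub> y : N"
  "x : N ==> y : N ==> x \<ominus>\<^bsub>M\<^esub> y : N" "r : carrier R ==> x : N ==> r \<odot>\<^bsub>M\<^esub> x : N" "x : N ==> \<ominus>\<^bsub>M\<^esub> x : N"
 using module.submoduleE[OF assms] subgroup.one_closed[OF submodule.axioms(1)[OF assms(2)]]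
 by (auto simp: a_minus_def)

lemma submoduleI':
 assumes "module R M" "N \<subseteq> carrier M" "N \<noteq> {}" "!!x y. x : N ==> y : N ==> x \<oplus>\<^bsub>M\<^esub> y : N"
  "!!r x. r : carrier R ==> x : N ==> r \<odot>\<^bsub>M\<^esub> x : N"
 shows "submodule N R M"
proof -
 interpret module R M by fact
 obtain x where "x : N" using assms(3) by auto
 then have "\<zero>\<^bsub>M\<^esub> : N"
  using assms(5)[of "\<zero>\<^bsub>R\<^esub>" x] assms(2) by auto
 then show ?thesis
  using assms by (intro submoduleI) (auto simp: module_neg_smult[OF assms(1)] subset_iff)
qed

lemma lin_span_submodule:
 assumes "module R M" "X \<subseteq> carrier M"
 shows "submodule (lin_span R M X) R M" "X \<subseteq> lin_span R M X"
proof -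
 interpret module R M by fact
 have c: "submodule (carrier M) R M" by (rule carrier_is_submodule)
 show "submodule (lin_span R M X) R M"
 proof (rule submoduleI')
  show "lin_span R M X \<subseteq> carrier M"
   using assms c by (auto simp: lin_span_def)
  have "\<zero>\<^bsub>M\<^esub> : lin_span R M X"
   by (auto simp: lin_span_def submodule_facts[OF assms(1)])
  then show "lin_span R M X \<noteq> {}" by auto
 qed (auto simp: lin_span_def submodule_facts[OF assms(1)] assms)
 show "X \<subseteq> lin_span R M X"
  by (auto simp: lin_span_def)
qed

lemma lin_span_subset: "submodule N R M ==> X \<subseteq> N ==> lin_span R M X \<subseteq> N"
 by (auto simp: lin_span_def)

lemma lin_span_induct [consumes 3, case_names base zero add smult]:
 assumes "x : lin_span R M X" "module R M" "X \<subseteq> carrier M"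
  "!!x. x : X ==> P x" "P \<zero>\<^bsub>M\<^esub>"
  "!!x y. x : carrier M ==> y : carrier M ==> P x ==> P y ==> P (x \<oplus>\<^bsub>M\<^esub> y)"
  "!!r x. r : carrier R ==> x : carrier M ==> P x ==> P (r \<odot>\<^bsub>M\<^esub> x)"
 shows "P x"
proof -
 interpret module R M by fact
 have "submodule {x : carrier M. P x} R M"
  using assms by (intro submoduleI') auto
 then show ?thesis
  using lin_span_subset[of _ R M X] assms by blast
qed

lemma finsum_lin_maps:
 assumes "module R M" "module R N" "f : lin_maps R M N" "g : A \<rightarrow> carrier M"
 shows "f (finsum M g A) = finsum N (%i. f (g i)) A"
proof -
 interpret M: module R M by fact
 interpret N: module R N by fact
 show ?thesis
  using assms(4)
 proof (induction A rule: infinite_finite_induct)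
  case (insert a A)
  then have "(%i. f (g i)) : A \<rightarrow> carrier N" "f (g a) : carrier N" "finsum M g A : carrier M"
   using lin_mapsD(1)[OF assms(3)] by (auto simp: Pi_iff intro!: M.finsum_closed)
  with insert show ?case
   using lin_mapsD(2)[OF assms(3)] by (simp add: Pi_iff)
 qed (simp_all add: lin_maps_zero[OF assms(1-3)])
qed

section \<open>Base change\<close>

text \<open>The quotient is described by its fields and not by a fixed construction, so that the
  base change and the plain quotient \<open>quot\<close> used in descent share one
  development.\<close>

locale quotient_module =
 fixes R :: "('r, 'w) ring_scheme" and M :: "('r, 'm, 'x) module_scheme" and N :: "'m set"
  and Q :: "('r, 'm set, 'y) module_scheme"
 assumes module_M: "module R M" and submodule_N: "submodule N R M"
  and Q_simps: "carrier Q = a_rcosets\<^bsub>M\<^esub> N" "zero Q = N" "add Q = set_add M"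
   "!!s X. smult Q s X = (\<Union>f\<in>X. N +>\<^bsub>M\<^esub> (s \<odot>\<^bsub>M\<^esub> f))"
begin

interpretation M: module R M by (rule module_M)

interpretation N: abelian_subgroup N M
 by (rule abelian_subgroupI3)
  (use submodule.axioms(1)[OF submodule_N] M.abelian_group_axioms in \<open>auto intro: additive_subgroup.intro\<close>)

lemmas N_facts = submodule_facts[OF module_M submodule_N]

definition cls where "cls f = N +>\<^bsub>M\<^esub> f"

lemma Q_carrier: "carrier Q = cls ` carrier M"
 unfolding Q_simps cls_def A_RCOSETS_def RCOSETS_def a_r_coset_def by auto

lemma mem_cls: "f : carrier M ==> g : cls f \<longleftrightarrow> g : carrier M \<and> g \<ominus>\<^bsub>M\<^esub> f : N"
 unfolding cls_def a_minus_def using N.a_rcos_module N.a_elemrcos_carrier by blast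

lemma cls_eq: "f : carrier M ==> g : carrier M ==> cls f = cls g \<longleftrightarrow> f \<ominus>\<^bsub>M\<^esub> g : N"
 by (metis N.a_rcos_self N.a_repr_independence' cls_def mem_cls)

lemma cls_add: "f : carrier M ==> g : carrier M ==> cls (f \<oplus>\<^bsub>M\<^esub> g) = cls f \<oplus>\<^bsub>Q\<^esub> cls g"
 by (simp add: cls_def Q_simps N.a_rcos_sum)

lemma cls_zero: "f : carrier M ==> cls f = \<zero>\<^bsub>Q\<^esub> \<longleftrightarrow> f : N"
 using N.a_rcos_const[of f] N.a_rcos_self[of f] by (auto simp: cls_def Q_simps)

lemma cls_self: "f : carrier M ==> f : cls f"
 by (simp add: cls_def N.a_rcos_self)

lemma cls_smult: "s : carrier R ==> f : carrier M ==> cls (s \<odot>\<^bsub>M\<^esub> f) = s \<odot>\<^bsub>Q\<^esub> cls f"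
proof -
 assume *: "s : carrier R" "f : carrier M"
 have "cls (s \<odot>\<^bsub>M\<^esub> g) = cls (s \<odot>\<^bsub>M\<^esub> f)" if g: "g : cls f" for g
 proof -
  have gM: "g : carrier M" and gN: "g \<ominus>\<^bsub>M\<^esub> f : N" using g * by (auto simp: mem_cls)
  have "s \<odot>\<^bsub>M\<^esub> g \<ominus>\<^bsub>M\<^esub> s \<odot>\<^bsub>M\<^esub> f = s \<odot>\<^bsub>M\<^esub> (g \<ominus>\<^bsub>M\<^esub> f)"
   using * gM by (simp add: a_minus_def M.smult_r_distr M.smult_r_minus)
  then show ?thesis
   using * gM N_facts(5)[OF *(1) gN] by (simp add: cls_eq)
 qed
 then have "(\<Union>g\<in>cls f. cls (s \<odot>\<^bsub>M\<^esub> g)) = cls (s \<odot>\<^bsub>M\<^esub> f)"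
  using cls_self[OF *(2)] by blast
 then show ?thesis
  unfolding Q_simps(4) by (simp only: cls_def)
qed

lemma Q_module: "module R Q"
proof (rule moduleI)
 note simps = cls_add[symmetric] cls_smult[symmetric]
 have z: "\<zero>\<^bsub>Q\<^esub> = cls \<zero>\<^bsub>M\<^esub>"
  using cls_zero[of "\<zero>\<^bsub>M\<^esub>"] N_facts(2) by simp
 show "abelian_group Q"
 proof (rule abelian_groupI)
  fix x assume "x : carrier Q"
  then obtain f where "f : carrier M" "x = cls f" by (auto simp: Q_carrier)
  then show "\<exists>y\<in>carrier Q. y \<oplus>\<^bsub>Q\<^esub> x = \<zero>\<^bsub>Q\<^esub>"
   by (intro bexI[of _ "cls (\<ominus>\<^bsub>M\<^esub> f)"]) (auto simp: simps z Q_carrier M.l_neg)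
 qed (auto simp: Q_carrier simps z M.add.m_ac)
qed (auto simp: Q_carrier cls_add[symmetric] cls_smult[symmetric] M.is_cring M.smult_l_distr M.smult_r_distr M.smult_assoc1)

lemma cls_lin: "cls : lin_maps R M Q"
 by (rule lin_mapsI) (auto simp: Q_carrier cls_add cls_smult)

text \<open>Evaluation at an arbitrary representative; the choice is immaterial for maps that vanish
  on \<open>N\<close>.\<close>

definition factor :: "('m => 'p) => 'm set => 'p"
 where "factor g X = g (SOME f. f : X)"

lemma factor:
 assumes "module R P" "g : lin_maps R M P" "!!n. n : N ==> g n = \<zero>\<^bsub>P\<^esub>"
 shows "f : carrier M ==> factor g (cls f) = g f" "factor g : lin_maps R Q P"
proof -
 interpret P: module R P by fact
 show *: "factor g (cls f) = g f" if "f : carrier M" for f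
 proof -
  let ?h = "SOME h. h : cls f"
  have "?h : cls f" using someI[of "%h. h : cls f", OF cls_self[OF that]] .
  then have h: "?h : carrier M" "?h \<ominus>\<^bsub>M\<^esub> f : N" using that by (auto simp: mem_cls)
  then have "g ?h \<ominus>\<^bsub>P\<^esub> g f = \<zero>\<^bsub>P\<^esub>"
   using assms(3)[OF h(2)] lin_maps_diff[OF module_M assms(1,2) h(1) that] by simp
  then show ?thesis
   using lin_mapsD(1)[OF assms(2)] h(1) that P.M.eq_if_minus_zero[of "g ?h" "g f"] by (simp add: factor_def)
 qed
 show "factor g : lin_maps R Q P"
  using lin_mapsD[OF assms(2)]
  by (intro lin_mapsI) (auto simp: Q_carrier cls_add[symmetric] cls_smult[symmetric] *)
qed

end

locale scalar_ext =
 fixes R :: "('r, 'w) ring_scheme" and S :: "('r, 's, 'z) module_scheme" (structure) and M :: "('r, 'm, 'x) module_scheme"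
 assumes algebra_S: "algebra R S" and module_M: "module R M"
begin

lemma cring_S: "cring S" by (rule algebra.M_cring[OF algebra_S])

interpretation S: cring S by (rule cring_S)
interpretation RS: module R S by (rule algebra.module[OF algebra_S])
interpretation M: module R M by (rule module_M)

lemma one_S [simp]: "\<one> : carrier S" by simp

lemma scalar_closed [simp]: "r : carrier R ==> r \<odot> \<one> : carrier S" by simp

abbreviation F where "F \<equiv> formal_combs S M"
abbreviation N where "N \<equiv> tensor_relations R S M"
abbreviation BC where "BC \<equiv> base_change R S M"
abbreviation tens where "tens \<equiv> tensor R S M"

lemma F_simps [simp]:
 "zero F = (%_. \<zero>)" "add F f g = (%m. f m \<oplus> g m)" "smult F s f = (%m. s \<otimes> f m)"
 by (simp_all add: formal_combs_def)

lemma F_carrier: "f : carrier F \<longleftrightarrow> (\<forall>m. f m : carrier S) \<and> (\<forall>m. f m \<noteq> \<zero> \<longrightarrow> m : carrier M) \<and> finite {m. f m \<noteq> \<zero>}"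
 by (auto simp: formal_combs_def)

lemma F_add_closed:
 assumes "f : carrier F" "g : carrier F"
 shows "(%m. f m \<oplus> g m) : carrier F"
 proof -
  have "{m. f m \<oplus> g m \<noteq> \<zero>} \<subseteq> {m. f m \<noteq> \<zero>} \<union> {m. g m \<noteq> \<zero>}" by auto
  then have "finite {m. f m \<oplus> g m \<noteq> \<zero>}" using assms by (auto simp: F_carrier intro: finite_subset)
  moreover have "m : carrier M" if "f m \<oplus> g m \<noteq> \<zero>" for m
   using that assms unfolding F_carrier by (cases "f m = \<zero>") auto
  ultimately show ?thesis using assms by (auto simp: F_carrier)
 qed

lemma F_smult_closed:
 assumes "f : carrier F" "s : carrier S"
 shows "(%m. s \<otimes> f m) : carrier F"
 proof -
  have "{m. s \<otimes> f m \<noteq> \<zero>} \<subseteq> {m. f m \<noteq> \<zero>}" using assms by auto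
  then have "finite {m. s \<otimes> f m \<noteq> \<zero>}" using assms by (auto simp: F_carrier intro: finite_subset)
  moreover have "m : carrier M" if "s \<otimes> f m \<noteq> \<zero>" for m
   using that assms unfolding F_carrier by (cases "f m = \<zero>") auto
  ultimately show ?thesis using assms by (auto simp: F_carrier)
 qed

lemma F_module: "module S F"
proof (rule moduleI)
 show "abelian_group F"
 proof (rule abelian_groupI)
  fix f assume f: "f : carrier F"
  show "\<exists>g\<in>carrier F. g \<oplus>\<^bsub>F\<^esub> f = \<zero>\<^bsub>F\<^esub>"
  proof (intro bexI)
   show "(%m. (\<ominus> \<one>) \<otimes> f m) : carrier F" by (rule F_smult_closed) (use f in auto)
   have "(\<ominus> \<one>) \<otimes> f m \<oplus> f m = ((\<ominus> \<one>) \<oplus> \<one>) \<otimes> f m" for m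
    using f S.l_distr[of "\<ominus> \<one>" "\<one>" "f m"] by (simp add: F_carrier)
   then show "(%m. (\<ominus> \<one>) \<otimes> f m) \<oplus>\<^bsub>F\<^esub> f = \<zero>\<^bsub>F\<^esub>"
    using f by (simp add: F_carrier S.l_neg)
  qed
  fix g h assume "g : carrier F" "h : carrier F"
  with f show "f \<oplus>\<^bsub>F\<^esub> g \<oplus>\<^bsub>F\<^esub> h = f \<oplus>\<^bsub>F\<^esub> (g \<oplus>\<^bsub>F\<^esub> h)" "f \<oplus>\<^bsub>F\<^esub> g = g \<oplus>\<^bsub>F\<^esub> f"
   by (simp_all add: F_carrier S.add.m_ac)
 next
  show "\<zero>\<^bsub>F\<^esub> : carrier F" by (auto simp: F_carrier)
 qed (auto simp: F_add_closed, auto simp: F_carrier)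
qed (auto simp: F_smult_closed cring_S, auto simp: F_carrier S.l_distr S.r_distr S.m_assoc)

interpretation F: module S F by (rule F_module)

lemma single_closed: "m : carrier M ==> s : carrier S ==> single S m s : carrier F"
proof -
 assume *: "m : carrier M" "s : carrier S"
 have "{k. single S m s k \<noteq> \<zero>} \<subseteq> {m}" by (auto simp: single_def)
 then have "finite {k. single S m s k \<noteq> \<zero>}" by (rule finite_subset) simp
 then show ?thesis using * by (auto simp: F_carrier single_def)
qed

lemma single_smult: "s : carrier S ==> t : carrier S ==> s \<odot>\<^bsub>F\<^esub> single S m t = single S m (s \<otimes> t)"
 by (auto simp: single_def)

lemma F_induct [consumes 1, case_names single add smult]:
 assumes "f : carrier F" "!!m. m : carrier M ==> P (single S m \<one>)"
  "!!f g. f : carrier F ==> g : carrier F ==> P f ==> P g ==> P (f \<oplus>\<^bsub>F\<^esub> g)"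
  "!!s f. s : carrier S ==> f : carrier F ==> P f ==> P (s \<odot>\<^bsub>F\<^esub> f)"
 shows "P f"
proof -
 have 1: "P (single S m s)" if "m : carrier M" "s : carrier S" for m s
  using assms(4)[OF that(2) single_closed[OF that(1), of "\<one>"] assms(2)[OF that(1)]] that
  by (simp add: single_smult del: F_simps)
 have "finite A ==> f : carrier F ==> {m. f m \<noteq> \<zero>} \<subseteq> A ==> P f" for A f
 proof (induction A arbitrary: f rule: finite_induct)
  case empty
  then have "f = single S \<zero>\<^bsub>M\<^esub> \<zero>" by (auto simp: single_def)
  then show ?case using 1 by auto
 next
  case (insert a A)
  show ?case
  proof (cases "f a = \<zero>")
   case True
   then show ?thesis using insert by auto
  next
   case False
   let ?g = "f(a := \<zero>)"
   have "{m. ?g m \<noteq> \<zero>} \<subseteq> {m. f m \<noteq> \<zero>}" by auto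
   then have g: "?g : carrier F"
    using insert.prems unfolding F_carrier by (auto intro: finite_subset)
   have "{m. ?g m \<noteq> \<zero>} \<subseteq> A"
    using insert.prems by auto
   then have "P ?g" by (rule insert.IH[OF g])
   moreover have a: "a : carrier M" "f a : carrier S" using False insert.prems by (auto simp: F_carrier)
   moreover have "f = single S a (f a) \<oplus>\<^bsub>F\<^esub> ?g"
    using insert.prems(1) by (auto simp: single_def F_carrier)
   ultimately show ?thesis
    using assms(3)[OF single_closed[OF a] g 1[OF a]] by (simp del: F_simps)
  qed
 qed
 then show ?thesis using assms(1) by (auto simp: F_carrier)
qed

definition relations where "relations =
  {single S (m \<oplus>\<^bsub>M\<^esub> m') \<one> \<ominus>\<^bsub>F\<^esub> single S m \<one> \<ominus>\<^bsub>F\<^esub> single S m' \<one> | m m'.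
    m : carrier M \<and> m' : carrier M} \<union>
   {single S (r \<odot>\<^bsub>M\<^esub> m) \<one> \<ominus>\<^bsub>F\<^esub> single S m (r \<odot> \<one>) | r m.
    r : carrier R \<and> m : carrier M}"

lemma N_eq: "N = lin_span S F relations"
 by (simp add: tensor_relations_def relations_def)

lemma relations_closed: "relations \<subseteq> carrier F"
 unfolding relations_def by (auto intro!: F.M.minus_closed single_closed)

lemma N_submodule: "submodule N S F" and relations_N: "relations \<subseteq> N"
 unfolding N_eq using lin_span_submodule[OF F_module relations_closed] by auto

lemma BC_simps:
 "carrier BC = a_rcosets\<^bsub>F\<^esub> N" "zero BC = N" "add BC = set_add F" "mult BC = rcoset_mult F N"
 "smult BC s X = (\<Union>f\<in>X. N +>\<^bsub>F\<^esub> (s \<odot>\<^bsub>F\<^esub> f))" "one BC = N +>\<^bsub>F\<^esub> \<one>\<^bsub>F\<^esub>"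
 by (simp_all add: base_change_def Let_def)

sublocale Q: quotient_module S F N BC
 by (rule quotient_module.intro) (rule F_module N_submodule BC_simps)+

lemmas BC_module = Q.Q_module

lemma tens_eq: "tens m s = Q.cls (single S m s)"
 by (simp add: tensor_def Q.cls_def)

lemma tens_closed: "m : carrier M ==> s : carrier S ==> tens m s : carrier BC"
 by (simp add: tens_eq Q.Q_carrier single_closed)

lemma tens_smult: "m : carrier M ==> s : carrier S ==> t : carrier S ==> s \<odot>\<^bsub>BC\<^esub> tens m t = tens m (s \<otimes> t)"
 using Q.cls_smult[of s "single S m t"] single_closed[of m t] single_smult[of s t m] by (simp add: tens_eq del: F_simps)

lemma tens_add: "m : carrier M ==> m' : carrier M ==> tens (m \<oplus>\<^bsub>M\<^esub> m') \<one> = tens m \<one> \<oplus>\<^bsub>BC\<^esub> tens m' \<one>"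
proof -
 assume *: "m : carrier M" "m' : carrier M"
 have "single S (m \<oplus>\<^bsub>M\<^esub> m') \<one> \<ominus>\<^bsub>F\<^esub> single S m \<one> \<ominus>\<^bsub>F\<^esub> single S m' \<one> : N"
  using relations_N * unfolding relations_def by auto
 moreover have "single S (m \<oplus>\<^bsub>M\<^esub> m') \<one> \<ominus>\<^bsub>F\<^esub> single S m \<one> \<ominus>\<^bsub>F\<^esub> single S m' \<one> =
   single S (m \<oplus>\<^bsub>M\<^esub> m') \<one> \<ominus>\<^bsub>F\<^esub> (single S m \<one> \<oplus>\<^bsub>F\<^esub> single S m' \<one>)"
  using * single_closed[of _ "\<one>"] by (simp add: a_minus_def F.M.minus_add F.M.a_assoc del: F_simps)
 ultimately have "Q.cls (single S (m \<oplus>\<^bsub>M\<^esub> m') \<one>) = Q.cls (single S m \<one> \<oplus>\<^bsub>F\<^esub> single S m' \<one>)"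
  using * single_closed[of _ "\<one>"] by (simp add: Q.cls_eq del: F_simps)
 then show ?thesis
  using * single_closed[of _ "\<one>"] by (simp add: tens_eq Q.cls_add del: F_simps)
qed

lemma tens_scalar: "m : carrier M ==> r : carrier R ==> tens (r \<odot>\<^bsub>M\<^esub> m) \<one> = (r \<odot> \<one>) \<odot>\<^bsub>BC\<^esub> tens m \<one>"
proof -
 assume *: "m : carrier M" "r : carrier R"
 have "single S (r \<odot>\<^bsub>M\<^esub> m) \<one> \<ominus>\<^bsub>F\<^esub> single S m (r \<odot> \<one>) : N"
  using relations_N * unfolding relations_def by auto
 then show ?thesis
  using * by (simp add: tens_smult) (simp add: tens_eq Q.cls_eq single_closed)
qed

lemma BC_induct [consumes 1, case_names tens add smult]:
 assumes "x : carrier BC" "!!m. m : carrier M ==> P (tens m \<one>)"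
  "!!x y. x : carrier BC ==> y : carrier BC ==> P x ==> P y ==> P (x \<oplus>\<^bsub>BC\<^esub> y)"
  "!!s x. s : carrier S ==> x : carrier BC ==> P x ==> P (s \<odot>\<^bsub>BC\<^esub> x)"
 shows "P x"
proof -
 obtain f where f: "f : carrier F" "x = Q.cls f" using assms(1) by (auto simp: Q.Q_carrier)
 from f(1) have "P (Q.cls f)"
 proof (induction rule: F_induct)
  case (single m)
  then show ?case using assms(2) by (simp add: tens_eq)
 next
  case (add f g)
  then show ?case using assms(3) by (auto simp: Q.Q_carrier Q.cls_add simp del: F_simps)
 next
  case (smult s f)
  then show ?case using assms(4) by (auto simp: Q.Q_carrier Q.cls_smult simp del: F_simps)
 qed
 then show ?thesis by (simp add: f)
qed

lemma lin_maps_BC_eqI: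
 assumes "f : lin_maps S BC P" "g : lin_maps S BC P" "!!m. m : carrier M ==> f (tens m \<one>) = g (tens m \<one>)"
  "x : carrier BC"
 shows "f x = g x"
 using assms(4) by (induction rule: BC_induct) (simp_all add: assms(3) lin_mapsD[OF assms(1)] lin_mapsD[OF assms(2)])

subsection \<open>The universal property\<close>

definition semilinear :: "('s, 'p, 'q) module_scheme => ('m => 'p) => bool"
 where "semilinear P g \<longleftrightarrow> g : carrier M \<rightarrow> carrier P \<and>
  (\<forall>x\<in>carrier M. \<forall>y\<in>carrier M. g (x \<oplus>\<^bsub>M\<^esub> y) = g x \<oplus>\<^bsub>P\<^esub> g y) \<and>
  (\<forall>r\<in>carrier R. \<forall>x\<in>carrier M. g (r \<odot>\<^bsub>M\<^esub> x) = (r \<odot> \<one>) \<odot>\<^bsub>P\<^esub> g x)"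

definition comb :: "('s, 'p, 'q) module_scheme => ('m => 'p) => ('m => 's) => 'p"
 where "comb P g f = (\<Oplus>\<^bsub>P\<^esub>m\<in>{m. f m \<noteq> \<zero>}. f m \<odot>\<^bsub>P\<^esub> g m)"

definition lift :: "('s, 'p, 'q) module_scheme => ('m => 'p) => ('m => 's) set => 'p"
 where "lift P g = Q.factor (comb P g)"

text \<open>Sums over the supports of different combinations have different index sets; a common
  finite superset is what makes additivity provable termwise.\<close>

lemma comb_superset:
 assumes "module S P" "g : carrier M \<rightarrow> carrier P" "f : carrier F" "finite A" "{m. f m \<noteq> \<zero>} \<subseteq> A" "A \<subseteq> carrier M"
 shows "comb P g f = (\<Oplus>\<^bsub>P\<^esub>m\<in>A. f m \<odot>\<^bsub>P\<^esub> g m)"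
proof -
 interpret P: module S P by fact
 show ?thesis
  unfolding comb_def using assms
  by (intro P.M.add.finprod_mono_neutral_cong_left) (auto simp: F_carrier Pi_iff)
qed

lemma comb_lin:
 assumes "module S P" "g : carrier M \<rightarrow> carrier P"
 shows "comb P g : lin_maps S F P"
proof (rule lin_mapsI)
 interpret P: module S P by fact
 have gc: "g m : carrier P" if "m : carrier M" for m using that assms(2) by auto
 fix f assume f: "f : carrier F"
 let ?A = "{m. f m \<noteq> \<zero>}"
 have A: "finite ?A" "?A \<subseteq> carrier M" using f by (auto simp: F_carrier)
 have c: "f m : carrier S" for m using f by (auto simp: F_carrier)
 show "comb P g f : carrier P"
  unfolding comb_def using A assms(2) c by (intro P.M.finsum_closed) auto
 show "comb P g (s \<odot>\<^bsub>F\<^esub> f) = s \<odot>\<^bsub>P\<^esub> comb P g f" if s: "s : carrier S" for s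
 proof -
  have "comb P g (s \<odot>\<^bsub>F\<^esub> f) = (\<Oplus>\<^bsub>P\<^esub>m\<in>?A. (s \<otimes> f m) \<odot>\<^bsub>P\<^esub> g m)"
  proof -
   have "{m. s \<otimes> f m \<noteq> \<zero>} \<subseteq> ?A" using s by auto
   then show ?thesis
    using comb_superset[OF assms F.smult_closed[OF s f] A(1) _ A(2)] by simp
  qed
  also have "\<dots> = (\<Oplus>\<^bsub>P\<^esub>m\<in>?A. s \<odot>\<^bsub>P\<^esub> (f m \<odot>\<^bsub>P\<^esub> g m))"
   using A assms(2) c s by (intro P.M.finsum_cong') (auto simp: P.smult_assoc1 Pi_iff subset_iff)
  also have "\<dots> = s \<odot>\<^bsub>P\<^esub> comb P g f"
   unfolding comb_def
   by (rule finsum_lin_maps[symmetric, where f = "%x. s \<odot>\<^bsub>P\<^esub> x", OF assms(1) assms(1)])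
    (use A assms(2) c s in \<open>auto intro!: lin_mapsI simp: P.smult_r_distr P.smult_assoc1[symmetric] S.m_comm\<close>)
  finally show ?thesis .
 qed
 fix h assume h: "h : carrier F"
 let ?B = "{m. h m \<noteq> \<zero>}"
 have B: "finite ?B" "?B \<subseteq> carrier M" using h by (auto simp: F_carrier)
 have ch: "h m : carrier S" for m using h by (auto simp: F_carrier)
 have AB: "finite (?A \<union> ?B)" "?A \<union> ?B \<subseteq> carrier M" using A B by auto
 have "comb P g (f \<oplus>\<^bsub>F\<^esub> h) = (\<Oplus>\<^bsub>P\<^esub>m\<in>?A \<union> ?B. (f m \<oplus> h m) \<odot>\<^bsub>P\<^esub> g m)"
 proof -
  have "{m. f m \<oplus> h m \<noteq> \<zero>} \<subseteq> ?A \<union> ?B" by auto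
  then show ?thesis
   using comb_superset[OF assms F.M.a_closed[OF f h] AB(1) _ AB(2)] by simp
 qed
 also have "\<dots> = (\<Oplus>\<^bsub>P\<^esub>m\<in>?A \<union> ?B. f m \<odot>\<^bsub>P\<^esub> g m \<oplus>\<^bsub>P\<^esub> h m \<odot>\<^bsub>P\<^esub> g m)"
  using AB assms(2) c ch by (intro P.M.finsum_cong') (auto simp: P.smult_l_distr Pi_iff subset_iff)
 also have "\<dots> = comb P g f \<oplus>\<^bsub>P\<^esub> comb P g h"
  using AB assms(2) c ch comb_superset[OF assms f AB(1) _ AB(2)] comb_superset[OF assms h AB(1) _ AB(2)]
  by (subst P.M.finsum_addf) (use A(2) B(2) in \<open>auto intro!: P.smult_closed c ch gc\<close>)
 finally show "comb P g (f \<oplus>\<^bsub>F\<^esub> h) = comb P g f \<oplus>\<^bsub>P\<^esub> comb P g h" .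
qed

lemma comb_single:
 assumes "module S P" "g : carrier M \<rightarrow> carrier P" "m : carrier M" "s : carrier S"
 shows "comb P g (single S m s) = s \<odot>\<^bsub>P\<^esub> g m"
proof -
 interpret P: module S P by fact
 have "comb P g (single S m s) = (\<Oplus>\<^bsub>P\<^esub>k\<in>{m}. single S m s k \<odot>\<^bsub>P\<^esub> g k)"
  using assms by (intro comb_superset) (auto simp: single_closed, auto simp: single_def split: if_splits)
 then show ?thesis
  using assms by (simp add: single_def Pi_iff)
qed

lemma lift:
 assumes "module S P" "semilinear P g"
 shows "lift P g : lin_maps S BC P" "m : carrier M ==> s : carrier S ==> lift P g (tens m s) = s \<odot>\<^bsub>P\<^esub> g m"
  "f : carrier F ==> lift P g (Q.cls f) = comb P g f"
proof -
 interpret P: module S P by fact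
 have g: "g : carrier M \<rightarrow> carrier P" "!!x y. x : carrier M ==> y : carrier M ==> g (x \<oplus>\<^bsub>M\<^esub> y) = g x \<oplus>\<^bsub>P\<^esub> g y"
  "!!r x. r : carrier R ==> x : carrier M ==> g (r \<odot>\<^bsub>M\<^esub> x) = (r \<odot> \<one>) \<odot>\<^bsub>P\<^esub> g x"
  using assms(2) by (auto simp: semilinear_def)
 have gc: "g x : carrier P" if "x : carrier M" for x using g(1) that by auto
 note lin = comb_lin[OF assms(1) g(1)]
 have kill: "comb P g n = \<zero>\<^bsub>P\<^esub>" if "n : N" for n
 proof (rule lin_span_induct[OF that[unfolded N_eq] F_module relations_closed])
  fix x assume "x : relations"
  then consider m m' where "x = single S (m \<oplus>\<^bsub>M\<^esub> m') \<one> \<ominus>\<^bsub>F\<^esub> single S m \<one> \<ominus>\<^bsub>F\<^esub> single S m' \<one>"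
    "m : carrier M" "m' : carrier M"
   | r m where "x = single S (r \<odot>\<^bsub>M\<^esub> m) \<one> \<ominus>\<^bsub>F\<^esub> single S m (r \<odot> \<one>)" "r : carrier R" "m : carrier M"
   unfolding relations_def by blast
  then show "comb P g x = \<zero>\<^bsub>P\<^esub>"
  proof cases
   case 1
   then have "comb P g x = g m \<oplus>\<^bsub>P\<^esub> g m' \<ominus>\<^bsub>P\<^esub> g m \<ominus>\<^bsub>P\<^esub> g m'"
    by (simp add: lin_maps_diff[OF F_module assms(1) lin] single_closed F.M.minus_closed comb_single[OF assms(1) g(1)] g(2) gc
     del: F_simps)
   then show ?thesis
    using 1 gc by (simp add: P.M.sum_minus_both)
  next
   case 2
   then have "comb P g x = (r \<odot> \<one>) \<odot>\<^bsub>P\<^esub> g m \<ominus>\<^bsub>P\<^esub> (r \<odot> \<one>) \<odot>\<^bsub>P\<^esub> g m"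
    by (simp add: lin_maps_diff[OF F_module assms(1) lin] single_closed comb_single[OF assms(1) g(1)] g(3) gc
     del: F_simps)
   then show ?thesis
    using 2 gc by (simp add: a_minus_def P.M.r_neg)
  qed
 qed (simp_all add: lin_maps_zero[OF F_module assms(1) lin] lin_mapsD[OF lin] del: F_simps)
 have fac: "f : carrier F ==> Q.factor (comb P g) (Q.cls f) = comb P g f" "Q.factor (comb P g) : lin_maps S BC P" for f
  by (rule Q.factor[OF assms(1) lin]; use kill in auto)+
 show "lift P g : lin_maps S BC P" unfolding lift_def by (rule fac(2))
 show "lift P g (Q.cls f) = comb P g f" if "f : carrier F" for f unfolding lift_def using fac(1)[OF that] .
 show "lift P g (tens m s) = s \<odot>\<^bsub>P\<^esub> g m" if "m : carrier M" "s : carrier S"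
  unfolding lift_def tens_eq using fac(1)[OF single_closed[OF that]] comb_single[OF assms(1) g(1) that] by simp
qed

lemma lift_unit:
 assumes "module S P" "semilinear P g" "m : carrier M"
 shows "lift P g (tens m \<one>) = g m"
proof -
 interpret P: module S P by fact
 have "g m : carrier P" using assms by (auto simp: semilinear_def)
 then show ?thesis using lift(2)[OF assms(1-3)] by simp
qed

end

subsection \<open>The product\<close>

definition bilinear_mult :: "('r, 'w) ring_scheme => ('r, 'm, 'x) module_scheme => bool"
 where "bilinear_mult R M \<longleftrightarrow>
  (\<forall>x\<in>carrier M. (%y. x \<otimes>\<^bsub>M\<^esub> y) : lin_maps R M M \<and> (%y. y \<otimes>\<^bsub>M\<^esub> x) : lin_maps R M M)"

lemma bilinear_multD:
 assumes "bilinear_mult R M" "x : carrier M" "y : carrier M"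
 shows "x \<otimes>\<^bsub>M\<^esub> y : carrier M"
  "z : carrier M ==> x \<otimes>\<^bsub>M\<^esub> (y \<oplus>\<^bsub>M\<^esub> z) = x \<otimes>\<^bsub>M\<^esub> y \<oplus>\<^bsub>M\<^esub> x \<otimes>\<^bsub>M\<^esub> z"
  "z : carrier M ==> (x \<oplus>\<^bsub>M\<^esub> y) \<otimes>\<^bsub>M\<^esub> z = x \<otimes>\<^bsub>M\<^esub> z \<oplus>\<^bsub>M\<^esub> y \<otimes>\<^bsub>M\<^esub> z"
  "r : carrier R ==> x \<otimes>\<^bsub>M\<^esub> (r \<odot>\<^bsub>M\<^esub> y) = r \<odot>\<^bsub>M\<^esub> (x \<otimes>\<^bsub>M\<^esub> y)"
  "r : carrier R ==> (r \<odot>\<^bsub>M\<^esub> x) \<otimes>\<^bsub>M\<^esub> y = r \<odot>\<^bsub>M\<^esub> (x \<otimes>\<^bsub>M\<^esub> y)"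
 using assms lin_mapsD[of "%y. x \<otimes>\<^bsub>M\<^esub> y" R M M] lin_mapsD[of "%x. x \<otimes>\<^bsub>M\<^esub> y" R M M]
  lin_mapsD[of "%x. x \<otimes>\<^bsub>M\<^esub> z" R M M]
 by (auto simp: bilinear_mult_def)

context scalar_ext
begin

interpretation S: cring S by (rule cring_S)
interpretation RS: module R S by (rule algebra.module[OF algebra_S])
interpretation M: module R M by (rule module_M)
interpretation F: module S F by (rule F_module)

lemma F_mult: "(f \<otimes>\<^bsub>F\<^esub> g) k = (\<Oplus>p\<in>{(a, b). f a \<noteq> \<zero> \<and> g b \<noteq> \<zero> \<and> a \<otimes>\<^bsub>M\<^esub> b = k}. f (fst p) \<otimes> g (snd p))"
 by (simp add: formal_combs_def)

text \<open>Rewrites the convolution as a sum over a fixed rectangle with a case distinction, so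
  that products of different factors can be compared over one index set.\<close>

lemma F_mult_superset:
 assumes "f : carrier F" "g : carrier F" "finite A" "finite B" "{m. f m \<noteq> \<zero>} \<subseteq> A" "{m. g m \<noteq> \<zero>} \<subseteq> B"
 shows "(f \<otimes>\<^bsub>F\<^esub> g) k = (\<Oplus>p\<in>A \<times> B. if fst p \<otimes>\<^bsub>M\<^esub> snd p = k then f (fst p) \<otimes> g (snd p) else \<zero>)"
proof -
 have c: "f m : carrier S" "g m : carrier S" for m using assms(1,2) by (auto simp: F_carrier)
 have z: "f a \<otimes> g b = \<zero>" if "f a = \<zero> \<or> g b = \<zero>" for a b
  using that c[of a] c[of b] by auto
 show ?thesis
  unfolding F_mult using assms c z
  by (intro S.add.finprod_mono_neutral_cong_left) auto
qed

lemma F_mult_closed: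
 assumes "bilinear_mult R M" "f : carrier F" "g : carrier F"
 shows "f \<otimes>\<^bsub>F\<^esub> g : carrier F"
proof -
 let ?A = "{m. f m \<noteq> \<zero>}" and ?B = "{m. g m \<noteq> \<zero>}"
 have c: "f m : carrier S" "g m : carrier S" for m using assms(2,3) by (auto simp: F_carrier)
 have AB: "finite ?A" "finite ?B" "?A \<subseteq> carrier M" "?B \<subseteq> carrier M" using assms(2,3) by (auto simp: F_carrier)
 have nz: "k : (%p. fst p \<otimes>\<^bsub>M\<^esub> snd p) ` (?A \<times> ?B)" if "(f \<otimes>\<^bsub>F\<^esub> g) k \<noteq> \<zero>" for k
 proof (rule ccontr)
  assume "\<not> ?thesis"
  then have "{(a, b). f a \<noteq> \<zero> \<and> g b \<noteq> \<zero> \<and> a \<otimes>\<^bsub>M\<^esub> b = k} = {}" by force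
  then have "(f \<otimes>\<^bsub>F\<^esub> g) k = \<zero>" unfolding F_mult by (simp only: S.finsum_empty)
  then show False using that by simp
 qed
 then have "{k. (f \<otimes>\<^bsub>F\<^esub> g) k \<noteq> \<zero>} \<subseteq> (%p. fst p \<otimes>\<^bsub>M\<^esub> snd p) ` (?A \<times> ?B)" by blast
 then have "finite {k. (f \<otimes>\<^bsub>F\<^esub> g) k \<noteq> \<zero>}" using AB by (auto intro: finite_subset)
 moreover have "(f \<otimes>\<^bsub>F\<^esub> g) k : carrier S" for k
  unfolding F_mult using c by (intro S.finsum_closed) auto
 moreover have "k : carrier M" if "(f \<otimes>\<^bsub>F\<^esub> g) k \<noteq> \<zero>" for k
  using nz[OF that] AB(3,4) bilinear_multD(1)[OF assms(1)] by (auto simp: subset_iff)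
 ultimately show ?thesis by (simp add: F_carrier)
qed

lemma F_mult_bilinear:
 assumes "bilinear_mult R M"
 shows "bilinear_mult S F"
proof -
 have "(f \<oplus>\<^bsub>F\<^esub> f') \<otimes>\<^bsub>F\<^esub> g = f \<otimes>\<^bsub>F\<^esub> g \<oplus>\<^bsub>F\<^esub> f' \<otimes>\<^bsub>F\<^esub> g \<and> g \<otimes>\<^bsub>F\<^esub> (f \<oplus>\<^bsub>F\<^esub> f') = g \<otimes>\<^bsub>F\<^esub> f \<oplus>\<^bsub>F\<^esub> g \<otimes>\<^bsub>F\<^esub> f'"
  if f: "f : carrier F" and f': "f' : carrier F" and g: "g : carrier F" for f f' g
 proof -
  let ?A = "{m. f m \<noteq> \<zero>} \<union> {m. f' m \<noteq> \<zero>}" and ?B = "{m. g m \<noteq> \<zero>}"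
  have c: "f m : carrier S" "f' m : carrier S" "g m : carrier S" for m using f f' g by (auto simp: F_carrier)
  have AB: "finite ?A" "finite ?B" using f f' g by (auto simp: F_carrier)
  have s: "{m. (f \<oplus>\<^bsub>F\<^esub> f') m \<noteq> \<zero>} \<subseteq> ?A" by auto
  have "((f \<oplus>\<^bsub>F\<^esub> f') \<otimes>\<^bsub>F\<^esub> g) k = (f \<otimes>\<^bsub>F\<^esub> g) k \<oplus> (f' \<otimes>\<^bsub>F\<^esub> g) k" for k
  proof -
   have "((f \<oplus>\<^bsub>F\<^esub> f') \<otimes>\<^bsub>F\<^esub> g) k = (\<Oplus>p\<in>?A \<times> ?B. (if fst p \<otimes>\<^bsub>M\<^esub> snd p = k then f (fst p) \<otimes> g (snd p) else \<zero>) \<oplus>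
     (if fst p \<otimes>\<^bsub>M\<^esub> snd p = k then f' (fst p) \<otimes> g (snd p) else \<zero>))"
    unfolding F_mult_superset[OF F.M.a_closed[OF f f'] g AB s order_refl]
    using c by (intro S.finsum_cong') (auto simp: S.l_distr)
   also have "\<dots> = (f \<otimes>\<^bsub>F\<^esub> g) k \<oplus> (f' \<otimes>\<^bsub>F\<^esub> g) k"
    using c by (subst S.finsum_addf) (auto simp: F_mult_superset[OF f g AB] F_mult_superset[OF f' g AB])
   finally show ?thesis .
  qed
  moreover have "(g \<otimes>\<^bsub>F\<^esub> (f \<oplus>\<^bsub>F\<^esub> f')) k = (g \<otimes>\<^bsub>F\<^esub> f) k \<oplus> (g \<otimes>\<^bsub>F\<^esub> f') k" for k
  proof -
   have "(g \<otimes>\<^bsub>F\<^esub> (f \<oplus>\<^bsub>F\<^esub> f')) k = (\<Oplus>p\<in>?B \<times> ?A. (if fst p \<otimes>\<^bsub>M\<^esub> snd p = k then g (fst p) \<otimes> f (snd p) else \<zero>) \<oplus>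
     (if fst p \<otimes>\<^bsub>M\<^esub> snd p = k then g (fst p) \<otimes> f' (snd p) else \<zero>))"
    unfolding F_mult_superset[OF g F.M.a_closed[OF f f'] AB(2,1) order_refl s]
    using c by (intro S.finsum_cong') (auto simp: S.r_distr)
   also have "\<dots> = (g \<otimes>\<^bsub>F\<^esub> f) k \<oplus> (g \<otimes>\<^bsub>F\<^esub> f') k"
    using c by (subst S.finsum_addf) (auto simp: F_mult_superset[OF g f AB(2,1)] F_mult_superset[OF g f' AB(2,1)])
   finally show ?thesis .
  qed
  ultimately show ?thesis by auto
 qed
 moreover have "(s \<odot>\<^bsub>F\<^esub> f) \<otimes>\<^bsub>F\<^esub> g = s \<odot>\<^bsub>F\<^esub> (f \<otimes>\<^bsub>F\<^esub> g) \<and> g \<otimes>\<^bsub>F\<^esub> (s \<odot>\<^bsub>F\<^esub> f) = s \<odot>\<^bsub>F\<^esub> (g \<otimes>\<^bsub>F\<^esub> f)"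
  if f: "f : carrier F" and s: "s : carrier S" and g: "g : carrier F" for f s g
 proof -
  let ?A = "{m. f m \<noteq> \<zero>}" and ?B = "{m. g m \<noteq> \<zero>}"
  have c: "f m : carrier S" "g m : carrier S" for m using f g by (auto simp: F_carrier)
  have AB: "finite ?A" "finite ?B" using f g by (auto simp: F_carrier)
  have sub: "{m. (s \<odot>\<^bsub>F\<^esub> f) m \<noteq> \<zero>} \<subseteq> ?A" using s by auto
  have "((s \<odot>\<^bsub>F\<^esub> f) \<otimes>\<^bsub>F\<^esub> g) k = s \<otimes> (f \<otimes>\<^bsub>F\<^esub> g) k" for k
   unfolding F_mult_superset[OF F.smult_closed[OF s f] g AB sub order_refl] F_mult_superset[OF f g AB order_refl order_refl]
   using c s AB by (subst S.finsum_rdistr) (auto intro!: S.finsum_cong' simp: S.m_assoc)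
  moreover have "(g \<otimes>\<^bsub>F\<^esub> (s \<odot>\<^bsub>F\<^esub> f)) k = s \<otimes> (g \<otimes>\<^bsub>F\<^esub> f) k" for k
   unfolding F_mult_superset[OF g F.smult_closed[OF s f] AB(2,1) order_refl sub] F_mult_superset[OF g f AB(2,1) order_refl order_refl]
   using c s AB by (subst S.finsum_rdistr) (auto intro!: S.finsum_cong' simp: S.m_lcomm)
  ultimately show ?thesis by auto
 qed
 ultimately show ?thesis
  unfolding bilinear_mult_def using F_mult_closed[OF assms] by (auto intro!: lin_mapsI simp del: F_simps)
qed

lemma single_mult:
 assumes "a : carrier M" "b : carrier M"
 shows "single S a \<one> \<otimes>\<^bsub>F\<^esub> single S b \<one> = single S (a \<otimes>\<^bsub>M\<^esub> b) \<one>"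
proof
 fix k
 have "(single S a \<one> \<otimes>\<^bsub>F\<^esub> single S b \<one>) k =
  (\<Oplus>p\<in>{a} \<times> {b}. if fst p \<otimes>\<^bsub>M\<^esub> snd p = k then single S a \<one> (fst p) \<otimes> single S b \<one> (snd p) else \<zero>)"
  using assms by (intro F_mult_superset) (auto simp: single_closed, auto simp: single_def split: if_splits)
 then show "(single S a \<one> \<otimes>\<^bsub>F\<^esub> single S b \<one>) k = single S (a \<otimes>\<^bsub>M\<^esub> b) \<one> k"
  by (auto simp: single_def)
qed

text \<open>Multiplying a defining relation by \<open>single S b\<close> gives a defining relation
  again, by bilinearity of the product of \<open>M\<close>. Induction on the other factor then shows
  that the relations form a two-sided ideal, and the product passes to the tensor product.\<close>

lemma N_ideal:
 assumes "bilinear_mult R M" "n : N" "g : carrier F"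
 shows "n \<otimes>\<^bsub>F\<^esub> g : N" "g \<otimes>\<^bsub>F\<^esub> n : N"
proof -
 note bil = F_mult_bilinear[OF assms(1)]
 have left: "(%f. f \<otimes>\<^bsub>F\<^esub> g) : lin_maps S F F" and right: "(%f. g \<otimes>\<^bsub>F\<^esub> f) : lin_maps S F F" if "g : carrier F" for g
  using bil that by (auto simp: bilinear_mult_def)
 note facts = submodule_facts[OF F_module N_submodule]
 have sc: "single S m \<one> : carrier F" if "m : carrier M" for m using that by (rule single_closed) simp
 have sc': "single S m (r \<odot> \<one>) = (r \<odot> \<one>) \<odot>\<^bsub>F\<^esub> single S m \<one>" if "r : carrier R" for m r
  using that by (simp add: single_smult del: F_simps)
 have rel: "x \<otimes>\<^bsub>F\<^esub> single S b \<one> : N \<and> single S b \<one> \<otimes>\<^bsub>F\<^esub> x : N" if "x : relations" "b : carrier M" for x b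
 proof -
  note dist = lin_maps_diff[OF F_module F_module left[OF sc[OF that(2)]]] lin_maps_diff[OF F_module F_module right[OF sc[OF that(2)]]]
   lin_mapsD(3)[OF left[OF sc[OF that(2)]]] lin_mapsD(3)[OF right[OF sc[OF that(2)]]]
  have rel: "x : relations" by (rule that(1))
  consider m m' where "x = single S (m \<oplus>\<^bsub>M\<^esub> m') \<one> \<ominus>\<^bsub>F\<^esub> single S m \<one> \<ominus>\<^bsub>F\<^esub> single S m' \<one>"
    "m : carrier M" "m' : carrier M"
   | r m where "x = single S (r \<odot>\<^bsub>M\<^esub> m) \<one> \<ominus>\<^bsub>F\<^esub> single S m (r \<odot> \<one>)" "r : carrier R" "m : carrier M"
   using rel unfolding relations_def by blast
  then have "x \<otimes>\<^bsub>F\<^esub> single S b \<one> : relations \<and> single S b \<one> \<otimes>\<^bsub>F\<^esub> x : relations"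
  proof cases
   case 1
   have "\<exists>m1 m2. x \<otimes>\<^bsub>F\<^esub> single S b \<one> = single S (m1 \<oplus>\<^bsub>M\<^esub> m2) \<one> \<ominus>\<^bsub>F\<^esub> single S m1 \<one> \<ominus>\<^bsub>F\<^esub> single S m2 \<one>
     \<and> m1 : carrier M \<and> m2 : carrier M"
    using 1 that(2) by (intro exI[of _ "m \<otimes>\<^bsub>M\<^esub> b"] exI[of _ "m' \<otimes>\<^bsub>M\<^esub> b"])
     (simp add: dist sc F.M.minus_closed single_mult bilinear_multD[OF assms(1)] del: F_simps)
   moreover have "\<exists>m1 m2. single S b \<one> \<otimes>\<^bsub>F\<^esub> x = single S (m1 \<oplus>\<^bsub>M\<^esub> m2) \<one> \<ominus>\<^bsub>F\<^esub> single S m1 \<one> \<ominus>\<^bsub>F\<^esub> single S m2 \<one>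
     \<and> m1 : carrier M \<and> m2 : carrier M"
    using 1 that(2) by (intro exI[of _ "b \<otimes>\<^bsub>M\<^esub> m"] exI[of _ "b \<otimes>\<^bsub>M\<^esub> m'"])
     (simp add: dist sc F.M.minus_closed single_mult bilinear_multD[OF assms(1)] del: F_simps)
   ultimately show ?thesis unfolding relations_def by blast
  next
   case 2
   then have x: "x = single S (r \<odot>\<^bsub>M\<^esub> m) \<one> \<ominus>\<^bsub>F\<^esub> (r \<odot> \<one>) \<odot>\<^bsub>F\<^esub> single S m \<one>"
    by (simp only: sc')
   have "\<exists>k. x \<otimes>\<^bsub>F\<^esub> single S b \<one> = single S (r \<odot>\<^bsub>M\<^esub> k) \<one> \<ominus>\<^bsub>F\<^esub> single S k (r \<odot> \<one>) \<and> k : carrier M"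
    using 2(2,3) x that(2) by (intro exI[of _ "m \<otimes>\<^bsub>M\<^esub> b"])
     (simp add: dist sc sc' F.M.minus_closed single_mult bilinear_multD[OF assms(1)] del: F_simps)
   moreover have "\<exists>k. single S b \<one> \<otimes>\<^bsub>F\<^esub> x = single S (r \<odot>\<^bsub>M\<^esub> k) \<one> \<ominus>\<^bsub>F\<^esub> single S k (r \<odot> \<one>) \<and> k : carrier M"
    using 2(2,3) x that(2) by (intro exI[of _ "b \<otimes>\<^bsub>M\<^esub> m"])
     (simp add: dist sc sc' F.M.minus_closed single_mult bilinear_multD[OF assms(1)] del: F_simps)
   ultimately show ?thesis using 2 unfolding relations_def by blast
  qed
  then show ?thesis using relations_N by blast
 qed
 have "n \<otimes>\<^bsub>F\<^esub> g : N \<and> g \<otimes>\<^bsub>F\<^esub> n : N"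
  using assms(3)
 proof (induction rule: F_induct)
  case (single b)
  note lins = lin_mapsD[OF left[OF sc[OF single]]] lin_mapsD[OF right[OF sc[OF single]]]
   lin_maps_zero[OF F_module F_module left[OF sc[OF single]]] lin_maps_zero[OF F_module F_module right[OF sc[OF single]]]
  show ?case
   by (rule lin_span_induct[OF assms(2)[unfolded N_eq] F_module relations_closed])
    (simp_all add: rel single lins facts del: F_simps)
 next
  case (add f h)
  then show ?case
   using assms(2) facts(1) by (auto simp: bilinear_multD[OF bil] facts subset_iff simp del: F_simps)
 next
  case (smult s f)
  then show ?case
   using assms(2) facts(1) by (auto simp: bilinear_multD[OF bil] facts subset_iff simp del: F_simps)
 qed
 then show "n \<otimes>\<^bsub>F\<^esub> g : N" "g \<otimes>\<^bsub>F\<^esub> n : N" by auto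
qed

lemma cls_mult:
 assumes "bilinear_mult R M" "f : carrier F" "g : carrier F"
 shows "Q.cls f \<otimes>\<^bsub>BC\<^esub> Q.cls g = Q.cls (f \<otimes>\<^bsub>F\<^esub> g)"
proof -
 note bil = F_mult_bilinear[OF assms(1)]
 note facts = submodule_facts[OF F_module N_submodule]
 have left: "(%f. f \<otimes>\<^bsub>F\<^esub> g) : lin_maps S F F" and right: "(%f. g \<otimes>\<^bsub>F\<^esub> f) : lin_maps S F F" if "g : carrier F" for g
  using bil that by (auto simp: bilinear_mult_def)
 have "Q.cls (a \<otimes>\<^bsub>F\<^esub> b) = Q.cls (f \<otimes>\<^bsub>F\<^esub> g)" if "a : Q.cls f" "b : Q.cls g" for a b
 proof -
  have ab: "a : carrier F" "a \<ominus>\<^bsub>F\<^esub> f : N" "b : carrier F" "b \<ominus>\<^bsub>F\<^esub> g : N"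
   using that assms by (auto simp: Q.mem_cls)
  have "Q.cls (a \<otimes>\<^bsub>F\<^esub> b) = Q.cls (f \<otimes>\<^bsub>F\<^esub> b)"
   using N_ideal(1)[OF assms(1) ab(2,3)] ab assms
   by (simp add: Q.cls_eq bilinear_multD[OF bil] lin_maps_diff[OF F_module F_module left] del: F_simps)
  also have "\<dots> = Q.cls (f \<otimes>\<^bsub>F\<^esub> g)"
   using N_ideal(2)[OF assms(1) ab(4) assms(2)] ab assms
   by (simp add: Q.cls_eq bilinear_multD[OF bil] lin_maps_diff[OF F_module F_module right] del: F_simps)
  finally show ?thesis .
 qed
 then show ?thesis
  using Q.cls_self[OF assms(2)] Q.cls_self[OF assms(3)]
  unfolding BC_simps(4) rcoset_mult_def Q.cls_def[symmetric] by blast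
qed

lemma BC_bilinear:
 assumes "bilinear_mult R M"
 shows "bilinear_mult S BC"
 unfolding bilinear_mult_def
 by (auto intro!: lin_mapsI simp: Q.Q_carrier Q.cls_add[symmetric] Q.cls_smult[symmetric] cls_mult[OF assms]
  bilinear_multD[OF F_mult_bilinear[OF assms]] simp del: F_simps)

lemma tens_mult:
 assumes "bilinear_mult R M" "a : carrier M" "b : carrier M"
 shows "tens a \<one> \<otimes>\<^bsub>BC\<^esub> tens b \<one> = tens (a \<otimes>\<^bsub>M\<^esub> b) \<one>"
 using assms by (simp add: tens_eq cls_mult single_closed single_mult)

lemma F_finsum: "finite A ==> h : A \<rightarrow> carrier F ==> finsum F h A k = (\<Oplus>m\<in>A. h m k)"
proof (induction A rule: finite_induct)
 case (insert a A)
 then have "(%m. h m k) : A \<rightarrow> carrier S" "h a k : carrier S" by (auto simp: F_carrier Pi_iff)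
 with insert show ?case by (subst F.M.finsum_insert) (auto)
qed simp

end

text \<open>\<open>base_map\<close> is the linear extension of \<open>m \<mapsto> f m \<otimes> 1\<close>.\<close>

lemma base_map_lift:
 fixes M' :: "('r, 'n, 'y) module_scheme"
 assumes "scalar_ext R S M" "scalar_ext R S M'" "f : lin_maps R M M'" "X : carrier (base_change R S M)"
 shows "base_map R S M M' f X = scalar_ext.lift S (base_change R S M') (%m. tensor R S M' (f m) \<one>\<^bsub>S\<^esub>) X"
  "scalar_ext.semilinear R S M (base_change R S M') (%m. tensor R S M' (f m) \<one>\<^bsub>S\<^esub>)"
proof -
 interpret M: scalar_ext R S M by fact
 interpret M': scalar_ext R S M' by fact
 interpret S: cring S by (rule M.cring_S)
 interpret F': module S M'.F by (rule M'.F_module)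
 show semi: "M.semilinear M'.BC (%m. M'.tens (f m) \<one>\<^bsub>S\<^esub>)"
  using lin_mapsD[OF assms(3)] by (auto simp: M.semilinear_def M'.tens_closed M'.tens_add M'.tens_scalar)
 have "M'.Q.cls (%k. \<Oplus>\<^bsub>S\<^esub>m\<in>{m. g m \<noteq> \<zero>\<^bsub>S\<^esub> \<and> f m = k}. g m) = M.lift M'.BC (%m. M'.tens (f m) \<one>\<^bsub>S\<^esub>) X"
  if "g : X" for g
 proof -
  have X: "g : carrier M.F" "X = M.Q.cls g"
  proof -
   obtain h where h: "h : carrier M.F" "X = M.Q.cls h" using assms(4) by (auto simp: M.Q.Q_carrier)
   then show g: "g : carrier M.F" using that by (simp add: M.Q.mem_cls)
   show "X = M.Q.cls g"
    using h that g M.Q.cls_eq[OF g h(1)] by (simp add: M.Q.mem_cls)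
  qed
  let ?A = "{m. g m \<noteq> \<zero>\<^bsub>S\<^esub>}"
  have A: "finite ?A" "?A \<subseteq> carrier M" "!!m. g m : carrier S" using X(1) by (auto simp: M.F_carrier)
  have fA: "f m : carrier M'" if "m : ?A" for m using A(2) that lin_mapsD(1)[OF assms(3)] by auto
  have sA: "(%m. single S (f m) (g m)) : ?A \<rightarrow> carrier M'.F"
   using fA A(3) by (auto intro: M'.single_closed)
  have "M.lift M'.BC (%m. M'.tens (f m) \<one>\<^bsub>S\<^esub>) X = (\<Oplus>\<^bsub>M'.BC\<^esub>m\<in>?A. g m \<odot>\<^bsub>M'.BC\<^esub> M'.tens (f m) \<one>\<^bsub>S\<^esub>)"
   unfolding X(2) M.lift(3)[OF M'.BC_module semi X(1)] M.comb_def ..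
  also have "\<dots> = (\<Oplus>\<^bsub>M'.BC\<^esub>m\<in>?A. M'.Q.cls (single S (f m) (g m)))"
  proof -
   interpret BC': module S M'.BC by (rule M'.BC_module)
   show ?thesis
   proof (rule BC'.M.finsum_cong')
    fix m assume "m : ?A"
    then have "g m \<odot>\<^bsub>M'.BC\<^esub> M'.tens (f m) \<one>\<^bsub>S\<^esub> = M'.tens (f m) (g m)"
     using fA A(3) by (simp add: M'.tens_smult)
    then show "g m \<odot>\<^bsub>M'.BC\<^esub> M'.tens (f m) \<one>\<^bsub>S\<^esub> = M'.Q.cls (single S (f m) (g m))"
     by (simp only: M'.tens_eq)
   qed (use sA in \<open>auto simp: M'.Q.Q_carrier\<close>)
  qed
  also have "\<dots> = M'.Q.cls (finsum M'.F (%m. single S (f m) (g m)) ?A)"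
   by (rule finsum_lin_maps[OF M'.F_module M'.BC_module M'.Q.cls_lin sA, symmetric])
  also have "finsum M'.F (%m. single S (f m) (g m)) ?A = (%k. \<Oplus>\<^bsub>S\<^esub>m\<in>{m. g m \<noteq> \<zero>\<^bsub>S\<^esub> \<and> f m = k}. g m)"
  proof
   fix k
   show "finsum M'.F (%m. single S (f m) (g m)) ?A k = (\<Oplus>\<^bsub>S\<^esub>m\<in>{m. g m \<noteq> \<zero>\<^bsub>S\<^esub> \<and> f m = k}. g m)"
    unfolding M'.F_finsum[OF A(1) sA] using A
    by (intro S.add.finprod_mono_neutral_cong_right) (auto simp: single_def)
  qed
  finally show ?thesis ..
 qed
 moreover have "X \<noteq> {}"
  using assms(4) M.Q.cls_self by (auto simp: M.Q.Q_carrier)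
 ultimately show "base_map R S M M' f X = M.lift M'.BC (%m. M'.tens (f m) \<one>\<^bsub>S\<^esub>) X"
  unfolding base_map_def M'.Q.cls_def[symmetric] by blast
qed

section \<open>Descent along faithfully flat ring extensions\<close>

text \<open>Faithful flatness is formulated for modules on one fixed type. A module on another type
  is carried there along an injective encoding; the product field is a dummy.\<close>

definition transport :: "('m => 'n) => ('r, 'm, 'x) module_scheme => ('r, 'n) module"
 where "transport h M = (let k = inv_into (carrier M) h in
  \<lparr>carrier = h ` carrier M, mult = (%x y. x), one = h \<zero>\<^bsub>M\<^esub>, zero = h \<zero>\<^bsub>M\<^esub>,
   add = (%x y. h (k x \<oplus>\<^bsub>M\<^esub> k y)), smult = (%r x. h (r \<odot>\<^bsub>M\<^esub> k x))\<rparr>)"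

lemma transport:
 assumes "module R M" "inj_on h (carrier M)"
 shows "module R (transport h M)" "h : lin_maps R M (transport h M)" "carrier (transport h M) = h ` carrier M"
proof -
 interpret module R M by fact
 have k: "inv_into (carrier M) h (h x) = x" if "x : carrier M" for x
  using assms(2) that by simp
 have s: "h x \<oplus>\<^bsub>transport h M\<^esub> h y = h (x \<oplus>\<^bsub>M\<^esub> y)" "r \<odot>\<^bsub>transport h M\<^esub> h x = h (r \<odot>\<^bsub>M\<^esub> x)" "\<zero>\<^bsub>transport h M\<^esub> = h \<zero>\<^bsub>M\<^esub>"
  if "x : carrier M" "y : carrier M" for x y r
  using that by (simp_all add: transport_def Let_def k)
 show c: "carrier (transport h M) = h ` carrier M"
  by (simp add: transport_def Let_def)
 have z: "\<zero>\<^bsub>transport h M\<^esub> = h \<zero>\<^bsub>M\<^esub>" by (simp add: transport_def Let_def)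
 have ab: "abelian_group (transport h M)"
 proof (rule abelian_groupI)
  fix y assume "y : carrier (transport h M)"
  then obtain x where "x : carrier M" "y = h x" by (auto simp: c)
  then show "\<exists>y'\<in>carrier (transport h M). y' \<oplus>\<^bsub>transport h M\<^esub> y = \<zero>\<^bsub>transport h M\<^esub>"
   by (intro bexI[of _ "h (\<ominus>\<^bsub>M\<^esub> x)"]) (auto simp: s z c M.l_neg)
 qed (auto simp: c s z M.add.m_ac)
 show "module R (transport h M)"
  by (rule moduleI[OF R.is_cring ab]) (auto simp: c s z smult_l_distr smult_r_distr smult_assoc1)
 show "h : lin_maps R M (transport h M)"
  by (rule lin_mapsI) (auto simp: c s)
qed

lemma scalar_ext_lin_zero:
 assumes "scalar_ext R T M" "f : lin_maps T (base_change R T M) P" "module T P"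
  "!!m. m : carrier M ==> f (tensor R T M m \<one>\<^bsub>T\<^esub>) = \<zero>\<^bsub>P\<^esub>" "x : carrier (base_change R T M)"
 shows "f x = \<zero>\<^bsub>P\<^esub>"
proof -
 interpret scalar_ext R T M by fact
 interpret P: module T P by fact
 show ?thesis
  using assms(5) by (induction rule: BC_induct) (simp_all add: assms(4) lin_mapsD[OF assms(2)])
qed

text \<open>The test sequence is R x \<rightarrow> M \<rightarrow> M with the inclusion and the
  identity, which is exact iff R x = 0. After base change the inclusion becomes zero, as rx
  \<otimes> 1 = r (x \<otimes> 1) = 0, and the identity remains the identity, so the extended
  sequence is exact and exactness is reflected.\<close>

lemma flat_injective_aux:
 fixes M :: "('r, (nat => 'r) set) module"
 assumes "algebra R T" "faithfully_flat R T" "module R M" "x : carrier M"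
  and "tensor R T M x \<one>\<^bsub>T\<^esub> = \<zero>\<^bsub>base_change R T M\<^esub>"
 shows "x = \<zero>\<^bsub>M\<^esub>"
proof -
 interpret M: module R M by fact
 define H where "H = (%r. r \<odot>\<^bsub>M\<^esub> x) ` carrier R"
 define M0 :: "('r, (nat => 'r) set) module" where "M0 = M\<lparr>carrier := H\<rparr>"
 have H: "submodule H R M"
 proof (rule submoduleI'[OF assms(3)])
  show "H \<subseteq> carrier M" "H \<noteq> {}" using assms(4) by (auto simp: H_def)
  fix a b assume "a : H" "b : H"
  then show "a \<oplus>\<^bsub>M\<^esub> b : H"
   using assms(4) by (auto simp: H_def M.smult_l_distr[symmetric])
 next
  fix r a assume "r : carrier R" "a : H"
  then show "r \<odot>\<^bsub>M\<^esub> a : H"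
   using assms(4) by (auto simp: H_def M.smult_assoc1[symmetric])
 qed
 have M0: "module R M0"
  unfolding M0_def by (rule submodule.submodule_is_module[OF H assms(3)])
 have HM: "H \<subseteq> carrier M" using submodule_facts[OF assms(3) H] by auto
 have i: "(%x. x) : lin_maps R M0 M" "(%x. x) : lin_maps R M M"
  using HM by (auto intro!: lin_mapsI simp: M0_def)
 interpret E: scalar_ext R T M by (rule scalar_ext.intro) fact+
 interpret E0: scalar_ext R T M0 by (rule scalar_ext.intro) fact+
 interpret BC: module T E.BC by (rule E.BC_module)
 have zero: "base_map R T M0 M (%x. x) X = \<zero>\<^bsub>E.BC\<^esub>" if "X : carrier E0.BC" for X
 proof -
  note lift = base_map_lift[OF E0.scalar_ext_axioms E.scalar_ext_axioms i(1)]
  have semi: "E0.semilinear E.BC (%m. E.tens m \<one>\<^bsub>T\<^esub>)" by (rule lift(2)[OF that])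
  have "E.tens m \<one>\<^bsub>T\<^esub> = \<zero>\<^bsub>E.BC\<^esub>" if m: "m : carrier M0" for m
  proof -
   obtain r where r: "r : carrier R" "m = r \<odot>\<^bsub>M\<^esub> x" using m by (auto simp: M0_def H_def)
   have "r \<odot>\<^bsub>T\<^esub> \<one>\<^bsub>T\<^esub> : carrier T"
    using r(1) by simp
   then show ?thesis
    using r assms(4,5) E.tens_scalar[of x r] by simp
  qed
  then show ?thesis
   unfolding lift(1)[OF that]
   by (intro scalar_ext_lin_zero[OF E0.scalar_ext_axioms E0.lift(1)[OF E.BC_module semi] E.BC_module _ that])
    (simp add: E0.lift_unit[OF E.BC_module semi])
 qed
 have ident: "base_map R T M M (%x. x) X = X" if "X : carrier E.BC" for X
 proof -
  note lift = base_map_lift[OF E.scalar_ext_axioms E.scalar_ext_axioms i(2)]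
  show ?thesis
   unfolding lift(1)[OF that]
   by (rule E.lin_maps_BC_eqI[OF E.lift(1)[OF E.BC_module lift(2)[OF that]] _ _ that, where g = "%x. x"])
    (auto intro!: lin_mapsI simp: E.lift_unit[OF E.BC_module lift(2)[OF that]])
 qed
 have "E0.tens \<zero>\<^bsub>M0\<^esub> \<one>\<^bsub>T\<^esub> : carrier E0.BC"
  using abelian_monoid.zero_closed[of M0] M0 E0.cring_S
  by (intro E0.tens_closed) (auto simp: module_def abelian_group_def cring_def ring.ring_simprules)
 then have "exact_at (base_change R T M0) (base_change R T M) (base_change R T M)
   (base_map R T M0 M (%x. x)) (base_map R T M M (%x. x))"
  unfolding exact_at_def by (auto simp: zero ident image_iff)
 then have "exact_at M0 M M (%x. x) (%x. x)"
  using assms(2)[unfolded faithfully_flat_def, rule_format, OF conjI[OF M0 conjI[OF assms(3) conjI[OF assms(3) conjI[OF i]]]]]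
  by simp
 then have "H = {\<zero>\<^bsub>M\<^esub>}"
  unfolding exact_at_def by (auto simp: M0_def)
 moreover have "x : H"
  using assms(4) by (auto simp: H_def intro!: image_eqI[of _ _ "\<one>\<^bsub>R\<^esub>"])
 ultimately show ?thesis by auto
qed

lemma flat_injective:
 fixes M :: "('r, 'm, 'x) module_scheme" and code :: "'m => (nat => 'r) set"
 assumes "algebra R T" "faithfully_flat R T" "module R M" "inj_on code (carrier M)" "x : carrier M"
  and "tensor R T M x \<one>\<^bsub>T\<^esub> = \<zero>\<^bsub>base_change R T M\<^esub>"
 shows "x = \<zero>\<^bsub>M\<^esub>"
proof -
 let ?M = "transport code M"
 note tr = transport[OF assms(3,4)]
 interpret M: module R M by fact
 interpret E: scalar_ext R T M by (rule scalar_ext.intro) fact+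
 interpret E': scalar_ext R T ?M by (rule scalar_ext.intro[OF assms(1) tr(1)])
 have X: "E.tens x \<one>\<^bsub>T\<^esub> : carrier E.BC"
  using assms(5) E.cring_S by (intro E.tens_closed) (auto simp: cring_def ring.ring_simprules)
 note semi = base_map_lift(2)[OF E.scalar_ext_axioms E'.scalar_ext_axioms tr(2) X]
 have "E'.tens (code x) \<one>\<^bsub>T\<^esub> = E.lift E'.BC (%m. E'.tens (code m) \<one>\<^bsub>T\<^esub>) (E.tens x \<one>\<^bsub>T\<^esub>)"
  using E.lift_unit[OF E'.BC_module semi assms(5)] by simp
 also have "\<dots> = \<zero>\<^bsub>E'.BC\<^esub>"
  unfolding assms(6) by (rule lin_maps_zero[OF E.BC_module E'.BC_module E.lift(1)[OF E'.BC_module semi]])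
 finally have "code x = \<zero>\<^bsub>?M\<^esub>"
  using flat_injective_aux[OF assms(1,2) tr(1), of "code x"] assms(5) by (simp add: tr(3))
 also have "\<dots> = code \<zero>\<^bsub>M\<^esub>"
  using lin_maps_zero[OF assms(3) tr(1,2)] by simp
 finally show ?thesis
  using assms(4,5) by (auto dest: inj_onD)
qed

definition quot :: "('r, 'm, 'x) module_scheme => 'm set => ('r, 'm set) module"
 where "quot M N = \<lparr>carrier = a_rcosets\<^bsub>M\<^esub> N, mult = (%x y. x), one = N, zero = N, add = set_add M,
   smult = (%s X. \<Union>f\<in>X. N +>\<^bsub>M\<^esub> (s \<odot>\<^bsub>M\<^esub> f))\<rparr>"

lemma quot: "module R M ==> submodule N R M ==> quotient_module R M N (quot M N)"
 by (rule quotient_module.intro) (simp_all add: quot_def)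

text \<open>Membership in a submodule descends, because it is vanishing in the quotient.\<close>

lemma flat_descent:
 fixes M :: "('r, 'm, 'x) module_scheme" and F :: "('r, nat => 'r) module"
 assumes "algebra R T" "faithfully_flat R T" "module R M" "module R F" "p : lin_maps R F M" "p ` carrier F = carrier M"
  and "submodule N R M" "x : carrier M"
  and span: "tensor R T M x \<one>\<^bsub>T\<^esub> : lin_span T (base_change R T M) ((%n. tensor R T M n \<one>\<^bsub>T\<^esub>) ` N)"
 shows "x : N"
proof -
 interpret M: module R M by fact
 interpret Q: quotient_module R M N "quot M N" by (rule quot) fact+
 interpret E: scalar_ext R T M by (rule scalar_ext.intro) fact+
 interpret E': scalar_ext R T "quot M N" by (rule scalar_ext.intro[OF assms(1) Q.Q_module])
 interpret BC': module T E'.BC by (rule E'.BC_module)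
 have one: "\<one>\<^bsub>T\<^esub> : carrier T" using E.cring_S by (auto simp: cring_def ring.ring_simprules)
 have X: "E.tens x \<one>\<^bsub>T\<^esub> : carrier E.BC"
  using assms(8) one by (intro E.tens_closed)
 note semi = base_map_lift(2)[OF E.scalar_ext_axioms E'.scalar_ext_axioms Q.cls_lin X]
 let ?L = "E.lift E'.BC (%m. E'.tens (Q.cls m) \<one>\<^bsub>T\<^esub>)"
 note L = E.lift(1)[OF E'.BC_module semi]
 have NM: "N \<subseteq> carrier M" using submodule_facts[OF assms(3,7)] by auto
 have z: "E'.tens \<zero>\<^bsub>quot M N\<^esub> \<one>\<^bsub>T\<^esub> = \<zero>\<^bsub>E'.BC\<^esub>"
 proof -
  have "(%m. E'.tens m \<one>\<^bsub>T\<^esub>) \<zero>\<^bsub>quot M N\<^esub> \<oplus>\<^bsub>E'.BC\<^esub> E'.tens \<zero>\<^bsub>quot M N\<^esub> \<one>\<^bsub>T\<^esub> = E'.tens \<zero>\<^bsub>quot M N\<^esub> \<one>\<^bsub>T\<^esub>"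
   using module.axioms(2)[OF Q.Q_module] E'.tens_add[of "\<zero>\<^bsub>quot M N\<^esub>" "\<zero>\<^bsub>quot M N\<^esub>"]
   by (simp add: abelian_group_def abelian_monoid.zero_closed abelian_monoid.l_zero)
  then show ?thesis
   using E'.tens_closed[OF _ one, of "\<zero>\<^bsub>quot M N\<^esub>"] module.axioms(2)[OF Q.Q_module]
   by (simp add: abelian_group_def abelian_monoid.zero_closed BC'.M.add.r_cancel_one)
 qed
 have "?L (E.tens x \<one>\<^bsub>T\<^esub>) = \<zero>\<^bsub>E'.BC\<^esub>"
 proof (rule lin_span_induct[OF span E.BC_module])
  show "(%n. E.tens n \<one>\<^bsub>T\<^esub>) ` N \<subseteq> carrier E.BC"
   using NM one by (auto intro!: E.tens_closed)
  fix y assume "y : (%n. E.tens n \<one>\<^bsub>T\<^esub>) ` N"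
  then obtain n where n: "n : N" "y = E.tens n \<one>\<^bsub>T\<^esub>" by auto
  then have "?L y = E'.tens (Q.cls n) \<one>\<^bsub>T\<^esub>"
   using E.lift_unit[OF E'.BC_module semi] NM by auto
  also have "Q.cls n = \<zero>\<^bsub>quot M N\<^esub>"
   using n NM Q.cls_zero by blast
  finally show "?L y = \<zero>\<^bsub>E'.BC\<^esub>" by (simp add: z)
 qed (simp_all add: lin_maps_zero[OF E.BC_module E'.BC_module L] lin_mapsD[OF L])
 then have t: "E'.tens (Q.cls x) \<one>\<^bsub>T\<^esub> = \<zero>\<^bsub>E'.BC\<^esub>"
  using E.lift_unit[OF E'.BC_module semi assms(8)] by simp
 \<comment> \<open>A coset is encoded by its preimage under the surjection p from the free module.
   The preimage has the type required by \<open>faithfully_flat\<close>, and surjectivity of p makes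
   the encoding injective.\<close>
 define code where "code X = {v : carrier F. p v : X}" for X
 have inj: "inj_on code (carrier (quot M N))"
 proof (rule inj_onI)
  fix X Y assume *: "X : carrier (quot M N)" "Y : carrier (quot M N)" "code X = code Y"
  have sub: "Z \<subseteq> carrier M" if "Z : carrier (quot M N)" for Z
   using that Q.mem_cls by (auto simp: Q.Q_carrier)
  have "a : X \<longleftrightarrow> a : Y" if "a : carrier M" for a
  proof -
   have "a : p ` carrier F" using that assms(6) by simp
   then obtain v where "v : carrier F" "a = p v" by auto
   then show ?thesis using *(3) by (auto simp: code_def set_eq_iff)
  qed
  then show "X = Y" using sub *(1,2) by blast
 qed
 have "Q.cls x = \<zero>\<^bsub>quot M N\<^esub>"
  by (rule flat_injective[OF assms(1,2) Q.Q_module inj _ t]) (use assms(8) in \<open>auto simp: Q.Q_carrier\<close>)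
 then show ?thesis
  using Q.cls_zero assms(8) by simp
qed

lemma flat_scalar_injective:
 assumes "algebra R T" "faithfully_flat R T" "r : carrier R" "r \<odot>\<^bsub>T\<^esub> \<one>\<^bsub>T\<^esub> = \<zero>\<^bsub>T\<^esub>"
 shows "r = \<zero>\<^bsub>R\<^esub>"
proof -
 interpret T: algebra R T by fact
 define M :: "('a, 'a) module" where "M = \<lparr>carrier = carrier R, mult = mult R, one = \<one>\<^bsub>R\<^esub>, zero = \<zero>\<^bsub>R\<^esub>, add = add R, smult = mult R\<rparr>"
 have M: "module R M"
 proof (rule moduleI[OF T.R_cring])
  show "abelian_group M"
  proof (rule abelian_groupI)
   fix x assume "x : carrier M"
   then show "\<exists>y\<in>carrier M. y \<oplus>\<^bsub>M\<^esub> x = \<zero>\<^bsub>M\<^esub>"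
    by (intro bexI[of _ "\<ominus>\<^bsub>R\<^esub> x"]) (auto simp: M_def T.R.l_neg)
  qed (auto simp: M_def T.R.add.m_ac)
 qed (auto simp: M_def T.R.l_distr T.R.r_distr T.R.m_assoc)
 interpret E: scalar_ext R T M by (rule scalar_ext.intro) fact+
 interpret BC: module T E.BC by (rule E.BC_module)
 have one: "\<one>\<^bsub>R\<^esub> : carrier M" "r : carrier M" using assms(3) by (auto simp: M_def)
 have "E.tens (r \<odot>\<^bsub>M\<^esub> \<one>\<^bsub>R\<^esub>) \<one>\<^bsub>T\<^esub> = \<zero>\<^bsub>E.BC\<^esub>"
  using E.tens_scalar[OF one(1) assms(3)] E.tens_closed[OF one(1)] E.cring_S
  by (simp add: assms(4) cring_def ring.ring_simprules)
 then have "E.tens r \<one>\<^bsub>T\<^esub> = \<zero>\<^bsub>E.BC\<^esub>"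
  using assms(3) by (simp add: M_def)
 \<comment> \<open>The ring as a module over itself is encoded by singletons of constant
   functions.\<close>
 from flat_injective[OF assms(1,2) M _ one(2) this, of "%r. {%_. r}"]
 show ?thesis by (simp add: M_def inj_on_def fun_eq_iff)
qed

section \<open>Brown algebras seen through a splitting\<close>

declare split_brown_simps [simp del]

context split_transfer
begin

lemma sb_hom:
 "brown_comp R x \<oplus>\<^bsub>split_brown R\<^esub> brown_comp R y = brown_comp R (x + y)"
 "brown_comp R x \<otimes>\<^bsub>split_brown R\<^esub> brown_comp R y = brown_comp R (bmul x y)"
 "ring_comp R r \<odot>\<^bsub>split_brown R\<^esub> brown_comp R y = brown_comp R (bscl r y)"
 "invol (split_brown R) (brown_comp R y) = brown_comp R (brown_invol y)"
 "\<one>\<^bsub>split_brown R\<^esub> = brown_comp R (1, 0, 0, 1)" "\<zero>\<^bsub>split_brown R\<^esub> = brown_comp R 0"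
 by (simp_all only: split_brown_simps(2,5,6,7) brown_hom brown_const_hom)

lemmas sb = sb_hom brown_minus_hom V_op_hom

lemma brown_comp_cong: "ring_comp R r = ring_comp R s ==> brown_comp R (bscl r x) = brown_comp R (bscl s x)"
 by (simp flip: sb_hom(3))

lemma skewb_scl: "skewb t = bscl t (skewb 1)"
 by (simp add: skewb_def scl_minus)

text \<open>The involution fixes the Albert entries and exchanges the diagonal ones. A skew element
  therefore has Albert entries equal to their own negatives, which vanish because 2 is
  invertible.\<close>

lemma split_skew:
 assumes "x : carrier (split_brown R)" "invol (split_brown R) x = \<ominus>\<^bsub>split_brown R\<^esub> x" "h : carrier R" "h \<oplus> h = \<one>"
 obtains t where "x = brown_comp R (skewb t)"
proof -
 interpret cring R by (rule cring)
 obtain x' where x': "x = brown_comp R x'" using brown_surj[OF assms(1)] .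
 obtain r a b s where x'': "x' = (r, a, b, s)" by (cases x')
 obtain h' where h': "h = ring_comp R h'" using comp_surj[OF cring assms(3)] .
 have *: "brown_comp R (s, a, b, r) = brown_comp R (- r, - a, - b, - s)"
  using assms(2) by (simp add: x' sb) (simp add: x'')
 have z: "albert_map (ring_comp R) c = albert_map (ring_comp R) 0" if "albert_map (ring_comp R) c = albert_map (ring_comp R) (- c)" for c
 proof -
  have "ring_comp R (h' + h') = ring_comp R 1"
   using assms(4) h' by (simp only: comp_ring_hom[OF cring])
  then have "albert_map (ring_comp R) (scl 1 c) = albert_map (ring_comp R) (scl (h' + h') c)"
   by (simp only: albert_hom(3)[symmetric])
  also have "scl (h' + h') c = scl h' (c + c)" by (simp only: scl_linear)
  also have "albert_map (ring_comp R) (scl h' (c + c)) = albert_smult R (ring_comp R h') (albert_add R (albert_map (ring_comp R) c) (albert_map (ring_comp R) c))"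
   by (simp only: albert_hom)
  also have "\<dots> = albert_smult R (ring_comp R h') (albert_add R (albert_map (ring_comp R) c) (albert_map (ring_comp R) (- c)))"
   using that by simp
  also have "\<dots> = albert_map (ring_comp R) (scl h' (c + - c))"
   by (simp only: albert_hom)
  finally show ?thesis by simp
 qed
 have "x = brown_comp R (skewb r)"
  using * z[of a] z[of b] by (simp add: x' x'' brown_map_def skewb_def)
 then show thesis ..
qed

lemma brown_comp_scalar_cancel:
 assumes "brown_comp R (bscl u (1, 0, 0, 1)) = brown_comp R (bscl v (1, 0, 0, 1))"
 shows "ring_comp R u = ring_comp R v"
 using assms by (simp add: brown_map_def)

lemma skewb_cancel: "brown_comp R (skewb u) = brown_comp R (skewb v) ==> ring_comp R u = ring_comp R v"
 by (simp add: brown_map_def skewb_def)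

end

lemma inv_base_change_simps:
 "carrier (inv_base_change R S B) = carrier (base_change R S B)"
 "mult (inv_base_change R S B) = mult (base_change R S B)"
 "one (inv_base_change R S B) = one (base_change R S B)"
 "zero (inv_base_change R S B) = zero (base_change R S B)"
 "add (inv_base_change R S B) = add (base_change R S B)"
 "smult (inv_base_change R S B) = smult (base_change R S B)"
 "invol (inv_base_change R S B) = base_map R S B B (invol B)"
 by (simp_all add: inv_base_change_def module.extend_def inv_algebra.fields_def)

lemma lin_maps_inv_base_change:
 "lin_maps S (inv_base_change R S B) P = lin_maps S (base_change R S B) P"
 "lin_maps S P (inv_base_change R S B) = lin_maps S P (base_change R S B)"
 by (simp_all add: lin_maps_def inv_base_change_simps)

lemma algebra_with_involutionD:
 assumes "algebra_with_involution R B"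
 shows "module R B" "bilinear_mult R B" "\<one>\<^bsub>B\<^esub> : carrier B"
  "x : carrier B ==> \<one>\<^bsub>B\<^esub> \<otimes>\<^bsub>B\<^esub> x = x" "x : carrier B ==> x \<otimes>\<^bsub>B\<^esub> \<one>\<^bsub>B\<^esub> = x"
  "invol B : lin_maps R B B" "x : carrier B ==> invol B (invol B x) = x"
  "x : carrier B ==> y : carrier B ==> invol B (x \<otimes>\<^bsub>B\<^esub> y) = invol B y \<otimes>\<^bsub>B\<^esub> invol B x"
 using assms by (auto simp: algebra_with_involution_def bilinear_mult_def)

lemma (in scalar_ext) BC_one: "\<one>\<^bsub>BC\<^esub> = tens \<one>\<^bsub>M\<^esub> \<one>\<^bsub>S\<^esub>"
 by (simp add: BC_simps tensor_def formal_combs_def)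

locale split_form =
 fixes R :: "('r, 'w) ring_scheme" and B :: "('r, 'b) inv_algebra" (structure) and T :: "('r, 't) module" and h0 :: "('b => 't) set => 't brown"
  and j :: 'b and \<mu> :: 'r
 assumes B: "algebra_with_involution R B" and proj: "fg_projective R B"
  and T: "algebra R T" and flat: "faithfully_flat R T"
  and h0: "h0 : lin_maps T (inv_base_change R T B) (split_brown T)"
   "bij_betw h0 (carrier (inv_base_change R T B)) (carrier (split_brown T))"
   "h0 \<one>\<^bsub>inv_base_change R T B\<^esub> = \<one>\<^bsub>split_brown T\<^esub>"
   "!!x y. x : carrier (inv_base_change R T B) ==> y : carrier (inv_base_change R T B) ==>
     h0 (x \<otimes>\<^bsub>inv_base_change R T B\<^esub> y) = h0 x \<otimes>\<^bsub>split_brown T\<^esub> h0 y"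
   "!!x. x : carrier (inv_base_change R T B) ==> h0 (invol (inv_base_change R T B) x) = invol (split_brown T) (h0 x)"
  and six: "[(6::nat)] \<cdot>\<^bsub>R\<^esub> \<one>\<^bsub>R\<^esub> : Units R"
  and j: "j : skew B" "\<mu> : Units R" "j \<otimes>\<^bsub>B\<^esub> j = \<mu> \<odot>\<^bsub>B\<^esub> \<one>\<^bsub>B\<^esub>"
begin

abbreviation (input) "CB \<equiv> carrier B"

sublocale E: scalar_ext R T B
 by (rule scalar_ext.intro[OF T algebra_with_involutionD(1)[OF B]])

sublocale split_transfer T
 by (rule split_transfer.intro[OF E.cring_S])

lemmas B_facts = algebra_with_involutionD[OF B]

sublocale B: module R B by (rule B_facts(1))

interpretation S: module T "split_brown T" by (rule split_brown_module)

text \<open>The map along which identities of \<open>B\<close> are reduced to the split algebra over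
  \<open>T\<close>: it respects all operations and is injective by flatness
  (\<open>H_inj\<close>).\<close>

definition H where "H x = h0 (E.tens x \<one>\<^bsub>T\<^esub>)"

lemma mult_closed [simp]: "x : CB ==> y : CB ==> x \<otimes> y : CB"
 using bilinear_multD(1)[OF B_facts(2)] .

lemma invol_closed [simp]: "x : CB ==> invol B x : CB"
 using lin_mapsD(1)[OF B_facts(6)] .

lemmas one_closed' [simp] = B_facts(3)

lemma V_closed [simp]:
 "x : CB ==> y : CB ==> z : CB ==> V_op B x y z : CB"
 by (simp add: V_op_def)

lemma j_closed [simp]: "j : CB" and j_invol: "invol B j = \<ominus> j"
 using j by (auto simp: skew_def)

lemma mu_closed [simp]: "\<mu> : carrier R" using j(2) by (rule B.R.Units_closed)

lemma h0_lin: "h0 : lin_maps T E.BC (split_brown T)"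
 using h0(1) by (simp add: lin_maps_inv_base_change)

lemma h0_inj: "x : carrier E.BC ==> y : carrier E.BC ==> h0 x = h0 y ==> x = y"
 using h0(2) by (auto simp: inv_base_change_simps bij_betw_def inj_on_def)

lemma H_closed [simp]: "x : CB ==> H x : carrier (split_brown T)"
 unfolding H_def by (intro lin_mapsD(1)[OF h0_lin] E.tens_closed) auto

lemma H_add: "x : CB ==> y : CB ==> H (x \<oplus> y) = H x \<oplus>\<^bsub>split_brown T\<^esub> H y"
 unfolding H_def by (simp add: E.tens_add lin_mapsD(2)[OF h0_lin] E.tens_closed)

lemma H_smult: "r : carrier R ==> x : CB ==> H (r \<odot> x) = (r \<odot>\<^bsub>T\<^esub> \<one>\<^bsub>T\<^esub>) \<odot>\<^bsub>split_brown T\<^esub> H x"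
 unfolding H_def by (simp add: E.tens_scalar lin_mapsD(3)[OF h0_lin] E.tens_closed)

lemma H_one: "H \<one> = \<one>\<^bsub>split_brown T\<^esub>"
 using h0(3) by (simp add: H_def inv_base_change_simps E.BC_one)

lemma H_mult: "x : CB ==> y : CB ==> H (x \<otimes> y) = H x \<otimes>\<^bsub>split_brown T\<^esub> H y"
 using h0(4)[of "E.tens x \<one>\<^bsub>T\<^esub>" "E.tens y \<one>\<^bsub>T\<^esub>"]
 by (simp add: H_def inv_base_change_simps E.tens_mult[OF B_facts(2)] E.tens_closed)

lemma H_invol: "x : CB ==> H (invol B x) = invol (split_brown T) (H x)"
proof -
 assume x: "x : CB"
 have c: "E.tens x \<one>\<^bsub>T\<^esub> : carrier E.BC" using x by (simp add: E.tens_closed)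
 note lift = base_map_lift[OF E.scalar_ext_axioms E.scalar_ext_axioms B_facts(6) c]
 show ?thesis
  using h0(5)[of "E.tens x \<one>\<^bsub>T\<^esub>"] c x
  by (simp add: H_def inv_base_change_simps lift(1) E.lift_unit[OF E.BC_module lift(2)])
qed

lemma H_minus: "x : CB ==> H (\<ominus> x) = \<ominus>\<^bsub>split_brown T\<^esub> H x"
proof -
 assume x: "x : CB"
 have "H (\<ominus> x) \<oplus>\<^bsub>split_brown T\<^esub> H x = H \<zero>"
  using x H_add[of "\<ominus> x" x] by (simp add: B.M.l_neg)
 moreover have "H \<zero> = \<zero>\<^bsub>split_brown T\<^esub>"
  using H_add[of "\<zero>" "\<zero>"] by simp
 ultimately show ?thesis
  using S.M.minus_equality[of "H (\<ominus> x)" "H x"] x by simp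
qed

lemma H_diff: "x : CB ==> y : CB ==> H (x \<ominus> y) = H x \<ominus>\<^bsub>split_brown T\<^esub> H y"
 by (simp add: a_minus_def H_add H_minus)

lemma H_V: "x : CB ==> y : CB ==> z : CB ==>
  H (V_op B x y z) = V_op (split_brown T) (H x) (H y) (H z)"
 unfolding V_op_def by (simp add: H_add H_diff H_mult H_invol)

lemmas H_rules = H_add H_mult H_invol H_minus H_diff H_V H_one

lemma H_comp:
 assumes "x : CB"
 obtains x' where "H x = brown_comp T x'"
 using brown_surj[OF H_closed[OF assms]] .

lemma scalar_comp:
 assumes "r : carrier R"
 obtains u where "r \<odot>\<^bsub>T\<^esub> \<one>\<^bsub>T\<^esub> = ring_comp T u"
 using comp_surj[OF E.cring_S E.scalar_closed[OF assms]] .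

lemma proj_cover:
 obtains F :: "('r, nat => 'r) module" and n i p where "module R F" "free_of_rank R F n"
  "i : lin_maps R B F" "p : lin_maps R F B" "!!x. x : CB ==> p (i x) = x"
 using proj unfolding fg_projective_def by auto

lemma flat_descent_B:
 assumes "submodule N R B" "x : CB"
  "E.tens x \<one>\<^bsub>T\<^esub> : lin_span T E.BC ((%n. E.tens n \<one>\<^bsub>T\<^esub>) ` N)"
 shows "x : N"
proof -
 obtain F :: "('r, nat => 'r) module" and n i p where F: "module R F" "free_of_rank R F n"
  "i : lin_maps R B F" "p : lin_maps R F B" "!!x. x : CB ==> p (i x) = x"
  by (rule proj_cover) (rule that; assumption)
 have "CB \<subseteq> p ` carrier F"
  using F(5) lin_mapsD(1)[OF F(3)] by (metis image_eqI subsetI)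
 then have "p ` carrier F = CB"
  using lin_mapsD(1)[OF F(4)] by auto
 then show ?thesis
  using flat_descent[OF T flat B_facts(1) F(1) F(4) _ assms] by blast
qed

text \<open>Flat descent of membership in the zero submodule, applied to the difference of the two
  elements.\<close>

lemma H_inj: "x : CB ==> y : CB ==> H x = H y ==> x = y"
proof -
 assume *: "x : CB" "y : CB" "H x = H y"
 have z: "submodule {\<zero>} R B"
  by (rule submoduleI'[OF B_facts(1)]) auto
 have "H (x \<ominus> y) = H \<zero>"
  using * H_diff[of x y] H_add[of "\<zero>" "\<zero>"] by (simp add: a_minus_def S.M.r_neg)
 then have "E.tens (x \<ominus> y) \<one>\<^bsub>T\<^esub> = E.tens \<zero> \<one>\<^bsub>T\<^esub>"
  using * unfolding H_def by (intro h0_inj E.tens_closed) auto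
 moreover have "E.tens \<zero> \<one>\<^bsub>T\<^esub> : lin_span T E.BC ((%n. E.tens n \<one>\<^bsub>T\<^esub>) ` {\<zero>})"
  using lin_span_submodule(2)[OF E.BC_module, of "(%n. E.tens n \<one>\<^bsub>T\<^esub>) ` {\<zero>}"] by (auto intro!: E.tens_closed)
 ultimately have "x \<ominus> y : {\<zero>}"
  using * by (intro flat_descent_B[OF z]) auto
 then show ?thesis
  using * B.M.eq_if_minus_zero by simp
qed

lemma half:
 obtains h where "h : carrier R" "h \<oplus>\<^bsub>R\<^esub> h = \<one>\<^bsub>R\<^esub>"
proof
 let ?i = "inv\<^bsub>R\<^esub> ([(6::nat)] \<cdot>\<^bsub>R\<^esub> \<one>\<^bsub>R\<^esub>)"
 have i: "?i : carrier R" "[(6::nat)] \<cdot>\<^bsub>R\<^esub> \<one>\<^bsub>R\<^esub> \<otimes>\<^bsub>R\<^esub> ?i = \<one>\<^bsub>R\<^esub>"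
  using six by auto
 have s: "[(3::nat)] \<cdot>\<^bsub>R\<^esub> \<one>\<^bsub>R\<^esub> \<oplus>\<^bsub>R\<^esub> [(3::nat)] \<cdot>\<^bsub>R\<^esub> \<one>\<^bsub>R\<^esub> = [(6::nat)] \<cdot>\<^bsub>R\<^esub> \<one>\<^bsub>R\<^esub>"
  using B.R.add.nat_pow_mult[of "\<one>\<^bsub>R\<^esub>" 3 3] by simp
 show "[(3::nat)] \<cdot>\<^bsub>R\<^esub> \<one>\<^bsub>R\<^esub> \<otimes>\<^bsub>R\<^esub> ?i : carrier R" using i by simp
 show "[(3::nat)] \<cdot>\<^bsub>R\<^esub> \<one>\<^bsub>R\<^esub> \<otimes>\<^bsub>R\<^esub> ?i \<oplus>\<^bsub>R\<^esub> [(3::nat)] \<cdot>\<^bsub>R\<^esub> \<one>\<^bsub>R\<^esub> \<otimes>\<^bsub>R\<^esub> ?i = \<one>\<^bsub>R\<^esub>"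
  using i s by (simp add: B.R.l_distr[symmetric])
qed

lemma skew_comp:
 assumes "s : skew B"
 obtains t where "H s = brown_comp T (skewb t)"
proof -
 obtain h where h: "h : carrier R" "h \<oplus>\<^bsub>R\<^esub> h = \<one>\<^bsub>R\<^esub>" by (rule half)
 interpret T: algebra R T by (rule T)
 have "h \<odot>\<^bsub>T\<^esub> \<one>\<^bsub>T\<^esub> \<oplus>\<^bsub>T\<^esub> h \<odot>\<^bsub>T\<^esub> \<one>\<^bsub>T\<^esub> = \<one>\<^bsub>T\<^esub>"
  using h T.smult_l_distr[of h h "\<one>\<^bsub>T\<^esub>"] by simp
 moreover have "invol (split_brown T) (H s) = \<ominus>\<^bsub>split_brown T\<^esub> H s"
  using assms H_invol[of s] H_minus[of s] by (simp add: skew_def)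
 ultimately show ?thesis
  using split_skew[of "H s" "h \<odot>\<^bsub>T\<^esub> \<one>\<^bsub>T\<^esub>"] that h(1) assms by (auto simp: skew_def)
qed

text \<open>Over \<open>T\<close> the given \<open>j\<close> is \<rho> times the standard skew
  element, and squaring gives \<rho>^2 = \<mu>. So \<rho> is invertible with inverse \<rho>
  \<mu>^-1, and every skew element can be compared with \<open>j\<close>.\<close>

lemma j_comp:
 obtains \<rho> where "H j = brown_comp T (skewb \<rho>)" "ring_comp T (\<rho> * \<rho>) = \<mu> \<odot>\<^bsub>T\<^esub> \<one>\<^bsub>T\<^esub>"
proof -
 obtain \<rho> where \<rho>: "H j = brown_comp T (skewb \<rho>)" using skew_comp[OF j(1)] .
 obtain m where m: "\<mu> \<odot>\<^bsub>T\<^esub> \<one>\<^bsub>T\<^esub> = ring_comp T m" using scalar_comp[OF mu_closed] .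
 have "brown_comp T (bmul (skewb \<rho>) (skewb \<rho>)) = brown_comp T (bscl m (1, 0, 0, 1))"
  using arg_cong[OF j(3), of H] by (simp only: H_rules H_smult j_closed mu_closed one_closed' \<rho> m sb)
 moreover have "bmul (skewb \<rho>) (skewb \<rho>) = bscl (\<rho> * \<rho>) (1, 0, 0, 1)"
  by (simp add: skewb_def)
 ultimately show thesis
  using that[OF \<rho>] brown_comp_scalar_cancel[of "\<rho> * \<rho>" m] m by simp
qed

lemma unit_faithful: "r : carrier R ==> r \<odot> \<one> = \<zero> ==> r = \<zero>\<^bsub>R\<^esub>"
proof -
 assume r: "r : carrier R" "r \<odot> \<one> = \<zero>"
 obtain u where u: "r \<odot>\<^bsub>T\<^esub> \<one>\<^bsub>T\<^esub> = ring_comp T u" using scalar_comp[OF r(1)] .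
 have "brown_comp T (bscl u (1, 0, 0, 1)) = brown_comp T 0"
  using arg_cong[OF r(2), of H] r(1) H_add[of "\<zero>" "\<zero>"] by (simp add: H_smult H_one u sb)
 then have "ring_comp T u = \<zero>\<^bsub>T\<^esub>"
  by (simp add: brown_map_def brown_zero comp_ring_hom[OF E.cring_S])
 then show ?thesis
  using flat_scalar_injective[OF T flat r(1)] u by simp
qed

text \<open>Over \<open>T\<close>, s and \<open>j\<close> are multiples t and \<rho> of the standard
  skew element, so s = (t \<rho> \<mu>^-1) \<open>j\<close> there. The coefficient is only known to
  lie in \<open>T\<close>, but membership of s in the submodule R \<open>j\<close> descends.\<close>

lemma skew_multiple:
 assumes "s : skew B"
 shows "\<exists>c\<in>carrier R. s = c \<odot> j"
proof -
 interpret T: algebra R T by (rule T)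
 have s: "s : CB" using assms by (simp add: skew_def)
 obtain \<rho> where \<rho>: "H j = brown_comp T (skewb \<rho>)" "ring_comp T (\<rho> * \<rho>) = \<mu> \<odot>\<^bsub>T\<^esub> \<one>\<^bsub>T\<^esub>" by (rule j_comp)
 obtain t where t: "H s = brown_comp T (skewb t)" using skew_comp[OF assms] .
 obtain n where n: "inv\<^bsub>R\<^esub> \<mu> \<odot>\<^bsub>T\<^esub> \<one>\<^bsub>T\<^esub> = ring_comp T n" using scalar_comp[of "inv\<^bsub>R\<^esub> \<mu>"] j(2) by auto
 have "(\<mu> \<odot>\<^bsub>T\<^esub> \<one>\<^bsub>T\<^esub>) \<otimes>\<^bsub>T\<^esub> (inv\<^bsub>R\<^esub> \<mu> \<odot>\<^bsub>T\<^esub> \<one>\<^bsub>T\<^esub>) = \<one>\<^bsub>T\<^esub>"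
  using j(2) by (simp add: T.smult_assoc2 T.smult_assoc1[symmetric])
 then have unit: "ring_comp T (\<rho> * \<rho> * n) = ring_comp T 1"
  by (simp only: comp_ring_hom(2,5)[OF E.cring_S] \<rho>(2)[unfolded comp_ring_hom(2)[OF E.cring_S]] n) (simp add: comp_ring_hom[OF E.cring_S])
 have "ring_comp T (t * (\<rho> * \<rho> * n)) = ring_comp T t"
  using unit by (simp add: comp_ring_hom[OF E.cring_S] comp_closed[OF E.cring_S])
 moreover have "t * \<rho> * n * \<rho> = t * (\<rho> * \<rho> * n)" by (simp add: mult_ac)
 ultimately have eq: "ring_comp T (t * \<rho> * n * \<rho>) = ring_comp T t" by (simp only:)
 define c where "c = ring_comp T (t * \<rho> * n)"
 have c: "c : carrier T" by (simp add: c_def comp_closed[OF E.cring_S])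
 have "h0 (c \<odot>\<^bsub>E.BC\<^esub> E.tens j \<one>\<^bsub>T\<^esub>) = c \<odot>\<^bsub>split_brown T\<^esub> H j"
  unfolding H_def by (intro lin_mapsD(3)[OF h0_lin] c E.tens_closed) auto
 also have "\<dots> = brown_comp T (bscl (t * \<rho> * n * \<rho>) (skewb 1))"
  by (simp only: c_def \<rho>(1) skewb_scl[of \<rho>] sb bscl_linear)
 also have "\<dots> = h0 (E.tens s \<one>\<^bsub>T\<^esub>)"
  using brown_comp_cong[OF eq, of "skewb 1"] t by (simp add: H_def skewb_scl[symmetric])
 finally have "E.tens s \<one>\<^bsub>T\<^esub> = c \<odot>\<^bsub>E.BC\<^esub> E.tens j \<one>\<^bsub>T\<^esub>"
  using s c module.smult_closed[OF E.BC_module c E.tens_closed[OF j_closed E.one_S]]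
  by (intro h0_inj[symmetric]) (auto intro!: E.tens_closed)
 moreover define N where "N = (%r. r \<odot> j) ` carrier R"
 have N: "submodule N R B"
 proof (rule submoduleI'[OF B_facts(1)])
  show "N \<subseteq> CB" "N \<noteq> {}" by (auto simp: N_def)
 qed (auto simp: N_def B.smult_l_distr[symmetric] B.smult_assoc1[symmetric])
 have jN: "j : N" unfolding N_def by (auto intro!: image_eqI[of _ _ "\<one>\<^bsub>R\<^esub>"])
 have sub: "(%n. E.tens n \<one>\<^bsub>T\<^esub>) ` N \<subseteq> carrier E.BC"
  using submodule_facts(1)[OF B_facts(1) N] by (auto intro!: E.tens_closed)
 note sp = lin_span_submodule[OF E.BC_module sub]
 ultimately have "E.tens s \<one>\<^bsub>T\<^esub> : lin_span T E.BC ((%n. E.tens n \<one>\<^bsub>T\<^esub>) ` N)"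
  using sp(2) jN c submodule_facts(5)[OF E.BC_module sp(1)] by auto
 then show ?thesis
  using flat_descent_B[OF N s] by (auto simp: N_def)
qed

lemma j_j: "x : CB ==> j \<otimes> (j \<otimes> x) = \<mu> \<odot> x"
proof (rule H_inj)
 assume x: "x : CB"
 obtain \<rho> where \<rho>: "H j = brown_comp T (skewb \<rho>)" "ring_comp T (\<rho> * \<rho>) = \<mu> \<odot>\<^bsub>T\<^esub> \<one>\<^bsub>T\<^esub>" by (rule j_comp)
 obtain x' where x': "H x = brown_comp T x'" using H_comp[OF x] .
 have "bmul (skewb \<rho>) (bmul (skewb \<rho>) x') = bscl (\<rho> * \<rho>) x'"
  by (cases x' rule: brown_cases) (simp add: skewb_bmul scl_minus scl_linear)
 then show "H (j \<otimes> (j \<otimes> x)) = H (\<mu> \<odot> x)"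
  using x by (simp only: H_rules H_smult mult_closed j_closed mu_closed \<rho>(1) \<rho>(2)[symmetric] x' sb)
qed (simp_all)

text \<open>The action of \<open>V_op B x y\<close> on \<open>j\<close> in degree two. By
  \<open>d_skew\<close> it is a multiple of \<open>j\<close>.\<close>

definition d where "d x y = (j \<otimes> y) \<otimes> invol B x \<oplus> x \<otimes> (invol B y \<otimes> j)"

lemma d_closed [simp]: "x : CB ==> y : CB ==> d x y : CB"
 by (simp add: d_def)

lemma d_facts:
 assumes x: "x : CB" and y: "y : CB"
 shows "d y x = d x y"
  "z : CB ==> V_op B y x (j \<otimes> z) \<oplus> j \<otimes> V_op B x y z = d x y \<otimes> z"
  "V_op B x y j \<ominus> invol B (V_op B x y j) \<oplus> j \<otimes> invol B (V_op B x y \<one>) \<oplus> V_op B x y \<one> \<otimes> j = d x y \<oplus> d x y"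
proof -
 obtain \<rho> where \<rho>: "H j = brown_comp T (skewb \<rho>)" by (rule j_comp)
 obtain x' where x': "H x = brown_comp T x'" using H_comp[OF x] .
 obtain y' where y': "H y = brown_comp T y'" using H_comp[OF y] .
 note rules = H_rules mult_closed invol_closed j_closed one_closed' V_closed d_closed B.M.a_closed B.M.minus_closed x y \<rho> x' y' sb
 have dH: "H (d u v) = brown_comp T (skewb (\<rho> * delta u' v'))" if "u : CB" "v : CB" "H u = brown_comp T u'" "H v = brown_comp T v'" for u v u' v'
  using that by (simp only: rules d_def delta_eq)
 show "d y x = d x y"
  using x y by (intro H_inj) (simp_all add: dH x' y' delta_commute)
 show "V_op B y x (j \<otimes> z) \<oplus> j \<otimes> V_op B x y z = d x y \<otimes> z" if z: "z : CB"
 proof (rule H_inj)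
  obtain z' where z': "H z = brown_comp T z'" using H_comp[OF z] .
  have "Vb y' x' (bmul (skewb \<rho>) z') + bmul (skewb \<rho>) (Vb x' y' z') = bmul (skewb (\<rho> * delta x' y')) z'"
   using arg_cong[OF Vb_flip[of y' x' z'], of "bscl \<rho>"] by (simp add: skewb_bmul Vb_linear bscl_linear)
  then show "H (V_op B y x (j \<otimes> z) \<oplus> j \<otimes> V_op B x y z) = H (d x y \<otimes> z)"
   using z z' by (simp only: rules dH)
 qed (use x y z in simp_all)
 show "V_op B x y j \<ominus> invol B (V_op B x y j) \<oplus> j \<otimes> invol B (V_op B x y \<one>) \<oplus> V_op B x y \<one> \<otimes> j = d x y \<oplus> d x y"
 proof (rule H_inj)
  have sk: "skewb (a + b) = skewb a + skewb b" for a b :: "('t, \<lparr>smult :: 'r => 't => 't\<rparr>) all_rings"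
   by (simp add: skewb_def)
  show "H (V_op B x y j \<ominus> invol B (V_op B x y j) \<oplus> j \<otimes> invol B (V_op B x y \<one>) \<oplus> V_op B x y \<one> \<otimes> j) = H (d x y \<oplus> d x y)"
   by (simp only: rules dH Vb_delta sk)
 qed (use x y in simp_all)
qed

lemma structurable:
 assumes "x : CB" "y : CB" "z : CB" "w : CB" "u : CB"
 shows "V_op B x y (V_op B z w u) = V_op B (V_op B x y z) w u \<ominus> V_op B z (V_op B y x w) u \<oplus> V_op B z w (V_op B x y u)"
proof (rule H_inj)
 obtain x' where x': "H x = brown_comp T x'" using H_comp[OF assms(1)] .
 obtain y' where y': "H y = brown_comp T y'" using H_comp[OF assms(2)] .
 obtain z' where z': "H z = brown_comp T z'" using H_comp[OF assms(3)] .
 obtain w' where w': "H w = brown_comp T w'" using H_comp[OF assms(4)] .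
 obtain u' where u': "H u = brown_comp T u'" using H_comp[OF assms(5)] .
 show "H (V_op B x y (V_op B z w u)) = H (V_op B (V_op B x y z) w u \<ominus> V_op B z (V_op B y x w) u \<oplus> V_op B z w (V_op B x y u))"
  using assms by (simp only: H_rules V_closed B.M.a_closed B.M.minus_closed sb x' y' z' w' u' Vb_structurable[of x' y'])
qed (use assms in simp_all)

end

section \<open>Representability of linear forms and the Casimir identity over
  \<open>R\<close>\<close>

text \<open>Used with P the graph of an additive map, to push the map inside the sum, or with P
  equality in one component of the product ring.\<close>

lemma basis_sum_rel:
 assumes P: "!!a b c d. P a b ==> P c d ==> P (a + c) (b + d)" "P 0 0"
  and "!!u w. P (F u w) (G u w)"
 shows "P (basis_sum F) (basis_sum G)"
proof -
 have "P (sum f A) (sum g A)" if "!!i. P (f i) (g i)" for f g and A :: "nat set"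
  using that by (induction A rule: infinite_finite_induct) (simp_all add: P)
 then show ?thesis
  unfolding basis_sum_def by (intro P(1)) (auto simp: assms(3))
qed

lemma sform_linear:
 "sform (x + x') y = sform x y + sform x' y" "sform y (x + x') = sform y x + sform y x'"
 "sform (bscl r x) y = r * sform x y" "sform y (bscl r x) = r * sform y x"
 by ((cases x rule: brown_cases, cases x' rule: brown_cases, cases y rule: brown_cases, simp add: albert_simps algebra_simps)[1])+

lemma sform_zero [simp]: "sform 0 y = 0" "sform y 0 = 0"
 using sform_linear(3)[of 0 0 y] sform_linear(4)[of y 0 0] by simp_all

lemma ea_sum:  "ea (sum f A) = (\<Sum>i\<in>A. ea (f i :: 'a::comm_ring_1 albert))" "eb (sum f A) = (\<Sum>i\<in>A. eb (f i))"
proof -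
 have *: "ea 0 = (0 :: 'a brown)" "eb 0 = (0 :: 'a brown)" "ea (x + y) = ea x + ea y" "eb (x + y) = eb x + eb y" for x y :: "'a albert"
  by (simp_all add: ea_def eb_def brown_zero)
 show "ea (sum f A) = (\<Sum>i\<in>A. ea (f i))" "eb (sum f A) = (\<Sum>i\<in>A. eb (f i))"
  by (induction A rule: infinite_finite_induct; simp add: *)+
qed

text \<open>This lemma and \<open>basis_expand\<close> are the completeness relations of the basis
  pairs. They contain \<open>flipb\<close> because the pairs are dual for \<open>delta\<close>,
  which is \<open>sform\<close> composed with \<open>flipb\<close>.\<close>

lemma basis_flip: "basis_sum (%u w. bscl (sform v u) w) = flipb v"
proof (cases v rule: brown_cases)
 case (1 r a b s)
 have sf: "sform v er = - s" "sform v es = r" "sform v (ea c) = - trace b c" "sform v (eb c) = trace a c" for c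
  by (simp_all add: 1 er_def es_def ea_def eb_def)
 have bs: "bscl t (ea c) = ea (scl t c)" "bscl t (eb c) = eb (scl t c)" for t c
  by (simp_all add: ea_def eb_def)
 show ?thesis
  unfolding basis_sum_def sf bs ea_sum[symmetric] scl_minus sum_negf alb_expand'
  by (simp add: 1 er_def es_def ea_def eb_def)
qed

lemma basis_expand: "basis_sum (%u v. bscl (sform (flipb v) x) u) = x"
proof (cases x rule: brown_cases)
 case (1 r a b s)
 have sf: "sform (flipb es) x = r" "sform (flipb er) x = s" "sform (flipb (ea c)) x = trace b c" "sform (flipb (eb c)) x = trace a c" for c
  by (simp_all add: 1 er_def es_def ea_def eb_def trace_minus trace_commute)
 have bs: "bscl t (ea c) = ea (scl t c)" "bscl t (eb c) = eb (scl t c)" for t c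
  by (simp_all add: ea_def eb_def)
 show ?thesis
  unfolding basis_sum_def sf bs ea_sum[symmetric] alb_expand
  by (simp add: 1 er_def es_def ea_def eb_def)
qed

text \<open>Compares an arbitrary finite family with the standard pairs: by
  \<open>basis_flip\<close> the vectors are expanded in the standard ones, and the sum over k
  collapses to an operator in the first argument, which is the identity when the families are dual
  to each other.\<close>

lemma basis_sum_family:
 fixes F :: "'a::comm_ring_1 brown => 'a brown => 'a brown" and n :: nat
 assumes F: "!!a a' b. F (a + a') b = F a b + F a' b" "!!a b b'. F a (b + b') = F a b + F a b'"
  "!!r a b. F (bscl r a) b = bscl r (F a b)" "!!r a b. F a (bscl r b) = bscl r (F a b)"
 shows "(\<Sum>k<n. F (e k) (flipb (v k))) = basis_sum (%u w. F (\<Sum>k<n. bscl (sform (v k) u) (e k)) w)"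
proof -
 have z: "F 0 b = 0" "F a 0 = 0" for a b
  using F(3)[of 0 0 b] F(4)[of a 0 0] by simp_all
 have 1: "F a (flipb (v k)) = basis_sum (%u w. bscl (sform (v k) u) (F a w))" for k a
 proof -
  have "(%x y. F a x = y) (basis_sum (%u w. bscl (sform (v k) u) w)) (basis_sum (%u w. bscl (sform (v k) u) (F a w)))"
   by (rule basis_sum_rel) (auto simp: F z)
  then show ?thesis by (simp add: basis_flip)
 qed
 have s: "F (\<Sum>k<n. bscl (sform (v k) u) (e k)) w = (\<Sum>k<n. bscl (sform (v k) u) (F (e k) w))" for u w
  by (induction n) (simp_all add: F z)
 show ?thesis
  unfolding 1 s
 proof (induction n)
  case 0
  have "basis_sum (%u w. 0 :: 'a brown) = 0" by (simp add: basis_sum_def)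
  then show ?case by simp
 next
  case (Suc n)
  then show ?case by (simp add: basis_sum_linear)
 qed
qed

definition self_module :: "('r, 'w) ring_scheme => ('r, 'r) module"
 where "self_module R = \<lparr>carrier = carrier R, mult = mult R, one = \<one>\<^bsub>R\<^esub>, zero = \<zero>\<^bsub>R\<^esub>, add = add R, smult = mult R\<rparr>"

lemma self_module_simps [simp]:
 "carrier (self_module R) = carrier R" "add (self_module R) = add R" "smult (self_module R) = mult R" "zero (self_module R) = \<zero>\<^bsub>R\<^esub>"
 by (simp_all add: self_module_def)

lemma self_module: "cring R ==> module R (self_module R)"
proof -
 assume "cring R"
 then interpret cring R .
 have "abelian_group (self_module R)"
 proof (rule abelian_groupI)
  fix x assume "x : carrier (self_module R)"
  then show "\<exists>y\<in>carrier (self_module R). y \<oplus>\<^bsub>self_module R\<^esub> x = \<zero>\<^bsub>self_module R\<^esub>"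
   by (intro bexI[of _ "\<ominus>\<^bsub>R\<^esub> x"]) (auto simp: l_neg)
 qed (auto simp: add.m_ac)
 then show ?thesis
  by (rule moduleI[OF is_cring]) (auto simp: l_distr r_distr m_assoc)
qed

lemma lin_forms_eq: "lin_forms R M = lin_maps R M (self_module R)"
 by (simp add: lin_forms_def lin_maps_def)

lemma free_coords:
 assumes "module R F" "free_of_rank R F n"
 obtains b c where "b : {..<n} \<rightarrow> carrier F" "!!k. k < n ==> c k : lin_forms R F"
  "!!v. v : carrier F ==> v = (\<Oplus>\<^bsub>F\<^esub>k\<in>{..<n}. c k v \<odot>\<^bsub>F\<^esub> b k)"
  "!!a k. a : {..<n} \<rightarrow> carrier R ==> k < n ==> c k (\<Oplus>\<^bsub>F\<^esub>k\<in>{..<n}. a k \<odot>\<^bsub>F\<^esub> b k) = a k"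
proof -
 interpret F: module R F by fact
 obtain b where b: "b : {..<n} \<rightarrow> carrier F"
  "!!x. x : carrier F ==> \<exists>!c. c : {..<n} \<rightarrow>\<^sub>E carrier R \<and> x = (\<Oplus>\<^bsub>F\<^esub>i\<in>{..<n}. c i \<odot>\<^bsub>F\<^esub> b i)"
  by (rule bexE[OF assms(2)[unfolded free_of_rank_def]]) (rule that, assumption, drule bspec, assumption)
 define S where "S a = (\<Oplus>\<^bsub>F\<^esub>i\<in>{..<n}. a i \<odot>\<^bsub>F\<^esub> b i)" for a
 define C where "C x = (THE c. c : {..<n} \<rightarrow>\<^sub>E carrier R \<and> x = S c)" for x
 have C: "C x : {..<n} \<rightarrow>\<^sub>E carrier R" "x = S (C x)" if "x : carrier F" for x
  using theI'[OF b(2)[OF that]] by (auto simp: C_def S_def)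
 have bc: "b i : carrier F" if "i < n" for i using b(1) that by auto
 have Sc: "S a : carrier F" if "a : {..<n} \<rightarrow> carrier R" for a
  unfolding S_def using that bc by (intro F.M.finsum_closed) (auto simp: Pi_iff)
 have CS: "C (S a) k = a k" if "a : {..<n} \<rightarrow> carrier R" "k < n" for a k
 proof -
  have e: "S (restrict a {..<n}) = S a"
   unfolding S_def using that bc by (intro F.M.finsum_cong') (auto simp: Pi_iff)
  have "restrict a {..<n} : {..<n} \<rightarrow>\<^sub>E carrier R" using that by auto
  then have "C (S a) = restrict a {..<n}"
   using b(2)[OF Sc[OF that(1)]] C[OF Sc[OF that(1)]] e unfolding S_def[symmetric] by metis
  then show ?thesis using that by simp
 qed
 have "(%x. C x k) : lin_forms R F" if k: "k < n" for k
  unfolding lin_forms_eq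
 proof (rule lin_mapsI; simp)
  fix x assume x: "x : carrier F"
  show "C x k : carrier R" using C(1)[OF x] k by auto
  show "C (r \<odot>\<^bsub>F\<^esub> x) k = r \<otimes>\<^bsub>R\<^esub> C x k" if r: "r : carrier R" for r
  proof -
   have cx: "C x i : carrier R" if "i < n" for i using C(1)[OF x] that by auto
   have "(%v. r \<odot>\<^bsub>F\<^esub> v) : lin_maps R F F"
    using r by (auto intro!: lin_mapsI simp: F.smult_r_distr F.smult_assoc1[symmetric] F.R.m_comm)
   then have "r \<odot>\<^bsub>F\<^esub> S (C x) = S (%i. r \<otimes>\<^bsub>R\<^esub> C x i)"
    unfolding S_def using r cx bc
    by (subst finsum_lin_maps[OF assms(1) assms(1)]) (auto intro!: F.M.finsum_cong' simp: F.smult_assoc1 Pi_iff)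
   then have "r \<odot>\<^bsub>F\<^esub> x = S (%i. r \<otimes>\<^bsub>R\<^esub> C x i)" using C(2)[OF x] by simp
   then show ?thesis using CS[of "%i. r \<otimes>\<^bsub>R\<^esub> C x i" k] k r cx by auto
  qed
  fix y assume y: "y : carrier F"
  show "C (x \<oplus>\<^bsub>F\<^esub> y) k = C x k \<oplus>\<^bsub>R\<^esub> C y k"
  proof -
   have cx: "C x i : carrier R" "C y i : carrier R" if "i < n" for i using C(1)[OF x] C(1)[OF y] that by auto
   have "S (%i. C x i \<oplus>\<^bsub>R\<^esub> C y i) = (\<Oplus>\<^bsub>F\<^esub>i\<in>{..<n}. C x i \<odot>\<^bsub>F\<^esub> b i \<oplus>\<^bsub>F\<^esub> C y i \<odot>\<^bsub>F\<^esub> b i)"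
    unfolding S_def using cx bc by (intro F.M.finsum_cong') (auto simp: F.smult_l_distr Pi_iff)
   then have "S (C x) \<oplus>\<^bsub>F\<^esub> S (C y) = S (%i. C x i \<oplus>\<^bsub>R\<^esub> C y i)"
    unfolding S_def using cx bc by (subst (asm) F.M.finsum_addf) (auto simp: Pi_iff)
   then have "x \<oplus>\<^bsub>F\<^esub> y = S (%i. C x i \<oplus>\<^bsub>R\<^esub> C y i)" using C(2)[OF x] C(2)[OF y] by simp
   then show ?thesis using CS[of "%i. C x i \<oplus>\<^bsub>R\<^esub> C y i" k] k cx by auto
  qed
 qed
 then show thesis
  using that[of b "%k x. C x k"] b(1) C(2) CS unfolding S_def by blast
qed

context split_transfer
begin

text \<open>The form \<open>sform\<close>, read off from record operations as the upper diagonal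
  entry of a skew element.\<close>

definition sf where "sf X Y = fst (X \<otimes>\<^bsub>split_brown R\<^esub> invol (split_brown R) Y \<ominus>\<^bsub>split_brown R\<^esub> Y \<otimes>\<^bsub>split_brown R\<^esub> invol (split_brown R) X)"

lemma sf_comp: "sf (brown_comp R x) (brown_comp R y) = ring_comp R (sform x y)"
 by (simp add: sf_def sb sform_eq) (simp add: brown_map_def skewb_def)

lemma sf_lin:
 assumes "Y : carrier (split_brown R)"
 shows "(%X. sf X Y) : lin_forms R (split_brown R)" "(%X. sf Y X) : lin_forms R (split_brown R)"
proof -
 obtain y where y: "Y = brown_comp R y" using brown_surj[OF assms] .
 show "(%X. sf X Y) : lin_forms R (split_brown R)" "(%X. sf Y X) : lin_forms R (split_brown R)"
  unfolding lin_forms_eq y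
  by (rule lin_mapsI; (elim brown_surj comp_surj[OF cring])?; (elim brown_surj comp_surj[OF cring])?;
   simp only: sb sf_comp sform_linear comp_ring_hom[OF cring] comp_closed[OF cring] self_module_simps)+
qed

lemma finsum_comp: "finite A ==> (\<Oplus>\<^bsub>split_brown R\<^esub>k\<in>A. brown_comp R (f k)) = brown_comp R (\<Sum>k\<in>A. f k)"
proof (induction A rule: finite_induct)
 interpret S: module R "split_brown R" by (rule split_brown_module)
 case empty
 then show ?case by (simp add: sb)
next
 interpret S: module R "split_brown R" by (rule split_brown_module)
 case (insert a A)
 then show ?case by (subst S.M.finsum_insert) (auto simp: brown_closed sb)
qed

text \<open>The representing vector is \<Sum> g(u) \<open>flipb v\<close> over the basis pairs (u,
  v), as \<open>basis_expand\<close> shows.\<close>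

lemma form_represented:
 assumes "g : lin_forms R (split_brown R)"
 obtains W where "W : carrier (split_brown R)" "!!X. X : carrier (split_brown R) ==> sf W X = g X"
proof -
 note g = lin_mapsD[OF assms[unfolded lin_forms_eq], simplified]
 have gz: "g (brown_comp R 0) = \<zero>"
  using lin_maps_zero[OF split_brown_module self_module[OF cring] assms[unfolded lin_forms_eq]] by (simp add: sb)
 have "\<exists>t. ring_comp R t = g (brown_comp R u)" for u
  using comp_surj[OF cring g(1)[OF brown_closed]] by metis
 then obtain \<gamma> where \<gamma>: "!!u. ring_comp R (\<gamma> u) = g (brown_comp R u)" by metis
 define w where "w = basis_sum (%u v. bscl (\<gamma> u) (flipb v))"
 have "sf (brown_comp R w) X = g X" if X: "X : carrier (split_brown R)" for X
 proof -
  obtain x where x: "X = brown_comp R x" using brown_surj[OF X] .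
  have "(%a b. sform a x = b) w (basis_sum (%u v. \<gamma> u * sform (flipb v) x))"
   unfolding w_def by (rule basis_sum_rel) (auto simp: sform_linear)
  moreover have "(%a y. ring_comp R a = g (brown_comp R y)) (basis_sum (%u v. \<gamma> u * sform (flipb v) x)) (basis_sum (%u v. bscl (sform (flipb v) x) u))"
  proof (rule basis_sum_rel)
   interpret cring R by (rule cring)
   fix u v
   show "ring_comp R (\<gamma> u * sform (flipb v) x) = g (brown_comp R (bscl (sform (flipb v) x) u))"
    by (simp add: sb(3)[symmetric] g brown_closed comp_closed[OF cring] comp_ring_hom[OF cring] \<gamma> m_comm)
  qed (auto simp: comp_ring_hom[OF cring] gz sb(1)[symmetric] g(2) brown_closed)
  ultimately show ?thesis
   by (simp add: x sf_comp basis_expand)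
 qed
 then show thesis using that[OF brown_closed] by blast
qed

end

lemma finsum_additive:
 assumes "abelian_group M" "abelian_group N" "g : A \<rightarrow> carrier M"
  and f: "!!x. x : carrier M ==> f x : carrier N" "!!x y. x : carrier M ==> y : carrier M ==> f (x \<oplus>\<^bsub>M\<^esub> y) = f x \<oplus>\<^bsub>N\<^esub> f y"
 shows "f (finsum M g A) = finsum N (%i. f (g i)) A"
proof -
 interpret M: abelian_group M by fact
 interpret N: abelian_group N by fact
 have z: "f \<zero>\<^bsub>M\<^esub> = \<zero>\<^bsub>N\<^esub>"
  using f(2)[of "\<zero>\<^bsub>M\<^esub>" "\<zero>\<^bsub>M\<^esub>"] f(1)[of "\<zero>\<^bsub>M\<^esub>"] N.add.r_cancel_one[of "f \<zero>\<^bsub>M\<^esub>" "f \<zero>\<^bsub>M\<^esub>"] by simp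
 show ?thesis
  using assms(3)
 proof (induction A rule: infinite_finite_induct)
  case (insert a A)
  then have "(%i. f (g i)) : A \<rightarrow> carrier N" "f (g a) : carrier N" "finsum M g A : carrier M"
   using f(1) by (auto simp: Pi_iff intro!: M.finsum_closed)
  with insert show ?case
   using f(2) by (simp add: Pi_iff)
 qed (simp_all add: z)
qed

lemma lin_comb_lin:
 assumes "module R M" "module R N" "!!k. k : A ==> f k : lin_forms R M" "!!k. k : A ==> v k : carrier N" "finite A"
 shows "(%x. \<Oplus>\<^bsub>N\<^esub>k\<in>A. f k x \<odot>\<^bsub>N\<^esub> v k) : lin_maps R M N"
proof (rule lin_mapsI)
 interpret N: module R N by fact
 note f = lin_mapsD[OF assms(3)[unfolded lin_forms_eq], simplified]
 fix x assume x: "x : carrier M"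
 show "(\<Oplus>\<^bsub>N\<^esub>k\<in>A. f k x \<odot>\<^bsub>N\<^esub> v k) : carrier N"
  using x f(1) assms(4) by (intro N.M.finsum_closed) auto
 show "(\<Oplus>\<^bsub>N\<^esub>k\<in>A. f k (r \<odot>\<^bsub>M\<^esub> x) \<odot>\<^bsub>N\<^esub> v k) = r \<odot>\<^bsub>N\<^esub> (\<Oplus>\<^bsub>N\<^esub>k\<in>A. f k x \<odot>\<^bsub>N\<^esub> v k)" if r: "r : carrier R" for r
 proof -
  have "r \<odot>\<^bsub>N\<^esub> (\<Oplus>\<^bsub>N\<^esub>k\<in>A. f k x \<odot>\<^bsub>N\<^esub> v k) = (\<Oplus>\<^bsub>N\<^esub>k\<in>A. r \<odot>\<^bsub>N\<^esub> (f k x \<odot>\<^bsub>N\<^esub> v k))"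
   using r x f(1) assms(4)
   by (intro finsum_additive[where f = "%x. r \<odot>\<^bsub>N\<^esub> x"] N.M.abelian_group_axioms) (auto simp: N.smult_r_distr)
  also have "\<dots> = (\<Oplus>\<^bsub>N\<^esub>k\<in>A. f k (r \<odot>\<^bsub>M\<^esub> x) \<odot>\<^bsub>N\<^esub> v k)"
   using r x f(1,3) assms(4) by (intro N.M.finsum_cong') (auto simp: N.smult_assoc1)
  finally show ?thesis ..
 qed
 fix y assume y: "y : carrier M"
 have "(\<Oplus>\<^bsub>N\<^esub>k\<in>A. f k (x \<oplus>\<^bsub>M\<^esub> y) \<odot>\<^bsub>N\<^esub> v k) = (\<Oplus>\<^bsub>N\<^esub>k\<in>A. f k x \<odot>\<^bsub>N\<^esub> v k \<oplus>\<^bsub>N\<^esub> f k y \<odot>\<^bsub>N\<^esub> v k)"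
  using x y f(1,2) assms(4) by (intro N.M.finsum_cong') (auto simp: N.smult_l_distr)
 also have "\<dots> = (\<Oplus>\<^bsub>N\<^esub>k\<in>A. f k x \<odot>\<^bsub>N\<^esub> v k) \<oplus>\<^bsub>N\<^esub> (\<Oplus>\<^bsub>N\<^esub>k\<in>A. f k y \<odot>\<^bsub>N\<^esub> v k)"
  using x y f(1) assms(4) by (intro N.M.finsum_addf) auto
 finally show "(\<Oplus>\<^bsub>N\<^esub>k\<in>A. f k (x \<oplus>\<^bsub>M\<^esub> y) \<odot>\<^bsub>N\<^esub> v k) = (\<Oplus>\<^bsub>N\<^esub>k\<in>A. f k x \<odot>\<^bsub>N\<^esub> v k) \<oplus>\<^bsub>N\<^esub> (\<Oplus>\<^bsub>N\<^esub>k\<in>A. f k y \<odot>\<^bsub>N\<^esub> v k)" .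
qed

context split_form
begin

interpretation S: module T "split_brown T" by (rule split_brown_module)

lemma bil: "x : CB ==> y : CB ==> z : CB ==> x \<otimes> (y \<oplus> z) = x \<otimes> y \<oplus> x \<otimes> z"
 "x : CB ==> y : CB ==> z : CB ==> (x \<oplus> y) \<otimes> z = x \<otimes> z \<oplus> y \<otimes> z"
 "r : carrier R ==> x : CB ==> y : CB ==> x \<otimes> (r \<odot> y) = r \<odot> (x \<otimes> y)"
 "r : carrier R ==> x : CB ==> y : CB ==> (r \<odot> x) \<otimes> y = r \<odot> (x \<otimes> y)"
 "x : CB ==> y : CB ==> invol B (x \<oplus> y) = invol B x \<oplus> invol B y"
 "r : carrier R ==> x : CB ==> invol B (r \<odot> x) = r \<odot> invol B x"
 using bilinear_multD[OF B_facts(2)] lin_mapsD[OF B_facts(6)] by auto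

lemma j_faithful: "r : carrier R ==> r \<odot> j = \<zero> ==> r = \<zero>\<^bsub>R\<^esub>"
proof -
 assume r: "r : carrier R" "r \<odot> j = \<zero>"
 have "(r \<otimes>\<^bsub>R\<^esub> \<mu>) \<odot> \<one> = (r \<odot> j) \<otimes> j"
  using r(1) by (simp add: bil B.smult_assoc1 j(3))
 also have "\<dots> = \<zero>\<^bsub>R\<^esub> \<odot> (\<zero> \<otimes> j)"
  unfolding r(2) using bil(4)[of "\<zero>\<^bsub>R\<^esub>" "\<zero>" j] by simp
 finally have "r \<otimes>\<^bsub>R\<^esub> \<mu> = \<zero>\<^bsub>R\<^esub>"
  using unit_faithful[of "r \<otimes>\<^bsub>R\<^esub> \<mu>"] r(1) by simp
 then have "r \<otimes>\<^bsub>R\<^esub> \<mu> \<otimes>\<^bsub>R\<^esub> inv\<^bsub>R\<^esub> \<mu> = \<zero>\<^bsub>R\<^esub>"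
  using j(2) by simp
 then show ?thesis
  using r(1) j(2) by (simp add: B.R.m_assoc)
qed

lemma j_cancel: "r : carrier R ==> s : carrier R ==> r \<odot> j = s \<odot> j ==> r = s"
proof -
 assume *: "r : carrier R" "s : carrier R" "r \<odot> j = s \<odot> j"
 then have "(r \<ominus>\<^bsub>R\<^esub> s) \<odot> j = \<zero>"
  by (simp add: a_minus_def B.smult_l_distr B.smult_l_minus B.M.r_neg)
 then show ?thesis
  using * j_faithful[of "r \<ominus>\<^bsub>R\<^esub> s"] B.R.eq_if_minus_zero by simp
qed

text \<open>The form b_j without its factor: as \<open>j\<close> squares to \<mu>, b_j is \<mu>
  times \<open>beta\<close>. The scalar exists because the difference is skew and skew elements are
  multiples of \<open>j\<close>.\<close>

definition beta where "beta x y = (THE c. c : carrier R \<and> x \<otimes> invol B y \<ominus> y \<otimes> invol B x = c \<odot> j)"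

lemma beta:
 assumes "x : CB" "y : CB"
 shows "beta x y : carrier R" "x \<otimes> invol B y \<ominus> y \<otimes> invol B x = beta x y \<odot> j"
proof -
 let ?s = "x \<otimes> invol B y \<ominus> y \<otimes> invol B x"
 have "invol B ?s = y \<otimes> invol B x \<ominus> x \<otimes> invol B y"
  using assms by (simp add: lin_maps_diff[OF B_facts(1) B_facts(1) B_facts(6)] B_facts(7,8))
 also have "\<dots> = \<ominus> ?s"
  using assms by (simp add: a_minus_def B.M.minus_add B.M.a_comm)
 finally have "?s : skew B" using assms by (simp add: skew_def)
 then obtain c where "c : carrier R" "?s = c \<odot> j" using skew_multiple by blast
 then have "\<exists>!c. c : carrier R \<and> ?s = c \<odot> j"
  by (intro ex1I[of _ c]) (auto intro: j_cancel)
 then show "beta x y : carrier R" "?s = beta x y \<odot> j"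
  using theI'[of "%c. c : carrier R \<and> ?s = c \<odot> j"] unfolding beta_def by auto
qed

lemma beta_lin:
 assumes x: "x : CB"
 shows "(%y. beta y x) : lin_forms R B" "beta x : lin_forms R B"
proof -
 have add: "a \<oplus> b \<ominus> (c \<oplus> e) = (a \<ominus> c) \<oplus> (b \<ominus> e)" if "a : CB" "b : CB" "c : CB" "e : CB" for a b c e
  using that by (simp add: a_minus_def B.M.minus_add B.M.add.m_ac)
 have sm: "r \<odot> a \<ominus> r \<odot> c = r \<odot> (a \<ominus> c)" if "a : CB" "c : CB" "r : carrier R" for a c r
  using that by (simp add: a_minus_def B.smult_r_distr B.smult_r_minus)
 show "(%y. beta y x) : lin_forms R B"
  unfolding lin_forms_eq
 proof (rule lin_mapsI; simp)
  fix y assume y: "y : CB"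
  show "beta y x : carrier R" using beta(1)[OF y x] .
  show "beta (r \<odot> y) x = r \<otimes>\<^bsub>R\<^esub> beta y x" if r: "r : carrier R" for r
   using x y r beta(1) beta(2)[of "r \<odot> y" x]
   by (intro j_cancel) (simp_all add: bil sm beta(2) B.smult_assoc1)
  fix z assume z: "z : CB"
  show "beta (y \<oplus> z) x = beta y x \<oplus>\<^bsub>R\<^esub> beta z x"
   using x y z beta(1) beta(2)[of "y \<oplus> z" x]
   by (intro j_cancel) (simp_all add: bil add beta(2) B.smult_l_distr)
 qed
 show "beta x : lin_forms R B"
  unfolding lin_forms_eq
 proof (rule lin_mapsI; simp)
  fix y assume y: "y : CB"
  show "beta x y : carrier R" using beta(1)[OF x y] .
  show "beta x (r \<odot> y) = r \<otimes>\<^bsub>R\<^esub> beta x y" if r: "r : carrier R" for r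
   using x y r beta(1) beta(2)[of x "r \<odot> y"]
   by (intro j_cancel) (simp_all add: bil sm beta(2) B.smult_assoc1)
  fix z assume z: "z : CB"
  show "beta x (y \<oplus> z) = beta x y \<oplus>\<^bsub>R\<^esub> beta x z"
   using x y z beta(1) beta(2)[of x "y \<oplus> z"]
   by (intro j_cancel) (simp_all add: bil add beta(2) B.smult_l_distr)
 qed
qed

text \<open>\<open>beta\<close> is measured against \<open>j\<close> and \<open>sf\<close> against
  the standard skew element; their ratio is \<rho>.\<close>

lemma sf_H:
 assumes \<rho>: "H j = brown_comp T (skewb \<rho>)" and xy: "x : CB" "y : CB"
 shows "sf (H x) (H y) = (beta x y \<odot>\<^bsub>T\<^esub> \<one>\<^bsub>T\<^esub>) \<otimes>\<^bsub>T\<^esub> ring_comp T \<rho>"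
proof -
 obtain u where u: "beta x y \<odot>\<^bsub>T\<^esub> \<one>\<^bsub>T\<^esub> = ring_comp T u" using scalar_comp[OF beta(1)[OF xy]] .
 have "sf (H x) (H y) = fst (H (x \<otimes> invol B y \<ominus> y \<otimes> invol B x))"
  unfolding sf_def using xy by (simp add: H_rules)
 also have "H (x \<otimes> invol B y \<ominus> y \<otimes> invol B x) = brown_comp T (bscl u (skewb \<rho>))"
  using xy by (simp only: beta H_smult j_closed \<rho> u sb)
 finally show ?thesis
  by (simp add: u brown_map_def skewb_def comp_ring_hom[OF E.cring_S])
qed

text \<open>The dual basis lemma for a direct summand of a free module. The number n is the rank of
  the free module, not of \<open>B\<close>, so the vectors \<open>p (b k)\<close> are generators but
  in general no basis.\<close>

lemma coordinates:
 obtains F :: "('r, nat => 'r) module" and n b c p f where "module R F" "p : lin_maps R F B"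
  "b : {..<n} \<rightarrow> carrier F" "!!k. k < n ==> c k : lin_forms R F" "!!k. k < n ==> f k : lin_forms R B"
  "!!a k. a : {..<n} \<rightarrow> carrier R ==> k < (n :: nat) ==> c k (\<Oplus>\<^bsub>F\<^esub>k\<in>{..<n}. a k \<odot>\<^bsub>F\<^esub> b k) = a k"
  "!!x. x : CB ==> x = (\<Oplus>k\<in>{..<n}. f k x \<odot> p (b k))"
proof -
 obtain F :: "('r, nat => 'r) module" and n i p where F: "module R F" "free_of_rank R F n"
  "i : lin_maps R B F" "p : lin_maps R F B" "!!x. x : CB ==> p (i x) = x"
  by (rule proj_cover) (rule that; assumption)
 obtain b c where bc: "b : {..<n} \<rightarrow> carrier F" "!!k. k < n ==> c k : lin_forms R F"
  "!!v. v : carrier F ==> v = (\<Oplus>\<^bsub>F\<^esub>k\<in>{..<n}. c k v \<odot>\<^bsub>F\<^esub> b k)"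
  "!!a k. a : {..<n} \<rightarrow> carrier R ==> k < n ==> c k (\<Oplus>\<^bsub>F\<^esub>k\<in>{..<n}. a k \<odot>\<^bsub>F\<^esub> b k) = a k"
  by (rule free_coords[OF F(1,2)]) (rule that; assumption)
 interpret F: module R F by (rule F(1))
 show thesis
 proof (rule that[OF F(1) F(4) bc(1,2) _ bc(4), of "%k x. c k (i x)"])
  show "(%x. c k (i x)) : lin_forms R B" if "k < n" for k
   using lin_maps_comp[OF F(3) bc(2)[OF that, unfolded lin_forms_eq]] by (simp add: lin_forms_eq)
  fix x assume x: "x : CB"
  note ck = lin_mapsD(1)[OF bc(2)[unfolded lin_forms_eq], simplified]
  have ix: "i x : carrier F" using lin_mapsD(1)[OF F(3) x] .
  have "x = p (\<Oplus>\<^bsub>F\<^esub>k\<in>{..<n}. c k (i x) \<odot>\<^bsub>F\<^esub> b k)"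
   using F(5)[OF x] bc(3)[OF ix] by simp
  also have "\<dots> = (\<Oplus>k\<in>{..<n}. p (c k (i x) \<odot>\<^bsub>F\<^esub> b k))"
   using ix bc(1) ck by (intro finsum_lin_maps[OF F(1) B_facts(1) F(4)]) (auto simp: Pi_iff)
  also have "\<dots> = (\<Oplus>k\<in>{..<n}. c k (i x) \<odot> p (b k))"
   using ix bc(1) ck lin_mapsD(1,3)[OF F(4)] by (intro B.M.finsum_cong') (auto simp: Pi_iff)
  finally show "x = (\<Oplus>k\<in>{..<n}. c k (i x) \<odot> p (b k))" .
 qed
qed

text \<open>The form \<open>beta\<close> is perfect. A representing vector cannot be descended
  directly, so representability is recast as membership of a vector v in the image of a linear map
  \<theta> into the free module; over \<open>T\<close> it holds by \<open>form_represented\<close>,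
  and membership descends.\<close>

lemma form_represented_B:
 assumes g: "g : lin_forms R B"
 shows "\<exists>u\<in>carrier B. \<forall>x\<in>carrier B. beta u x = g x"
proof (rule coordinates)
 fix F :: "('r, nat => 'r) module" and n :: nat and b c p f
 assume F: "module R F" "p : lin_maps R F B"
  "b : {..<n} \<rightarrow> carrier F" "!!k. k < n ==> c k : lin_forms R F" "!!k. k < n ==> f k : lin_forms R B"
  "!!a k. a : {..<n} \<rightarrow> carrier R ==> k < n ==> c k (\<Oplus>\<^bsub>F\<^esub>k\<in>{..<n}. a k \<odot>\<^bsub>F\<^esub> b k) = a k"
  "!!x. x : CB ==> x = (\<Oplus>k\<in>{..<n}. f k x \<odot> p (b k))"
 interpret T: algebra R T by (rule T)
 interpret F: module R F by (rule F(1))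
 interpret EF: scalar_ext R T F by (rule scalar_ext.intro[OF T F(1)])
 interpret BF: module T EF.BC by (rule EF.BC_module)
 interpret BC: module T E.BC by (rule E.BC_module)
 define e where "e k = p (b k)" for k
 have bk: "b k : carrier F" and ek: "e k : CB" if "k < n" for k
  using F(3) that lin_mapsD(1)[OF F(2)] by (auto simp: e_def)
 note gl = lin_mapsD[OF g[unfolded lin_forms_eq], simplified]
 \<comment> \<open>\<theta> y stores the values of \<open>beta y\<close> on the generators as
   coordinates in \<open>F\<close>, and v those of g. A form is determined by these values, so g is
   represented iff v lies in the image of \<theta>.\<close>
 define \<theta> where "\<theta> y = (\<Oplus>\<^bsub>F\<^esub>k\<in>{..<n}. beta y (e k) \<odot>\<^bsub>F\<^esub> b k)" for y
 have \<theta>: "\<theta> : lin_maps R B F"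
  unfolding \<theta>_def using bk ek by (intro lin_comb_lin B_facts(1) F(1) beta_lin(1)) auto
 define v where "v = (\<Oplus>\<^bsub>F\<^esub>k\<in>{..<n}. g (e k) \<odot>\<^bsub>F\<^esub> b k)"
 have vF: "v : carrier F" unfolding v_def using bk ek gl by (intro F.M.finsum_closed) auto
 define N where "N = \<theta> ` CB"
 have N: "submodule N R F"
 proof (rule submoduleI'[OF F(1)])
  show "N \<subseteq> carrier F" "N \<noteq> {}" using lin_mapsD(1)[OF \<theta>] by (auto simp: N_def)
 qed (auto simp: N_def lin_mapsD(2,3)[OF \<theta>, symmetric])
 let ?X = "(%m. EF.tens m \<one>\<^bsub>T\<^esub>) ` N"
 have X: "?X \<subseteq> carrier EF.BC" using submodule_facts(1)[OF F(1) N] by (auto intro!: EF.tens_closed)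
 note sp = lin_span_submodule[OF EF.BC_module X]
 note spf = submodule_facts[OF EF.BC_module sp(1)]
 obtain \<rho> where \<rho>: "H j = brown_comp T (skewb \<rho>)" by (rule j_comp)
 let ?\<rho> = "ring_comp T \<rho>"
 have rc: "?\<rho> : carrier T" by (simp add: comp_closed[OF E.cring_S])
 have tsum: "EF.tens (\<Oplus>\<^bsub>F\<^esub>k\<in>{..<n}. a k \<odot>\<^bsub>F\<^esub> b k) \<one>\<^bsub>T\<^esub> = (\<Oplus>\<^bsub>EF.BC\<^esub>k\<in>{..<n}. (a k \<odot>\<^bsub>T\<^esub> \<one>\<^bsub>T\<^esub>) \<odot>\<^bsub>EF.BC\<^esub> EF.tens (b k) \<one>\<^bsub>T\<^esub>)"
  if "!!k. k < n ==> a k : carrier R" for a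
 proof -
  have "EF.tens (\<Oplus>\<^bsub>F\<^esub>k\<in>{..<n}. a k \<odot>\<^bsub>F\<^esub> b k) \<one>\<^bsub>T\<^esub> = (\<Oplus>\<^bsub>EF.BC\<^esub>k\<in>{..<n}. EF.tens (a k \<odot>\<^bsub>F\<^esub> b k) \<one>\<^bsub>T\<^esub>)"
   using that bk by (intro finsum_additive[where f = "%x. EF.tens x \<one>\<^bsub>T\<^esub>"] F.M.abelian_group_axioms BF.M.abelian_group_axioms) (auto simp: EF.tens_closed EF.tens_add)
  also have "\<dots> = (\<Oplus>\<^bsub>EF.BC\<^esub>k\<in>{..<n}. (a k \<odot>\<^bsub>T\<^esub> \<one>\<^bsub>T\<^esub>) \<odot>\<^bsub>EF.BC\<^esub> EF.tens (b k) \<one>\<^bsub>T\<^esub>)"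
   using that bk by (intro BF.M.finsum_cong') (auto simp: EF.tens_scalar EF.tens_closed)
  finally show ?thesis .
 qed
 \<comment> \<open>On y \<otimes> 1 this is \<rho> times \<theta> y \<otimes> 1, hence all its
   values lie in the span of the extended image of \<theta>.\<close>
 define \<Psi> where "\<Psi> \<omega> = (\<Oplus>\<^bsub>EF.BC\<^esub>k\<in>{..<n}. sf (h0 \<omega>) (H (e k)) \<odot>\<^bsub>EF.BC\<^esub> EF.tens (b k) \<one>\<^bsub>T\<^esub>)" for \<omega>
 have \<Psi>: "\<Psi> : lin_maps T E.BC EF.BC"
  unfolding \<Psi>_def
 proof (rule lin_comb_lin[OF E.BC_module EF.BC_module])
  fix k assume "k : {..<n}"
  then have "H (e k) : carrier (split_brown T)" "b k : carrier F" using ek bk by auto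
  then show "(\<lambda>\<omega>. sf (h0 \<omega>) (H (e k))) : lin_forms T E.BC" "EF.tens (b k) \<one>\<^bsub>T\<^esub> : carrier EF.BC"
   using lin_maps_comp[OF h0_lin sf_lin(1)[unfolded lin_forms_eq]] by (auto simp: lin_forms_eq EF.tens_closed)
 qed simp
 have span: "\<Psi> \<omega> : lin_span T EF.BC ?X" if "\<omega> : carrier E.BC" for \<omega>
  using that
 proof (induction rule: E.BC_induct)
  case (tens y)
  have "\<Psi> (E.tens y \<one>\<^bsub>T\<^esub>) = (\<Oplus>\<^bsub>EF.BC\<^esub>k\<in>{..<n}. ?\<rho> \<odot>\<^bsub>EF.BC\<^esub> ((beta y (e k) \<odot>\<^bsub>T\<^esub> \<one>\<^bsub>T\<^esub>) \<odot>\<^bsub>EF.BC\<^esub> EF.tens (b k) \<one>\<^bsub>T\<^esub>))"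
   unfolding \<Psi>_def H_def[symmetric] using tens ek bk rc beta(1)
   by (intro BF.M.finsum_cong') (auto simp: sf_H[OF \<rho>] BF.smult_assoc1[symmetric] EF.tens_closed S.R.m_comm)
  also have "\<dots> = ?\<rho> \<odot>\<^bsub>EF.BC\<^esub> (\<Oplus>\<^bsub>EF.BC\<^esub>k\<in>{..<n}. (beta y (e k) \<odot>\<^bsub>T\<^esub> \<one>\<^bsub>T\<^esub>) \<odot>\<^bsub>EF.BC\<^esub> EF.tens (b k) \<one>\<^bsub>T\<^esub>)"
   using tens ek bk rc beta(1)
   by (intro finsum_additive[where f = "%x. ?\<rho> \<odot>\<^bsub>EF.BC\<^esub> x", symmetric] BF.M.abelian_group_axioms) (auto simp: BF.smult_r_distr EF.tens_closed)
  also have "\<dots> = ?\<rho> \<odot>\<^bsub>EF.BC\<^esub> EF.tens (\<theta> y) \<one>\<^bsub>T\<^esub>"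
   unfolding \<theta>_def using tens ek beta(1) by (subst tsum) auto
  finally show ?case
   using sp(2) tens rc spf(5) by (auto simp: N_def)
 qed (auto simp: lin_mapsD(2,3)[OF \<Psi>] spf(3,5))
 let ?G = "E.lift (self_module T) (%x. g x \<odot>\<^bsub>T\<^esub> \<one>\<^bsub>T\<^esub>)"
 have semi: "E.semilinear (self_module T) (%x. g x \<odot>\<^bsub>T\<^esub> \<one>\<^bsub>T\<^esub>)"
  unfolding E.semilinear_def using gl by (auto simp: T.smult_l_distr T.smult_assoc1 T.smult_assoc2)
 note G = E.lift(1)[OF self_module[OF E.cring_S] semi] E.lift_unit[OF self_module[OF E.cring_S] semi]
 define k0 where "k0 X = inv_into (carrier E.BC) h0 X" for X
 have bij: "bij_betw h0 (carrier E.BC) (carrier (split_brown T))" using h0(2) by (simp add: inv_base_change_simps)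
 have k0: "k0 (h0 \<omega>) = \<omega>" if "\<omega> : carrier E.BC" for \<omega>
  using bij that by (simp add: k0_def bij_betw_inv_into_left)
 have surj: "\<exists>\<omega>\<in>carrier E.BC. X = h0 \<omega>" if "X : carrier (split_brown T)" for X
  using bij that by (auto simp: bij_betw_def)
 have "(%X. ?G (k0 X)) : lin_forms T (split_brown T)"
  unfolding lin_forms_eq
 proof (rule lin_mapsI)
  fix X assume "X : carrier (split_brown T)"
  then obtain \<omega> where \<omega>: "\<omega> : carrier E.BC" "X = h0 \<omega>" using surj by blast
  then show "?G (k0 X) : carrier (self_module T)" using lin_mapsD(1)[OF G(1)] by (simp add: k0)
  show "?G (k0 (r \<odot>\<^bsub>split_brown T\<^esub> X)) = r \<odot>\<^bsub>self_module T\<^esub> ?G (k0 X)" if "r : carrier T" for r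
   using that \<omega> lin_mapsD(3)[OF h0_lin that \<omega>(1), symmetric] lin_mapsD(3)[OF G(1)] by (simp add: k0)
  fix Y assume "Y : carrier (split_brown T)"
  then obtain \<omega>' where \<omega>': "\<omega>' : carrier E.BC" "Y = h0 \<omega>'" using surj by blast
  show "?G (k0 (X \<oplus>\<^bsub>split_brown T\<^esub> Y)) = ?G (k0 X) \<oplus>\<^bsub>self_module T\<^esub> ?G (k0 Y)"
   using \<omega> \<omega>' lin_mapsD(2)[OF h0_lin \<omega>(1) \<omega>'(1), symmetric] lin_mapsD(2)[OF G(1)] by (simp add: k0)
 qed
 \<comment> \<open>W represents, on the split algebra, the \<open>T\<close>-linear extension of g;
   its preimage \<omega> under the splitting is sent by \<Psi> to v \<otimes> 1.\<close>
 then obtain W where W: "W : carrier (split_brown T)" "!!X. X : carrier (split_brown T) ==> sf W X = ?G (k0 X)"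
  using form_represented by blast
 obtain \<omega> where \<omega>: "\<omega> : carrier E.BC" "W = h0 \<omega>" using surj[OF W(1)] by blast
 have "sf (h0 \<omega>) (H (e k)) = g (e k) \<odot>\<^bsub>T\<^esub> \<one>\<^bsub>T\<^esub>" if "k < n" for k
  using W(2)[OF H_closed[OF ek[OF that]]] \<omega>(2) ek[OF that] G(2)[OF ek[OF that]] by (simp add: H_def k0 E.tens_closed)
 then have "\<Psi> \<omega> = (\<Oplus>\<^bsub>EF.BC\<^esub>k\<in>{..<n}. (g (e k) \<odot>\<^bsub>T\<^esub> \<one>\<^bsub>T\<^esub>) \<odot>\<^bsub>EF.BC\<^esub> EF.tens (b k) \<one>\<^bsub>T\<^esub>)"
  unfolding \<Psi>_def using ek bk gl(1) by (intro BF.M.finsum_cong') (auto simp: EF.tens_closed)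
 also have "\<dots> = EF.tens v \<one>\<^bsub>T\<^esub>"
  unfolding v_def using ek gl(1) by (subst tsum) auto
 finally have "EF.tens v \<one>\<^bsub>T\<^esub> : lin_span T EF.BC ?X" using span[OF \<omega>(1)] by simp
 moreover have id: "(%x. x) : lin_maps R F F" "(%x. x) ` carrier F = carrier F" by (auto intro!: lin_mapsI)
 ultimately have "v : N"
  using flat_descent[OF T flat F(1) F(1) id N vF] by blast
 then obtain u where u: "u : CB" "v = \<theta> u" by (auto simp: N_def)
 have eq: "beta u (e k) = g (e k)" if k: "k < n" for k
 proof -
  have "c k v = g (e k)" unfolding v_def by (rule F(6)) (use k gl(1) ek in auto)
  moreover have "c k v = beta u (e k)" unfolding u(2) \<theta>_def by (rule F(6)) (use k beta(1) u(1) ek in auto)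
  ultimately show ?thesis by simp
 qed
 have "beta u x = g x" if x: "x : CB" for x
 proof -
  note fk = lin_mapsD(1)[OF F(5)[unfolded lin_forms_eq], simplified]
  have ev: "h x = (\<Oplus>\<^bsub>self_module R\<^esub>k\<in>{..<n}. f k x \<otimes>\<^bsub>R\<^esub> h (e k))" if h: "h : lin_forms R B" for h
  proof -
   interpret SR: module R "self_module R" by (rule self_module[OF B.R.is_cring])
   note hl = lin_mapsD[OF h[unfolded lin_forms_eq], simplified]
   have "h x = h (\<Oplus>k\<in>{..<n}. f k x \<odot> e k)" using F(7)[OF x] by (simp add: e_def)
   also have "\<dots> = (\<Oplus>\<^bsub>self_module R\<^esub>k\<in>{..<n}. h (f k x \<odot> e k))"
    using x fk ek by (intro finsum_lin_maps[OF B_facts(1) self_module[OF B.R.is_cring] h[unfolded lin_forms_eq]]) auto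
   also have "\<dots> = (\<Oplus>\<^bsub>self_module R\<^esub>k\<in>{..<n}. f k x \<otimes>\<^bsub>R\<^esub> h (e k))"
    using x fk ek hl by (intro SR.M.finsum_cong') auto
   finally show ?thesis .
  qed
  interpret SR: module R "self_module R" by (rule self_module[OF B.R.is_cring])
  show ?thesis
   unfolding ev[OF beta_lin(2)[OF u(1)]] ev[OF g] using eq x fk ek gl(1) by (intro SR.M.finsum_cong') auto
 qed
 then show ?thesis using u(1) by blast
qed

lemma ring_comp_nat: "ring_comp T (of_nat m) = ([m] \<cdot>\<^bsub>R\<^esub> \<one>\<^bsub>R\<^esub>) \<odot>\<^bsub>T\<^esub> \<one>\<^bsub>T\<^esub>"
proof (induction m)
 interpret T: algebra R T by (rule T)
 case 0
 then show ?case by (simp add: comp_ring_hom[OF E.cring_S])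
next
 interpret T: algebra R T by (rule T)
 case (Suc m)
 then show ?case by (simp add: comp_ring_hom[OF E.cring_S] T.smult_l_distr S.R.a_comm)
qed

text \<open>The dual families are built from the dual basis lemma: the e_k generate
  \<open>B\<close>, the forms \<open>f k\<close> are represented by vectors u_k, and e'_k is u_k
  divided by \<open>j\<close>. The hypothesis on \<delta> names the degree-two action without
  defining it for all operators.\<close>

theorem casimir_B:
 "\<exists>(n :: nat) e e'. e : {..<n} \<rightarrow> CB \<and> e' : {..<n} \<rightarrow> CB \<and>
  (\<forall>x\<in>carrier B. \<forall>y\<in>carrier B. \<forall>z\<in>carrier B. \<forall>\<delta>\<in>carrier R. d x y = \<delta> \<odot> j \<longrightarrow>
   (\<Oplus>k\<in>{..<n}. V_op B (V_op B x y (e k)) (e' k) z) =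
   ([(12::nat)] \<cdot>\<^bsub>R\<^esub> \<one>\<^bsub>R\<^esub>) \<odot> V_op B x y z \<oplus> ([(8::nat)] \<cdot>\<^bsub>R\<^esub> \<one>\<^bsub>R\<^esub> \<otimes>\<^bsub>R\<^esub> \<delta>) \<odot> z)"
proof (rule coordinates)
 fix F :: "('r, nat => 'r) module" and n :: nat and b c p f
 assume F: "module R F" "p : lin_maps R F B"
  "b : {..<n} \<rightarrow> carrier F" "!!k. k < n ==> c k : lin_forms R F" "!!k. k < n ==> f k : lin_forms R B"
  "!!a k. a : {..<n} \<rightarrow> carrier R ==> k < n ==> c k (\<Oplus>\<^bsub>F\<^esub>k\<in>{..<n}. a k \<odot>\<^bsub>F\<^esub> b k) = a k"
  "!!x. x : CB ==> x = (\<Oplus>k\<in>{..<n}. f k x \<odot> p (b k))"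
 interpret T: algebra R T by (rule T)
 note hom = comp_ring_hom[OF E.cring_S] and closed = comp_closed[OF E.cring_S]
 define e where "e k = p (b k)" for k
 have ek: "e k : CB" if "k < n" for k
  using F(3) that lin_mapsD(1)[OF F(2)] by (auto simp: e_def)
 note fk = lin_mapsD(1)[OF F(5)[unfolded lin_forms_eq], simplified]
 have "\<exists>u. \<forall>k<n. u k : CB \<and> (\<forall>x\<in>carrier B. beta (u k) x = f k x)"
  using form_represented_B[OF F(5)] by (intro choice) metis
 then obtain u where u: "!!k. k < n ==> u k : CB" "!!k x. k < n ==> x : CB ==> beta (u k) x = f k x"
  by auto
 define \<nu> where "\<nu> = inv\<^bsub>R\<^esub> \<mu>"
 have \<nu>: "\<nu> : carrier R" "\<mu> \<otimes>\<^bsub>R\<^esub> \<nu> = \<one>\<^bsub>R\<^esub>" using j(2) by (auto simp: \<nu>_def)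
 \<comment> \<open>Since j e'_k = u_k, duality for \<open>beta\<close> becomes duality for the form
   (x, y) \<mapsto> \<open>beta (j \<otimes> y) x\<close>, the counterpart of
   \<open>delta\<close>.\<close>
 define e' where "e' k = \<nu> \<odot> (j \<otimes> u k)" for k
 have e'k: "e' k : CB" if "k < n" for k using u(1)[OF that] \<nu> by (simp add: e'_def)
 obtain \<rho> where \<rho>: "H j = brown_comp T (skewb \<rho>)" "ring_comp T (\<rho> * \<rho>) = \<mu> \<odot>\<^bsub>T\<^esub> \<one>\<^bsub>T\<^esub>" by (rule j_comp)
 obtain \<eta> where \<eta>: "\<nu> \<odot>\<^bsub>T\<^esub> \<one>\<^bsub>T\<^esub> = ring_comp T \<eta>" using scalar_comp[OF \<nu>(1)] .
 have unit: "ring_comp T (\<rho> * \<rho> * \<eta>) = \<one>\<^bsub>T\<^esub>"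
  unfolding hom(2)[of "\<rho> * \<rho>"] \<rho>(2) \<eta>[symmetric] using \<nu> by (simp add: T.smult_assoc2 T.smult_assoc1[symmetric])
 have "\<exists>v. H (e k) = brown_comp T v" "\<exists>v. H (u k) = brown_comp T v" if "k < n" for k
  using H_comp ek[OF that] u(1)[OF that] by metis+
 then have "\<exists>a. \<forall>k<n. H (e k) = brown_comp T (a k)" "\<exists>a. \<forall>k<n. H (u k) = brown_comp T (a k)"
  by (intro choice; metis)+
 then obtain a w where a: "!!k. k < n ==> H (e k) = brown_comp T (a k)" and w: "!!k. k < n ==> H (u k) = brown_comp T (w k)"
  by auto
 define v where "v k = bscl (\<eta> * \<rho>) (w k)" for k
 have v: "H (e' k) = brown_comp T (flipb (v k))" if "k < n" for k
  using that u(1)[OF that] \<nu>(1)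
  by (simp only: e'_def H_smult mult_closed j_closed H_mult \<eta> \<rho> w sb v_def skewb_bmul flipb_linear bscl_linear)
 \<comment> \<open>The vectors a_k and v_k were lifted from \<open>T\<close>, so L is the identity
   only after projection to the component \<open>T\<close>. That is checked on the elements H x,
   which generate the split algebra over \<open>T\<close>.\<close>
 define L where "L y = (\<Sum>k<n. bscl (sform (v k) y) (a k))" for y
 have L: "brown_comp T (L y) = brown_comp T y" for y
 proof -
  define \<L> where "\<L> X = (\<Oplus>\<^bsub>split_brown T\<^esub>k\<in>{..<n}. sf (brown_comp T (v k)) X \<odot>\<^bsub>split_brown T\<^esub> brown_comp T (a k))" for X
  have lin: "\<L> : lin_maps T (split_brown T) (split_brown T)"
   unfolding \<L>_def by (intro lin_comb_lin split_brown_module sf_lin brown_closed) auto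
  have LL: "\<L> (brown_comp T y) = brown_comp T (L y)" for y
   by (simp add: \<L>_def sf_comp sb finsum_comp L_def)
  have base: "\<L> (H x) = H x" if x: "x : CB" for x
  proof -
   obtain x' where x': "H x = brown_comp T x'" using H_comp[OF x] .
   have s: "ring_comp T (sform (v k) x') = f k x \<odot>\<^bsub>T\<^esub> \<one>\<^bsub>T\<^esub>" if k: "k < n" for k
   proof -
    have "ring_comp T (sform (w k) x') = (f k x \<odot>\<^bsub>T\<^esub> \<one>\<^bsub>T\<^esub>) \<otimes>\<^bsub>T\<^esub> ring_comp T \<rho>"
     using sf_H[OF \<rho>(1) u(1)[OF k] x] u(2)[OF k x] w[OF k] x' by (simp add: sf_comp)
    moreover have "f k x \<odot>\<^bsub>T\<^esub> \<one>\<^bsub>T\<^esub> : carrier T" using fk[OF k x] by simp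
    ultimately have "ring_comp T (sform (v k) x') = (f k x \<odot>\<^bsub>T\<^esub> \<one>\<^bsub>T\<^esub>) \<otimes>\<^bsub>T\<^esub> ring_comp T (\<rho> * \<rho> * \<eta>)"
     by (simp add: v_def sform_linear hom closed S.R.m_ac)
    then show ?thesis using unit fk[OF k x] by simp
   qed
   have "\<L> (H x) = (\<Oplus>\<^bsub>split_brown T\<^esub>k\<in>{..<n}. (f k x \<odot>\<^bsub>T\<^esub> \<one>\<^bsub>T\<^esub>) \<odot>\<^bsub>split_brown T\<^esub> H (e k))"
    unfolding \<L>_def x' sf_comp using s a fk[OF _ x] ek by (intro S.M.finsum_cong') (auto simp: brown_closed)
   also have "\<dots> = (\<Oplus>\<^bsub>split_brown T\<^esub>k\<in>{..<n}. H (f k x \<odot> e k))"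
    using fk[OF _ x] ek by (intro S.M.finsum_cong') (auto simp: H_smult)
   also have "\<dots> = H (\<Oplus>k\<in>{..<n}. f k x \<odot> e k)"
    using fk[OF _ x] ek by (intro finsum_additive[symmetric] B.M.abelian_group_axioms S.M.abelian_group_axioms) (auto simp: H_add)
   finally show ?thesis using F(7)[OF x] by (simp add: e_def)
  qed
  obtain \<omega> where \<omega>: "\<omega> : carrier E.BC" "brown_comp T y = h0 \<omega>"
   using h0(2) brown_closed[of y] by (auto simp: bij_betw_def inv_base_change_simps)
  have "(\<lambda>\<omega>. \<L> (h0 \<omega>)) \<omega> = h0 \<omega>"
   by (rule E.lin_maps_BC_eqI[OF lin_maps_comp[OF h0_lin lin] h0_lin _ \<omega>(1)]) (use base in \<open>simp add: H_def\<close>)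
  then show ?thesis using LL[of y] \<omega>(2) by simp
 qed
 show ?thesis
 proof (intro exI conjI ballI impI)
  show "e : {..<n} \<rightarrow> CB" "e' : {..<n} \<rightarrow> CB" using ek e'k by auto
  fix x y z \<delta>
  assume x: "x : CB" and y: "y : CB" and z: "z : CB" and \<delta>: "\<delta> : carrier R" "d x y = \<delta> \<odot> j"
  obtain x' where x': "H x = brown_comp T x'" using H_comp[OF x] .
  obtain y' where y': "H y = brown_comp T y'" using H_comp[OF y] .
  obtain z' where z': "H z = brown_comp T z'" using H_comp[OF z] .
  obtain \<epsilon> where \<epsilon>: "\<delta> \<odot>\<^bsub>T\<^esub> \<one>\<^bsub>T\<^esub> = ring_comp T \<epsilon>" using scalar_comp[OF \<delta>(1)] .
  have "brown_comp T (skewb (\<rho> * delta x' y')) = H (d x y)"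
   using x y by (simp only: d_def H_rules mult_closed invol_closed j_closed \<rho> x' y' sb delta_eq)
  also have "\<dots> = brown_comp T (skewb (\<epsilon> * \<rho>))"
   using \<delta> by (simp only: H_smult j_closed \<epsilon> \<rho> sb) (simp add: skewb_def scl_minus)
  finally have "ring_comp T (\<rho> * delta x' y') = ring_comp T (\<epsilon> * \<rho>)" by (rule skewb_cancel)
  then have "ring_comp T (\<rho> * \<eta> * (\<rho> * delta x' y')) = ring_comp T (\<rho> * \<eta> * (\<epsilon> * \<rho>))" by (simp only: hom(2))
  moreover have "\<rho> * \<eta> * (\<rho> * delta x' y') = (\<rho> * \<rho> * \<eta>) * delta x' y'" "\<rho> * \<eta> * (\<epsilon> * \<rho>) = (\<rho> * \<rho> * \<eta>) * \<epsilon>"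
   by (simp_all add: mult_ac)
  ultimately have del: "ring_comp T (delta x' y') = ring_comp T \<epsilon>"
   by (simp only: hom(2)[of "\<rho> * \<rho> * \<eta>"] unit) (simp add: closed)
  define K where "K u w = Vb (Vb x' y' u) w z'" for u w
  \<comment> \<open>Replacing L u by u is legitimate only in the component \<open>T\<close>, so the
    relation passed to \<open>basis_sum_rel\<close> is equality of projections.\<close>
  have "(%p q. brown_comp T p = brown_comp T q) (basis_sum (%u w. K (L u) w)) (basis_sum K)"
   by (rule basis_sum_rel) (auto simp: K_def L simp flip: sb(1) V_op_hom)
  then have cas: "brown_comp T (\<Sum>k<n. K (a k) (flipb (v k))) = brown_comp T (bscl 12 (Vb x' y' z') + bscl (8 * delta x' y') z')"
   using casimir[of x' y' z'] basis_sum_family[of K a v n] unfolding L_def K_def by (simp add: Vb_linear)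
  have Vc: "V_op B (V_op B x y (e k)) (e' k) z : CB" if "k < n" for k
   using x y z ek e'k that by simp
  show "(\<Oplus>k\<in>{..<n}. V_op B (V_op B x y (e k)) (e' k) z) =
   ([(12::nat)] \<cdot>\<^bsub>R\<^esub> \<one>\<^bsub>R\<^esub>) \<odot> V_op B x y z \<oplus> ([(8::nat)] \<cdot>\<^bsub>R\<^esub> \<one>\<^bsub>R\<^esub> \<otimes>\<^bsub>R\<^esub> \<delta>) \<odot> z"
  proof (rule H_inj)
   have "H (\<Oplus>k\<in>{..<n}. V_op B (V_op B x y (e k)) (e' k) z) = (\<Oplus>\<^bsub>split_brown T\<^esub>k\<in>{..<n}. H (V_op B (V_op B x y (e k)) (e' k) z))"
    using Vc by (intro finsum_additive B.M.abelian_group_axioms S.M.abelian_group_axioms) (auto simp: H_add)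
   also have "\<dots> = (\<Oplus>\<^bsub>split_brown T\<^esub>k\<in>{..<n}. brown_comp T (K (a k) (flipb (v k))))"
    using x y z ek e'k by (intro S.M.finsum_cong') (auto simp: H_V x' y' z' a v sb K_def brown_closed)
   also have "\<dots> = brown_comp T (bscl 12 (Vb x' y' z') + bscl (8 * delta x' y') z')"
    by (simp add: finsum_comp cas)
   also have "\<dots> = brown_comp T (bscl (of_nat 12) (Vb x' y' z') + bscl (of_nat 8 * \<epsilon>) z')"
    using brown_comp_cong[of "8 * delta x' y'" "8 * \<epsilon>" z'] del by (simp add: hom flip: sb(1))
   also have "\<dots> = H (([(12::nat)] \<cdot>\<^bsub>R\<^esub> \<one>\<^bsub>R\<^esub>) \<odot> V_op B x y z \<oplus> ([(8::nat)] \<cdot>\<^bsub>R\<^esub> \<one>\<^bsub>R\<^esub> \<otimes>\<^bsub>R\<^esub> \<delta>) \<odot> z)"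
   proof -
    have n: "[(m::nat)] \<cdot>\<^bsub>R\<^esub> \<one>\<^bsub>R\<^esub> : carrier R" for m by simp
    have "([(8::nat)] \<cdot>\<^bsub>R\<^esub> \<one>\<^bsub>R\<^esub> \<otimes>\<^bsub>R\<^esub> \<delta>) \<odot>\<^bsub>T\<^esub> \<one>\<^bsub>T\<^esub> = ring_comp T (of_nat 8 * \<epsilon>)"
     using \<delta>(1) by (simp only: hom(2) ring_comp_nat \<epsilon>[symmetric]) (simp add: T.smult_assoc1 T.smult_assoc2)
    then show ?thesis
     using x y z \<delta>(1)
     by (simp only: H_add H_smult H_V V_closed B.smult_closed B.R.m_closed n x' y' z' sb ring_comp_nat[symmetric])
   qed
   finally show "H (\<Oplus>k\<in>{..<n}. V_op B (V_op B x y (e k)) (e' k) z) =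
    H (([(12::nat)] \<cdot>\<^bsub>R\<^esub> \<one>\<^bsub>R\<^esub>) \<odot> V_op B x y z \<oplus> ([(8::nat)] \<cdot>\<^bsub>R\<^esub> \<one>\<^bsub>R\<^esub> \<otimes>\<^bsub>R\<^esub> \<delta>) \<odot> z)" .
   show "(\<Oplus>k\<in>{..<n}. V_op B (V_op B x y (e k)) (e' k) z) : CB"
    using Vc by (intro B.M.finsum_closed) auto
  qed (use x y z \<delta> in simp)
 qed
qed

end

section \<open>The commutator algebra of endomorphisms\<close>

lemma end_lie_carrierI:
 assumes "module R M" "f : lin_maps R M M"
 shows "(\<lambda>z\<in>carrier M. f z) : carrier (end_lie R M)"
 using lin_maps_cong[OF assms(2,1), of "\<lambda>z\<in>carrier M. f z"] by (simp add: end_lie_def)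

lemma end_lie_eqI:
 assumes "D : carrier (end_lie R M)" "E : carrier (end_lie R M)" "!!z. z : carrier M ==> D z = E z"
 shows "D = E"
 using assms by (auto simp: end_lie_def intro: extensionalityI)

lemma end_lie_lin: "D : carrier (end_lie R M) ==> D : lin_maps R M M"
 by (simp add: end_lie_def)

lemma end_lie_apply:
 assumes "z : carrier M"
 shows "(D \<oplus>\<^bsub>end_lie R M\<^esub> E) z = D z \<oplus>\<^bsub>M\<^esub> E z" "(r \<odot>\<^bsub>end_lie R M\<^esub> D) z = r \<odot>\<^bsub>M\<^esub> D z"
  "\<zero>\<^bsub>end_lie R M\<^esub> z = \<zero>\<^bsub>M\<^esub>" "(D \<otimes>\<^bsub>end_lie R M\<^esub> E) z = D (E z) \<ominus>\<^bsub>M\<^esub> E (D z)"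
 using assms by (simp_all add: end_lie_def)

context
 fixes R :: "('r, 'w) ring_scheme" and M :: "('r, 'm, 'x) module_scheme"
 assumes M: "module R M"
begin

interpretation M: module R M by (rule M)

lemma end_lie_closed:
 assumes D: "D : carrier (end_lie R M)" and E: "E : carrier (end_lie R M)"
 shows "D \<oplus>\<^bsub>end_lie R M\<^esub> E : carrier (end_lie R M)" "r : carrier R ==> r \<odot>\<^bsub>end_lie R M\<^esub> D : carrier (end_lie R M)"
  "\<zero>\<^bsub>end_lie R M\<^esub> : carrier (end_lie R M)" "D \<otimes>\<^bsub>end_lie R M\<^esub> E : carrier (end_lie R M)"
proof -
 note d = lin_mapsD[OF end_lie_lin[OF D]] lin_mapsD[OF end_lie_lin[OF E]]
 have eqs: "D \<oplus>\<^bsub>end_lie R M\<^esub> E = (\<lambda>z\<in>carrier M. D z \<oplus>\<^bsub>M\<^esub> E z)" "r \<odot>\<^bsub>end_lie R M\<^esub> D = (\<lambda>z\<in>carrier M. r \<odot>\<^bsub>M\<^esub> D z)"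
  "\<zero>\<^bsub>end_lie R M\<^esub> = (\<lambda>z\<in>carrier M. \<zero>\<^bsub>M\<^esub>)" "D \<otimes>\<^bsub>end_lie R M\<^esub> E = (\<lambda>z\<in>carrier M. D (E z) \<ominus>\<^bsub>M\<^esub> E (D z))"
  for r by (simp_all add: end_lie_def)
 show "D \<oplus>\<^bsub>end_lie R M\<^esub> E : carrier (end_lie R M)"
  unfolding eqs by (intro end_lie_carrierI M lin_mapsI) (simp_all add: d M.M.a_ac M.smult_r_distr)
 show "r \<odot>\<^bsub>end_lie R M\<^esub> D : carrier (end_lie R M)" if r: "r : carrier R"
  unfolding eqs by (intro end_lie_carrierI M lin_mapsI)
   (simp_all add: r d M.smult_r_distr M.smult_assoc1[symmetric] M.R.m_comm)
 show "\<zero>\<^bsub>end_lie R M\<^esub> : carrier (end_lie R M)"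
  unfolding eqs by (intro end_lie_carrierI M lin_mapsI) simp_all
 show "D \<otimes>\<^bsub>end_lie R M\<^esub> E : carrier (end_lie R M)"
  unfolding eqs by (intro end_lie_carrierI M lin_mapsI)
   (simp_all add: d a_minus_def M.M.minus_add M.M.a_ac M.smult_r_distr M.smult_r_minus)
qed

lemma end_lie_module: "module R (end_lie R M)"
proof -
 note eqI = end_lie_eqI[of _ R M]
 note d = lin_mapsD[OF end_lie_lin[of _ R M]]
 show ?thesis
 proof (rule moduleI[OF M.R.is_cring])
  show "abelian_group (end_lie R M)"
  proof (rule abelian_groupI)
   fix D assume D: "D : carrier (end_lie R M)"
   note m = end_lie_closed(2)[OF D D, of "\<ominus>\<^bsub>R\<^esub> \<one>\<^bsub>R\<^esub>"]
   show "\<exists>E\<in>carrier (end_lie R M). E \<oplus>\<^bsub>end_lie R M\<^esub> D = \<zero>\<^bsub>end_lie R M\<^esub>"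
    using D m end_lie_closed[OF D D]
    by (intro bexI[OF _ m] eqI) (simp_all add: end_lie_closed end_lie_apply d M.smult_l_minus M.M.l_neg)
   show "\<zero>\<^bsub>end_lie R M\<^esub> \<oplus>\<^bsub>end_lie R M\<^esub> D = D"
    using D end_lie_closed[OF D D] by (intro eqI) (simp_all add: end_lie_closed end_lie_apply d)
   fix E assume E: "E : carrier (end_lie R M)"
   show "D \<oplus>\<^bsub>end_lie R M\<^esub> E : carrier (end_lie R M)" using D E by (simp add: end_lie_closed)
   show "D \<oplus>\<^bsub>end_lie R M\<^esub> E = E \<oplus>\<^bsub>end_lie R M\<^esub> D"
    using D E by (intro eqI) (simp_all add: end_lie_closed end_lie_apply d M.M.a_ac)
   fix F assume F: "F : carrier (end_lie R M)"
   show "(D \<oplus>\<^bsub>end_lie R M\<^esub> E) \<oplus>\<^bsub>end_lie R M\<^esub> F = D \<oplus>\<^bsub>end_lie R M\<^esub> (E \<oplus>\<^bsub>end_lie R M\<^esub> F)"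
    using D E F by (intro eqI) (simp_all add: end_lie_closed end_lie_apply d M.M.a_ac)
  next
   have "(\<lambda>z\<in>carrier M. z) : carrier (end_lie R M)"
    by (intro end_lie_carrierI M lin_mapsI) simp_all
   then show "\<zero>\<^bsub>end_lie R M\<^esub> : carrier (end_lie R M)" using end_lie_closed(3) by blast
  qed
 next
  fix D assume D: "D : carrier (end_lie R M)"
  show "\<one>\<^bsub>R\<^esub> \<odot>\<^bsub>end_lie R M\<^esub> D = D"
   using D by (intro eqI) (simp_all add: end_lie_closed end_lie_apply d)
 next
  fix r D assume r: "r : carrier R" and D: "D : carrier (end_lie R M)"
  show "r \<odot>\<^bsub>end_lie R M\<^esub> D : carrier (end_lie R M)" using r D by (simp add: end_lie_closed)
  fix s assume s: "s : carrier R"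
  show "(r \<oplus>\<^bsub>R\<^esub> s) \<odot>\<^bsub>end_lie R M\<^esub> D = r \<odot>\<^bsub>end_lie R M\<^esub> D \<oplus>\<^bsub>end_lie R M\<^esub> s \<odot>\<^bsub>end_lie R M\<^esub> D"
   using r s D by (intro eqI) (simp_all add: end_lie_closed end_lie_apply d M.smult_l_distr)
  show "(r \<otimes>\<^bsub>R\<^esub> s) \<odot>\<^bsub>end_lie R M\<^esub> D = r \<odot>\<^bsub>end_lie R M\<^esub> (s \<odot>\<^bsub>end_lie R M\<^esub> D)"
   using r s D by (intro eqI) (simp_all add: end_lie_closed end_lie_apply d M.smult_assoc1)
 next
  fix r D E assume r: "r : carrier R" and D: "D : carrier (end_lie R M)" and E: "E : carrier (end_lie R M)"
  show "r \<odot>\<^bsub>end_lie R M\<^esub> (D \<oplus>\<^bsub>end_lie R M\<^esub> E) = r \<odot>\<^bsub>end_lie R M\<^esub> D \<oplus>\<^bsub>end_lie R M\<^esub> r \<odot>\<^bsub>end_lie R M\<^esub> E"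
   using r D E by (intro eqI) (simp_all add: end_lie_closed end_lie_apply d M.smult_r_distr)
 qed
qed

interpretation End: module R "end_lie R M" by (rule end_lie_module)

lemma end_lie_apply_minus:
 assumes "D : carrier (end_lie R M)" "z : carrier M"
 shows "(\<ominus>\<^bsub>end_lie R M\<^esub> D) z = \<ominus>\<^bsub>M\<^esub> D z"
 using assms by (simp add: module_neg_smult[OF end_lie_module] module_neg_smult[OF M] end_lie_apply lin_mapsD(1)[OF end_lie_lin[of _ R M]])

lemma end_lie_mult_bilinear: "bilinear_mult R (end_lie R M)"
 unfolding bilinear_mult_def
proof (intro ballI conjI lin_mapsI)
 note eqI = end_lie_eqI[of _ R M]
 note d = lin_mapsD[OF end_lie_lin[of _ R M]]
 fix D E assume D: "D : carrier (end_lie R M)" and E: "E : carrier (end_lie R M)"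
 show "D \<otimes>\<^bsub>end_lie R M\<^esub> E : carrier (end_lie R M)" "E \<otimes>\<^bsub>end_lie R M\<^esub> D : carrier (end_lie R M)"
  using D E by (simp_all add: end_lie_closed)
 fix r assume r: "r : carrier R"
 show "D \<otimes>\<^bsub>end_lie R M\<^esub> (r \<odot>\<^bsub>end_lie R M\<^esub> E) = r \<odot>\<^bsub>end_lie R M\<^esub> (D \<otimes>\<^bsub>end_lie R M\<^esub> E)"
  "(r \<odot>\<^bsub>end_lie R M\<^esub> E) \<otimes>\<^bsub>end_lie R M\<^esub> D = r \<odot>\<^bsub>end_lie R M\<^esub> (E \<otimes>\<^bsub>end_lie R M\<^esub> D)"
  using r D E by (auto intro!: eqI simp: end_lie_closed end_lie_apply d a_minus_def M.smult_r_distr M.smult_r_minus)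
next
 note eqI = end_lie_eqI[of _ R M]
 note d = lin_mapsD[OF end_lie_lin[of _ R M]]
 fix D E F assume D: "D : carrier (end_lie R M)" and E: "E : carrier (end_lie R M)" and F: "F : carrier (end_lie R M)"
 show "D \<otimes>\<^bsub>end_lie R M\<^esub> (E \<oplus>\<^bsub>end_lie R M\<^esub> F) = D \<otimes>\<^bsub>end_lie R M\<^esub> E \<oplus>\<^bsub>end_lie R M\<^esub> D \<otimes>\<^bsub>end_lie R M\<^esub> F"
  "(E \<oplus>\<^bsub>end_lie R M\<^esub> F) \<otimes>\<^bsub>end_lie R M\<^esub> D = E \<otimes>\<^bsub>end_lie R M\<^esub> D \<oplus>\<^bsub>end_lie R M\<^esub> F \<otimes>\<^bsub>end_lie R M\<^esub> D"
  using D E F by (auto intro!: eqI simp: end_lie_closed end_lie_apply d a_minus_def M.M.minus_add M.M.a_ac)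
qed

lemma end_lie_antisym:
 "D : carrier (end_lie R M) ==> E : carrier (end_lie R M) ==> D \<otimes>\<^bsub>end_lie R M\<^esub> E = \<ominus>\<^bsub>end_lie R M\<^esub> (E \<otimes>\<^bsub>end_lie R M\<^esub> D)"
 by (rule end_lie_eqI[of _ R M])
  (simp_all add: end_lie_closed end_lie_apply end_lie_apply_minus lin_mapsD[OF end_lie_lin[of _ R M]] a_minus_def M.M.minus_add M.M.a_ac)

end

lemma module_prod5:
 assumes "module R M1" "module R M2" "module R M3"
  and N: "submodule N1 R M1" "submodule N3 R M3"
 shows "module R \<lparr>carrier = N1 \<times> carrier M2 \<times> N3 \<times> carrier M2 \<times> N1, mult = \<beta>, one = u,
   zero = (\<zero>\<^bsub>M1\<^esub>, \<zero>\<^bsub>M2\<^esub>, \<zero>\<^bsub>M3\<^esub>, \<zero>\<^bsub>M2\<^esub>, \<zero>\<^bsub>M1\<^esub>),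
   add = (%(s, x, D, y, t) (s', x', D', y', t').
    (s \<oplus>\<^bsub>M1\<^esub> s', x \<oplus>\<^bsub>M2\<^esub> x', D \<oplus>\<^bsub>M3\<^esub> D', y \<oplus>\<^bsub>M2\<^esub> y', t \<oplus>\<^bsub>M1\<^esub> t')),
   smult = (%r (s, x, D, y, t). (r \<odot>\<^bsub>M1\<^esub> s, r \<odot>\<^bsub>M2\<^esub> x, r \<odot>\<^bsub>M3\<^esub> D, r \<odot>\<^bsub>M2\<^esub> y, r \<odot>\<^bsub>M1\<^esub> t))\<rparr>"
  (is "module R ?M")
proof -
 interpret M1: module R M1 by fact
 interpret M2: module R M2 by fact
 interpret M3: module R M3 by fact
 note f1 = submodule_facts[OF assms(1) N(1)] and f3 = submodule_facts[OF assms(3) N(2)]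
 note c = subsetD[OF f1(1)] subsetD[OF f3(1)]
 show ?thesis
 proof (rule moduleI[OF M1.R.is_cring])
  show "abelian_group ?M"
  proof (rule abelian_groupI)
   fix z assume "z : carrier ?M"
   then obtain s x D y t where z: "z = (s, x, D, y, t)" "s : N1" "x : carrier M2" "D : N3" "y : carrier M2" "t : N1" by auto
   then show "\<exists>w\<in>carrier ?M. w \<oplus>\<^bsub>?M\<^esub> z = \<zero>\<^bsub>?M\<^esub>"
    by (intro bexI[of _ "(\<ominus>\<^bsub>M1\<^esub> s, \<ominus>\<^bsub>M2\<^esub> x, \<ominus>\<^bsub>M3\<^esub> D, \<ominus>\<^bsub>M2\<^esub> y, \<ominus>\<^bsub>M1\<^esub> t)"])
     (auto simp: f1 f3 c M1.M.l_neg M2.M.l_neg M3.M.l_neg)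
  qed (auto simp: f1 f3 c M1.M.a_ac M2.M.a_ac M3.M.a_ac)
 qed (auto simp: f1 f3 c M1.smult_l_distr M2.smult_l_distr M3.smult_l_distr M1.smult_r_distr M2.smult_r_distr M3.smult_r_distr
   M1.smult_assoc1 M2.smult_assoc1 M3.smult_assoc1)
qed

lemma skew_submodule:
 assumes "algebra_with_involution R B"
 shows "submodule (skew B) R B"
proof -
 note B = algebra_with_involutionD[OF assms]
 interpret B: module R B by (rule B(1))
 note inv = lin_mapsD[OF B(6)]
 show ?thesis
 proof (rule submoduleI'[OF B(1)])
  show "skew B \<subseteq> carrier B" by (auto simp: skew_def)
  have "\<ominus>\<^bsub>B\<^esub> \<zero>\<^bsub>B\<^esub> = \<zero>\<^bsub>B\<^esub>" by (rule B.M.minus_equality) simp_all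
  then have "\<zero>\<^bsub>B\<^esub> : skew B" using lin_maps_zero[OF B(1,1,6)] by (simp only: skew_def mem_Collect_eq B.M.zero_closed simp_thms)
  then show "skew B \<noteq> {}" by blast
 qed (auto simp: skew_def inv B.M.minus_add B.M.a_comm B.smult_r_minus)
qed

section \<open>The span of the operators \<open>V_op B x y\<close> and its action on the other
  degrees\<close>

context split_form
begin

abbreviation (input) "EB \<equiv> end_lie R B"

sublocale End: module R "end_lie R B" by (rule end_lie_module[OF B_facts(1)])

lemmas End_eqI = end_lie_eqI[of _ R B]
lemmas End_apply = end_lie_apply[where M = B and R = R] end_lie_apply_minus[OF B_facts(1)]
lemmas End_closed = end_lie_closed[OF B_facts(1)]

lemma V_linear:
 assumes x: "x : CB" and y: "y : CB"
 shows "V_op B x y : carrier EB"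
  "x' : CB ==> V_op B (x \<oplus> x') y = V_op B x y \<oplus>\<^bsub>EB\<^esub> V_op B x' y"
  "y' : CB ==> V_op B x (y \<oplus> y') = V_op B x y \<oplus>\<^bsub>EB\<^esub> V_op B x y'"
  "r : carrier R ==> V_op B (r \<odot> x) y = r \<odot>\<^bsub>EB\<^esub> V_op B x y"
  "r : carrier R ==> V_op B x (r \<odot> y) = r \<odot>\<^bsub>EB\<^esub> V_op B x y"
proof -
 have V: "V_op B x y : carrier EB" if x: "x : CB" and y: "y : CB" for x y
  unfolding V_op_def
  by (intro end_lie_carrierI B_facts(1) lin_mapsI)
   (use x y in \<open>simp_all add: bil a_minus_def B.M.minus_add B.M.a_ac B.smult_r_distr B.smult_r_minus\<close>)
 show "V_op B x y : carrier EB" using V[OF x y] .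
 note s = x y V End_closed End_apply
 have E: "V_op B x y z = ((x \<otimes> invol B y) \<otimes> z) \<oplus> ((z \<otimes> invol B y) \<otimes> x) \<ominus> ((z \<otimes> invol B x) \<otimes> y)"
  if "z : CB" for x y z using that by (simp add: V_op_def)
 show "V_op B (x \<oplus> x') y = V_op B x y \<oplus>\<^bsub>EB\<^esub> V_op B x' y" if "x' : CB"
  by (rule End_eqI) (use that in \<open>simp_all add: s\<close>, simp add: E s bil a_minus_def B.M.minus_add B.M.a_ac)
 show "V_op B x (y \<oplus> y') = V_op B x y \<oplus>\<^bsub>EB\<^esub> V_op B x y'" if "y' : CB"
  by (rule End_eqI) (use that in \<open>simp_all add: s\<close>, simp add: E s bil a_minus_def B.M.minus_add B.M.a_ac)
 show "V_op B (r \<odot> x) y = r \<odot>\<^bsub>EB\<^esub> V_op B x y" if "r : carrier R"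
  by (rule End_eqI) (use that in \<open>simp_all add: s\<close>, simp add: E s bil a_minus_def B.smult_r_minus B.smult_r_distr)
 show "V_op B x (r \<odot> y) = r \<odot>\<^bsub>EB\<^esub> V_op B x y" if "r : carrier R"
  by (rule End_eqI) (use that in \<open>simp_all add: s\<close>, simp add: E s bil a_minus_def B.smult_r_minus B.smult_r_distr)
qed

abbreviation (input) "Vs \<equiv> V_span R B"

lemma V_gens: "{V_op B x y | x y. x : CB \<and> y : CB} \<subseteq> carrier EB"
 using V_linear(1) by auto

lemma V_span_submodule: "submodule Vs R EB" and V_in_span [simp]: "x : CB ==> y : CB ==> V_op B x y : Vs"
 using lin_span_submodule[OF End.module_axioms V_gens] unfolding V_span_def by auto

lemmas V_span_facts [simp] = submodule_facts[OF End.module_axioms V_span_submodule]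

lemma V_span_closed: "D : Vs ==> D : carrier EB" by (rule subsetD[OF V_span_facts(1)])

lemma V_span_lin: "D : Vs ==> D : lin_maps R B B" by (rule end_lie_lin[OF V_span_closed])

lemma V_span_induct [consumes 1, case_names V zero add smult]:
 assumes "D : Vs" "!!x y. x : CB ==> y : CB ==> P (V_op B x y)" "P \<zero>\<^bsub>EB\<^esub>"
  "!!D E. D : carrier EB ==> E : carrier EB ==> P D ==> P E ==> P (D \<oplus>\<^bsub>EB\<^esub> E)"
  "!!r D. r : carrier R ==> D : carrier EB ==> P D ==> P (r \<odot>\<^bsub>EB\<^esub> D)"
 shows "P D"
 using assms(1)[unfolded V_span_def] End.module_axioms V_gens
 by (induction rule: lin_span_induct) (use assms in auto)

lemmas End_bil = bilinear_multD[OF end_lie_mult_bilinear[OF B_facts(1)]]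

lemma V_commutator:
 assumes "x : CB" "y : CB" "z : CB" "w : CB"
 shows "V_op B x y \<otimes>\<^bsub>EB\<^esub> V_op B z w = V_op B (V_op B x y z) w \<ominus>\<^bsub>EB\<^esub> V_op B z (V_op B y x w)"
proof (rule End_eqI)
 fix u assume u: "u : CB"
 show "(V_op B x y \<otimes>\<^bsub>EB\<^esub> V_op B z w) u = (V_op B (V_op B x y z) w \<ominus>\<^bsub>EB\<^esub> V_op B z (V_op B y x w)) u"
  using assms u by (simp add: End_apply V_linear(1) structurable[OF assms u] a_minus_def B.M.a_assoc B.M.r_neg)
qed (use assms in \<open>simp_all add: V_linear(1) End_closed\<close>)

lemma V_span_mult [simp]:
 assumes D: "D : Vs" and E: "E : Vs"
 shows "D \<otimes>\<^bsub>EB\<^esub> E : Vs"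
 using E
proof (induction rule: V_span_induct)
 case (V z w)
 show ?case
  using D
 proof (induction rule: V_span_induct)
  case (V x y)
  then show ?case using \<open>z : CB\<close> \<open>w : CB\<close> by (simp add: V_commutator)
 next
  case zero
  show ?case
   using End_bil(5)[of "\<zero>\<^bsub>EB\<^esub>" "V_op B z w" "\<zero>\<^bsub>R\<^esub>"] \<open>z : CB\<close> \<open>w : CB\<close> by (simp add: V_linear(1) End_closed)
 qed (use V in \<open>simp_all add: End_bil V_linear(1)\<close>)
next
 case zero
 show ?case using End_bil(4)[of D "\<zero>\<^bsub>EB\<^esub>" "\<zero>\<^bsub>R\<^esub>"] V_span_closed[OF D] by (simp add: End_closed)
qed (use V_span_closed[OF D] in \<open>simp_all add: End_bil\<close>)

definition kap where "kap s = (THE c. c : carrier R \<and> s = c \<odot> j)"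

lemma kap_j [simp]: "c : carrier R ==> kap (c \<odot> j) = c"
 unfolding kap_def by (rule the_equality) (auto intro: j_cancel)

lemma kap: "s : skew B ==> kap s : carrier R" "s : skew B ==> s = kap s \<odot> j"
 using skew_multiple by force+

lemmas skew_facts [simp] = submodule_facts[OF B_facts(1) skew_submodule[OF B]]

lemma skew_closed: "s : skew B ==> s : CB" by (simp add: skew_def)

lemma skew_j [simp]: "c : carrier R ==> c \<odot> j : skew B" using j(1) by simp

lemma kap_linear: "s : skew B ==> t : skew B ==> kap (s \<oplus> t) = kap s \<oplus>\<^bsub>R\<^esub> kap t"
 "s : skew B ==> c : carrier R ==> kap (c \<odot> s) = c \<otimes>\<^bsub>R\<^esub> kap s"
proof -
 show "kap (s \<oplus> t) = kap s \<oplus>\<^bsub>R\<^esub> kap t" if "s : skew B" "t : skew B"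
 proof -
  have "s \<oplus> t = (kap s \<oplus>\<^bsub>R\<^esub> kap t) \<odot> j" using that kap by (simp add: B.smult_l_distr flip: kap(2))
  then show ?thesis using that kap(1) by simp
 qed
 show "kap (c \<odot> s) = c \<otimes>\<^bsub>R\<^esub> kap s" if "s : skew B" "c : carrier R"
 proof -
  have "c \<odot> s = (c \<otimes>\<^bsub>R\<^esub> kap s) \<odot> j" using that kap by (simp add: B.smult_assoc1 flip: kap(2))
  then show ?thesis using that kap(1) by simp
 qed
qed

definition hf where "hf = (SOME h. h : carrier R \<and> h \<oplus>\<^bsub>R\<^esub> h = \<one>\<^bsub>R\<^esub>)"

lemma hf: "hf : carrier R" "hf \<oplus>\<^bsub>R\<^esub> hf = \<one>\<^bsub>R\<^esub>"
proof -
 have "\<exists>h. h : carrier R \<and> h \<oplus>\<^bsub>R\<^esub> h = \<one>\<^bsub>R\<^esub>" using half by metis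
 from someI_ex[OF this] show "hf : carrier R" "hf \<oplus>\<^bsub>R\<^esub> hf = \<one>\<^bsub>R\<^esub>" by (auto simp: hf_def)
qed

text \<open>The degree-two action of an endomorphism in the span of the \<open>V_op B x y\<close>, a multiple of the
 identity, is recovered from the values of the endomorphism at \<open>j\<close> and \<open>1\<close>; hence it is well defined.\<close>

definition dl where "dl D = hf \<otimes>\<^bsub>R\<^esub> kap (D j \<ominus> invol B (D j) \<oplus> j \<otimes> invol B (D \<one>) \<oplus> D \<one> \<otimes> j)"

lemma bil_minus:
 "x : CB ==> y : CB ==> x \<otimes> (\<ominus> y) = \<ominus> (x \<otimes> y)"
 "x : CB ==> y : CB ==> (\<ominus> x) \<otimes> y = \<ominus> (x \<otimes> y)"
 "x : CB ==> invol B (\<ominus> x) = \<ominus> invol B x"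
 by (simp_all add: module_neg_smult[OF B_facts(1)] bil)

lemma dl_skew:
 assumes "u : CB" "v : CB"
 shows "u \<ominus> invol B u \<oplus> j \<otimes> invol B v \<oplus> v \<otimes> j : skew B"
 using assms by (simp add: skew_def bil bil_minus B_facts(7,8) j_invol a_minus_def B.M.minus_add B.M.a_ac)

lemma dl_lin: "dl : lin_forms R EB"
 unfolding lin_forms_eq
proof (rule lin_mapsI; simp)
 fix D assume D: "D : carrier EB"
 note d = lin_mapsD[OF end_lie_lin[OF D]]
 show "dl D : carrier R" unfolding dl_def using hf kap(1)[OF dl_skew] d by simp
 show "dl (r \<odot>\<^bsub>EB\<^esub> D) = r \<otimes>\<^bsub>R\<^esub> dl D" if r: "r : carrier R" for r
 proof -
  let ?s = "D j \<ominus> invol B (D j) \<oplus> j \<otimes> invol B (D \<one>) \<oplus> D \<one> \<otimes> j"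
  have "dl (r \<odot>\<^bsub>EB\<^esub> D) = hf \<otimes>\<^bsub>R\<^esub> kap (r \<odot> ?s)"
   unfolding dl_def using r d by (simp add: End_apply bil a_minus_def B.smult_r_minus B.smult_r_distr)
  then show ?thesis
   unfolding dl_def using r d hf(1) kap(1)[OF dl_skew] by (simp add: kap_linear dl_skew B.R.m_lcomm)
 qed
 fix E assume E: "E : carrier EB"
 note e = lin_mapsD[OF end_lie_lin[OF E]]
 let ?s = "%D. D j \<ominus> invol B (D j) \<oplus> j \<otimes> invol B (D \<one>) \<oplus> D \<one> \<otimes> j"
 have "dl (D \<oplus>\<^bsub>EB\<^esub> E) = hf \<otimes>\<^bsub>R\<^esub> kap (?s D \<oplus> ?s E)"
  unfolding dl_def using d e by (simp add: End_apply bil a_minus_def B.M.minus_add B.M.a_ac)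
 then show "dl (D \<oplus>\<^bsub>EB\<^esub> E) = dl D \<oplus>\<^bsub>R\<^esub> dl E"
  unfolding dl_def using d e hf(1) kap(1)[OF dl_skew] by (simp add: kap_linear dl_skew B.R.r_distr)
qed

lemmas dl_linear = lin_mapsD[OF dl_lin[unfolded lin_forms_eq], simplified]

lemma d_skew: "x : CB ==> y : CB ==> d x y = beta (j \<otimes> y) x \<odot> j"
 unfolding d_def by (subst beta(2)[symmetric]) (simp_all add: B_facts(7,8) j_invol bil_minus a_minus_def)

text \<open>In degree one the bracket of \<open>j\<close> and 1 is 2 \<open>j\<close>, and the
  Leibniz rule for D on it is the argument of \<open>kap\<close> in \<open>dl\<close>; so
  \<open>kap\<close> yields twice the degree-two action and \<open>hf\<close> halves it. For D =
  \<open>V_op B x y\<close> this is the third part of \<open>d_facts\<close>.\<close>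

lemma dl_V: "x : CB ==> y : CB ==> dl (V_op B x y) = beta (j \<otimes> y) x"
proof -
 assume x: "x : CB" and y: "y : CB"
 then have b: "beta (j \<otimes> y) x : carrier R" by (simp add: beta)
 have "dl (V_op B x y) = hf \<otimes>\<^bsub>R\<^esub> kap ((beta (j \<otimes> y) x \<oplus>\<^bsub>R\<^esub> beta (j \<otimes> y) x) \<odot> j)"
  unfolding dl_def d_facts(3)[OF x y] using x y b by (simp add: d_skew B.smult_l_distr)
 also have "\<dots> = (hf \<oplus>\<^bsub>R\<^esub> hf) \<otimes>\<^bsub>R\<^esub> beta (j \<otimes> y) x" using b hf(1) by (simp add: B.R.r_distr B.R.l_distr)
 finally show ?thesis using b hf(2) by simp
qed

text \<open>The action on degree \<open>-1\<close> of an endomorphism in the span of the \<open>V_op B x y\<close>.\<close>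

definition dm where "dm D w = inv\<^bsub>R\<^esub> \<mu> \<odot> (j \<otimes> D (j \<otimes> w)) \<ominus> dl D \<odot> w"

lemma nu_closed [simp]: "inv\<^bsub>R\<^esub> \<mu> : carrier R" "inv\<^bsub>R\<^esub> \<mu> \<otimes>\<^bsub>R\<^esub> \<mu> = \<one>\<^bsub>R\<^esub>" "\<mu> \<otimes>\<^bsub>R\<^esub> inv\<^bsub>R\<^esub> \<mu> = \<one>\<^bsub>R\<^esub>"
 using j(2) by auto

text \<open>The formula of \<open>dm\<close> is forced by letting D act on the bracket of
  \<open>j\<close> in degree 2 with w in degree -1, which is \<open>j \<otimes> w\<close> in degree
  1: it gives j (\<open>dm D w\<close>) = D (j w) - \<open>dl D\<close> j w, and multiplication by
  \<mu>^-1 \<open>j\<close> solves for \<open>dm D w\<close>. On generators the second part of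
  \<open>d_facts\<close> turns it into the prescribed action.\<close>

lemma dm_V:
 assumes x: "x : CB" and y: "y : CB" and z: "z : CB"
 shows "dm (V_op B x y) z = \<ominus> V_op B y x z"
proof -
 have "V_op B y x (j \<otimes> (j \<otimes> z)) = \<mu> \<odot> V_op B y x z"
  using x y z by (simp add: j_j lin_mapsD(3)[OF end_lie_lin[OF V_linear(1)]])
 moreover have "d x y \<otimes> (j \<otimes> z) = \<mu> \<odot> (dl (V_op B x y) \<odot> z)"
  using x y z by (simp add: d_skew dl_V bil j_j beta B.smult_assoc1[symmetric] B.R.m_comm)
 ultimately have e: "\<mu> \<odot> V_op B y x z \<oplus> j \<otimes> V_op B x y (j \<otimes> z) = \<mu> \<odot> (dl (V_op B x y) \<odot> z)"
  using d_facts(2)[OF x y, of "j \<otimes> z"] z by simp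
 have nu: "inv\<^bsub>R\<^esub> \<mu> \<odot> (\<mu> \<odot> v) = v" if "v : CB" for v
  using that by (simp add: B.smult_assoc1[symmetric])
 have dz: "dl (V_op B x y) \<odot> z : CB" using x y z by (simp add: V_linear dl_linear)
 have "V_op B y x z \<oplus> inv\<^bsub>R\<^esub> \<mu> \<odot> (j \<otimes> V_op B x y (j \<otimes> z)) = dl (V_op B x y) \<odot> z"
  using arg_cong[OF e, of "%v. inv\<^bsub>R\<^esub> \<mu> \<odot> v"] x y z dz by (simp add: B.smult_r_distr nu)
 from this[symmetric] show ?thesis
  unfolding dm_def using x y z by (simp add: a_minus_def B.M.minus_add B.M.a_ac B.M.r_neg B.M.r_neg1 B.M.r_neg2)
qed

lemma dm_linear:
 assumes D: "D : carrier EB" and w: "w : CB"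
 shows "dm D w : CB"
  "w' : CB ==> dm D (w \<oplus> w') = dm D w \<oplus> dm D w'"
  "r : carrier R ==> dm D (r \<odot> w) = r \<odot> dm D w"
  "E : carrier EB ==> dm (D \<oplus>\<^bsub>EB\<^esub> E) w = dm D w \<oplus> dm E w"
  "r : carrier R ==> dm (r \<odot>\<^bsub>EB\<^esub> D) w = r \<odot> dm D w"
proof -
 note d = lin_mapsD[OF end_lie_lin[of _ R B]] dl_linear
 show "dm D w : CB" using D w by (simp add: dm_def d)
 show "dm D (w \<oplus> w') = dm D w \<oplus> dm D w'" if "w' : CB"
  using D w that by (simp add: dm_def d bil B.smult_r_distr a_minus_def B.M.minus_add B.M.a_ac)
 show "dm D (r \<odot> w) = r \<odot> dm D w" if "r : carrier R"
  using D w that by (simp add: dm_def d bil B.smult_r_distr a_minus_def B.smult_r_minus B.smult_assoc1[symmetric] B.R.m_comm)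
 show "dm (D \<oplus>\<^bsub>EB\<^esub> E) w = dm D w \<oplus> dm E w" if "E : carrier EB"
  using D w that by (simp add: dm_def d End_apply bil B.smult_r_distr B.smult_l_distr a_minus_def B.M.minus_add B.M.a_ac)
 show "dm (r \<odot>\<^bsub>EB\<^esub> D) w = r \<odot> dm D w" if "r : carrier R"
  using D w that by (simp add: dm_def d End_apply bil B.smult_r_distr a_minus_def B.smult_r_minus B.smult_assoc1[symmetric] B.R.m_comm)
qed

end

section \<open>Existence and uniqueness of the bracket of L(B)\<close>

context split_form
begin

text \<open>The module structure of L(B) does not depend on the bracket; the dummy product makes it
  available before the bracket has been constructed.\<close>

definition "L0 = tkk_with R B (%u v. u)"

lemma tkk_with_simps:
 "carrier (tkk_with R B \<beta>) = carrier L0" "add (tkk_with R B \<beta>) = add L0" "zero (tkk_with R B \<beta>) = zero L0"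
 "smult (tkk_with R B \<beta>) = smult L0" "a_inv (tkk_with R B \<beta>) = a_inv L0" "mult (tkk_with R B \<beta>) = \<beta>"
 by (simp_all add: L0_def tkk_with_def a_inv_def)

lemma tkk_with_module: "module R (tkk_with R B \<beta>)"
 unfolding tkk_with_def tkk_zero_def
 by (rule module_prod5[OF B_facts(1) B_facts(1) End.module_axioms skew_submodule[OF B] V_span_submodule])

lemma L0_module: "module R L0" unfolding L0_def by (rule tkk_with_module)

interpretation L0: module R L0 by (rule L0_module)

lemma tkk_ops:
 "(s, x, D, y, t) : carrier L0 \<longleftrightarrow> s : skew B \<and> x : CB \<and> D : Vs \<and> y : CB \<and> t : skew B"
 "(s, x, D, y, t) \<oplus>\<^bsub>L0\<^esub> (s', x', D', y', t') = (s \<oplus> s', x \<oplus> x', D \<oplus>\<^bsub>EB\<^esub> D', y \<oplus> y', t \<oplus> t')"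
 "r \<odot>\<^bsub>L0\<^esub> (s, x, D, y, t) = (r \<odot> s, r \<odot> x, r \<odot>\<^bsub>EB\<^esub> D, r \<odot> y, r \<odot> t)"
 "\<zero>\<^bsub>L0\<^esub> = (\<zero>, \<zero>, \<zero>\<^bsub>EB\<^esub>, \<zero>, \<zero>)"
 by (simp_all add: L0_def tkk_with_def tkk_zero_def)

lemma tkk_minus:
 assumes "(s, x, D, y, t) : carrier L0"
 shows "\<ominus>\<^bsub>L0\<^esub> (s, x, D, y, t) = (\<ominus> s, \<ominus> x, \<ominus>\<^bsub>EB\<^esub> D, \<ominus> y, \<ominus> t)"
 using assms skew_closed V_span_closed
 by (intro L0.M.minus_equality) (simp_all add: tkk_ops B.M.l_neg End.M.l_neg)

lemma tkk_cases:
 assumes "u : carrier L0"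
 obtains s x D y t where "u = (s, x, D, y, t)" "s : skew B" "x : CB" "D : Vs" "y : CB" "t : skew B"
 using assms by (cases u) (auto simp: tkk_ops)

definition alt_bil where "alt_bil \<beta> \<longleftrightarrow> (\<forall>u\<in>carrier L0. \<forall>v\<in>carrier L0. \<beta> u v : carrier L0 \<and> \<beta> u v = \<ominus>\<^bsub>L0\<^esub> \<beta> v u \<and>
 (\<forall>w\<in>carrier L0. \<beta> u (v \<oplus>\<^bsub>L0\<^esub> w) = \<beta> u v \<oplus>\<^bsub>L0\<^esub> \<beta> u w) \<and> (\<forall>r\<in>carrier R. \<beta> u (r \<odot>\<^bsub>L0\<^esub> v) = r \<odot>\<^bsub>L0\<^esub> \<beta> u v))"

lemma alt_bilD:
 assumes "alt_bil \<beta>" "u : carrier L0" "v : carrier L0"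
 shows "\<beta> u v : carrier L0" "\<beta> u v = \<ominus>\<^bsub>L0\<^esub> \<beta> v u"
  "w : carrier L0 ==> \<beta> u (v \<oplus>\<^bsub>L0\<^esub> w) = \<beta> u v \<oplus>\<^bsub>L0\<^esub> \<beta> u w" "r : carrier R ==> \<beta> u (r \<odot>\<^bsub>L0\<^esub> v) = r \<odot>\<^bsub>L0\<^esub> \<beta> u v"
  "w : carrier L0 ==> \<beta> (v \<oplus>\<^bsub>L0\<^esub> w) u = \<beta> v u \<oplus>\<^bsub>L0\<^esub> \<beta> w u" "r : carrier R ==> \<beta> (r \<odot>\<^bsub>L0\<^esub> v) u = r \<odot>\<^bsub>L0\<^esub> \<beta> v u"
proof -
 have *: "!!u v. u : carrier L0 ==> v : carrier L0 ==> \<beta> u v : carrier L0"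
  "!!u v. u : carrier L0 ==> v : carrier L0 ==> \<beta> u v = \<ominus>\<^bsub>L0\<^esub> \<beta> v u"
  "!!u v w. u : carrier L0 ==> v : carrier L0 ==> w : carrier L0 ==> \<beta> u (v \<oplus>\<^bsub>L0\<^esub> w) = \<beta> u v \<oplus>\<^bsub>L0\<^esub> \<beta> u w"
  "!!u v r. u : carrier L0 ==> v : carrier L0 ==> r : carrier R ==> \<beta> u (r \<odot>\<^bsub>L0\<^esub> v) = r \<odot>\<^bsub>L0\<^esub> \<beta> u v"
  using assms(1) unfolding alt_bil_def by blast+
 show "\<beta> u v : carrier L0" "\<beta> u v = \<ominus>\<^bsub>L0\<^esub> \<beta> v u"
  "w : carrier L0 ==> \<beta> u (v \<oplus>\<^bsub>L0\<^esub> w) = \<beta> u v \<oplus>\<^bsub>L0\<^esub> \<beta> u w" "r : carrier R ==> \<beta> u (r \<odot>\<^bsub>L0\<^esub> v) = r \<odot>\<^bsub>L0\<^esub> \<beta> u v"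
  using assms(2,3) by (auto intro: *(1,3,4) *(2)[OF assms(2,3)])
 show "\<beta> (v \<oplus>\<^bsub>L0\<^esub> w) u = \<beta> v u \<oplus>\<^bsub>L0\<^esub> \<beta> w u" if w: "w : carrier L0"
 proof -
  have "\<beta> (v \<oplus>\<^bsub>L0\<^esub> w) u = \<ominus>\<^bsub>L0\<^esub> (\<beta> u v \<oplus>\<^bsub>L0\<^esub> \<beta> u w)"
   using *(2)[of "v \<oplus>\<^bsub>L0\<^esub> w" u] *(3) assms(2,3) w by simp
  then show ?thesis
   using *(1) *(2)[of v u] *(2)[of w u] assms(2,3) w by (simp add: L0.M.minus_add)
 qed
 show "\<beta> (r \<odot>\<^bsub>L0\<^esub> v) u = r \<odot>\<^bsub>L0\<^esub> \<beta> v u" if r: "r : carrier R"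
 proof -
  have "\<beta> (r \<odot>\<^bsub>L0\<^esub> v) u = \<ominus>\<^bsub>L0\<^esub> (r \<odot>\<^bsub>L0\<^esub> \<beta> u v)"
   using *(2)[of "r \<odot>\<^bsub>L0\<^esub> v" u] *(4) assms(2,3) r by simp
  then show ?thesis
   using *(1) *(2)[of v u] assms(2,3) r by (simp add: L0.smult_r_minus)
 qed
qed

text \<open>The elements for which \<open>tkk_bracket\<close> prescribes brackets; as they span
  L(B), a bilinear bracket is determined by its values on them.\<close>

definition gens where "gens = {in_p2 R B s | s. s : skew B} \<union> {in_m2 R B s | s. s : skew B} \<union>
 {in_p1 R B x | x. x : CB} \<union> {in_m1 R B x | x. x : CB} \<union>
 {in_0 R B (V_op B x y) | x y. x : CB \<and> y : CB}"

lemma ins_closed [simp]: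
 "s : skew B ==> in_p2 R B s : carrier L0" "s : skew B ==> in_m2 R B s : carrier L0"
 "x : CB ==> in_p1 R B x : carrier L0" "x : CB ==> in_m1 R B x : carrier L0"
 "D : Vs ==> in_0 R B D : carrier L0"
 by (simp_all add: tkk_ops in_p2_def in_m2_def in_p1_def in_m1_def in_0_def)

lemma ins_linear:
 "s : skew B ==> t : skew B ==> in_p2 R B (s \<oplus> t) = in_p2 R B s \<oplus>\<^bsub>L0\<^esub> in_p2 R B t"
 "s : skew B ==> r : carrier R ==> in_p2 R B (r \<odot> s) = r \<odot>\<^bsub>L0\<^esub> in_p2 R B s"
 "s : skew B ==> t : skew B ==> in_m2 R B (s \<oplus> t) = in_m2 R B s \<oplus>\<^bsub>L0\<^esub> in_m2 R B t"
 "s : skew B ==> r : carrier R ==> in_m2 R B (r \<odot> s) = r \<odot>\<^bsub>L0\<^esub> in_m2 R B s"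
 "x : CB ==> y : CB ==> in_p1 R B (x \<oplus> y) = in_p1 R B x \<oplus>\<^bsub>L0\<^esub> in_p1 R B y"
 "x : CB ==> r : carrier R ==> in_p1 R B (r \<odot> x) = r \<odot>\<^bsub>L0\<^esub> in_p1 R B x"
 "x : CB ==> y : CB ==> in_m1 R B (x \<oplus> y) = in_m1 R B x \<oplus>\<^bsub>L0\<^esub> in_m1 R B y"
 "x : CB ==> r : carrier R ==> in_m1 R B (r \<odot> x) = r \<odot>\<^bsub>L0\<^esub> in_m1 R B x"
 "D : carrier EB ==> E : carrier EB ==> in_0 R B (D \<oplus>\<^bsub>EB\<^esub> E) = in_0 R B D \<oplus>\<^bsub>L0\<^esub> in_0 R B E"
 "D : carrier EB ==> r : carrier R ==> in_0 R B (r \<odot>\<^bsub>EB\<^esub> D) = r \<odot>\<^bsub>L0\<^esub> in_0 R B D"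
 "in_0 R B \<zero>\<^bsub>EB\<^esub> = \<zero>\<^bsub>L0\<^esub>"
 by (simp_all add: tkk_ops in_p2_def in_m2_def in_p1_def in_m1_def in_0_def skew_closed)

lemma gens_closed: "gens \<subseteq> carrier L0" by (auto simp: gens_def)

lemma tkk_decompose:
 assumes "s : skew B" "x : CB" "D : Vs" "y : CB" "t : skew B"
 shows "(s, x, D, y, t) = in_m2 R B s \<oplus>\<^bsub>L0\<^esub> in_m1 R B x \<oplus>\<^bsub>L0\<^esub> in_0 R B D \<oplus>\<^bsub>L0\<^esub> in_p1 R B y \<oplus>\<^bsub>L0\<^esub> in_p2 R B t"
 using assms skew_closed V_span_closed by (simp add: tkk_ops in_p2_def in_m2_def in_p1_def in_m1_def in_0_def)

lemma gens_span: "carrier L0 \<subseteq> lin_span R L0 gens"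
proof
 fix u assume "u : carrier L0"
 then obtain s x D y t where u: "u = (s, x, D, y, t)" "s : skew B" "x : CB" "D : Vs" "y : CB" "t : skew B"
  by (rule tkk_cases)
 note sp = lin_span_submodule[OF L0_module gens_closed]
 note f = submodule_facts[OF L0_module sp(1)]
 have "in_0 R B D : lin_span R L0 gens"
  using u(4)
 proof (induction rule: V_span_induct)
  case (V x y)
  then have "in_0 R B (V_op B x y) : gens" by (auto simp: gens_def)
  then show ?case using sp(2) by blast
 qed (simp_all add: ins_linear f)
 moreover have "in_m2 R B s : gens" "in_m1 R B x : gens" "in_p1 R B y : gens" "in_p2 R B t : gens"
  using u by (auto simp: gens_def)
 ultimately show "u : lin_span R L0 gens"
  unfolding u(1) tkk_decompose[OF u(2-6)] using sp(2) by (intro f(3)) auto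
qed

lemma tkk_induct [consumes 1, case_names gen zero add smult]:
 assumes "u : carrier L0" "!!u. u : gens ==> P u" "P \<zero>\<^bsub>L0\<^esub>"
  "!!u v. u : carrier L0 ==> v : carrier L0 ==> P u ==> P v ==> P (u \<oplus>\<^bsub>L0\<^esub> v)"
  "!!r u. r : carrier R ==> u : carrier L0 ==> P u ==> P (r \<odot>\<^bsub>L0\<^esub> u)"
 shows "P u"
 using subsetD[OF gens_span assms(1)] L0_module gens_closed
 by (induction rule: lin_span_induct) (use assms in auto)

lemma alt_bil_zero:
 assumes "alt_bil \<beta>" "u : carrier L0"
 shows "\<beta> u \<zero>\<^bsub>L0\<^esub> = \<zero>\<^bsub>L0\<^esub>" "\<beta> \<zero>\<^bsub>L0\<^esub> u = \<zero>\<^bsub>L0\<^esub>"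
 using alt_bilD(4,6)[OF assms(1,2) L0.M.zero_closed, of "\<zero>\<^bsub>R\<^esub>"] alt_bilD(1)[OF assms(1)] assms(2) by simp_all

lemma alt_bil_agree:
 assumes \<beta>: "alt_bil \<beta>" "alt_bil \<beta>'" and g: "!!u v. u : gens ==> v : gens ==> \<beta> u v = \<beta>' u v"
  and u: "u : carrier L0" and v: "v : carrier L0"
 shows "\<beta> u v = \<beta>' u v"
 using v
proof (induction rule: tkk_induct)
 case (gen v)
 have v: "v : carrier L0" using gen gens_closed by auto
 show ?case
  using u
 proof (induction rule: tkk_induct)
  case (gen u)
  then show ?case using g \<open>v : gens\<close> by blast
 qed (use v \<beta> in \<open>simp_all add: alt_bilD(3-6) alt_bil_zero\<close>)
qed (use u \<beta> in \<open>simp_all add: alt_bilD(3-6) alt_bil_zero\<close>)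

lemma tkk_bracketD:
 assumes "tkk_bracket R B \<beta>"
 shows "D : Vs ==> E : Vs ==> \<beta> (in_0 R B D) (in_0 R B E) = in_0 R B (D \<otimes>\<^bsub>EB\<^esub> E)"
  "x : CB ==> y : CB ==> z : CB ==> \<beta> (in_0 R B (V_op B x y)) (in_p1 R B z) = in_p1 R B (V_op B x y z)"
  "x : CB ==> y : CB ==> z : CB ==> \<beta> (in_0 R B (V_op B x y)) (in_m1 R B z) = in_m1 R B (\<ominus> V_op B y x z)"
  "x : CB ==> y : CB ==> s : skew B ==> \<beta> (in_0 R B (V_op B x y)) (in_p2 R B s) = in_p2 R B
     ((s \<otimes> y) \<otimes> invol B x \<oplus> x \<otimes> (invol B y \<otimes> s))"
  "x : CB ==> y : CB ==> s : skew B ==> \<beta> (in_0 R B (V_op B x y)) (in_m2 R B s) = in_m2 R B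
     (\<ominus> ((s \<otimes> x) \<otimes> invol B y) \<ominus> y \<otimes> (invol B x \<otimes> s))"
  "x : CB ==> y : CB ==> \<beta> (in_p1 R B x) (in_p1 R B y) = in_p2 R B (x \<otimes> invol B y \<ominus> y \<otimes> invol B x)"
  "x : CB ==> y : CB ==> \<beta> (in_m1 R B x) (in_m1 R B y) = in_m2 R B (x \<otimes> invol B y \<ominus> y \<otimes> invol B x)"
  "x : CB ==> y : CB ==> \<beta> (in_p1 R B x) (in_m1 R B y) = in_0 R B (V_op B x y)"
  "s : skew B ==> t : skew B ==> \<beta> (in_p2 R B s) (in_m2 R B t) = in_0 R B (V_op B (s \<otimes> t) \<one>)"
  "s : skew B ==> t : skew B ==> \<beta> (in_p2 R B s) (in_p2 R B t) = \<zero>\<^bsub>L0\<^esub>"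
  "s : skew B ==> t : skew B ==> \<beta> (in_m2 R B s) (in_m2 R B t) = \<zero>\<^bsub>L0\<^esub>"
  "s : skew B ==> x : CB ==> \<beta> (in_p2 R B s) (in_m1 R B x) = in_p1 R B (s \<otimes> x)"
  "s : skew B ==> x : CB ==> \<beta> (in_m2 R B s) (in_p1 R B x) = in_m1 R B (s \<otimes> x)"
  "s : skew B ==> x : CB ==> \<beta> (in_p2 R B s) (in_p1 R B x) = \<zero>\<^bsub>L0\<^esub>"
  "s : skew B ==> x : CB ==> \<beta> (in_m2 R B s) (in_m1 R B x) = \<zero>\<^bsub>L0\<^esub>"
proof -
 have z: "\<zero>\<^bsub>L0\<^esub> = tkk_zero R B" by (simp add: L0_def tkk_with_def)
 show "D : Vs ==> E : Vs ==> \<beta> (in_0 R B D) (in_0 R B E) = in_0 R B (D \<otimes>\<^bsub>EB\<^esub> E)"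
  using assms unfolding tkk_bracket_def by blast
qed (use assms[unfolded tkk_bracket_def] in \<open>simp_all add: L0_def tkk_with_def\<close>)

lemma tkk_bracket_alt:
 assumes "tkk_bracket R B \<beta>"
 shows "alt_bil \<beta>" "\<beta> : extensional (carrier L0)" "u : carrier L0 ==> \<beta> u : extensional (carrier L0)"
proof -
 have *: "\<beta> : extensional (carrier L0)" "\<forall>u\<in>carrier L0. \<beta> u : lin_maps R (tkk_with R B \<beta>) (tkk_with R B \<beta>) \<inter> extensional (carrier L0)"
  "\<forall>u\<in>carrier L0. \<forall>v\<in>carrier L0. \<beta> u v = \<ominus>\<^bsub>L0\<^esub> \<beta> v u"
  using assms unfolding tkk_bracket_def Let_def tkk_with_simps by - (elim conjE, assumption)+
 then show "\<beta> : extensional (carrier L0)" "u : carrier L0 ==> \<beta> u : extensional (carrier L0)" by auto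
 have l: "\<beta> u : lin_maps R (tkk_with R B \<beta>) (tkk_with R B \<beta>)" if "u : carrier L0" for u using *(2) that by auto
 note l' = lin_mapsD[OF l, unfolded tkk_with_simps]
 show "alt_bil \<beta>"
  unfolding alt_bil_def
 proof (intro ballI conjI)
  show "\<beta> u v = \<ominus>\<^bsub>L0\<^esub> \<beta> v u" if "u : carrier L0" "v : carrier L0" for u v using *(3) that by blast
 qed (rule l'; assumption)+
qed

lemma tkk_bracket_unique:
 assumes "tkk_bracket R B \<beta>" "tkk_bracket R B \<beta>'"
 shows "\<beta> = \<beta>'"
proof -
 note alt = tkk_bracket_alt[OF assms(1)] tkk_bracket_alt[OF assms(2)]
 \<comment> \<open>Each entry of the table is prescribed for one order of the two generators;
   antisymmetry supplies the other one.\<close>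
 have g: "\<beta> u v = \<beta>' u v \<or> \<beta> v u = \<beta>' v u" if "u : gens" "v : gens" for u v
  using that unfolding gens_def
  by (elim UnE CollectE exE conjE) (simp_all add: tkk_bracketD[OF assms(1)] tkk_bracketD[OF assms(2)])
 have "\<beta> u v = \<beta>' u v" if "u : gens" "v : gens" for u v
 proof -
  have c: "u : carrier L0" "v : carrier L0" using that gens_closed by auto
  show ?thesis
  proof (cases "\<beta> v u = \<beta>' v u")
   case True
   show ?thesis unfolding alt_bilD(2)[OF alt(1) c] alt_bilD(2)[OF alt(4) c] True ..
  qed (use g[OF that] in simp)
 qed
 then have "\<beta> u v = \<beta>' u v" if "u : carrier L0" "v : carrier L0" for u v
  using alt_bil_agree[OF alt(1,4) _ that] by blast
 then have "\<beta> u = \<beta>' u" if "u : carrier L0" for u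
  by (rule extensionalityI[OF alt(3)[OF that] alt(6)[OF that]]) (rule that)
 then show ?thesis by (rule extensionalityI[OF alt(2,5)])
qed

text \<open>The bracket in closed form on all five components, operators acting on degrees 2 and -2
  through \<open>dl\<close> and on degree -1 through \<open>dm\<close>. As it refers to the operator
  D and not to a presentation of D by generators, it is well defined without any knowledge of their
  relations.\<close>

fun bro where "bro (s, x, D, y, t) (s', x', D', y', t') =
 (beta x x' \<odot> j \<ominus> dl D \<odot> s' \<oplus> dl D' \<odot> s,
  dm D x' \<ominus> dm D' x \<oplus> s \<otimes> y' \<ominus> s' \<otimes> y,
  (D \<otimes>\<^bsub>EB\<^esub> D') \<oplus>\<^bsub>EB\<^esub> V_op B y x' \<ominus>\<^bsub>EB\<^esub> V_op B y' x \<oplus>\<^bsub>EB\<^esub> V_op B (t \<otimes> s') \<one> \<ominus>\<^bsub>EB\<^esub> V_op B (t' \<otimes> s) \<one>,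
  D y' \<ominus> D' y \<oplus> t \<otimes> x' \<ominus> t' \<otimes> x,
  beta y y' \<odot> j \<oplus> dl D \<odot> t' \<ominus> dl D' \<odot> t)"

lemmas beta_linear = lin_mapsD[OF beta_lin(2)[unfolded lin_forms_eq], simplified]

lemma beta_antisym: "x : CB ==> y : CB ==> beta x y = \<ominus>\<^bsub>R\<^esub> beta y x"
proof (rule j_cancel)
 assume xy: "x : CB" "y : CB"
 then show "beta x y \<odot> j = (\<ominus>\<^bsub>R\<^esub> beta y x) \<odot> j"
  using beta(1)[of y x] beta(2)[of x y] beta(2)[of y x, symmetric]
  by (simp add: B.smult_l_minus a_minus_def B.M.minus_add B.M.a_comm)
qed (simp_all add: beta)

lemma D_facts:
 assumes "D : Vs" "y : CB"
 shows "D y : CB" "y' : CB ==> D (y \<oplus> y') = D y \<oplus> D y'" "r : carrier R ==> D (r \<odot> y) = r \<odot> D y"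
 using lin_mapsD[OF V_span_lin[OF assms(1)]] assms(2) by auto

lemma alt_bil_bro: "alt_bil bro"
 unfolding alt_bil_def
proof (intro ballI conjI)
 note c = beta dl_linear dm_linear End_apply V_span_closed skew_closed D_facts V_linear End_bil bil
 fix u v assume u: "u : carrier L0" and v: "v : carrier L0"
 from u obtain s x D y t where u': "u = (s, x, D, y, t)" and ut: "s : skew B" "x : CB" "D : Vs" "y : CB" "t : skew B"
  by (rule tkk_cases)
 from v obtain s' x' D' y' t' where v': "v = (s', x', D', y', t')" and vt: "s' : skew B" "x' : CB" "D' : Vs" "y' : CB" "t' : skew B"
  by (rule tkk_cases)
 show cl: "bro u v : carrier L0"
  using ut vt by (simp add: u' v' tkk_ops c)
 have cl': "bro v u : carrier L0"
  using ut vt by (simp add: u' v' tkk_ops c)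
 show "bro u v = \<ominus>\<^bsub>L0\<^esub> bro v u"
  using ut vt beta_antisym[of x x'] beta_antisym[of y y'] end_lie_antisym[OF B_facts(1), of D D']
  unfolding u' v' bro.simps tkk_minus[OF cl'[unfolded u' v' bro.simps]]
  by (simp add: c a_minus_def B.M.minus_add End.M.minus_add B.M.a_ac End.M.a_ac B.smult_l_minus)
 show "bro u (r \<odot>\<^bsub>L0\<^esub> v) = r \<odot>\<^bsub>L0\<^esub> bro u v" if r: "r : carrier R" for r
  using ut vt r unfolding u' v'
  by (simp add: tkk_ops c beta_linear a_minus_def B.smult_r_distr End.smult_r_distr B.smult_r_minus End.smult_r_minus B.smult_assoc1[symmetric] B.R.m_comm)
 fix w assume w: "w : carrier L0"
 from w obtain s'' x'' D'' y'' t'' where w': "w = (s'', x'', D'', y'', t'')" and wt: "s'' : skew B" "x'' : CB" "D'' : Vs" "y'' : CB" "t'' : skew B"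
  by (rule tkk_cases)
 show "bro u (v \<oplus>\<^bsub>L0\<^esub> w) = bro u v \<oplus>\<^bsub>L0\<^esub> bro u w"
  using ut vt wt unfolding u' v' w'
  by (simp add: tkk_ops c beta_linear a_minus_def B.smult_r_distr B.smult_l_distr B.M.minus_add End.M.minus_add B.M.a_ac End.M.a_ac)
qed

lemma zeros:
 assumes "x : CB"
 shows "beta \<zero> x = \<zero>\<^bsub>R\<^esub>" "beta x \<zero> = \<zero>\<^bsub>R\<^esub>" "dl \<zero>\<^bsub>EB\<^esub> = \<zero>\<^bsub>R\<^esub>"
  "D : carrier EB ==> dm D \<zero> = \<zero>" "dm \<zero>\<^bsub>EB\<^esub> x = \<zero>" "D : carrier EB ==> D \<zero> = \<zero>"
  "V_op B \<zero> x = \<zero>\<^bsub>EB\<^esub>" "V_op B x \<zero> = \<zero>\<^bsub>EB\<^esub>" "\<zero> \<otimes> x = \<zero>" "x \<otimes> \<zero> = \<zero>"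
  "D : carrier EB ==> D \<otimes>\<^bsub>EB\<^esub> \<zero>\<^bsub>EB\<^esub> = \<zero>\<^bsub>EB\<^esub>" "D : carrier EB ==> \<zero>\<^bsub>EB\<^esub> \<otimes>\<^bsub>EB\<^esub> D = \<zero>\<^bsub>EB\<^esub>"
proof -
 note m = lin_maps_zero[OF B_facts(1) B_facts(1)] lin_maps_zero[OF B_facts(1) End.module_axioms] lin_maps_zero[OF End.module_axioms B_facts(1)]
  lin_maps_zero[OF End.module_axioms End.module_axioms] lin_maps_zero[OF B_facts(1) self_module[OF B.R.is_cring], simplified]
  lin_maps_zero[OF End.module_axioms self_module[OF B.R.is_cring], simplified]
 show "beta x \<zero> = \<zero>\<^bsub>R\<^esub>" using m(5)[of "beta x"] beta_lin(2)[OF assms] by (simp add: lin_forms_eq)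
 then show "beta \<zero> x = \<zero>\<^bsub>R\<^esub>" using beta_antisym[of "\<zero>" x] assms by simp
 show "dl \<zero>\<^bsub>EB\<^esub> = \<zero>\<^bsub>R\<^esub>" using m(6)[of dl] dl_lin by (simp add: lin_forms_eq)
 show "D : carrier EB ==> dm D \<zero> = \<zero>" by (rule m(1)[of "dm D"], rule lin_mapsI) (simp_all add: dm_linear)
 show "dm \<zero>\<^bsub>EB\<^esub> x = \<zero>" by (rule m(3)[of "%D. dm D x"], rule lin_mapsI) (simp_all add: dm_linear assms)
 show "D : carrier EB ==> D \<zero> = \<zero>" using m(1)[of D] end_lie_lin by blast
 show "V_op B \<zero> x = \<zero>\<^bsub>EB\<^esub>" by (rule m(2)[of "%y. V_op B y x"], rule lin_mapsI) (simp_all add: V_linear assms)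
 show "V_op B x \<zero> = \<zero>\<^bsub>EB\<^esub>" by (rule m(2)[of "%y. V_op B x y"], rule lin_mapsI) (simp_all add: V_linear assms)
 show "\<zero> \<otimes> x = \<zero>" by (rule m(1)[of "%y. y \<otimes> x"], rule lin_mapsI) (simp_all add: bil assms)
 show "x \<otimes> \<zero> = \<zero>" by (rule m(1)[of "%y. x \<otimes> y"], rule lin_mapsI) (simp_all add: bil assms)
 show "D : carrier EB ==> D \<otimes>\<^bsub>EB\<^esub> \<zero>\<^bsub>EB\<^esub> = \<zero>\<^bsub>EB\<^esub>" by (rule m(4)[of "%E. D \<otimes>\<^bsub>EB\<^esub> E"], rule lin_mapsI) (simp_all add: End_bil)
 show "D : carrier EB ==> \<zero>\<^bsub>EB\<^esub> \<otimes>\<^bsub>EB\<^esub> D = \<zero>\<^bsub>EB\<^esub>" by (rule m(4)[of "%E. E \<otimes>\<^bsub>EB\<^esub> D"], rule lin_mapsI) (simp_all add: End_bil)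
qed

definition br where "br = (\<lambda>u\<in>carrier L0. \<lambda>v\<in>carrier L0. bro u v)"

text \<open>Both sides are linear in s, and s = \<open>kap s\<close> times \<open>j\<close>, so the
  claim reduces to \<open>d x y\<close> and its symmetry in x and y.\<close>

lemma skew_act:
 assumes "x : CB" "y : CB" "s : skew B"
 shows "(s \<otimes> y) \<otimes> invol B x \<oplus> x \<otimes> (invol B y \<otimes> s) = dl (V_op B x y) \<odot> s"
  "\<ominus> ((s \<otimes> x) \<otimes> invol B y) \<ominus> y \<otimes> (invol B x \<otimes> s) = \<ominus> (dl (V_op B x y) \<odot> s)"
proof -
 have *: "(s \<otimes> y) \<otimes> invol B x \<oplus> x \<otimes> (invol B y \<otimes> s) = kap s \<odot> d x y" if "x : CB" "y : CB" for x y
  using that kap(1)[OF assms(3)] by (subst (1 2) kap(2)[OF assms(3)]) (simp add: d_def bil B.smult_r_distr)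
 have **: "kap s \<odot> d x y = dl (V_op B x y) \<odot> s"
  using assms kap(1)[OF assms(3)] by (subst (2) kap(2)[OF assms(3)]) (simp add: d_skew dl_V beta B.smult_assoc1[symmetric] B.R.m_comm)
 show "(s \<otimes> y) \<otimes> invol B x \<oplus> x \<otimes> (invol B y \<otimes> s) = dl (V_op B x y) \<odot> s"
  using *[OF assms(1,2)] ** by simp
 have "\<ominus> ((s \<otimes> x) \<otimes> invol B y \<oplus> y \<otimes> (invol B x \<otimes> s)) = \<ominus> (dl (V_op B x y) \<odot> s)"
  using *[OF assms(2,1)] ** d_facts(1)[OF assms(1,2)] by simp
 then show "\<ominus> ((s \<otimes> x) \<otimes> invol B y) \<ominus> y \<otimes> (invol B x \<otimes> s) = \<ominus> (dl (V_op B x y) \<odot> s)"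
  using assms by (simp add: a_minus_def B.M.minus_add skew_closed)
qed

lemma br_bracket: "tkk_bracket R B br"
proof -
 have z: "tkk_zero R B = \<zero>\<^bsub>L0\<^esub>" by (simp add: L0_def tkk_with_def)
 have br: "br u v = bro u v" if "u : carrier L0" "v : carrier L0" for u v using that by (simp add: br_def)
 have brc: "br u = (\<lambda>v\<in>carrier L0. bro u v)" if "u : carrier L0" for u using that by (simp add: br_def)
 have lin: "br u : lin_maps R (tkk_with R B br) (tkk_with R B br)" if u: "u : carrier L0" for u
  by (rule lin_mapsI; simp only: tkk_with_simps) (use u in \<open>simp_all add: br alt_bilD(1,3,4)[OF alt_bil_bro]\<close>)
 have zz: "\<ominus> \<zero> = \<zero>" "\<ominus>\<^bsub>EB\<^esub> \<zero>\<^bsub>EB\<^esub> = \<zero>\<^bsub>EB\<^esub>" by (rule B.M.minus_equality End.M.minus_equality; simp)+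
 note table = br in_p2_def in_m2_def in_p1_def in_m1_def in_0_def tkk_ops zeros zeros(3,4,6,11,12)[OF B.M.zero_closed] End_apply(3) beta dl_linear dm_linear dm_V D_facts V_linear End_bil
  V_span_closed skew_closed a_minus_def zz skew_act
 show ?thesis
  unfolding tkk_bracket_def Let_def tkk_with_simps z
 proof (intro conjI ballI)
  show "br : extensional (carrier L0)" by (simp add: br_def)
  fix u assume u: "u : carrier L0"
  show "br u : lin_maps R (tkk_with R B br) (tkk_with R B br) \<inter> extensional (carrier L0)"
   using lin[OF u] u by (simp add: brc)
  fix v assume v: "v : carrier L0"
  show "br u v = \<ominus>\<^bsub>L0\<^esub> br v u" using alt_bilD(2)[OF alt_bil_bro u v] u v by (simp add: br)
 next
  fix D E assume "D : Vs" "E : Vs"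
  then show "br (in_0 R B D) (in_0 R B E) = in_0 R B (D \<otimes>\<^bsub>EB\<^esub> E)" by (simp add: table)
 next
  fix x y assume x: "x : CB" and y: "y : CB"
  show "br (in_p1 R B x) (in_p1 R B y) = in_p2 R B (x \<otimes> invol B y \<ominus> y \<otimes> invol B x)"
   "br (in_m1 R B x) (in_m1 R B y) = in_m2 R B (x \<otimes> invol B y \<ominus> y \<otimes> invol B x)"
   unfolding beta(2)[OF x y] using x y by (simp_all add: table)
  show "br (in_p1 R B x) (in_m1 R B y) = in_0 R B (V_op B x y)" using x y by (simp add: table)
  fix z assume z: "z : CB"
  show "br (in_0 R B (V_op B x y)) (in_p1 R B z) = in_p1 R B (V_op B x y z)"
   "br (in_0 R B (V_op B x y)) (in_m1 R B z) = in_m1 R B (\<ominus> V_op B y x z)"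
   using x y z by (simp_all add: table)
 next
  fix x y s assume "x : CB" "y : CB" "s : skew B"
  then show "br (in_0 R B (V_op B x y)) (in_p2 R B s) = in_p2 R B
     ((s \<otimes> y) \<otimes> invol B x \<oplus> x \<otimes> (invol B y \<otimes> s))"
   "br (in_0 R B (V_op B x y)) (in_m2 R B s) = in_m2 R B
     (\<ominus> ((s \<otimes> x) \<otimes> invol B y) \<ominus> y \<otimes> (invol B x \<otimes> s))"
   unfolding skew_act[OF \<open>x : CB\<close> \<open>y : CB\<close> \<open>s : skew B\<close>] by (simp_all add: table)
 next
  fix s t assume "s : skew B" "t : skew B"
  then show "br (in_p2 R B s) (in_m2 R B t) = in_0 R B (V_op B (s \<otimes> t) \<one>)"
   "br (in_p2 R B s) (in_p2 R B t) = \<zero>\<^bsub>L0\<^esub>" "br (in_m2 R B s) (in_m2 R B t) = \<zero>\<^bsub>L0\<^esub>"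
   by (simp_all add: table)
 next
  fix s x assume "s : skew B" "x : CB"
  then show "br (in_p2 R B s) (in_m1 R B x) = in_p1 R B (s \<otimes> x)" "br (in_m2 R B s) (in_p1 R B x) = in_m1 R B (s \<otimes> x)"
   "br (in_p2 R B s) (in_p1 R B x) = \<zero>\<^bsub>L0\<^esub>" "br (in_m2 R B s) (in_m1 R B x) = \<zero>\<^bsub>L0\<^esub>"
   by (simp_all add: table)
 qed
qed

lemma tkk_eq: "tkk R B = tkk_with R B br"
 unfolding tkk_def using the_equality[of "tkk_bracket R B" br] br_bracket tkk_bracket_unique by metis

lemma tkk_simps:
 "carrier (tkk R B) = carrier L0" "add (tkk R B) = add L0" "zero (tkk R B) = zero L0"
 "smult (tkk R B) = smult L0" "a_inv (tkk R B) = a_inv L0" "mult (tkk R B) = br"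
 by (simp_all only: tkk_eq tkk_with_simps)

lemma tkk_module: "module R (tkk R B)"
 unfolding tkk_eq by (rule tkk_with_module)

lemmas br_facts = alt_bilD[OF tkk_bracket_alt(1)[OF br_bracket]]
lemmas br_table = tkk_bracketD[OF br_bracket]

lemma tkk_bilinear: "bilinear_mult R (tkk R B)"
 unfolding bilinear_mult_def
 by (intro ballI conjI; rule lin_mapsI; simp only: tkk_simps; rule br_facts; assumption)

end

section \<open>An axiomatic model of the extended Lie algebra\<close>

lemma lin_maps_add:
 assumes "module R M" "module R N" "f : lin_maps R M N" "g : lin_maps R M N"
 shows "(%x. f x \<oplus>\<^bsub>N\<^esub> g x) : lin_maps R M N"
proof -
 interpret N: module R N by fact
 note d = lin_mapsD[OF assms(3)] lin_mapsD[OF assms(4)]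
 show ?thesis by (rule lin_mapsI) (simp_all add: d N.M.a_ac N.smult_r_distr)
qed

lemma lin_maps_finsum:
 assumes "module R M" "module R N" "!!k. k : A ==> f k : lin_maps R M N" "finite A"
 shows "(%x. \<Oplus>\<^bsub>N\<^esub>k\<in>A. f k x) : lin_maps R M N"
 using assms(4,3)
proof (induction A rule: finite_induct)
 case empty
 interpret N: module R N by fact
 show ?case by (rule lin_mapsI) simp_all
next
 case (insert a A)
 interpret N: module R N by fact
 interpret M: module R M by fact
 have "(%x. f a x \<oplus>\<^bsub>N\<^esub> (\<Oplus>\<^bsub>N\<^esub>k\<in>A. f k x)) : lin_maps R M N"
  using insert by (intro lin_maps_add assms(1,2)) auto
 then show ?case
 proof (rule lin_maps_cong[OF _ assms(1)])
  fix x assume "x : carrier M"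
  then show "f a x \<oplus>\<^bsub>N\<^esub> (\<Oplus>\<^bsub>N\<^esub>k\<in>A. f k x) = (\<Oplus>\<^bsub>N\<^esub>k\<in>insert a A. f k x)"
   using insert(1,2) lin_mapsD(1)[OF insert(4)] by (subst N.M.finsum_insert) auto
 qed
qed

text \<open>What is used of \<open>B_S\<close> and \<open>L_S\<close>. The identities are linear in
  each variable, so they pass from \<open>R\<close> to \<open>S\<close> by checking pure tensors.
  The maps \<open>cp\<close>, \<open>vp\<close>, \<open>vm\<close>, \<open>cm\<close> are
  coordinates in degrees 2, 1, -1, -2; degree zero has no coordinates and is reached only through
  the brackets of \<open>Ip x\<close> with \<open>Im y\<close>. The term
  \<open>cp (Ip (j y) \<otimes> Ip x)\<close> is the degree-two action \<delta> of such a
  bracket.\<close>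

locale tkk_model =
 fixes S :: "('s, 'w) ring_scheme" and L :: "('s, 'l, 'x) module_scheme" (structure) and B :: "('s, 'c) inv_algebra"
  and j \<mu> Jp Jm Ip Im cp cm vp vm and n :: nat and e e'
 assumes L_module: "module S L" and L_bil: "bilinear_mult S L"
  and B_module: "module S B" and B_bil: "bilinear_mult S B"
  and antisym: "!!u v. u : carrier L ==> v : carrier L ==> u \<otimes>\<^bsub>L\<^esub> v = \<ominus>\<^bsub>L\<^esub> (v \<otimes>\<^bsub>L\<^esub> u)"
  and B_closed [simp]: "j : carrier B" "\<one>\<^bsub>B\<^esub> : carrier B" "!!x. x : carrier B ==> invol B x : carrier B"
  and units: "\<mu> : Units S" "[(6::nat)] \<cdot>\<^bsub>S\<^esub> \<one>\<^bsub>S\<^esub> : Units S"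
  and J_closed [simp]: "Jp : carrier L" "Jm : carrier L"
  and I_lin: "Ip : lin_maps S B L" "Im : lin_maps S B L"
  and c_lin: "cp : lin_forms S L" "cm : lin_forms S L"
  and v_lin: "vp : lin_maps S L B" "vm : lin_maps S L B"
  and proj_J [simp]: "cp Jp = \<one>\<^bsub>S\<^esub>" "cm Jp = \<zero>\<^bsub>S\<^esub>" "vp Jp = \<zero>\<^bsub>B\<^esub>" "vm Jp = \<zero>\<^bsub>B\<^esub>"
   "cp Jm = \<zero>\<^bsub>S\<^esub>" "cm Jm = \<one>\<^bsub>S\<^esub>" "vp Jm = \<zero>\<^bsub>B\<^esub>" "vm Jm = \<zero>\<^bsub>B\<^esub>"
  and proj_I [simp]: "!!x. x : carrier B ==> cp (Ip x) = \<zero>\<^bsub>S\<^esub>" "!!x. x : carrier B ==> cm (Ip x) = \<zero>\<^bsub>S\<^esub>"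
   "!!x. x : carrier B ==> vp (Ip x) = x" "!!x. x : carrier B ==> vm (Ip x) = \<zero>\<^bsub>B\<^esub>"
   "!!x. x : carrier B ==> cp (Im x) = \<zero>\<^bsub>S\<^esub>" "!!x. x : carrier B ==> cm (Im x) = \<zero>\<^bsub>S\<^esub>"
   "!!x. x : carrier B ==> vp (Im x) = \<zero>\<^bsub>B\<^esub>" "!!x. x : carrier B ==> vm (Im x) = x"
  and proj_V [simp]: "!!x y. x : carrier B ==> y : carrier B ==> cp (Ip x \<otimes>\<^bsub>L\<^esub> Im y) = \<zero>\<^bsub>S\<^esub>"
   "!!x y. x : carrier B ==> y : carrier B ==> cm (Ip x \<otimes>\<^bsub>L\<^esub> Im y) = \<zero>\<^bsub>S\<^esub>"
   "!!x y. x : carrier B ==> y : carrier B ==> vp (Ip x \<otimes>\<^bsub>L\<^esub> Im y) = \<zero>\<^bsub>B\<^esub>"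
   "!!x y. x : carrier B ==> y : carrier B ==> vm (Ip x \<otimes>\<^bsub>L\<^esub> Im y) = \<zero>\<^bsub>B\<^esub>"
  and generated: "carrier L \<subseteq> lin_span S L ({Jp, Jm} \<union> Ip ` carrier B \<union> Im ` carrier B \<union>
    {Ip x \<otimes>\<^bsub>L\<^esub> Im y | x y. x : carrier B \<and> y : carrier B})"
  and table_J: "Jp \<otimes>\<^bsub>L\<^esub> Jm = \<mu> \<odot>\<^bsub>L\<^esub> (Ip \<one>\<^bsub>B\<^esub> \<otimes>\<^bsub>L\<^esub> Im \<one>\<^bsub>B\<^esub>)" "Jp \<otimes>\<^bsub>L\<^esub> Jp = \<zero>\<^bsub>L\<^esub>" "Jm \<otimes>\<^bsub>L\<^esub> Jm = \<zero>\<^bsub>L\<^esub>"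
   "!!x. x : carrier B ==> Jp \<otimes>\<^bsub>L\<^esub> Ip x = \<zero>\<^bsub>L\<^esub>" "!!x. x : carrier B ==> Jm \<otimes>\<^bsub>L\<^esub> Im x = \<zero>\<^bsub>L\<^esub>"
   "!!x. x : carrier B ==> Jp \<otimes>\<^bsub>L\<^esub> Im x = Ip (j \<otimes>\<^bsub>B\<^esub> x)" "!!x. x : carrier B ==> Jm \<otimes>\<^bsub>L\<^esub> Ip x = Im (j \<otimes>\<^bsub>B\<^esub> x)"
  and table_I: "!!x y. x : carrier B ==> y : carrier B ==> Ip x \<otimes>\<^bsub>L\<^esub> Ip y = cp (Ip x \<otimes>\<^bsub>L\<^esub> Ip y) \<odot>\<^bsub>L\<^esub> Jp"
   "!!x y. x : carrier B ==> y : carrier B ==> Im x \<otimes>\<^bsub>L\<^esub> Im y = cp (Ip x \<otimes>\<^bsub>L\<^esub> Ip y) \<odot>\<^bsub>L\<^esub> Jm"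
  and table_V: "!!x y z. x : carrier B ==> y : carrier B ==> z : carrier B ==> (Ip x \<otimes>\<^bsub>L\<^esub> Im y) \<otimes>\<^bsub>L\<^esub> Ip z = Ip (V_op B x y z)"
   "!!x y z. x : carrier B ==> y : carrier B ==> z : carrier B ==> (Ip x \<otimes>\<^bsub>L\<^esub> Im y) \<otimes>\<^bsub>L\<^esub> Im z = \<ominus>\<^bsub>L\<^esub> Im (V_op B y x z)"
   "!!x y. x : carrier B ==> y : carrier B ==>
     (Ip x \<otimes>\<^bsub>L\<^esub> Im y) \<otimes>\<^bsub>L\<^esub> Jp = cp (Ip (j \<otimes>\<^bsub>B\<^esub> y) \<otimes>\<^bsub>L\<^esub> Ip x) \<odot>\<^bsub>L\<^esub> Jp"
   "!!x y. x : carrier B ==> y : carrier B ==>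
     (Ip x \<otimes>\<^bsub>L\<^esub> Im y) \<otimes>\<^bsub>L\<^esub> Jm = \<ominus>\<^bsub>L\<^esub> (cp (Ip (j \<otimes>\<^bsub>B\<^esub> y) \<otimes>\<^bsub>L\<^esub> Ip x) \<odot>\<^bsub>L\<^esub> Jm)"
   "!!x y z w. x : carrier B ==> y : carrier B ==> z : carrier B ==> w : carrier B ==>
     (Ip x \<otimes>\<^bsub>L\<^esub> Im y) \<otimes>\<^bsub>L\<^esub> (Ip z \<otimes>\<^bsub>L\<^esub> Im w) = Ip (V_op B x y z) \<otimes>\<^bsub>L\<^esub> Im w \<ominus>\<^bsub>L\<^esub> Ip z \<otimes>\<^bsub>L\<^esub> Im (V_op B y x w)"
  and jj: "!!x. x : carrier B ==> j \<otimes>\<^bsub>B\<^esub> (j \<otimes>\<^bsub>B\<^esub> x) = \<mu> \<odot>\<^bsub>B\<^esub> x" "j \<otimes>\<^bsub>B\<^esub> j = \<mu> \<odot>\<^bsub>B\<^esub> \<one>\<^bsub>B\<^esub>"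
  and dl_sym: "!!x y. x : carrier B ==> y : carrier B ==>
   cp (Ip (j \<otimes>\<^bsub>B\<^esub> y) \<otimes>\<^bsub>L\<^esub> Ip x) = cp (Ip (j \<otimes>\<^bsub>B\<^esub> x) \<otimes>\<^bsub>L\<^esub> Ip y)"
  and V_flip: "!!x y z. x : carrier B ==> y : carrier B ==> z : carrier B ==>
   V_op B y x (j \<otimes>\<^bsub>B\<^esub> z) \<oplus>\<^bsub>B\<^esub> j \<otimes>\<^bsub>B\<^esub> V_op B x y z = cp (Ip (j \<otimes>\<^bsub>B\<^esub> y) \<otimes>\<^bsub>L\<^esub> Ip x) \<odot>\<^bsub>B\<^esub> (j \<otimes>\<^bsub>B\<^esub> z)"
  and V_one: "!!z. z : carrier B ==> V_op B \<one>\<^bsub>B\<^esub> \<one>\<^bsub>B\<^esub> z = z"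
  and form: "!!x y. x : carrier B ==> y : carrier B ==>
   x \<otimes>\<^bsub>B\<^esub> invol B y \<ominus>\<^bsub>B\<^esub> y \<otimes>\<^bsub>B\<^esub> invol B x = cp (Ip x \<otimes>\<^bsub>L\<^esub> Ip y) \<odot>\<^bsub>B\<^esub> j"
   "cp (Ip (j \<otimes>\<^bsub>B\<^esub> \<one>\<^bsub>B\<^esub>) \<otimes>\<^bsub>L\<^esub> Ip \<one>\<^bsub>B\<^esub>) = [(2::nat)] \<cdot>\<^bsub>S\<^esub> \<one>\<^bsub>S\<^esub>"
  and e_closed: "e : {..<n} \<rightarrow> carrier B" "e' : {..<n} \<rightarrow> carrier B"
  and casimir: "!!x y. x : carrier B ==> y : carrier B ==> (\<Oplus>\<^bsub>L\<^esub>k\<in>{..<n}. Ip (V_op B x y (e k)) \<otimes>\<^bsub>L\<^esub> Im (e' k)) =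
   ([(12::nat)] \<cdot>\<^bsub>S\<^esub> \<one>\<^bsub>S\<^esub>) \<odot>\<^bsub>L\<^esub> (Ip x \<otimes>\<^bsub>L\<^esub> Im y) \<oplus>\<^bsub>L\<^esub>
   ([(8::nat)] \<cdot>\<^bsub>S\<^esub> \<one>\<^bsub>S\<^esub> \<otimes>\<^bsub>S\<^esub> cp (Ip (j \<otimes>\<^bsub>B\<^esub> y) \<otimes>\<^bsub>L\<^esub> Ip x)) \<odot>\<^bsub>L\<^esub> (Ip \<one>\<^bsub>B\<^esub> \<otimes>\<^bsub>L\<^esub> Im \<one>\<^bsub>B\<^esub>)"
begin

abbreviation (input) "CB \<equiv> carrier B"
abbreviation (input) "CL \<equiv> carrier L"

sublocale L: module S L by (rule L_module)
sublocale B: module S B by (rule B_module)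

definition bt where "bt x y = cp (Ip x \<otimes> Ip y)"
abbreviation V where "V x y \<equiv> Ip x \<otimes>\<^bsub>L\<^esub> Im y"
abbreviation \<zeta> where "\<zeta> \<equiv> V \<one>\<^bsub>B\<^esub> \<one>\<^bsub>B\<^esub>"
abbreviation nt :: "nat => 's" where "nt k \<equiv> [k] \<cdot>\<^bsub>S\<^esub> \<one>\<^bsub>S\<^esub>"
abbreviation it :: "int => 's" where "it k \<equiv> [k] \<cdot>\<^bsub>S\<^esub> \<one>\<^bsub>S\<^esub>"

lemmas brack = bilinear_multD[OF L_bil]
lemmas prod = bilinear_multD[OF B_bil]
lemmas I_facts = lin_mapsD[OF I_lin(1)] lin_mapsD[OF I_lin(2)]
lemmas v_facts = lin_mapsD[OF v_lin(1)] lin_mapsD[OF v_lin(2)]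
lemmas c_facts = lin_mapsD[OF c_lin(1)[unfolded lin_forms_eq], simplified] lin_mapsD[OF c_lin(2)[unfolded lin_forms_eq], simplified]
lemmas closed = I_facts(1,4) v_facts(1,4) c_facts(1,4) brack(1) prod(1)
lemmas linear = I_facts v_facts c_facts brack prod
lemmas I_minus = lin_maps_minus[OF B_module L_module I_lin(1)] lin_maps_minus[OF B_module L_module I_lin(2)]
lemmas v_minus = lin_maps_minus[OF L_module B_module v_lin(1)] lin_maps_minus[OF L_module B_module v_lin(2)]
lemma c_minus: "u : CL ==> cp (\<ominus> u) = \<ominus>\<^bsub>S\<^esub> cp u" "u : CL ==> cm (\<ominus> u) = \<ominus>\<^bsub>S\<^esub> cm u"
 by (simp_all add: module_neg_smult[OF L_module] c_facts L.R.l_minus)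

lemmas zero = lin_maps_zero[OF B_module L_module I_lin(1)] lin_maps_zero[OF B_module L_module I_lin(2)]
 lin_maps_zero[OF L_module B_module v_lin(1)] lin_maps_zero[OF L_module B_module v_lin(2)]
 lin_maps_zero[OF L_module self_module[OF L.R.is_cring] c_lin(1)[unfolded lin_forms_eq], simplified]
 lin_maps_zero[OF L_module self_module[OF L.R.is_cring] c_lin(2)[unfolded lin_forms_eq], simplified]

lemma brack_minus:
 assumes "u : CL" "v : CL"
 shows "u \<otimes> (\<ominus> v) = \<ominus> (u \<otimes> v)" "(\<ominus> u) \<otimes> v = \<ominus> (u \<otimes> v)"
 using assms by (simp_all add: module_neg_smult[OF L_module] brack)

lemma brack_zero [simp]:
 assumes "u : CL"
 shows "u \<otimes> \<zero> = \<zero>" "\<zero> \<otimes> u = \<zero>"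
 using brack(4)[of u "\<zero>" "\<zero>\<^bsub>S\<^esub>"] brack(5)[of "\<zero>" u "\<zero>\<^bsub>S\<^esub>"] assms brack(1) by simp_all

declare closed [simp]

lemma gen_induct [consumes 1, case_names Jp Jm Ip Im V zero add smult]:
 assumes "z : CL" "P Jp" "P Jm" "!!x. x : CB ==> P (Ip x)" "!!x. x : CB ==> P (Im x)"
  "!!x y. x : CB ==> y : CB ==> P (V x y)" "P \<zero>"
  "!!x y. x : CL ==> y : CL ==> P x ==> P y ==> P (x \<oplus> y)"
  "!!r x. r : carrier S ==> x : CL ==> P x ==> P (r \<odot> x)"
 shows "P z"
proof -
 let ?X = "{Jp, Jm} \<union> Ip ` CB \<union> Im ` CB \<union> {V x y | x y. x : CB \<and> y : CB}"
 have "z : lin_span S L ?X" using generated assms(1) by blast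
 moreover have "?X \<subseteq> CL" by auto
 ultimately show ?thesis
  by (rule lin_span_induct[OF _ L_module]) (use assms(2-) in auto)
qed

lemma lin_maps_eqI:
 assumes "f : lin_maps S L N" "g : lin_maps S L N" "module S N" "z : CL"
  "f Jp = g Jp" "f Jm = g Jm" "!!x. x : CB ==> f (Ip x) = g (Ip x)" "!!x. x : CB ==> f (Im x) = g (Im x)"
  "!!x y. x : CB ==> y : CB ==> f (V x y) = g (V x y)"
 shows "f z = g z"
 using assms(4)
 by (induction rule: gen_induct)
  (use assms in \<open>simp_all add: lin_mapsD[OF assms(1)] lin_mapsD[OF assms(2)] lin_maps_zero[OF L_module]\<close>)

lemma nu [simp]: "inv\<^bsub>S\<^esub> \<mu> : carrier S" "\<mu> : carrier S" "\<mu> \<otimes>\<^bsub>S\<^esub> inv\<^bsub>S\<^esub> \<mu> = \<one>\<^bsub>S\<^esub>" "inv\<^bsub>S\<^esub> \<mu> \<otimes>\<^bsub>S\<^esub> \<mu> = \<one>\<^bsub>S\<^esub>"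
 using units(1) by auto

lemma it: "it k : carrier S" "it (k + l) = it k \<oplus>\<^bsub>S\<^esub> it l" "it (- k) = \<ominus>\<^bsub>S\<^esub> it k" "it (k * l) = it k \<otimes>\<^bsub>S\<^esub> it l"
 "it 1 = \<one>\<^bsub>S\<^esub>" "it 0 = \<zero>\<^bsub>S\<^esub>" "it (int m) = nt m"
proof -
 show "it (k + l) = it k \<oplus>\<^bsub>S\<^esub> it l" using L.R.add.int_pow_mult[of "\<one>\<^bsub>S\<^esub>" k l] by simp
 show "it (- k) = \<ominus>\<^bsub>S\<^esub> it k" using L.R.add.int_pow_neg[of "\<one>\<^bsub>S\<^esub>" k] by (simp add: a_inv_def)
 have "it k \<otimes>\<^bsub>S\<^esub> it l = [k] \<cdot>\<^bsub>S\<^esub> (it l)" using L.R.add_pow_ldistr_int[of "\<one>\<^bsub>S\<^esub>" "it l" k] by simp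
 also have "\<dots> = it (l * k)" using L.R.add.int_pow_pow[of "\<one>\<^bsub>S\<^esub>" k l] by simp
 finally show "it (k * l) = it k \<otimes>\<^bsub>S\<^esub> it l" by (simp add: mult.commute)
 show "it 1 = \<one>\<^bsub>S\<^esub>" "it (int m) = nt m" using add_pow_int_ge[of 1 S "\<one>\<^bsub>S\<^esub>"] add_pow_int_ge[of "int m" S "\<one>\<^bsub>S\<^esub>"] by simp_all
 show "it 0 = \<zero>\<^bsub>S\<^esub>" using add_pow_int_ge[of 0 S "\<one>\<^bsub>S\<^esub>"] by simp
qed simp_all

text \<open>216 is the cube of 6. Its divisors include 1, 2, 3 and 4, up to sign the differences of
  distinct degrees between -2 and 2, as well as the Casimir constant 12.\<close>

lemma it_unit:
 assumes "k dvd 216"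
 shows "it k : Units S"
proof -
 obtain l where l: "216 = k * l" using assms by (elim dvdE)
 have six: "it 6 : Units S" using units(2) it(7)[of 6] by simp
 have "it 216 = it 6 \<otimes>\<^bsub>S\<^esub> it 6 \<otimes>\<^bsub>S\<^esub> it 6" using it(4)[of 6 6] it(4)[of 36 6] by simp
 then have u: "it k \<otimes>\<^bsub>S\<^esub> it l : Units S" using six l it(4)[of k l] by (simp add: L.R.Units_m_closed)
 let ?i = "inv\<^bsub>S\<^esub> (it k \<otimes>\<^bsub>S\<^esub> it l)"
 have i: "?i : carrier S" "it k \<otimes>\<^bsub>S\<^esub> it l \<otimes>\<^bsub>S\<^esub> ?i = \<one>\<^bsub>S\<^esub>" using u by auto
 have "it k \<otimes>\<^bsub>S\<^esub> (it l \<otimes>\<^bsub>S\<^esub> ?i) = \<one>\<^bsub>S\<^esub>" using i it(1) by (simp add: L.R.m_assoc)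
 moreover have "it l \<otimes>\<^bsub>S\<^esub> ?i \<otimes>\<^bsub>S\<^esub> it k = \<one>\<^bsub>S\<^esub>" using i it(1) by (simp add: L.R.m_ac)
 ultimately show ?thesis using i(1) it(1) unfolding Units_def by (intro CollectI conjI bexI[of _ "it l \<otimes>\<^bsub>S\<^esub> ?i"]) auto
qed

lemma unit_cancel:
 assumes "u : Units S" "module S M" "x : carrier M" "u \<odot>\<^bsub>M\<^esub> x = \<zero>\<^bsub>M\<^esub>"
 shows "x = \<zero>\<^bsub>M\<^esub>"
proof -
 interpret M: module S M by fact
 have "inv\<^bsub>S\<^esub> u \<odot>\<^bsub>M\<^esub> (u \<odot>\<^bsub>M\<^esub> x) = x" using assms(1,3) by (simp add: M.smult_assoc1[symmetric] L.R.Units_closed)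
 then show ?thesis using assms by simp
qed

lemma unit_cancel_eq:
 assumes "u : Units S" "module S M" "x : carrier M" "y : carrier M" "u \<odot>\<^bsub>M\<^esub> x = u \<odot>\<^bsub>M\<^esub> y"
 shows "x = y"
proof -
 interpret M: module S M by fact
 have *: "inv\<^bsub>S\<^esub> u \<odot>\<^bsub>M\<^esub> (u \<odot>\<^bsub>M\<^esub> x) = x" "inv\<^bsub>S\<^esub> u \<odot>\<^bsub>M\<^esub> (u \<odot>\<^bsub>M\<^esub> y) = y"
  using assms(1,3,4) by (simp_all add: M.smult_assoc1[symmetric] L.R.Units_closed)
 show ?thesis by (subst *(1)[symmetric], subst *(2)[symmetric], simp only: assms(5))
qed

lemma V_op_lin: "x : CB ==> y : CB ==> V_op B x y : lin_maps S B B"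
 by (rule lin_mapsI)
  (simp_all add: V_op_def prod a_minus_def B.M.minus_add B.M.a_ac B.smult_r_distr B.smult_r_minus)

lemmas V_op_facts = lin_mapsD[OF V_op_lin]

lemma V_closed [simp]: "x : CB ==> y : CB ==> z : CB ==> V_op B x y z : CB"
 by (rule V_op_facts(1))

lemma bt:
 assumes "x : CB" "y : CB"
 shows "bt x y : carrier S" "r : carrier S ==> bt (r \<odot>\<^bsub>B\<^esub> x) y = r \<otimes>\<^bsub>S\<^esub> bt x y"
  "r : carrier S ==> bt x (r \<odot>\<^bsub>B\<^esub> y) = r \<otimes>\<^bsub>S\<^esub> bt x y" "bt x y = \<ominus>\<^bsub>S\<^esub> bt y x"
 using assms c_minus(1)[of "Ip y \<otimes> Ip x"] antisym[of "Ip x" "Ip y"] by (simp_all add: bt_def linear)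

lemma bt_two: "bt (j \<otimes>\<^bsub>B\<^esub> \<one>\<^bsub>B\<^esub>) \<one>\<^bsub>B\<^esub> = it 2"
 using form(2) it(7)[of 2] by (simp add: bt_def)

lemma table:
 assumes "x : CB"
 shows "Jp \<otimes> Jm = \<mu> \<odot> \<zeta>" "Jp \<otimes> Jp = \<zero>" "Jm \<otimes> Jm = \<zero>"
   "Jp \<otimes> Ip x = \<zero>" "Jm \<otimes> Im x = \<zero>"
   "Jp \<otimes> Im x = Ip (j \<otimes>\<^bsub>B\<^esub> x)" "Jm \<otimes> Ip x = Im (j \<otimes>\<^bsub>B\<^esub> x)"
  "y : CB ==> Ip x \<otimes> Ip y = bt x y \<odot> Jp" "y : CB ==> Im x \<otimes> Im y = bt x y \<odot> Jm"
  "y : CB ==> z : CB ==> V x y \<otimes> Ip z = Ip (V_op B x y z)"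
  "y : CB ==> z : CB ==> V x y \<otimes> Im z = \<ominus> Im (V_op B y x z)"
  "y : CB ==> V x y \<otimes> Jp = bt (j \<otimes>\<^bsub>B\<^esub> y) x \<odot> Jp"
  "y : CB ==> V x y \<otimes> Jm = \<ominus> (bt (j \<otimes>\<^bsub>B\<^esub> y) x \<odot> Jm)"
  "y : CB ==> z : CB ==> w : CB ==>
    V x y \<otimes> V z w = V (V_op B x y z) w \<ominus> V z (V_op B y x w)"
 using assms table_I(1)[of x y] by (simp_all add: bt_def table_J table_I(2) table_V)

lemma table':
 assumes "x : CB"
 shows "Jm \<otimes> Jp = \<ominus> (\<mu> \<odot> \<zeta>)"
   "Ip x \<otimes> Jp = \<zero>" "Im x \<otimes> Jm = \<zero>"
   "Im x \<otimes> Jp = \<ominus> Ip (j \<otimes>\<^bsub>B\<^esub> x)" "Ip x \<otimes> Jm = \<ominus> Im (j \<otimes>\<^bsub>B\<^esub> x)"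
  "y : CB ==> Im y \<otimes> Ip x = \<ominus> V x y"
  "y : CB ==> z : CB ==> Ip z \<otimes> V x y = \<ominus> Ip (V_op B x y z)"
  "y : CB ==> z : CB ==> Im z \<otimes> V x y = Im (V_op B y x z)"
  "y : CB ==> Jp \<otimes> V x y = \<ominus> (bt (j \<otimes>\<^bsub>B\<^esub> y) x \<odot> Jp)"
  "y : CB ==> Jm \<otimes> V x y = bt (j \<otimes>\<^bsub>B\<^esub> y) x \<odot> Jm"
proof -
 have zz: "\<ominus> \<zero> = \<zero>" by (rule L.M.minus_equality) simp_all
 note a = antisym[of Jm Jp] antisym[of "Ip x" Jp] antisym[of "Im x" Jm] antisym[of "Im x" Jp] antisym[of "Ip x" Jm]
  antisym[of "Im y" "Ip x"] antisym[of "Ip z" "V x y"] antisym[of "Im z" "V x y"] antisym[of Jp "V x y"] antisym[of Jm "V x y"]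
 show "Jm \<otimes> Jp = \<ominus> (\<mu> \<odot> \<zeta>)"
   "Ip x \<otimes> Jp = \<zero>" "Im x \<otimes> Jm = \<zero>"
   "Im x \<otimes> Jp = \<ominus> Ip (j \<otimes>\<^bsub>B\<^esub> x)" "Ip x \<otimes> Jm = \<ominus> Im (j \<otimes>\<^bsub>B\<^esub> x)"
  "y : CB ==> Im y \<otimes> Ip x = \<ominus> V x y"
  "y : CB ==> z : CB ==> Ip z \<otimes> V x y = \<ominus> Ip (V_op B x y z)"
  "y : CB ==> z : CB ==> Im z \<otimes> V x y = Im (V_op B y x z)"
  "y : CB ==> Jp \<otimes> V x y = \<ominus> (bt (j \<otimes>\<^bsub>B\<^esub> y) x \<odot> Jp)"
  "y : CB ==> Jm \<otimes> V x y = bt (j \<otimes>\<^bsub>B\<^esub> y) x \<odot> Jm"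
  using assms by (simp_all add: a table table(1-3)[OF assms] zz bt(1))
qed

text \<open>\<zeta> is the degree operator because \<open>V_op B \<one> \<one>\<close> is the
  identity of \<open>B\<close>. The bracket with a generator \<open>V x y\<close> vanishes, as the
  two terms of the commutator rule coincide, so only the four coordinates appear.\<close>

lemma zeta:
 assumes z: "z : CL"
 shows "\<zeta> \<otimes> z = ((it 2 \<otimes>\<^bsub>S\<^esub> cp z) \<odot> Jp \<oplus> Ip (vp z)) \<oplus> (it (- 1) \<odot> Im (vm z) \<oplus> (it (- 2) \<otimes>\<^bsub>S\<^esub> cm z) \<odot> Jm)"
 using z
proof (induction rule: gen_induct)
 note t = table table(1-3)[OF B_closed(1)] V_one bt_two it(1,3,5,6) zero L.smult_l_minus
 {
  case Jp
  show ?case by (simp add: t)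
 next
  case Jm
  show ?case by (simp add: t)
 next
  case (Ip x)
  then show ?case by (simp add: t)
 next
  case (Im x)
  then show ?case by (simp add: t)
 next
  case (V x y)
  then show ?case by (simp add: t a_minus_def L.M.r_neg)
 next
  case zero
  then show ?case by (simp add: t)
 next
  case (add x y)
  then show ?case by (simp add: linear it(1) L.R.r_distr L.smult_l_distr L.smult_r_distr L.M.a_ac)
 next
  case (smult r x)
  then show ?case by (simp add: linear it(1) L.smult_r_distr L.smult_assoc1[symmetric] L.R.m_ac)
 }
qed

lemma zeta_eigen:
 assumes z: "z : CL" and c: "\<zeta> \<otimes> z = it c \<odot> z"
 shows "it (2 - c) \<otimes>\<^bsub>S\<^esub> cp z = \<zero>\<^bsub>S\<^esub>" "it (1 - c) \<odot>\<^bsub>B\<^esub> vp z = \<zero>\<^bsub>B\<^esub>"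
  "it (- 1 - c) \<odot>\<^bsub>B\<^esub> vm z = \<zero>\<^bsub>B\<^esub>" "it (- 2 - c) \<otimes>\<^bsub>S\<^esub> cm z = \<zero>\<^bsub>S\<^esub>"
proof -
 let ?w = "((it 2 \<otimes>\<^bsub>S\<^esub> cp z) \<odot> Jp \<oplus> Ip (vp z)) \<oplus> (it (- 1) \<odot> Im (vm z) \<oplus> (it (- 2) \<otimes>\<^bsub>S\<^esub> cm z) \<odot> Jm)"
 have w: "?w = it c \<odot> z" using zeta[OF z] c by (simp only:)
 have *: "it (a - c) = it a \<ominus>\<^bsub>S\<^esub> it c" for a
  using it(2)[of a "- c"] it(3)[of c] by (simp only: a_minus_def diff_conv_add_uminus)
 have s: "(it a \<ominus>\<^bsub>S\<^esub> it c) \<otimes>\<^bsub>S\<^esub> y = it a \<otimes>\<^bsub>S\<^esub> y \<ominus>\<^bsub>S\<^esub> it c \<otimes>\<^bsub>S\<^esub> y" if "y : carrier S" for a y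
  using that it(1) by (simp add: a_minus_def L.R.l_distr L.R.l_minus)
 have b: "(it a \<ominus>\<^bsub>S\<^esub> it c) \<odot>\<^bsub>B\<^esub> y = it a \<odot>\<^bsub>B\<^esub> y \<ominus>\<^bsub>B\<^esub> it c \<odot>\<^bsub>B\<^esub> y" if "y : CB" for a y
  using that it(1) by (simp add: a_minus_def B.smult_l_distr B.smult_l_minus)
 note l = linear it(1) z zero it(5)
 have "cp ?w = it 2 \<otimes>\<^bsub>S\<^esub> cp z" "vp ?w = it 1 \<odot>\<^bsub>B\<^esub> vp z" "vm ?w = it (- 1) \<odot>\<^bsub>B\<^esub> vm z" "cm ?w = it (- 2) \<otimes>\<^bsub>S\<^esub> cm z"
  by (simp_all add: l)
 then have e: "it 2 \<otimes>\<^bsub>S\<^esub> cp z = it c \<otimes>\<^bsub>S\<^esub> cp z" "it 1 \<odot>\<^bsub>B\<^esub> vp z = it c \<odot>\<^bsub>B\<^esub> vp z" "it (- 1) \<odot>\<^bsub>B\<^esub> vm z = it c \<odot>\<^bsub>B\<^esub> vm z"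
  "it (- 2) \<otimes>\<^bsub>S\<^esub> cm z = it c \<otimes>\<^bsub>S\<^esub> cm z"
  unfolding w using it(1) z by (simp_all add: linear)
 show "it (2 - c) \<otimes>\<^bsub>S\<^esub> cp z = \<zero>\<^bsub>S\<^esub>" "it (1 - c) \<odot>\<^bsub>B\<^esub> vp z = \<zero>\<^bsub>B\<^esub>"
  "it (- 1 - c) \<odot>\<^bsub>B\<^esub> vm z = \<zero>\<^bsub>B\<^esub>" "it (- 2 - c) \<otimes>\<^bsub>S\<^esub> cm z = \<zero>\<^bsub>S\<^esub>"
  unfolding * using z it(1) by (simp_all only: s b closed e) (simp_all add: a_minus_def L.R.r_neg B.M.r_neg it(1))
qed

text \<open>An eigenvector of weight c has its coordinate in degree a annihilated by a - c, a unit
  when c and a are distinct degrees.\<close>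

lemma zeta_weight:
 assumes z: "z : CL" and c: "\<zeta> \<otimes> z = it c \<odot> z" and b: "c : {- 2..2}"
 shows "c \<noteq> 2 ==> cp z = \<zero>\<^bsub>S\<^esub>" "c \<noteq> 1 ==> vp z = \<zero>\<^bsub>B\<^esub>" "c \<noteq> - 1 ==> vm z = \<zero>\<^bsub>B\<^esub>" "c \<noteq> - 2 ==> cm z = \<zero>\<^bsub>S\<^esub>"
proof -
 have d: "a - c dvd 216" if "a : {- 2..2}" "c \<noteq> a" for a
 proof -
  have "a - c : {- 4, - 3, - 2, - 1, 1, 2, 3, 4}" using that b by auto
  then show ?thesis by auto
 qed
 note u = it_unit[OF d] and e = zeta_eigen[OF z c]
 note S = self_module[OF L.R.is_cring]
 show "c \<noteq> 2 ==> cp z = \<zero>\<^bsub>S\<^esub>" using unit_cancel[OF u S, of 2 "cp z"] e(1) z by simp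
 show "c \<noteq> - 2 ==> cm z = \<zero>\<^bsub>S\<^esub>" using unit_cancel[OF u S, of "- 2" "cm z"] e(4) z by simp
 show "c \<noteq> 1 ==> vp z = \<zero>\<^bsub>B\<^esub>" using unit_cancel[OF u B_module, of 1 "vp z"] e(2) z by simp
 show "c \<noteq> - 1 ==> vm z = \<zero>\<^bsub>B\<^esub>" using unit_cancel[OF u B_module, of "- 1" "vm z"] e(3) z by simp
qed

text \<open>The components are cut out by the coordinates, degree zero as their common kernel. In
  this form they are compared with eigenspaces; \<open>comps_eq\<close> gives them as spans.\<close>

definition comps where "comps = {{z : carrier L. z = cp z \<odot> Jp}, {z : carrier L. z = Ip (vp z)},
 {z : carrier L. cp z = \<zero>\<^bsub>S\<^esub> \<and> vp z = \<zero>\<^bsub>B\<^esub> \<and> vm z = \<zero>\<^bsub>B\<^esub> \<and> cm z = \<zero>\<^bsub>S\<^esub>},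
 {z : carrier L. z = Im (vm z)}, {z : carrier L. z = cm z \<odot> Jm}}"

lemma comps_eigen:
 assumes "X : comps"
 obtains c where "X = {z : carrier L. \<zeta> \<otimes> z = it c \<odot> z}"
proof -
 note w = zeta_weight zeta it(1,3,5,6) zero L.smult_l_minus
 have two: "z = w" if "it 2 \<odot> z = it 2 \<odot> w" "z : CL" "w : CL" for z w
  using unit_cancel_eq[OF it_unit L_module that(2,3,1)] by simp
 have one: "z = w" if "\<ominus> z = \<ominus> w" "z : CL" "w : CL" for z w
  using that by (metis L.M.minus_minus)
 have "{z : carrier L. z = cp z \<odot> Jp} = {z : carrier L. \<zeta> \<otimes> z = it 2 \<odot> z}" (is "?A = ?B")
 proof (intro Collect_cong conj_cong refl iffI)
  fix z assume z: "z : CL"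
  assume "z = cp z \<odot> Jp"
  then obtain c where "c : carrier S" "z = c \<odot> Jp" using c_facts(1)[OF z] by blast
  then show "\<zeta> \<otimes> z = it 2 \<odot> z"
   using it(1) by (simp add: linear table bt_two L.smult_assoc1[symmetric] L.R.m_comm)
 next
  fix z assume z: "z : CL" and e: "\<zeta> \<otimes> z = it 2 \<odot> z"
  have "it 2 \<odot> z = it 2 \<odot> (cp z \<odot> Jp)"
   unfolding e[symmetric] zeta[OF z] using zeta_weight[OF z e] z it(1) by (simp add: zero L.smult_assoc1)
  then show "z = cp z \<odot> Jp" by (rule two) (use z in simp_all)
 qed
 moreover have "{z : carrier L. z = cm z \<odot> Jm} = {z : carrier L. \<zeta> \<otimes> z = it (- 2) \<odot> z}"
 proof (intro Collect_cong conj_cong refl iffI)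
  fix z assume z: "z : CL"
  assume "z = cm z \<odot> Jm"
  then obtain c where "c : carrier S" "z = c \<odot> Jm" using c_facts(4)[OF z] by blast
  then show "\<zeta> \<otimes> z = it (- 2) \<odot> z"
   using it(1) by (simp add: linear table bt_two L.smult_assoc1[symmetric] L.R.m_comm it(3) L.smult_l_minus L.R.r_minus L.smult_r_minus)
 next
  fix z assume z: "z : CL" and e: "\<zeta> \<otimes> z = it (- 2) \<odot> z"
  have "it (- 2) \<odot> z = it (- 2) \<odot> (cm z \<odot> Jm)"
   unfolding e[symmetric] zeta[OF z] using zeta_weight[OF z e] z it(1) by (simp add: zero L.smult_assoc1)
  then show "z = cm z \<odot> Jm" by (rule unit_cancel_eq[OF it_unit L_module, rotated -1]) (use z in simp_all)
 qed
 moreover have "{z : carrier L. z = Ip (vp z)} = {z : carrier L. \<zeta> \<otimes> z = it 1 \<odot> z}"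
 proof (intro Collect_cong conj_cong refl iffI)
  fix z assume z: "z : CL"
  assume "z = Ip (vp z)"
  then obtain c where "c : CB" "z = Ip c" using v_facts(1)[OF z] by blast
  then show "\<zeta> \<otimes> z = it 1 \<odot> z" by (simp add: table V_one it(5))
 next
  fix z assume z: "z : CL" and e: "\<zeta> \<otimes> z = it 1 \<odot> z"
  then have "z = \<zeta> \<otimes> z" by (simp add: it(5))
  also have "\<dots> = Ip (vp z)" unfolding zeta[OF z] using zeta_weight[OF z e] z it(1) by (simp add: zero)
  finally show "z = Ip (vp z)" .
 qed
 moreover have "{z : carrier L. z = Im (vm z)} = {z : carrier L. \<zeta> \<otimes> z = it (- 1) \<odot> z}"
 proof (intro Collect_cong conj_cong refl iffI)
  fix z assume z: "z : CL"
  assume "z = Im (vm z)"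
  then obtain c where "c : CB" "z = Im c" using v_facts(4)[OF z] by blast
  then show "\<zeta> \<otimes> z = it (- 1) \<odot> z" by (simp add: table V_one it(3,5) L.smult_l_minus)
 next
  fix z assume z: "z : CL" and e: "\<zeta> \<otimes> z = it (- 1) \<odot> z"
  have "it (- 1) \<odot> z = it (- 1) \<odot> Im (vm z)"
   unfolding e[symmetric] zeta[OF z] using zeta_weight[OF z e] z it(1) by (simp add: zero)
  then show "z = Im (vm z)" by (rule unit_cancel_eq[OF it_unit L_module, rotated -1]) (use z in simp_all)
 qed
 moreover have "{z : carrier L. cp z = \<zero>\<^bsub>S\<^esub> \<and> vp z = \<zero>\<^bsub>B\<^esub> \<and> vm z = \<zero>\<^bsub>B\<^esub> \<and> cm z = \<zero>\<^bsub>S\<^esub>} = {z : carrier L. \<zeta> \<otimes> z = it 0 \<odot> z}"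
 proof (intro Collect_cong conj_cong refl iffI)
  fix z assume z: "z : CL"
  assume "cp z = \<zero>\<^bsub>S\<^esub> \<and> vp z = \<zero>\<^bsub>B\<^esub> \<and> vm z = \<zero>\<^bsub>B\<^esub> \<and> cm z = \<zero>\<^bsub>S\<^esub>"
  then show "\<zeta> \<otimes> z = it 0 \<odot> z" unfolding zeta[OF z] using z it(1) by (simp add: zero it(6))
 next
  fix z assume z: "z : CL" and e: "\<zeta> \<otimes> z = it 0 \<odot> z"
  show "cp z = \<zero>\<^bsub>S\<^esub> \<and> vp z = \<zero>\<^bsub>B\<^esub> \<and> vm z = \<zero>\<^bsub>B\<^esub> \<and> cm z = \<zero>\<^bsub>S\<^esub>" using zeta_weight[OF z e] by simp
 qed
 ultimately show thesis
  using assms unfolding comps_def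
  by (elim insertE emptyE) (rule that, erule trans, assumption)+
qed

\<comment> \<open>Extremal elements, graded automorphisms and isometries\<close>
end

lemma aut_groupD:
 assumes "f : carrier (aut_group S C)"
 shows "f : lin_maps S C C" "f : extensional (carrier C)" "bij_betw f (carrier C) (carrier C)"
  "x : carrier C ==> y : carrier C ==> f (x \<otimes>\<^bsub>C\<^esub> y) = f x \<otimes>\<^bsub>C\<^esub> f y"
 using assms by (auto simp: aut_group_def lin_autos_def)

text \<open>A linear form with value 1 at x shows that a scalar r is determined by r x.\<close>

lemma extremal_form_eqI:
 assumes "\<alpha> : lin_forms S C" "\<alpha> x = \<one>\<^bsub>S\<^esub>" "cring S" "x : carrier C" "r : carrier S" "x \<otimes>\<^bsub>C\<^esub> (x \<otimes>\<^bsub>C\<^esub> y) = r \<odot>\<^bsub>C\<^esub> x"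
 shows "extremal_form S C x y = r"
 unfolding extremal_form_def
proof (rule the_equality)
 interpret cring S by fact
 note l = lin_mapsD(3)[OF assms(1)[unfolded lin_forms_eq], simplified]
 fix r' assume r': "r' : carrier S \<and> x \<otimes>\<^bsub>C\<^esub> (x \<otimes>\<^bsub>C\<^esub> y) = r' \<odot>\<^bsub>C\<^esub> x"
 then have "r' \<odot>\<^bsub>C\<^esub> x = r \<odot>\<^bsub>C\<^esub> x" using assms(6) by simp
 then have "\<alpha> (r' \<odot>\<^bsub>C\<^esub> x) = \<alpha> (r \<odot>\<^bsub>C\<^esub> x)" by simp
 then show "r' = r" using r' assms(2,4,5) l by simp
qed (use assms in simp)

context tkk_model
begin

text \<open>The square of ad \<open>Jp\<close> raises degrees by 4, so it kills everything except
  degree -2, where [Jp, [Jp, Jm]] = \<mu> [Jp, \<zeta>] = -2 \<mu> Jp. With \<open>Jm\<close> scaled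
  by \<mu>^-1 the extremal form takes the required value -2.\<close>

lemma ad_square:
 assumes "z : CL"
 shows "Jp \<otimes> (Jp \<otimes> z) = ((it (- 2) \<otimes>\<^bsub>S\<^esub> \<mu>) \<otimes>\<^bsub>S\<^esub> cm z) \<odot> Jp"
  "Jm \<otimes> (Jm \<otimes> z) = ((it (- 2) \<otimes>\<^bsub>S\<^esub> \<mu>) \<otimes>\<^bsub>S\<^esub> cp z) \<odot> Jm"
proof -
 note t = table table(1-3)[OF B_closed(1)] table' table'(1)[OF B_closed(1)] bt_two it(1,3) zero bt(1) linear brack_minus
  L.smult_l_minus L.smult_r_minus L.R.l_minus L.R.r_minus L.smult_assoc1[symmetric] L.R.m_comm
 show "Jp \<otimes> (Jp \<otimes> z) = ((it (- 2) \<otimes>\<^bsub>S\<^esub> \<mu>) \<otimes>\<^bsub>S\<^esub> cm z) \<odot> Jp"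
  using assms
 proof (induction rule: gen_induct)
  case (add x y)
  then show ?case by (simp add: linear it(1) L.R.r_distr L.smult_l_distr)
 next
  case (smult r x)
  then show ?case by (simp add: linear it(1) L.smult_assoc1[symmetric] L.R.m_ac)
 qed (simp_all add: t)
 show "Jm \<otimes> (Jm \<otimes> z) = ((it (- 2) \<otimes>\<^bsub>S\<^esub> \<mu>) \<otimes>\<^bsub>S\<^esub> cp z) \<odot> Jm"
  using assms
 proof (induction rule: gen_induct)
  case (add x y)
  then show ?case by (simp add: linear it(1) L.R.r_distr L.smult_l_distr)
 next
  case (smult r x)
  then show ?case by (simp add: linear it(1) L.smult_assoc1[symmetric] L.R.m_ac)
 qed (simp_all add: t)
qed

lemma extremal_pair: "(Jp, inv\<^bsub>S\<^esub> \<mu> \<odot> Jm) : extremal_pairs S L"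
proof -
 let ?q = "inv\<^bsub>S\<^esub> \<mu> \<odot> Jm"
 \<comment> \<open>The factor \<mu> compensates the scaling of \<open>Jm\<close>, so that the form
   takes the value 1 at \<open>?q\<close>.\<close>
 let ?\<alpha> = "%z. \<mu> \<otimes>\<^bsub>S\<^esub> cm z"
 have \<alpha>: "?\<alpha> : lin_forms S L" "?\<alpha> ?q = \<one>\<^bsub>S\<^esub>"
  unfolding lin_forms_eq by (rule lin_mapsI) (simp_all add: c_facts L.R.r_distr L.R.m_lcomm)
 have p: "extremal S L Jp"
  unfolding extremal_def
 proof (intro conjI ballI)
  show "\<exists>\<alpha>\<in>lin_forms S L. \<alpha> Jp = \<one>\<^bsub>S\<^esub>" using c_lin by (intro bexI[of _ cp]) simp_all
  fix y assume y: "y : CL"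
  show "\<exists>r\<in>carrier S. Jp \<otimes> (Jp \<otimes> y) = r \<odot> Jp"
   using ad_square(1)[OF y] by (rule bexI) (simp add: y it(1))
 qed simp
 have q: "extremal S L ?q"
  unfolding extremal_def
 proof (intro conjI ballI)
  show "\<exists>\<alpha>\<in>lin_forms S L. \<alpha> ?q = \<one>\<^bsub>S\<^esub>" by (rule bexI[of _ ?\<alpha>]) (rule \<alpha>)+
  fix y assume y: "y : CL"
  have "?q \<otimes> (?q \<otimes> y) = (inv\<^bsub>S\<^esub> \<mu> \<otimes>\<^bsub>S\<^esub> inv\<^bsub>S\<^esub> \<mu>) \<odot> (Jm \<otimes> (Jm \<otimes> y))"
   using y by (simp add: brack L.smult_assoc1)
  also have "\<dots> = (inv\<^bsub>S\<^esub> \<mu> \<otimes>\<^bsub>S\<^esub> ((it (- 2) \<otimes>\<^bsub>S\<^esub> \<mu>) \<otimes>\<^bsub>S\<^esub> cp y)) \<odot> ?q"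
   unfolding ad_square(2)[OF y] using y it(1) by (simp add: L.smult_assoc1[symmetric] L.R.m_ac)
  finally show "\<exists>r\<in>carrier S. ?q \<otimes> (?q \<otimes> y) = r \<odot> ?q"
   by (rule bexI) (simp add: y it(1))
 qed simp
 have "Jp \<otimes> (Jp \<otimes> ?q) = it (- 2) \<odot> Jp"
  using ad_square(1)[of ?q] it(1) by (simp add: c_facts L.R.m_assoc)
 then have "extremal_form S L Jp ?q = it (- 2)"
  using c_lin(1) it(1) L.R.is_cring by (intro extremal_form_eqI[of cp]) simp_all
 moreover have "it (- 2) = \<ominus>\<^bsub>S\<^esub> nt 2" using it(3)[of 2] it(7)[of 2] by simp
 ultimately show ?thesis using p q by (simp add: extremal_pairs_def)
qed

definition graded where "graded f \<longleftrightarrow> f : carrier (aut_group S L) \<and> (\<forall>X\<in>comps. f ` X = X)"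

definition restr where "restr f = (\<lambda>x\<in>carrier B. inv_into (CB) Ip (f (Ip x)))"

lemma Ip_inj: "inj_on Ip (CB)"
 by (rule inj_onI) (metis proj_I(3))

lemma fixing_graded:
 assumes f: "f : carrier (aut_group S L)" and fix_J: "f Jp = Jp" "f Jm = Jm"
 shows "graded f"
proof -
 note F = aut_groupD[OF f] and l = lin_mapsD[OF aut_groupD(1)[OF f]]
 have "\<mu> \<odot> f \<zeta> = f (Jp \<otimes> Jm)" using table(1)[OF B_closed(1)] by (simp add: l)
 also have "\<dots> = \<mu> \<odot> \<zeta>" unfolding table(1)[OF B_closed(1), symmetric] by (simp add: F(4) fix_J)
 finally have z: "f \<zeta> = \<zeta>" by (rule unit_cancel_eq[OF units(1) L_module, rotated -1]) (simp_all add: l)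
 have "f ` X = X" if X: "X : comps" for X
 proof -
  obtain c where c: "X = {z : carrier L. \<zeta> \<otimes> z = it c \<odot> z}" by (rule comps_eigen[OF X])
  have *: "\<zeta> \<otimes> f z = it c \<odot> f z \<longleftrightarrow> \<zeta> \<otimes> z = it c \<odot> z" if w: "z : CL" for z
  proof -
   have "\<zeta> \<otimes> f z = it c \<odot> f z \<longleftrightarrow> f (\<zeta> \<otimes> z) = f (it c \<odot> z)"
    using w it(1) by (simp add: F(4) z l)
   also have "\<dots> \<longleftrightarrow> \<zeta> \<otimes> z = it c \<odot> z"
    using F(3) w it(1) by (intro inj_on_eq_iff[of f "CL"]) (simp_all add: bij_betw_def)
   finally show ?thesis .
  qed
  show ?thesis
  proof (intro equalityI subsetI)
   fix y assume "y : f ` X"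
   then show "y : X" unfolding c using * l(1) by auto
  next
   fix y assume y: "y : X"
   then have "y : f ` CL" using F(3) by (simp add: c bij_betw_def)
   then obtain x where "x : CL" "y = f x" by auto
   then show "y : f ` X" using y * unfolding c by auto
  qed
 qed
 then show ?thesis using f by (simp add: graded_def)
qed

lemma graded_Ip:
 assumes f: "graded f" and x: "x : CB"
 shows "\<exists>y\<in>carrier B. f (Ip x) = Ip y" "\<exists>y\<in>carrier B. f (Im x) = Im y" "\<exists>y\<in>carrier B. Ip x = f (Ip y)"
  "\<exists>c\<in>carrier S. f Jp = c \<odot> Jp" "\<exists>c\<in>carrier S. Jp = f (c \<odot> Jp)"
proof -
 let ?P = "{z : carrier L. z = Ip (vp z)}" and ?M = "{z : carrier L. z = Im (vm z)}" and ?J = "{z : carrier L. z = cp z \<odot> Jp}"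
 have im: "f ` ?P = ?P" "f ` ?M = ?M" "f ` ?J = ?J" using f unfolding graded_def comps_def by simp_all
 have "Ip x : ?P" "Im x : ?M" "Jp : ?J" using x by simp_all
 then have m: "f (Ip x) : ?P" "f (Im x) : ?M" "f Jp : ?J" "Ip x : f ` ?P" "Jp : f ` ?J" using im by blast+
 show "\<exists>y\<in>carrier B. f (Ip x) = Ip y" using m(1) v_facts(1) by blast
 show "\<exists>y\<in>carrier B. f (Im x) = Im y" using m(2) v_facts(4) by blast
 show "\<exists>c\<in>carrier S. f Jp = c \<odot> Jp" using m(3) c_facts(1) by blast
 obtain z where z: "z : CL" "z = Ip (vp z)" "Ip x = f z" using m(4) by blast
 have "Ip x = f (Ip (vp z))" using z(2,3) by simp
 then show "\<exists>y\<in>carrier B. Ip x = f (Ip y)" using v_facts(1)[OF z(1)] by blast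
 obtain w where w: "w : CL" "w = cp w \<odot> Jp" "Jp = f w" using m(5) by blast
 have "Jp = f (cp w \<odot> Jp)" using w(2,3) by simp
 then show "\<exists>c\<in>carrier S. Jp = f (c \<odot> Jp)" using c_facts(1)[OF w(1)] by blast
qed

lemma graded_restr:
 assumes f: "graded f"
 shows "x : CB ==> f (Ip x) = Ip (restr f x)" "x : CB ==> restr f x : CB" "restr f : lin_autos S B"
proof -
 have fa: "f : carrier (aut_group S L)" using f by (simp add: graded_def)
 note F = aut_groupD[OF fa] and l = lin_mapsD[OF aut_groupD(1)[OF fa]]
 have r: "f (Ip x) = Ip (restr f x) \<and> restr f x : CB" if x: "x : CB" for x
 proof -
  obtain y where "y : CB" "f (Ip x) = Ip y" using graded_Ip(1)[OF f x] by blast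
  then show ?thesis using x by (simp add: restr_def inv_into_f_f[OF Ip_inj])
 qed
 then show "x : CB ==> f (Ip x) = Ip (restr f x)" "x : CB ==> restr f x : CB" by auto
 have eq: "restr f x = vp (f (Ip x))" if "x : CB" for x using r[OF that] by simp
 have "(%x. vp (f (Ip x))) : lin_maps S B B"
  by (intro lin_maps_comp[OF lin_maps_comp[OF I_lin(1) F(1)] v_lin(1)])
 then have "restr f : lin_maps S B B" by (rule lin_maps_cong[OF _ B_module]) (simp add: eq)
 moreover have "restr f : extensional (CB)" by (simp add: restr_def)
 moreover have "bij_betw (restr f) (CB) (CB)"
 proof (rule bij_betwI')
  fix x y assume xy: "x : CB" "y : CB"
  have "restr f x = restr f y \<longleftrightarrow> f (Ip x) = f (Ip y)"
   using r[OF xy(1)] r[OF xy(2)] inj_on_eq_iff[OF Ip_inj, of "restr f x" "restr f y"] by simp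
  also have "\<dots> \<longleftrightarrow> Ip x = Ip y" using F(3) xy by (intro inj_on_eq_iff[of f "CL"]) (simp_all add: bij_betw_def)
  finally show "restr f x = restr f y \<longleftrightarrow> x = y" using inj_on_eq_iff[OF Ip_inj xy] by simp
 next
  fix x assume x: "x : CB"
  show "restr f x : CB" using r[OF x] by simp
  obtain y where y: "y : CB" "Ip x = f (Ip y)" using graded_Ip(3)[OF f x] by blast
  then have "Ip x = Ip (restr f y)" using r by simp
  then have "x = restr f y" using inj_onD[OF Ip_inj] x r[OF y(1)] by blast
  then show "\<exists>y\<in>carrier B. x = restr f y" using y by blast
 qed
 ultimately show "restr f : lin_autos S B" by (simp add: lin_autos_def)
qed

lemma b_form_eq:
 assumes x: "x : CB" and y: "y : CB"
 shows "b_form S B j x y = bt x y \<otimes>\<^bsub>S\<^esub> \<mu>"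
 unfolding b_form_def form(1)[OF x y] bt_def[symmetric]
proof (rule the_equality)
 have e: "bt x y \<odot>\<^bsub>B\<^esub> j \<otimes>\<^bsub>B\<^esub> j = (bt x y \<otimes>\<^bsub>S\<^esub> \<mu>) \<odot>\<^bsub>B\<^esub> \<one>\<^bsub>B\<^esub>"
  using x y by (simp add: prod bt(1) jj B.smult_assoc1)
 then show "bt x y \<otimes>\<^bsub>S\<^esub> \<mu> : carrier S \<and> (bt x y \<otimes>\<^bsub>S\<^esub> \<mu>) \<odot>\<^bsub>B\<^esub> \<one>\<^bsub>B\<^esub> = bt x y \<odot>\<^bsub>B\<^esub> j \<otimes>\<^bsub>B\<^esub> j"
  using x y by (simp add: bt(1))
 fix r assume "r : carrier S \<and> r \<odot>\<^bsub>B\<^esub> \<one>\<^bsub>B\<^esub> = bt x y \<odot>\<^bsub>B\<^esub> j \<otimes>\<^bsub>B\<^esub> j"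
 then have r: "r : carrier S" "r \<odot>\<^bsub>B\<^esub> \<one>\<^bsub>B\<^esub> = (bt x y \<otimes>\<^bsub>S\<^esub> \<mu>) \<odot>\<^bsub>B\<^esub> \<one>\<^bsub>B\<^esub>" using e by auto
 \<comment> \<open>The scalar in r 1 is recovered by pairing with \<open>j\<close>:
   \<open>bt\<close> takes the value 2 at (\<open>j\<close>, 1), and 2 is a unit.\<close>
 have "r \<otimes>\<^bsub>S\<^esub> it 2 = bt (j \<otimes>\<^bsub>B\<^esub> \<one>\<^bsub>B\<^esub>) (r \<odot>\<^bsub>B\<^esub> \<one>\<^bsub>B\<^esub>)" using r(1) by (simp add: bt(3) bt_two)
 also have "\<dots> = (bt x y \<otimes>\<^bsub>S\<^esub> \<mu>) \<otimes>\<^bsub>S\<^esub> it 2" unfolding r(2) using x y by (simp add: bt(1,3) bt_two)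
 finally have "it 2 \<otimes>\<^bsub>S\<^esub> r = it 2 \<otimes>\<^bsub>S\<^esub> (bt x y \<otimes>\<^bsub>S\<^esub> \<mu>)" using x y r(1) it(1) bt(1) by (simp add: L.R.m_ac)
 then show "r = bt x y \<otimes>\<^bsub>S\<^esub> \<mu>"
  using unit_cancel_eq[OF it_unit[of 2] self_module[OF L.R.is_cring], of r "bt x y \<otimes>\<^bsub>S\<^esub> \<mu>"] r(1) x y bt(1) by simp
qed

lemma bt_minus: "x : CB ==> y : CB ==> bt x (j \<otimes>\<^bsub>B\<^esub> y) = \<ominus>\<^bsub>S\<^esub> bt (j \<otimes>\<^bsub>B\<^esub> x) y"
 using dl_sym[of x y] bt(4)[of x "j \<otimes>\<^bsub>B\<^esub> y"] by (simp add: bt_def)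

text \<open>Equivalent form of the two invariance conditions defining \<open>inv_triple\<close>.\<close>

definition isometry where "isometry g \<longleftrightarrow> g : lin_autos S B \<and>
 (\<forall>x\<in>carrier B. \<forall>y\<in>carrier B. bt (g x) (g y) = bt x y) \<and>
 (\<forall>x\<in>carrier B. \<forall>y\<in>carrier B. \<forall>z\<in>carrier B. g (V_op B x (j \<otimes>\<^bsub>B\<^esub> y) z) = V_op B (g x) (j \<otimes>\<^bsub>B\<^esub> g y) (g z))"

lemma t_prod_eq:
 assumes "x : CB" "y : CB" "z : CB"
 shows "t_prod S B j x y z = it 2 \<odot>\<^bsub>B\<^esub> V_op B x (j \<otimes>\<^bsub>B\<^esub> y) z \<oplus>\<^bsub>B\<^esub> \<ominus>\<^bsub>B\<^esub> ((bt y z \<otimes>\<^bsub>S\<^esub> \<mu>) \<odot>\<^bsub>B\<^esub> x \<oplus>\<^bsub>B\<^esub> (bt y x \<otimes>\<^bsub>S\<^esub> \<mu>) \<odot>\<^bsub>B\<^esub> z \<oplus>\<^bsub>B\<^esub> (bt x z \<otimes>\<^bsub>S\<^esub> \<mu>) \<odot>\<^bsub>B\<^esub> y)"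
proof -
 let ?v = "V_op B x (j \<otimes>\<^bsub>B\<^esub> y) z"
 have v: "?v : CB" using assms by simp
 have "[(2::nat)] \<cdot>\<^bsub>B\<^esub> ?v = ?v \<oplus>\<^bsub>B\<^esub> ?v" using v by (simp add: numeral_2_eq_2)
 also have "\<dots> = it 2 \<odot>\<^bsub>B\<^esub> ?v" using v it(2)[of 1 1] it(5) by (simp add: B.smult_l_distr)
 finally show ?thesis
  using assms by (simp add: t_prod_def b_form_eq bt(1) a_minus_def B.M.minus_add B.M.a_ac it(1))
qed

text \<open>The triple product is 2 \<open>V_op B x (j y) z\<close> minus terms built from b_j. Once
  b_j is invariant these terms transform correctly, so invariance of the triple product amounts to
  invariance of the operator term, as 2 is a unit. Likewise b_j may be replaced by
  \<open>bt\<close>, from which it differs by the unit \<mu>.\<close>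

lemma inv_triple_eq: "g : inv_triple S B j \<longleftrightarrow> isometry g"
proof (cases "g : lin_autos S B")
 case g: True
 then have l: "g : lin_maps S B B" by (simp add: lin_autos_def)
 note gl = lin_mapsD[OF l] lin_maps_minus[OF B_module B_module l]
 have b: "b_form S B j (g x) (g y) = b_form S B j x y \<longleftrightarrow> bt (g x) (g y) = bt x y" if "x : CB" "y : CB" for x y
 proof -
  have "\<mu> \<otimes>\<^bsub>S\<^esub> bt (g x) (g y) = \<mu> \<otimes>\<^bsub>S\<^esub> bt x y ==> bt (g x) (g y) = bt x y"
   using unit_cancel_eq[OF units(1) self_module[OF L.R.is_cring], of "bt (g x) (g y)" "bt x y"] that gl(1) bt(1) by simp
  then show ?thesis using that gl(1) bt(1) by (auto simp: b_form_eq L.R.m_comm)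
 qed
 have t: "g (t_prod S B j x y z) = t_prod S B j (g x) (g y) (g z) \<longleftrightarrow> g (V_op B x (j \<otimes>\<^bsub>B\<^esub> y) z) = V_op B (g x) (j \<otimes>\<^bsub>B\<^esub> g y) (g z)"
  if btg: "!!x y. x : CB ==> y : CB ==> bt (g x) (g y) = bt x y" and xyz: "x : CB" "y : CB" "z : CB" for x y z
 proof -
  let ?w = "(bt y z \<otimes>\<^bsub>S\<^esub> \<mu>) \<odot>\<^bsub>B\<^esub> g x \<oplus>\<^bsub>B\<^esub> (bt y x \<otimes>\<^bsub>S\<^esub> \<mu>) \<odot>\<^bsub>B\<^esub> g z \<oplus>\<^bsub>B\<^esub> (bt x z \<otimes>\<^bsub>S\<^esub> \<mu>) \<odot>\<^bsub>B\<^esub> g y"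
  have w: "?w : CB" using xyz gl(1) bt(1) by simp
  have 1: "g (t_prod S B j x y z) = it 2 \<odot>\<^bsub>B\<^esub> g (V_op B x (j \<otimes>\<^bsub>B\<^esub> y) z) \<oplus>\<^bsub>B\<^esub> \<ominus>\<^bsub>B\<^esub> ?w"
   using xyz it(1) by (simp add: t_prod_eq gl bt(1))
  have 2: "t_prod S B j (g x) (g y) (g z) = it 2 \<odot>\<^bsub>B\<^esub> V_op B (g x) (j \<otimes>\<^bsub>B\<^esub> g y) (g z) \<oplus>\<^bsub>B\<^esub> \<ominus>\<^bsub>B\<^esub> ?w"
   using xyz it(1) by (simp add: t_prod_eq gl bt(1) btg)
  have c: "g (V_op B x (j \<otimes>\<^bsub>B\<^esub> y) z) : CB" "V_op B (g x) (j \<otimes>\<^bsub>B\<^esub> g y) (g z) : CB"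
   using xyz gl(1) by simp_all
  have "g (t_prod S B j x y z) = t_prod S B j (g x) (g y) (g z) \<longleftrightarrow> it 2 \<odot>\<^bsub>B\<^esub> g (V_op B x (j \<otimes>\<^bsub>B\<^esub> y) z) = it 2 \<odot>\<^bsub>B\<^esub> V_op B (g x) (j \<otimes>\<^bsub>B\<^esub> g y) (g z)"
   unfolding 1 2 using c w it(1) by (intro B.M.add.right_cancel) simp_all
  also have "\<dots> \<longleftrightarrow> g (V_op B x (j \<otimes>\<^bsub>B\<^esub> y) z) = V_op B (g x) (j \<otimes>\<^bsub>B\<^esub> g y) (g z)"
   using unit_cancel_eq[OF it_unit[of 2] B_module c] by auto
  finally show ?thesis .
 qed
 show ?thesis
 proof
  assume "g : inv_triple S B j"
  then have i: "!!x y. x : CB ==> y : CB ==> b_form S B j (g x) (g y) = b_form S B j x y"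
   "!!x y z. x : CB ==> y : CB ==> z : CB ==> g (t_prod S B j x y z) = t_prod S B j (g x) (g y) (g z)"
   by (simp_all add: inv_triple_def)
  have bt: "!!x y. x : CB ==> y : CB ==> bt (g x) (g y) = bt x y" using i(1) b by blast
  show "isometry g" unfolding isometry_def using g bt i(2) t[OF bt] by simp
 next
  assume "isometry g"
  then have i: "!!x y. x : CB ==> y : CB ==> bt (g x) (g y) = bt x y"
   "!!x y z. x : CB ==> y : CB ==> z : CB ==> g (V_op B x (j \<otimes>\<^bsub>B\<^esub> y) z) = V_op B (g x) (j \<otimes>\<^bsub>B\<^esub> g y) (g z)"
   by (simp_all add: isometry_def)
  show "g : inv_triple S B j" unfolding inv_triple_def using g b i t[OF i(1)] by simp
 qed
qed (simp add: inv_triple_def isometry_def)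

lemma graded_isometry:
 assumes f: "graded f" and fix_J: "f Jp = Jp" "f Jm = Jm"
 shows "isometry (restr f)"
 unfolding isometry_def
proof (intro conjI ballI)
 note r = graded_restr[OF f]
 show "restr f : lin_autos S B" by (rule r(3))
 have fa: "f : carrier (aut_group S L)" using f by (simp add: graded_def)
 note F = aut_groupD[OF fa] and l = lin_mapsD[OF aut_groupD(1)[OF fa]]
 fix x y assume x: "x : CB" and y: "y : CB"
 have "Ip (restr f x) \<otimes> Ip (restr f y) = f (Ip x \<otimes> Ip y)" using x y by (simp add: F(4) r(1))
 also have "\<dots> = bt x y \<odot> Jp" using x y by (simp add: table(8) l bt(1) fix_J)
 finally show "bt (restr f x) (restr f y) = bt x y"
  using x y bt(1) by (simp add: bt_def[of "restr f x"] c_facts)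
 fix z assume z: "z : CB"
 have *: "Ip (V_op B x (j \<otimes>\<^bsub>B\<^esub> y) z) = (Ip x \<otimes> (Jm \<otimes> Ip y)) \<otimes> Ip z" if "x : CB" "y : CB" "z : CB" for x y z
  using that by (simp add: table)
 have "Ip (restr f (V_op B x (j \<otimes>\<^bsub>B\<^esub> y) z)) = f (Ip (V_op B x (j \<otimes>\<^bsub>B\<^esub> y) z))" using x y z by (simp add: r(1))
 also have "\<dots> = (Ip (restr f x) \<otimes> (Jm \<otimes> Ip (restr f y))) \<otimes> Ip (restr f z)"
  using x y z by (simp add: * F(4) r(1) fix_J del: table)
 also have "\<dots> = Ip (V_op B (restr f x) (j \<otimes>\<^bsub>B\<^esub> restr f y) (restr f z))" using x y z r(2) by (simp add: *)
 finally show "restr f (V_op B x (j \<otimes>\<^bsub>B\<^esub> y) z) = V_op B (restr f x) (j \<otimes>\<^bsub>B\<^esub> restr f y) (restr f z)"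
  using x y z r(2) by (intro inj_onD[OF Ip_inj]) simp_all
qed

text \<open>Degree one determines a graded automorphism: 2 \<open>Jp\<close> is a bracket in degree
  one, degree -1 is detected by its bracket with \<open>Jp\<close>, and the rest is generated. The
  image of \<open>Jp\<close> is only a multiple c \<open>Jp\<close>; the preimage of
  \<open>Jp\<close> furnishes c' with c' c = 1 and thereby allows cancelling c. This makes
  \<open>inv_into\<close> in \<open>from_L1\<close> a true inverse.\<close>

lemma graded_eqI:
 assumes f: "graded f" and g: "graded g" and e: "restr f = restr g"
 shows "f = g"
proof -
 have fa: "f : carrier (aut_group S L)" and ga: "g : carrier (aut_group S L)" using f g by (simp_all add: graded_def)
 note F = aut_groupD[OF fa] and l = lin_mapsD[OF aut_groupD(1)[OF fa]]
 note G = aut_groupD[OF ga] and m = lin_mapsD[OF aut_groupD(1)[OF ga]]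
 have Ip: "f (Ip x) = g (Ip x)" if "x : CB" for x
  using graded_restr(1)[OF f that] graded_restr(1)[OF g that] e by simp
 have two: "it 2 \<odot> Jp = Ip (j \<otimes>\<^bsub>B\<^esub> \<one>\<^bsub>B\<^esub>) \<otimes> Ip \<one>\<^bsub>B\<^esub>" "it 2 \<odot> Jm = Im (j \<otimes>\<^bsub>B\<^esub> \<one>\<^bsub>B\<^esub>) \<otimes> Im \<one>\<^bsub>B\<^esub>"
  by (simp_all add: table bt_two)
 have "it 2 \<odot> f Jp = it 2 \<odot> g Jp"
  using l(3)[of "it 2" Jp] m(3)[of "it 2" Jp] it(1) F(4) G(4) Ip by (simp add: two)
 then have Jp: "f Jp = g Jp" by (rule unit_cancel_eq[OF it_unit L_module, rotated -1]) (simp_all add: l m)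
 obtain c where c: "c : carrier S" "f Jp = c \<odot> Jp" using graded_Ip(4)[OF f B_closed(1)] by blast
 obtain c' where c': "c' : carrier S" "Jp = f (c' \<odot> Jp)" using graded_Ip(5)[OF f B_closed(1)] by blast
 have "cp Jp = cp ((c' \<otimes>\<^bsub>S\<^esub> c) \<odot> Jp)"
  using arg_cong[OF c'(2), of cp] c c' by (simp add: l L.smult_assoc1)
 then have u: "c' \<otimes>\<^bsub>S\<^esub> c = \<one>\<^bsub>S\<^esub>" using c(1) c'(1) by (simp add: c_facts)
 have Im: "f (Im x) = g (Im x)" if x: "x : CB" for x
 proof -
  obtain y where y: "y : CB" "f (Im x) = Im y" using graded_Ip(2)[OF f x] by blast
  obtain y' where y': "y' : CB" "g (Im x) = Im y'" using graded_Ip(2)[OF g x] by blast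
  have "f (Jp \<otimes> Im x) = g (Jp \<otimes> Im x)" using x Ip by (simp add: table)
  then have "f Jp \<otimes> f (Im x) = g Jp \<otimes> g (Im x)" using x by (simp only: F(4) G(4) J_closed closed)
  then have "c \<odot> Ip (j \<otimes>\<^bsub>B\<^esub> y) = c \<odot> Ip (j \<otimes>\<^bsub>B\<^esub> y')"
   using x y y' c(1) by (simp add: c(2) Jp[symmetric] brack table)
  then have "c' \<odot> (c \<odot> Ip (j \<otimes>\<^bsub>B\<^esub> y)) = c' \<odot> (c \<odot> Ip (j \<otimes>\<^bsub>B\<^esub> y'))" by simp
  then have "Ip (j \<otimes>\<^bsub>B\<^esub> y) = Ip (j \<otimes>\<^bsub>B\<^esub> y')" using c(1) c'(1) y(1) y'(1) by (simp add: L.smult_assoc1[symmetric] u)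
  then have "j \<otimes>\<^bsub>B\<^esub> y = j \<otimes>\<^bsub>B\<^esub> y'" by (rule inj_onD[OF Ip_inj]) (use y(1) y'(1) in simp_all)
  then have "j \<otimes>\<^bsub>B\<^esub> (j \<otimes>\<^bsub>B\<^esub> y) = j \<otimes>\<^bsub>B\<^esub> (j \<otimes>\<^bsub>B\<^esub> y')" by simp
  then have "y = y'" using y(1) y'(1) jj(1) unit_cancel_eq[OF units(1) B_module] by simp
  then show ?thesis using y y' by simp
 qed
 have "it 2 \<odot> f Jm = it 2 \<odot> g Jm"
  using l(3)[of "it 2" Jm] m(3)[of "it 2" Jm] it(1) F(4) G(4) Im by (simp add: two)
 then have Jm: "f Jm = g Jm" by (rule unit_cancel_eq[OF it_unit L_module, rotated -1]) (simp_all add: l m)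
 show ?thesis
 proof (rule extensionalityI[OF F(2) G(2)])
  show "f z = g z" if "z : CL" for z
   by (rule lin_maps_eqI[OF F(1) G(1) L_module that Jp Jm Ip Im]) (simp_all add: F(4) G(4) Ip Im)
 qed
qed

end

section \<open>Extending an isometry to an automorphism\<close>

context tkk_model
begin

text \<open>Conjugation of g by \<open>j\<close>, the inverse of \<open>j\<close> being \<mu>^-1
  \<open>j\<close>. It is forced as the action on degree -1 when \<open>Jm\<close> is fixed, since
  the bracket of \<open>Jm\<close> with \<open>Ip x\<close> is \<open>Im (j x)\<close>.\<close>

definition hat where "hat g y = inv\<^bsub>S\<^esub> \<mu> \<odot>\<^bsub>B\<^esub> (j \<otimes>\<^bsub>B\<^esub> g (j \<otimes>\<^bsub>B\<^esub> y))"

lemma isometryD: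
 assumes "isometry g"
 shows "g : lin_maps S B B" "g : extensional (CB)" "bij_betw g (CB) (CB)"
  "x : CB ==> y : CB ==> bt (g x) (g y) = bt x y"
  "x : CB ==> y : CB ==> z : CB ==> g (V_op B x (j \<otimes>\<^bsub>B\<^esub> y) z) = V_op B (g x) (j \<otimes>\<^bsub>B\<^esub> g y) (g z)"
 using assms by (auto simp: isometry_def lin_autos_def)

lemma nu_cancel: "x : CB ==> inv\<^bsub>S\<^esub> \<mu> \<odot>\<^bsub>B\<^esub> (\<mu> \<odot>\<^bsub>B\<^esub> x) = x" "x : CB ==> \<mu> \<odot>\<^bsub>B\<^esub> (inv\<^bsub>S\<^esub> \<mu> \<odot>\<^bsub>B\<^esub> x) = x"
 by (simp_all add: B.smult_assoc1[symmetric])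

text \<open>Expresses the operator with interchanged arguments through the original one,
  \<open>j\<close> and \<delta>; this is how compatibility of g with \<open>V_op B x y\<close>
  yields that of \<open>hat g\<close> with \<open>V_op B y x\<close>.\<close>

lemma V_flip_mu:
 assumes "x : CB" "y : CB" "w : CB"
 shows "\<mu> \<odot>\<^bsub>B\<^esub> V_op B y x w = bt (j \<otimes>\<^bsub>B\<^esub> y) x \<odot>\<^bsub>B\<^esub> (\<mu> \<odot>\<^bsub>B\<^esub> w) \<ominus>\<^bsub>B\<^esub> j \<otimes>\<^bsub>B\<^esub> V_op B x y (j \<otimes>\<^bsub>B\<^esub> w)"
proof -
 have "\<mu> \<odot>\<^bsub>B\<^esub> V_op B y x w \<oplus>\<^bsub>B\<^esub> j \<otimes>\<^bsub>B\<^esub> V_op B x y (j \<otimes>\<^bsub>B\<^esub> w) = bt (j \<otimes>\<^bsub>B\<^esub> y) x \<odot>\<^bsub>B\<^esub> (\<mu> \<odot>\<^bsub>B\<^esub> w)"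
  using V_flip[of x y "j \<otimes>\<^bsub>B\<^esub> w"] assms by (simp add: bt_def jj V_op_facts)
 from this[symmetric] show ?thesis using assms by (simp add: a_minus_def B.M.a_assoc B.M.r_neg)
qed

text \<open>The isometry condition concerns \<open>V_op B x (j y)\<close>; substituting \<mu>^-1 j y
  for y gives the rule for arbitrary arguments. The remaining rules follow by conjugating with
  \<open>j\<close> and cancelling \<mu>.\<close>

lemma isometry_hat:
 assumes g: "isometry g" and y: "y : CB"
 shows "hat g y : CB" "j \<otimes>\<^bsub>B\<^esub> hat g y = g (j \<otimes>\<^bsub>B\<^esub> y)" "hat g (j \<otimes>\<^bsub>B\<^esub> y) = j \<otimes>\<^bsub>B\<^esub> g y"
  "x : CB ==> z : CB ==> g (V_op B x y z) = V_op B (g x) (hat g y) (g z)"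
  "x : CB ==> z : CB ==> hat g (V_op B y x z) = V_op B (hat g y) (g x) (hat g z)"
  "x : CB ==> bt (hat g x) (hat g y) = bt x y" "hat g : lin_maps S B B"
proof -
 note gl = lin_mapsD[OF isometryD(1)[OF g]]
 note gm = lin_maps_diff[OF B_module B_module isometryD(1)[OF g]]
 have cl: "hat g y : CB" if "y : CB" for y using that gl(1) by (simp add: hat_def)
 have jh: "j \<otimes>\<^bsub>B\<^esub> hat g y = g (j \<otimes>\<^bsub>B\<^esub> y)" if "y : CB" for y
  using that gl(1) by (simp add: hat_def prod jj nu_cancel)
 have hj: "hat g (j \<otimes>\<^bsub>B\<^esub> y) = j \<otimes>\<^bsub>B\<^esub> g y" if "y : CB" for y
  using that gl by (simp add: hat_def prod jj nu_cancel)
 show hl: "hat g : lin_maps S B B"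
  by (rule lin_mapsI) (simp_all add: hat_def gl prod B.smult_r_distr B.smult_assoc1[symmetric] L.R.m_comm)
 have V: "g (V_op B x y z) = V_op B (g x) (hat g y) (g z)" if "x : CB" "y : CB" "z : CB" for x y z
 proof -
  have "j \<otimes>\<^bsub>B\<^esub> (inv\<^bsub>S\<^esub> \<mu> \<odot>\<^bsub>B\<^esub> (j \<otimes>\<^bsub>B\<^esub> y)) = y" using that by (simp add: prod jj nu_cancel)
  moreover have "j \<otimes>\<^bsub>B\<^esub> g (inv\<^bsub>S\<^esub> \<mu> \<odot>\<^bsub>B\<^esub> (j \<otimes>\<^bsub>B\<^esub> y)) = hat g y" using that by (simp add: hat_def gl prod)
  ultimately show ?thesis using isometryD(5)[OF g that(1) _ that(3), of "inv\<^bsub>S\<^esub> \<mu> \<odot>\<^bsub>B\<^esub> (j \<otimes>\<^bsub>B\<^esub> y)"] that by simp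
 qed
 show "hat g (V_op B y x z) = V_op B (hat g y) (g x) (hat g z)" if x: "x : CB" and z: "z : CB"
 proof -
  note hlD = lin_mapsD[OF hl]
  have "\<mu> \<odot>\<^bsub>B\<^esub> hat g (V_op B y x z) = hat g (\<mu> \<odot>\<^bsub>B\<^esub> V_op B y x z)" using x y z by (simp add: hlD)
  also have "\<dots> = bt (j \<otimes>\<^bsub>B\<^esub> y) x \<odot>\<^bsub>B\<^esub> (\<mu> \<odot>\<^bsub>B\<^esub> hat g z) \<ominus>\<^bsub>B\<^esub> j \<otimes>\<^bsub>B\<^esub> g (V_op B x y (j \<otimes>\<^bsub>B\<^esub> z))"
   unfolding V_flip_mu[OF x y z] using x y z by (simp add: lin_maps_diff[OF B_module B_module hl] hlD hj bt(1))
  also have "\<dots> = bt (j \<otimes>\<^bsub>B\<^esub> hat g y) (g x) \<odot>\<^bsub>B\<^esub> (\<mu> \<odot>\<^bsub>B\<^esub> hat g z) \<ominus>\<^bsub>B\<^esub> j \<otimes>\<^bsub>B\<^esub> V_op B (g x) (hat g y) (j \<otimes>\<^bsub>B\<^esub> hat g z)"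
   using x y z by (simp add: jh V isometryD(4)[OF g])
  also have "\<dots> = \<mu> \<odot>\<^bsub>B\<^esub> V_op B (hat g y) (g x) (hat g z)"
   using x y z by (simp add: V_flip_mu gl(1) cl)
  finally show ?thesis by (rule unit_cancel_eq[OF units(1) B_module, rotated -1]) (use x y z gl(1) cl in simp_all)
 qed
 show "bt (hat g x) (hat g y) = bt x y" if x: "x : CB"
 proof -
  have *: "bt (j \<otimes>\<^bsub>B\<^esub> x) (j \<otimes>\<^bsub>B\<^esub> y) = \<ominus>\<^bsub>S\<^esub> (\<mu> \<otimes>\<^bsub>S\<^esub> bt x y)" if "x : CB" "y : CB" for x y
   using that bt_minus[of "j \<otimes>\<^bsub>B\<^esub> x" y] by (simp add: jj bt(1,2))
  have "\<mu> \<otimes>\<^bsub>S\<^esub> bt (hat g x) (hat g y) = \<ominus>\<^bsub>S\<^esub> bt (g (j \<otimes>\<^bsub>B\<^esub> x)) (g (j \<otimes>\<^bsub>B\<^esub> y))"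
   using *[of "hat g x" "hat g y"] x y cl bt(1) by (simp add: jh)
  also have "\<dots> = \<mu> \<otimes>\<^bsub>S\<^esub> bt x y" using x y * bt(1) by (simp add: isometryD(4)[OF g])
  finally show ?thesis
   using unit_cancel_eq[OF units(1) self_module[OF L.R.is_cring], of "bt (hat g x) (hat g y)" "bt x y"] x y cl bt(1) by simp
 qed
 show "hat g y : CB" "j \<otimes>\<^bsub>B\<^esub> hat g y = g (j \<otimes>\<^bsub>B\<^esub> y)" "hat g (j \<otimes>\<^bsub>B\<^esub> y) = j \<otimes>\<^bsub>B\<^esub> g y"
  "x : CB ==> z : CB ==> g (V_op B x y z) = V_op B (g x) (hat g y) (g z)"
  using y cl jh hj V by blast+
qed

text \<open>The degree-zero part of the extension is defined by a formula rather than on the generators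
 \<open>V x y\<close>, which satisfy unknown linear relations; the Casimir identity makes the formula send
 \<open>V x y\<close> to \<open>V (g x) (hat g y)\<close>.\<close>

lemma extension:
 assumes g: "isometry g"
 obtains \<psi> where "\<psi> : lin_maps S L L" "\<psi> Jp = Jp" "\<psi> Jm = Jm" "!!x. x : CB ==> \<psi> (Ip x) = Ip (g x)"
  "!!x. x : CB ==> \<psi> (Im x) = Im (hat g x)" "!!x y. x : CB ==> y : CB ==> \<psi> (V x y) = V (g x) (hat g y)" "\<psi> \<zeta> = \<zeta>"
proof -
 note gl = lin_mapsD[OF isometryD(1)[OF g]] and hl = lin_mapsD[OF isometry_hat(7)[OF g B_closed(1)]]
 define g' where "g' = inv_into (CB) g"
 have g': "g' x : CB" "g (g' x) = x" if "x : CB" for x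
  using isometryD(3)[OF g] that unfolding g'_def
  by (auto simp: bij_betw_def intro: inv_into_into f_inv_into_f)
 have ek: "e k : CB" "e' k : CB" if "k < n" for k using e_closed that by auto
 \<comment> \<open>The Casimir sum of the action of z on degree one, conjugated by g. For z =
   \<open>V x y\<close> the conjugate is \<open>V_op B (g x) (hat g y)\<close>, so
   \<open>casimir\<close> applies to the images of x and y.\<close>
 define \<Sigma> where "\<Sigma> z = (\<Oplus>k\<in>{..<n}. Ip (g (vp (z \<otimes> Ip (g' (e k))))) \<otimes> Im (e' k))" for z
 have \<Sigma>: "\<Sigma> : lin_maps S L L"
  unfolding \<Sigma>_def
 proof (rule lin_maps_finsum[OF L_module L_module])
  fix k assume "k : {..<n}"
  then have "e' k : CB" "g' (e k) : CB" using ek g' by auto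
  then show "(%z. Ip (g (vp (z \<otimes> Ip (g' (e k))))) \<otimes> Im (e' k)) : lin_maps S L L"
   by (intro lin_mapsI) (simp_all add: linear gl)
 qed simp
 note \<Sigma>l = lin_mapsD[OF \<Sigma>]
 have twelve: "nt 12 : Units S" using it_unit[of 12] it(7)[of 12] by simp
 let ?c = "inv\<^bsub>S\<^esub> nt 12"
 have c: "?c : carrier S" "?c \<otimes>\<^bsub>S\<^esub> nt 12 = \<one>\<^bsub>S\<^esub>" "nt 8 : carrier S" using twelve by auto
 \<comment> \<open>In degree zero the Casimir identity is solved for the operator: the correction 8
   \<delta> \<zeta> is subtracted, with \<delta>(z) read off from the bracket of z with
   \<open>Jp\<close>, and the result is divided by 12. Isometries preserve \<delta>, so the same
   correction fits the source and the image.\<close>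
 define \<psi> where "\<psi> z = ((cp z \<odot> Jp \<oplus> Ip (g (vp z))) \<oplus> (Im (hat g (vm z)) \<oplus> cm z \<odot> Jm)) \<oplus>
  ?c \<odot> (\<Sigma> z \<oplus> \<ominus> ((nt 8 \<otimes>\<^bsub>S\<^esub> cp (z \<otimes> Jp)) \<odot> \<zeta>))" for z
 have lin: "\<psi> : lin_maps S L L"
 proof (rule lin_mapsI)
  fix x assume x: "x : CL"
  show "\<psi> x : CL" unfolding \<psi>_def using x c gl hl \<Sigma>l by simp
  show "\<psi> (r \<odot> x) = r \<odot> \<psi> x" if r: "r : carrier S" for r
   unfolding \<psi>_def using x c(1,3) gl hl \<Sigma>l r
   by (simp add: linear L.smult_r_distr L.smult_r_minus L.smult_assoc1[symmetric] L.R.m_ac)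
  fix y assume y: "y : CL"
  show "\<psi> (x \<oplus> y) = \<psi> x \<oplus> \<psi> y"
   unfolding \<psi>_def using x c(1,3) gl hl \<Sigma>l y
   by (simp add: linear L.smult_r_distr L.smult_l_distr L.R.r_distr L.M.minus_add L.M.a_ac)
 qed
 have g0: "g \<zero>\<^bsub>B\<^esub> = \<zero>\<^bsub>B\<^esub>" "hat g \<zero>\<^bsub>B\<^esub> = \<zero>\<^bsub>B\<^esub>"
  using lin_maps_zero[OF B_module B_module] isometryD(1)[OF g] isometry_hat(7)[OF g B_closed(1)] by auto
 have S0: "\<Sigma> z = \<zero>" if "!!y. y : CB ==> vp (z \<otimes> Ip y) = \<zero>\<^bsub>B\<^esub>" for z
 proof -
  have "\<Sigma> z = (\<Oplus>k\<in>{..<n}. \<zero>)"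
   unfolding \<Sigma>_def using that ek g' by (intro L.M.finsum_cong') (auto simp: g0 zero)
  then show ?thesis by simp
 qed
 note z = zero g0 table table(1-3)[OF B_closed(1)] table' table'(1)[OF B_closed(1)] v_minus c_minus c_facts v_facts bt(1)
 have zz: "\<ominus> \<zero> = \<zero>" "\<ominus>\<^bsub>B\<^esub> \<zero>\<^bsub>B\<^esub> = \<zero>\<^bsub>B\<^esub>" by (rule L.M.minus_equality B.M.minus_equality; simp)+
 show thesis
 proof (rule that[OF lin])
  have "\<Sigma> Jp = \<zero>" "\<Sigma> Jm = \<zero>" by (rule S0, simp add: z zz)+
  then show "\<psi> Jp = Jp" "\<psi> Jm = Jm" using c by (simp_all add: \<psi>_def z zz)
  fix x assume x: "x : CB"
  have "\<Sigma> (Ip x) = \<zero>" "\<Sigma> (Im x) = \<zero>" by (rule S0, simp add: z zz x)+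
  then show "\<psi> (Ip x) = Ip (g x)" "\<psi> (Im x) = Im (hat g x)" using c x gl hl by (simp_all add: \<psi>_def z zz)
  fix y assume y: "y : CB"
  let ?d = "(nt 8 \<otimes>\<^bsub>S\<^esub> bt (j \<otimes>\<^bsub>B\<^esub> y) x) \<odot> \<zeta>"
  have "\<Sigma> (V x y) = (\<Oplus>k\<in>{..<n}. Ip (V_op B (g x) (hat g y) (e k)) \<otimes> Im (e' k))"
   unfolding \<Sigma>_def using x y ek g' gl hl by (intro L.M.finsum_cong') (auto simp: table isometry_hat(4)[OF g])
  also have "\<dots> = nt 12 \<odot> V (g x) (hat g y) \<oplus> ?d"
   using x y gl hl by (simp add: casimir bt_def[symmetric] isometry_hat(2)[OF g] isometryD(4)[OF g])
  finally have "\<Sigma> (V x y) \<oplus> \<ominus> ?d = nt 12 \<odot> V (g x) (hat g y)"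
   using x y gl hl c bt(1) by (simp add: L.M.a_assoc L.M.r_neg)
  then have "\<psi> (V x y) = ?c \<odot> (nt 12 \<odot> V (g x) (hat g y))"
   using x y c gl hl by (simp add: \<psi>_def z)
  then show "\<psi> (V x y) = V (g x) (hat g y)" using x y gl hl c by (simp add: L.smult_assoc1[symmetric])
 next
  \<comment> \<open>A second evaluation at \<zeta>, now with \<open>V_op B \<one> \<one>\<close> as
    the identity, so that g and its inverse cancel. Compared with the rule for \<open>V x y\<close>
    it shows that \<open>V (g \<one>) (hat g \<one>)\<close> is \<zeta>, which is what preserving
    the bracket of \<open>Jp\<close> and \<open>Jm\<close> requires.\<close>
  let ?d = "(nt 8 \<otimes>\<^bsub>S\<^esub> bt (j \<otimes>\<^bsub>B\<^esub> \<one>\<^bsub>B\<^esub>) \<one>\<^bsub>B\<^esub>) \<odot> \<zeta>"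
  have d: "?d : CL" using c bt(1) by simp
  have "\<Sigma> \<zeta> = (\<Oplus>k\<in>{..<n}. Ip (V_op B \<one>\<^bsub>B\<^esub> \<one>\<^bsub>B\<^esub> (e k)) \<otimes> Im (e' k))"
   unfolding \<Sigma>_def using ek g' by (intro L.M.finsum_cong') (auto simp: table V_one)
  also have "\<dots> = nt 12 \<odot> \<zeta> \<oplus> ?d" by (simp add: casimir bt_def[symmetric])
  finally have "\<Sigma> \<zeta> \<oplus> \<ominus> ?d = nt 12 \<odot> \<zeta>"
   using c d by (simp add: L.M.a_assoc L.M.r_neg)
  moreover have "cp (\<zeta> \<otimes> Jp) = bt (j \<otimes>\<^bsub>B\<^esub> \<one>\<^bsub>B\<^esub>) \<one>\<^bsub>B\<^esub>" by (simp add: table c_facts bt(1))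
  ultimately have "\<psi> \<zeta> = ?c \<odot> (nt 12 \<odot> \<zeta>)"
   unfolding \<psi>_def by (simp add: zero g0 c)
  then show "\<psi> \<zeta> = \<zeta>" using c by (simp add: L.smult_assoc1[symmetric])
 qed
qed

lemma isometry_inverse:
 assumes g: "isometry g"
 obtains h where "isometry h" "!!x. x : CB ==> g (h x) = x" "!!x. x : CB ==> h (g x) = x"
proof -
 note G = isometryD[OF g] and gl = lin_mapsD[OF isometryD(1)[OF g]]
 define h where "h = (\<lambda>x\<in>carrier B. inv_into (CB) g x)"
 have h: "h x : CB" "g (h x) = x" "h (g x) = x" if "x : CB" for x
  using that G(3) gl(1)[OF that] by (auto simp: h_def bij_betw_def inv_into_f_f intro: inv_into_into f_inv_into_f)
 have inj: "x = y" if "g x = g y" "x : CB" "y : CB" for x y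
  using that G(3) by (auto simp: bij_betw_def inj_on_def)
 have lin: "h : lin_maps S B B" by (rule lin_mapsI; (rule inj)?) (simp_all add: h gl)
 have "bij_betw h (CB) (CB)"
 proof (rule bij_betwI')
  fix x y assume "x : CB" "y : CB"
  then show "h x = h y \<longleftrightarrow> x = y" using h(2) by metis
 qed (use h gl(1) in metis)+
 then have "isometry h"
  unfolding isometry_def lin_autos_def
 proof (intro conjI ballI CollectI IntI lin)
  show "h : extensional (CB)" by (simp add: h_def)
  fix x y assume xy: "x : CB" "y : CB"
  then show "bt (h x) (h y) = bt x y" using G(4)[of "h x" "h y"] h by simp
  fix z assume z: "z : CB"
  show "h (V_op B x (j \<otimes>\<^bsub>B\<^esub> y) z) = V_op B (h x) (j \<otimes>\<^bsub>B\<^esub> h y) (h z)"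
   by (rule inj) (use xy z in \<open>simp_all add: h G(5)\<close>)
 qed
 with h that show thesis by blast
qed

text \<open>Bijectivity comes from the extension of the inverse isometry: both composites are linear
  and fix the generators. Multiplicativity is checked on pairs of generators and spread by
  linearity, one argument at a time.\<close>

lemma isometry_extends:
 assumes g: "isometry g"
 shows "\<exists>f. f : carrier (aut_group S L) \<and> f Jp = Jp \<and> f Jm = Jm \<and> restr f = g"
proof -
 obtain \<psi> where \<psi>: "\<psi> : lin_maps S L L" "\<psi> Jp = Jp" "\<psi> Jm = Jm" "!!x. x : CB ==> \<psi> (Ip x) = Ip (g x)"
  "!!x. x : CB ==> \<psi> (Im x) = Im (hat g x)" "!!x y. x : CB ==> y : CB ==> \<psi> (V x y) = V (g x) (hat g y)" "\<psi> \<zeta> = \<zeta>"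
  by (rule extension[OF g]) (rule that; assumption)
 obtain h where h: "isometry h" "!!x. x : CB ==> g (h x) = x" "!!x. x : CB ==> h (g x) = x"
  by (rule isometry_inverse[OF g]) (rule that; assumption)
 obtain \<phi> where \<phi>: "\<phi> : lin_maps S L L" "\<phi> Jp = Jp" "\<phi> Jm = Jm" "!!x. x : CB ==> \<phi> (Ip x) = Ip (h x)"
  "!!x. x : CB ==> \<phi> (Im x) = Im (hat h x)" "!!x y. x : CB ==> y : CB ==> \<phi> (V x y) = V (h x) (hat h y)"
  by (rule extension[OF h(1)]) (rule that; assumption)
 note gl = lin_mapsD[OF isometryD(1)[OF g]] lin_mapsD[OF isometryD(1)[OF h(1)]]
 note hl = lin_mapsD[OF isometry_hat(7)[OF g B_closed(1)]] lin_mapsD[OF isometry_hat(7)[OF h(1) B_closed(1)]]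
 have hat: "hat g (hat h x) = x" "hat h (hat g x) = x" if "x : CB" for x
  using that h(2,3) by (simp add: hat_def[of g] isometry_hat(2)[OF h(1)] jj nu_cancel,
   simp add: hat_def[of h] isometry_hat(2)[OF g] jj nu_cancel)
 have id: "(%z. z) : lin_maps S L L" by (rule lin_mapsI) simp_all
 have inv: "\<psi> (\<phi> z) = z" "\<phi> (\<psi> z) = z" if z: "z : CL" for z
 proof -
  show "\<psi> (\<phi> z) = z"
   by (rule lin_maps_eqI[OF lin_maps_comp[OF \<phi>(1) \<psi>(1)] id L_module z]) (simp_all add: \<psi> \<phi> h hat gl hl)
  show "\<phi> (\<psi> z) = z"
   by (rule lin_maps_eqI[OF lin_maps_comp[OF \<psi>(1) \<phi>(1)] id L_module z]) (simp_all add: \<psi> \<phi> h hat gl hl)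
 qed
 note l = lin_mapsD[OF \<psi>(1)] lin_maps_minus[OF L_module L_module \<psi>(1)] lin_maps_zero[OF L_module L_module \<psi>(1)]
  lin_maps_diff[OF L_module L_module \<psi>(1)]
 have g1: "V (g \<one>\<^bsub>B\<^esub>) (hat g \<one>\<^bsub>B\<^esub>) = \<zeta>" using \<psi>(6)[of "\<one>\<^bsub>B\<^esub>" "\<one>\<^bsub>B\<^esub>"] \<psi>(7) by simp
 have btg: "bt (j \<otimes>\<^bsub>B\<^esub> hat g y) (g x) = bt (j \<otimes>\<^bsub>B\<^esub> y) x" if "x : CB" "y : CB" for x y
  using that by (simp add: isometry_hat(2)[OF g] isometryD(4)[OF g])
 note t = table table(1-3)[OF B_closed(1)] table' table'(1)[OF B_closed(1)] g1 btg \<psi> l gl hl bt(1)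
  isometry_hat(2)[OF g, symmetric] isometry_hat(3-6)[OF g] isometryD(4)[OF g]
 let ?G = "{Jp, Jm} \<union> Ip ` CB \<union> Im ` CB \<union> {V x y | x y. x : CB \<and> y : CB}"
 \<comment> \<open>For each pair of generators at least one order is settled by the bracket tables;
   antisymmetry then yields the other.\<close>
 have gen: "\<psi> (u \<otimes> v) = \<psi> u \<otimes> \<psi> v \<or> \<psi> (v \<otimes> u) = \<psi> v \<otimes> \<psi> u" if "u : ?G" "v : ?G" for u v
  using that by (elim UnE insertE emptyE imageE CollectE exE conjE) (simp_all add: t)
 have gen_hom: "\<psi> (u \<otimes> v) = \<psi> u \<otimes> \<psi> v" if "u : ?G" "v : ?G" for u v
 proof -
  have c: "u : CL" "v : CL" using that by auto
  show ?thesis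
  proof (cases "\<psi> (v \<otimes> u) = \<psi> v \<otimes> \<psi> u")
   case True
   then show ?thesis unfolding antisym[OF c] antisym[OF l(1)[OF c(1)] l(1)[OF c(2)]] using c by (simp add: l)
  qed (use gen[OF that] in simp)
 qed
 have hom: "\<psi> (u \<otimes> v) = \<psi> u \<otimes> \<psi> v" if u: "u : CL" and v: "v : CL" for u v
 proof -
  have right: "\<psi> (u \<otimes> v) = \<psi> u \<otimes> \<psi> v" if uG: "u : ?G" for u
  proof -
   have u: "u : CL" using uG by auto
   show ?thesis
   proof (rule lin_maps_eqI[where f = "%v. \<psi> (u \<otimes> v)" and g = "%v. \<psi> u \<otimes> \<psi> v", OF _ _ L_module v])
    show "(%v. \<psi> (u \<otimes> v)) : lin_maps S L L" "(%v. \<psi> u \<otimes> \<psi> v) : lin_maps S L L"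
     by (rule lin_mapsI; use u in \<open>simp add: brack l\<close>)+
   qed (rule gen_hom[OF uG]; auto)+
  qed
  show ?thesis
  proof (rule lin_maps_eqI[where f = "%u. \<psi> (u \<otimes> v)" and g = "%u. \<psi> u \<otimes> \<psi> v", OF _ _ L_module u])
   show "(%u. \<psi> (u \<otimes> v)) : lin_maps S L L" "(%u. \<psi> u \<otimes> \<psi> v) : lin_maps S L L"
    by (rule lin_mapsI; use v in \<open>simp add: brack l\<close>)+
  qed (rule right; auto)+
 qed
 let ?f = "\<lambda>z\<in>carrier L. \<psi> z"
 have "?f : lin_maps S L L" by (rule lin_maps_cong[OF \<psi>(1) L_module]) simp
 moreover have "bij_betw ?f (CL) (CL)"
  by (rule bij_betw_byWitness[where f' = \<phi>]) (use inv l lin_mapsD(1)[OF \<phi>(1)] in auto)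
 ultimately have "?f : carrier (aut_group S L)" using hom by (simp add: aut_group_def lin_autos_def)
 moreover have "restr ?f = g"
 proof (rule extensionalityI[OF _ isometryD(2)[OF g]])
  show "restr ?f : extensional (CB)" by (simp add: restr_def)
  fix x assume "x : CB"
  then show "restr ?f x = g x" by (simp add: restr_def \<psi> gl inv_into_f_f[OF Ip_inj])
 qed
 ultimately show ?thesis using \<psi>(2,3) by (intro exI[of _ ?f]) simp
qed


text \<open>Since \<mu>^-1 is a unit, fixing its multiple of \<open>Jm\<close> is fixing
  \<open>Jm\<close>. An automorphism fixing the pair is graded and recovered from its restriction;
  conversely the extension of an isometry is the only graded automorphism with that
  restriction.\<close>

theorem stabilizer_eq:
 "{f : carrier (aut_group S L). f Jp = Jp \<and> f (inv\<^bsub>S\<^esub> \<mu> \<odot> Jm) = inv\<^bsub>S\<^esub> \<mu> \<odot> Jm} =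
  inv_into {f. graded f} restr ` inv_triple S B j" (is "?A = ?B")
proof -
 have inj: "inj_on restr {f. graded f}" by (rule inj_onI) (use graded_eqI in blast)
 have fix_J: "f Jm = Jm \<longleftrightarrow> f (inv\<^bsub>S\<^esub> \<mu> \<odot> Jm) = inv\<^bsub>S\<^esub> \<mu> \<odot> Jm" if "f : carrier (aut_group S L)" for f
 proof -
  note l = lin_mapsD[OF aut_groupD(1)[OF that]]
  have "inv\<^bsub>S\<^esub> \<mu> \<odot> f Jm = inv\<^bsub>S\<^esub> \<mu> \<odot> Jm ==> f Jm = Jm"
   by (rule unit_cancel_eq[OF L.R.Units_inv_Units[OF units(1)] L_module]) (simp_all add: l)
  then show ?thesis by (auto simp: l)
 qed
 show ?thesis
 proof (intro equalityI subsetI)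
  fix f assume "f : ?A"
  then have f: "f : carrier (aut_group S L)" "f Jp = Jp" "f Jm = Jm" using fix_J by auto
  note gr = fixing_graded[OF f]
  have "restr f : inv_triple S B j" unfolding inv_triple_eq by (rule graded_isometry[OF gr f(2,3)])
  moreover have "inv_into {f. graded f} restr (restr f) = f" using gr by (intro inv_into_f_f[OF inj]) simp
  ultimately show "f : ?B" by (metis image_eqI)
 next
  fix f assume "f : ?B"
  then obtain g where g: "isometry g" "f = inv_into {f. graded f} restr g" using inv_triple_eq by auto
  obtain f' where f': "f' : carrier (aut_group S L)" "f' Jp = Jp" "f' Jm = Jm" "restr f' = g" using isometry_extends[OF g(1)] by blast
  have "f = f'" unfolding g(2) f'(4)[symmetric] using fixing_graded[OF f'(1-3)] by (intro inv_into_f_f[OF inj]) simp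
  then show "f : ?A" using f' fix_J by auto
 qed
qed

end

section \<open>Base change of L(B) to an arbitrary \<open>R\<close>-ring\<close>

lemma module_cong:
 fixes N :: "('r, 'm, 'x) module_scheme" and M :: "('r, 'm, 'y) module_scheme"
 assumes "module R M" "carrier N = carrier M" "add N = add M" "zero N = zero M" "smult N = smult M"
 shows "module R N" "x : carrier M ==> \<ominus>\<^bsub>N\<^esub> x = \<ominus>\<^bsub>M\<^esub> x"
proof -
 interpret M: module R M by fact
 show N: "module R N"
 proof (rule moduleI[OF M.R.is_cring])
  show "abelian_group N"
  proof (rule abelian_groupI; unfold assms(2-5))
   fix x assume x: "x : carrier M"
   then show "\<exists>y\<in>carrier M. y \<oplus>\<^bsub>M\<^esub> x = \<zero>\<^bsub>M\<^esub>"
    by (intro bexI[of _ "\<ominus>\<^bsub>M\<^esub> x"]) (simp_all add: M.M.l_neg)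
  qed (simp_all add: M.M.a_ac)
 qed (simp_all add: assms(2-5) M.smult_l_distr M.smult_r_distr M.smult_assoc1)
 show "x : carrier M ==> \<ominus>\<^bsub>N\<^esub> x = \<ominus>\<^bsub>M\<^esub> x"
  using module_neg_smult[OF N, of x] module_neg_smult[OF assms(1), of x] by (simp add: assms)
qed

lemma V_op_trilinear:
 assumes B: "module R B" "bilinear_mult R B" and inv: "invol B : lin_maps R B B"
  and x: "x : carrier B" and y: "y : carrier B" and z: "z : carrier B"
 shows "V_op B x y z : carrier B"
  "x' : carrier B ==> V_op B (x \<oplus>\<^bsub>B\<^esub> x') y z = V_op B x y z \<oplus>\<^bsub>B\<^esub> V_op B x' y z"
  "x' : carrier B ==> V_op B y (x \<oplus>\<^bsub>B\<^esub> x') z = V_op B y x z \<oplus>\<^bsub>B\<^esub> V_op B y x' z"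
  "x' : carrier B ==> V_op B y z (x \<oplus>\<^bsub>B\<^esub> x') = V_op B y z x \<oplus>\<^bsub>B\<^esub> V_op B y z x'"
  "r : carrier R ==> V_op B (r \<odot>\<^bsub>B\<^esub> x) y z = r \<odot>\<^bsub>B\<^esub> V_op B x y z"
  "r : carrier R ==> V_op B y (r \<odot>\<^bsub>B\<^esub> x) z = r \<odot>\<^bsub>B\<^esub> V_op B y x z"
  "r : carrier R ==> V_op B y z (r \<odot>\<^bsub>B\<^esub> x) = r \<odot>\<^bsub>B\<^esub> V_op B y z x"
proof -
 interpret module R B by fact
 note s = V_op_def lin_mapsD[OF inv] bilinear_multD[OF B(2)] a_minus_def M.minus_add M.a_ac smult_r_distr smult_r_minus x y z
 show "V_op B x y z : carrier B" by (simp add: s)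
 show "V_op B (x \<oplus>\<^bsub>B\<^esub> x') y z = V_op B x y z \<oplus>\<^bsub>B\<^esub> V_op B x' y z"
  "V_op B y (x \<oplus>\<^bsub>B\<^esub> x') z = V_op B y x z \<oplus>\<^bsub>B\<^esub> V_op B y x' z"
  "V_op B y z (x \<oplus>\<^bsub>B\<^esub> x') = V_op B y z x \<oplus>\<^bsub>B\<^esub> V_op B y z x'" if "x' : carrier B"
  using that by (simp_all add: s)
 show "V_op B (r \<odot>\<^bsub>B\<^esub> x) y z = r \<odot>\<^bsub>B\<^esub> V_op B x y z" "V_op B y (r \<odot>\<^bsub>B\<^esub> x) z = r \<odot>\<^bsub>B\<^esub> V_op B y x z"
  "V_op B y z (r \<odot>\<^bsub>B\<^esub> x) = r \<odot>\<^bsub>B\<^esub> V_op B y z x" if "r : carrier R"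
  using that by (simp_all add: s)
qed

context scalar_ext
begin

lemma tens_zero: "tens \<zero>\<^bsub>M\<^esub> \<one>\<^bsub>S\<^esub> = \<zero>\<^bsub>BC\<^esub>"
proof -
 interpret M: module R M by (rule module_M)
 interpret BC: module S BC by (rule BC_module)
 show ?thesis
  using tens_add[of "\<zero>\<^bsub>M\<^esub>" "\<zero>\<^bsub>M\<^esub>"] BC.M.add.r_cancel_one[of "tens \<zero>\<^bsub>M\<^esub> \<one>\<^bsub>S\<^esub>" "tens \<zero>\<^bsub>M\<^esub> \<one>\<^bsub>S\<^esub>"] by (simp add: tens_closed)
qed

lemma tens_minus: "m : carrier M ==> tens (\<ominus>\<^bsub>M\<^esub> m) \<one>\<^bsub>S\<^esub> = \<ominus>\<^bsub>BC\<^esub> tens m \<one>\<^bsub>S\<^esub>"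
proof -
 assume m: "m : carrier M"
 interpret M: module R M by (rule module_M)
 interpret BC: module S BC by (rule BC_module)
 show ?thesis
  using m tens_add[of "\<ominus>\<^bsub>M\<^esub> m" m]
  by (intro BC.M.minus_equality[symmetric]) (simp_all add: tens_closed M.M.l_neg tens_zero)
qed

lemma form_lift:
 assumes "f : lin_forms R M"
 shows "lift (self_module S) (%m. f m \<odot>\<^bsub>S\<^esub> \<one>\<^bsub>S\<^esub>) : lin_forms S BC"
  "m : carrier M ==> lift (self_module S) (%m. f m \<odot>\<^bsub>S\<^esub> \<one>\<^bsub>S\<^esub>) (tens m \<one>\<^bsub>S\<^esub>) = f m \<odot>\<^bsub>S\<^esub> \<one>\<^bsub>S\<^esub>"
proof -
 interpret S: algebra R S by (rule algebra_S)
 have semi: "semilinear (self_module S) (%m. f m \<odot>\<^bsub>S\<^esub> \<one>\<^bsub>S\<^esub>)"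
  using lin_mapsD[OF assms[unfolded lin_forms_eq]]
  by (auto simp: semilinear_def S.smult_l_distr S.smult_assoc1 S.smult_assoc2)
 show "lift (self_module S) (%m. f m \<odot>\<^bsub>S\<^esub> \<one>\<^bsub>S\<^esub>) : lin_forms S BC"
  unfolding lin_forms_eq by (rule lift(1)[OF self_module[OF cring_S] semi])
 show "m : carrier M ==> lift (self_module S) (%m. f m \<odot>\<^bsub>S\<^esub> \<one>\<^bsub>S\<^esub>) (tens m \<one>\<^bsub>S\<^esub>) = f m \<odot>\<^bsub>S\<^esub> \<one>\<^bsub>S\<^esub>"
  by (rule lift_unit[OF self_module[OF cring_S] semi])
qed

end

lemma base_map_lin:
 assumes "scalar_ext R S M" "scalar_ext R S M'" "f : lin_maps R M M'"
 shows "base_map R S M M' f : lin_maps S (base_change R S M) (base_change R S M')"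
  "m : carrier M ==> base_map R S M M' f (tensor R S M m \<one>\<^bsub>S\<^esub>) = tensor R S M' (f m) \<one>\<^bsub>S\<^esub>"
proof -
 interpret M: scalar_ext R S M by fact
 interpret M': scalar_ext R S M' by fact
 interpret BC: module S M.BC by (rule M.BC_module)
 note b = base_map_lift[OF assms]
 have semi: "M.semilinear M'.BC (%m. M'.tens (f m) \<one>\<^bsub>S\<^esub>)" by (rule b(2)[OF BC.M.zero_closed])
 show "base_map R S M M' f : lin_maps S M.BC M'.BC"
  by (rule lin_maps_cong[OF M.lift(1)[OF M'.BC_module semi] M.BC_module]) (simp add: b(1))
 show "m : carrier M ==> base_map R S M M' f (M.tens m \<one>\<^bsub>S\<^esub>) = M'.tens (f m) \<one>\<^bsub>S\<^esub>"
  by (simp add: b(1) M.tens_closed M.lift_unit[OF M'.BC_module semi])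
qed

locale brown_ext = split_form R B T h0 j \<mu>
 for R :: "('r, 'w) ring_scheme" and B :: "('r, 'b) inv_algebra" (structure) and T :: "('r, 't) module" and h0 and j and \<mu> +
 fixes S :: "('r, 's) module"
 assumes S: "algebra R S"
begin

abbreviation (input) "BI \<equiv> inv_base_change R S B"
abbreviation (input) "LL \<equiv> base_change R S (tkk R B)"
abbreviation (input) "CI \<equiv> carrier (inv_base_change R S B)"
abbreviation (input) "CL \<equiv> carrier (base_change R S (tkk R B))"
abbreviation lie_mult (infixl "\<star>" 70) where "u \<star> v \<equiv> u \<otimes>\<^bsub>base_change R S (tkk R B)\<^esub> v"
abbreviation "tn x \<equiv> tensor R S B x \<one>\<^bsub>S\<^esub>"
abbreviation "tu u \<equiv> tensor R S (tkk R B) u \<one>\<^bsub>S\<^esub>"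
abbreviation "sc r \<equiv> r \<odot>\<^bsub>S\<^esub> \<one>\<^bsub>S\<^esub>"

sublocale BS: scalar_ext R S B by (rule scalar_ext.intro[OF S B_facts(1)])
sublocale LS: scalar_ext R S "tkk R B" by (rule scalar_ext.intro[OF S tkk_module])
sublocale LL: module S "base_change R S (tkk R B)" by (rule LS.BC_module)

lemmas ibc = inv_base_change_simps

lemma BI_module: "module S BI" and BI_minus: "x : carrier BS.BC ==> \<ominus>\<^bsub>BI\<^esub> x = \<ominus>\<^bsub>BS.BC\<^esub> x"
 using module_cong[OF BS.BC_module, of BI] by (simp_all add: ibc)

sublocale BI: module S "inv_base_change R S B" by (rule BI_module)

lemma BI_bil: "bilinear_mult S BI"
 using BS.BC_bilinear[OF B_facts(2)] by (simp add: bilinear_mult_def ibc lin_maps_inv_base_change)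

lemma BI_invol: "invol BI : lin_maps S BI BI"
 using base_map_lin(1)[OF BS.scalar_ext_axioms BS.scalar_ext_axioms B_facts(6)] by (simp add: ibc lin_maps_inv_base_change)

lemma LL_bil: "bilinear_mult S LL" by (rule LS.BC_bilinear[OF tkk_bilinear])

lemma tn_closed [simp]: "x : CB ==> tn x : CI"
 by (simp add: ibc BS.tens_closed)

lemma tn_hom:
 assumes x: "x : CB"
 shows "y : CB ==> tn x \<oplus>\<^bsub>BI\<^esub> tn y = tn (x \<oplus> y)" "y : CB ==> tn x \<otimes>\<^bsub>BI\<^esub> tn y = tn (x \<otimes> y)"
  "r : carrier R ==> sc r \<odot>\<^bsub>BI\<^esub> tn x = tn (r \<odot> x)" "\<ominus>\<^bsub>BI\<^esub> tn x = tn (\<ominus> x)"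
  "y : CB ==> tn x \<ominus>\<^bsub>BI\<^esub> tn y = tn (x \<ominus> y)" "invol BI (tn x) = tn (invol B x)" "\<one>\<^bsub>BI\<^esub> = tn \<one>" "\<zero>\<^bsub>BI\<^esub> = tn \<zero>"
 using x base_map_lin(2)[OF BS.scalar_ext_axioms BS.scalar_ext_axioms B_facts(6) x] BI_minus[OF BS.tens_closed[OF x BS.one_S]]
  BI_minus[OF BS.tens_closed[OF _ BS.one_S], of y]
 by (simp_all add: ibc BS.tens_add BS.tens_scalar BS.tens_mult[OF B_facts(2)] BS.tens_minus BS.BC_one BS.tens_zero a_minus_def)

lemma BI_induct [consumes 1, case_names tens add smult]:
 assumes "x : CI" "!!m. m : CB ==> P (tn m)"
  "!!x y. x : CI ==> y : CI ==> P x ==> P y ==> P (x \<oplus>\<^bsub>BI\<^esub> y)"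
  "!!s x. s : carrier S ==> x : CI ==> P x ==> P (s \<odot>\<^bsub>BI\<^esub> x)"
 shows "P x"
 using assms unfolding ibc by (rule BS.BC_induct)

text \<open>An identity linear in each variable holds once it holds for elements m \<otimes> 1.
  These multi-variable rules let the tables below be computed over \<open>R\<close>, where the
  bracket is explicit.\<close>

lemma BI_induct2 [consumes 2, case_names tens add1 smult1 add2 smult2]:
 assumes xy: "x : CI" "y : CI" and t: "!!x y. x : CB ==> y : CB ==> P (tn x) (tn y)"
  and 1: "!!x x' y. x : CI ==> x' : CI ==> y : CI ==> P x y ==> P x' y ==> P (x \<oplus>\<^bsub>BI\<^esub> x') y"
  "!!r x y. r : carrier S ==> x : CI ==> y : CI ==> P x y ==> P (r \<odot>\<^bsub>BI\<^esub> x) y"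
  and 2: "!!x y y'. x : CI ==> y : CI ==> y' : CI ==> P x y ==> P x y' ==> P x (y \<oplus>\<^bsub>BI\<^esub> y')"
  "!!r x y. r : carrier S ==> x : CI ==> y : CI ==> P x y ==> P x (r \<odot>\<^bsub>BI\<^esub> y)"
 shows "P x y"
 using xy(1)
proof (induction rule: BI_induct)
 case (tens x)
 show ?case using xy(2) by (induction rule: BI_induct) (use tens t 2 in auto)
qed (use xy 1 in auto)

lemma BI_induct3 [consumes 3, case_names tens add1 smult1 add2 smult2 add3 smult3]:
 assumes xyz: "x : CI" "y : CI" "z : CI"
  and t: "!!x y z. x : CB ==> y : CB ==> z : CB ==> P (tn x) (tn y) (tn z)"
  and 1: "!!x x' y z. x : CI ==> x' : CI ==> y : CI ==> z : CI ==> P x y z ==> P x' y z ==> P (x \<oplus>\<^bsub>BI\<^esub> x') y z"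
  "!!r x y z. r : carrier S ==> x : CI ==> y : CI ==> z : CI ==> P x y z ==> P (r \<odot>\<^bsub>BI\<^esub> x) y z"
  and 2: "!!x y y' z. x : CI ==> y : CI ==> y' : CI ==> z : CI ==> P x y z ==> P x y' z ==> P x (y \<oplus>\<^bsub>BI\<^esub> y') z"
  "!!r x y z. r : carrier S ==> x : CI ==> y : CI ==> z : CI ==> P x y z ==> P x (r \<odot>\<^bsub>BI\<^esub> y) z"
  and 3: "!!x y z z'. x : CI ==> y : CI ==> z : CI ==> z' : CI ==> P x y z ==> P x y z' ==> P x y (z \<oplus>\<^bsub>BI\<^esub> z')"
  "!!r x y z. r : carrier S ==> x : CI ==> y : CI ==> z : CI ==> P x y z ==> P x y (r \<odot>\<^bsub>BI\<^esub> z)"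
 shows "P x y z"
 using xyz(1)
proof (induction rule: BI_induct)
 case (tens x)
 then have x: "tn x : CI" by simp
 show ?case using xyz(2,3)
 proof (induction rule: BI_induct2)
  case (tens y z)
  then show ?case using t \<open>x : CB\<close> by blast
 qed (rule 2 3; (assumption | rule x))+
qed (rule 1; (assumption | rule xyz))+

lemma BI_induct4 [consumes 4, case_names tens add1 smult1 add2 smult2 add3 smult3 add4 smult4]:
 assumes xyz: "x : CI" "y : CI" "z : CI" "w : CI"
  and t: "!!x y z w. x : CB ==> y : CB ==> z : CB ==> w : CB ==> P (tn x) (tn y) (tn z) (tn w)"
  and 1: "!!x x' y z w. x : CI ==> x' : CI ==> y : CI ==> z : CI ==> w : CI ==> P x y z w ==> P x' y z w ==> P (x \<oplus>\<^bsub>BI\<^esub> x') y z w"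
  "!!r x y z w. r : carrier S ==> x : CI ==> y : CI ==> z : CI ==> w : CI ==> P x y z w ==> P (r \<odot>\<^bsub>BI\<^esub> x) y z w"
  and 2: "!!x y y' z w. x : CI ==> y : CI ==> y' : CI ==> z : CI ==> w : CI ==> P x y z w ==> P x y' z w ==> P x (y \<oplus>\<^bsub>BI\<^esub> y') z w"
  "!!r x y z w. r : carrier S ==> x : CI ==> y : CI ==> z : CI ==> w : CI ==> P x y z w ==> P x (r \<odot>\<^bsub>BI\<^esub> y) z w"
  and 3: "!!x y z z' w. x : CI ==> y : CI ==> z : CI ==> z' : CI ==> w : CI ==> P x y z w ==> P x y z' w ==> P x y (z \<oplus>\<^bsub>BI\<^esub> z') w"
  "!!r x y z w. r : carrier S ==> x : CI ==> y : CI ==> z : CI ==> w : CI ==> P x y z w ==> P x y (r \<odot>\<^bsub>BI\<^esub> z) w"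
  and 4: "!!x y z w w'. x : CI ==> y : CI ==> z : CI ==> w : CI ==> w' : CI ==> P x y z w ==> P x y z w' ==> P x y z (w \<oplus>\<^bsub>BI\<^esub> w')"
  "!!r x y z w. r : carrier S ==> x : CI ==> y : CI ==> z : CI ==> w : CI ==> P x y z w ==> P x y z (r \<odot>\<^bsub>BI\<^esub> w)"
 shows "P x y z w"
 using xyz(1)
proof (induction rule: BI_induct)
 case (tens x)
 then have x: "tn x : CI" by simp
 show ?case using xyz(2-4)
 proof (induction rule: BI_induct3)
  case (tens y z w)
  then show ?case using t \<open>x : CB\<close> by blast
 qed (rule 2 3 4; (assumption | rule x))+
qed (rule 1; (assumption | rule xyz))+

lemma tu_closed [simp]: "u : carrier L0 ==> tu u : CL"
 by (simp add: LS.tens_closed tkk_simps)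

lemma tu_hom:
 assumes u: "u : carrier L0"
 shows "v : carrier L0 ==> tu u \<oplus>\<^bsub>LL\<^esub> tu v = tu (u \<oplus>\<^bsub>L0\<^esub> v)" "v : carrier L0 ==> tu u \<star> tu v = tu (br u v)"
  "r : carrier R ==> sc r \<odot>\<^bsub>LL\<^esub> tu u = tu (r \<odot>\<^bsub>L0\<^esub> u)" "\<ominus>\<^bsub>LL\<^esub> tu u = tu (\<ominus>\<^bsub>L0\<^esub> u)" "\<zero>\<^bsub>LL\<^esub> = tu \<zero>\<^bsub>L0\<^esub>"
  "v : carrier L0 ==> tu u \<ominus>\<^bsub>LL\<^esub> tu v = tu (u \<ominus>\<^bsub>L0\<^esub> v)"
 using u LS.tens_add[of u v] LS.tens_scalar[of u r] LS.tens_mult[OF tkk_bilinear, of u v] LS.tens_minus[of u] LS.tens_minus[of v] LS.tens_zero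
  LS.tens_add[of u "\<ominus>\<^bsub>L0\<^esub> v"] L0_module
 by (simp_all add: tkk_simps a_minus_def module.axioms abelian_group.a_inv_closed[OF module.axioms(2)[OF L0_module]])

lemmas LL_induct = LS.BC_induct[unfolded tkk_simps, consumes 1, case_names tens add smult]

lemma LL_antisym:
 assumes u: "u : CL" and v: "v : CL"
 shows "u \<star> v = \<ominus>\<^bsub>LL\<^esub> (v \<star> u)"
 using u
proof (induction rule: LL_induct)
 case (tens m)
 show ?case
  using v
 proof (induction rule: LL_induct)
  case (tens m')
  then show ?case using \<open>m : carrier L0\<close> br_facts(2)[of m m'] by (simp add: tu_hom br_facts(1))
 qed (use tens in \<open>simp_all add: bilinear_multD[OF LL_bil] LL.M.minus_add LL.smult_r_minus\<close>)
qed (use v in \<open>simp_all add: bilinear_multD[OF LL_bil] LL.M.minus_add LL.smult_r_minus\<close>)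

end

context brown_ext
begin

interpretation Sa: algebra R S by (rule S)

lemma sc_closed [simp]: "r : carrier R ==> sc r : carrier S" by (rule BS.scalar_closed)

lemma sc_hom: "r : carrier R ==> s : carrier R ==> sc (r \<oplus>\<^bsub>R\<^esub> s) = sc r \<oplus>\<^bsub>S\<^esub> sc s"
 "r : carrier R ==> s : carrier R ==> sc (r \<otimes>\<^bsub>R\<^esub> s) = sc r \<otimes>\<^bsub>S\<^esub> sc s" "sc \<one>\<^bsub>R\<^esub> = \<one>\<^bsub>S\<^esub>" "sc \<zero>\<^bsub>R\<^esub> = \<zero>\<^bsub>S\<^esub>"
 by (simp_all add: Sa.smult_l_distr Sa.smult_assoc1 Sa.smult_assoc2)

lemma sc_nat: "sc ([(k::nat)] \<cdot>\<^bsub>R\<^esub> \<one>\<^bsub>R\<^esub>) = [k] \<cdot>\<^bsub>S\<^esub> \<one>\<^bsub>S\<^esub>"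
 by (induction k) (simp_all add: sc_hom)

definition "JP = tu (in_p2 R B j)"
definition "JM = tu (in_m2 R B j)"
definition "IP = base_map R S B (tkk R B) (in_p1 R B)"
definition "IM = base_map R S B (tkk R B) (in_m1 R B)"
definition "CP = LS.lift (self_module S) (%u. sc (kap (snd (snd (snd (snd u))))))"
definition "CM = LS.lift (self_module S) (%u. sc (kap (fst u)))"
definition "VP = base_map R S (tkk R B) B (%u. fst (snd (snd (snd u))))"
definition "VM = base_map R S (tkk R B) B (%u. fst (snd u))"

lemma proj_lin:
 "(%u. kap (snd (snd (snd (snd u))))) : lin_forms R (tkk R B)" "(%u. kap (fst u)) : lin_forms R (tkk R B)"
 "(%u. fst (snd (snd (snd u)))) : lin_maps R (tkk R B) B" "(%u. fst (snd u)) : lin_maps R (tkk R B) B"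
 "in_p1 R B : lin_maps R B (tkk R B)" "in_m1 R B : lin_maps R B (tkk R B)"
 unfolding lin_forms_eq by (rule lin_mapsI; simp add: tkk_simps ins_linear; elim tkk_cases; simp add: tkk_ops kap kap_linear)+

lemma I_lin: "IP : lin_maps S BI LL" "IM : lin_maps S BI LL"
 and I_tn: "x : CB ==> IP (tn x) = tu (in_p1 R B x)" "x : CB ==> IM (tn x) = tu (in_m1 R B x)"
 using base_map_lin[OF BS.scalar_ext_axioms LS.scalar_ext_axioms proj_lin(5)] base_map_lin[OF BS.scalar_ext_axioms LS.scalar_ext_axioms proj_lin(6)]
 by (simp_all add: IP_def IM_def lin_maps_inv_base_change)

lemma v_lin: "VP : lin_maps S LL BI" "VM : lin_maps S LL BI"
 and v_tu: "u : carrier L0 ==> VP (tu u) = tn (fst (snd (snd (snd u))))" "u : carrier L0 ==> VM (tu u) = tn (fst (snd u))"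
 using base_map_lin[OF LS.scalar_ext_axioms BS.scalar_ext_axioms proj_lin(3)] base_map_lin[OF LS.scalar_ext_axioms BS.scalar_ext_axioms proj_lin(4)]
 by (simp_all add: VP_def VM_def lin_maps_inv_base_change tkk_simps)

lemma c_lin: "CP : lin_forms S LL" "CM : lin_forms S LL"
 and c_tu: "u : carrier L0 ==> CP (tu u) = sc (kap (snd (snd (snd (snd u)))))" "u : carrier L0 ==> CM (tu u) = sc (kap (fst u))"
 using LS.form_lift[OF proj_lin(1)] LS.form_lift[OF proj_lin(2)] by (simp_all add: CP_def CM_def tkk_simps)

lemmas IL = lin_mapsD[OF I_lin(1)] lin_mapsD[OF I_lin(2)]
lemmas vL = lin_mapsD[OF v_lin(1)] lin_mapsD[OF v_lin(2)]
lemmas cL = lin_mapsD[OF c_lin(1)[unfolded lin_forms_eq], simplified] lin_mapsD[OF c_lin(2)[unfolded lin_forms_eq], simplified]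
lemmas VL = V_op_trilinear[OF BI_module BI_bil BI_invol]
lemmas LLb = bilinear_multD[OF LL_bil]
lemmas BIb = bilinear_multD[OF BI_bil]
lemmas invL = lin_mapsD[OF BI_invol]
lemmas lins = IL vL cL VL LLb BIb invL LL.smult_r_distr LL.smult_l_distr BI.smult_r_distr BI.smult_l_distr
 LL.smult_assoc1[symmetric] BI.smult_assoc1[symmetric] LL.smult_r_minus BI.smult_r_minus LL.M.minus_add BI.M.minus_add a_minus_def LL.M.a_ac BI.M.a_ac
 lin_maps_minus[OF BI_module LL.module_axioms I_lin(1)] lin_maps_minus[OF BI_module LL.module_axioms I_lin(2)] LL.R.l_distr LL.R.r_distr LL.R.m_ac

lemma V_tn: "x : CB ==> y : CB ==> z : CB ==> V_op BI (tn x) (tn y) (tn z) = tn (V_op B x y z)"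
 by (simp add: V_op_def tn_hom)

lemma kap_values [simp]: "kap j = \<one>\<^bsub>R\<^esub>" "kap \<zero> = \<zero>\<^bsub>R\<^esub>"
 using kap_j[of "\<one>\<^bsub>R\<^esub>"] kap_j[of "\<zero>\<^bsub>R\<^esub>"] by simp_all

lemmas ins_def = in_p2_def in_m2_def in_p1_def in_m1_def in_0_def

lemma pairing_tn:
 assumes x: "x : CB" and y: "y : CB"
 shows "IP (tn x) \<star> IM (tn y) = tu (in_0 R B (V_op B x y))"
  "IP (tn x) \<star> IP (tn y) = sc (beta x y) \<odot>\<^bsub>LL\<^esub> JP" "IM (tn x) \<star> IM (tn y) = sc (beta x y) \<odot>\<^bsub>LL\<^esub> JM"
  "CP (IP (tn x) \<star> IP (tn y)) = sc (beta x y)"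
proof -
 show "IP (tn x) \<star> IM (tn y) = tu (in_0 R B (V_op B x y))"
  using x y by (simp add: I_tn tu_hom br_table)
 show *: "IP (tn x) \<star> IP (tn y) = sc (beta x y) \<odot>\<^bsub>LL\<^esub> JP" "IM (tn x) \<star> IM (tn y) = sc (beta x y) \<odot>\<^bsub>LL\<^esub> JM"
  using x y by (simp_all add: I_tn tu_hom br_table beta JP_def JM_def ins_linear j(1))
 show "CP (IP (tn x) \<star> IP (tn y)) = sc (beta x y)"
  unfolding * using x y by (simp add: cL JP_def j(1) c_tu sc_hom beta) (simp add: ins_def sc_hom beta)
qed

lemma table_pure:
 shows "JP : CL" "JM : CL" "JP \<star> JM = sc \<mu> \<odot>\<^bsub>LL\<^esub> (IP \<one>\<^bsub>BI\<^esub> \<star> IM \<one>\<^bsub>BI\<^esub>)" "JP \<star> JP = \<zero>\<^bsub>LL\<^esub>" "JM \<star> JM = \<zero>\<^bsub>LL\<^esub>"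
  "CP JP = \<one>\<^bsub>S\<^esub>" "CM JP = \<zero>\<^bsub>S\<^esub>" "VP JP = \<zero>\<^bsub>BI\<^esub>" "VM JP = \<zero>\<^bsub>BI\<^esub>"
  "CP JM = \<zero>\<^bsub>S\<^esub>" "CM JM = \<one>\<^bsub>S\<^esub>" "VP JM = \<zero>\<^bsub>BI\<^esub>" "VM JM = \<zero>\<^bsub>BI\<^esub>"
proof -
 show "JP : CL" "JM : CL" by (simp_all add: JP_def JM_def j(1))
 show "JP \<star> JM = sc \<mu> \<odot>\<^bsub>LL\<^esub> (IP \<one>\<^bsub>BI\<^esub> \<star> IM \<one>\<^bsub>BI\<^esub>)" "JP \<star> JP = \<zero>\<^bsub>LL\<^esub>" "JM \<star> JM = \<zero>\<^bsub>LL\<^esub>"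
  by (simp_all add: tn_hom(7)[OF one_closed'] pairing_tn JP_def JM_def tu_hom tu_hom(5)[OF ins_closed(1)[OF j(1)]] br_table j(1,3) V_linear ins_linear[symmetric])
 show "CP JP = \<one>\<^bsub>S\<^esub>" "CM JP = \<zero>\<^bsub>S\<^esub>" "VP JP = \<zero>\<^bsub>BI\<^esub>" "VM JP = \<zero>\<^bsub>BI\<^esub>"
  "CP JM = \<zero>\<^bsub>S\<^esub>" "CM JM = \<one>\<^bsub>S\<^esub>" "VP JM = \<zero>\<^bsub>BI\<^esub>" "VM JM = \<zero>\<^bsub>BI\<^esub>"
  by (simp_all add: JP_def JM_def c_tu v_tu j(1) tn_hom(8)[OF j_closed]) (simp_all add: ins_def sc_hom)
qed

lemma table1:
 assumes x: "x : CI"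
 shows "CP (IP x) = \<zero>\<^bsub>S\<^esub>" "CM (IP x) = \<zero>\<^bsub>S\<^esub>" "VP (IP x) = x" "VM (IP x) = \<zero>\<^bsub>BI\<^esub>"
  "CP (IM x) = \<zero>\<^bsub>S\<^esub>" "CM (IM x) = \<zero>\<^bsub>S\<^esub>" "VP (IM x) = \<zero>\<^bsub>BI\<^esub>" "VM (IM x) = x"
  "JP \<star> IP x = \<zero>\<^bsub>LL\<^esub>" "JM \<star> IM x = \<zero>\<^bsub>LL\<^esub>"
  "JP \<star> IM x = IP (tn j \<otimes>\<^bsub>BI\<^esub> x)" "JM \<star> IP x = IM (tn j \<otimes>\<^bsub>BI\<^esub> x)"
  "tn j \<otimes>\<^bsub>BI\<^esub> (tn j \<otimes>\<^bsub>BI\<^esub> x) = sc \<mu> \<odot>\<^bsub>BI\<^esub> x" "V_op BI \<one>\<^bsub>BI\<^esub> \<one>\<^bsub>BI\<^esub> x = x"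
proof -
 note z = tn_hom(8)[OF j_closed] tu_hom(5)[OF ins_closed(1)[OF j(1)]] tn_hom(7)[OF j_closed]
 have i1: "invol B \<one> = \<one>"
  using B_facts(4)[of "invol B \<one>"] B_facts(8)[of "\<one>" "invol B \<one>"] B_facts(4,5,7)[of "\<one>"] B_facts(4,5,7)[of "invol B \<one>"] by simp
 have "V_op B \<one> \<one> y = y" if "y : CB" for y
  using that by (simp add: V_op_def i1 B_facts a_minus_def B.M.a_assoc B.M.r_neg)
 note p = I_tn c_tu v_tu tu_hom tn_hom br_table j(1) JP_def JM_def j_j V_tn this z
 have jn: "tn j : CI" "\<one>\<^bsub>BI\<^esub> : CI" by (simp_all add: z)
 show "CP (IP x) = \<zero>\<^bsub>S\<^esub>"
  using x by (induction rule: BI_induct, (simp add: p, (simp add: ins_def sc_hom p)?)[1], simp_all add: lins table_pure(1,2) jn)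
 show "CM (IP x) = \<zero>\<^bsub>S\<^esub>"
  using x by (induction rule: BI_induct, (simp add: p, (simp add: ins_def sc_hom p)?)[1], simp_all add: lins table_pure(1,2) jn)
 show "VP (IP x) = x"
  using x by (induction rule: BI_induct, (simp add: p, (simp add: ins_def sc_hom p)?)[1], simp_all add: lins table_pure(1,2) jn)
 show "VM (IP x) = \<zero>\<^bsub>BI\<^esub>"
  using x by (induction rule: BI_induct, (simp add: p, (simp add: ins_def sc_hom p)?)[1], simp_all add: lins table_pure(1,2) jn)
 show "CP (IM x) = \<zero>\<^bsub>S\<^esub>"
  using x by (induction rule: BI_induct, (simp add: p, (simp add: ins_def sc_hom p)?)[1], simp_all add: lins table_pure(1,2) jn)
 show "CM (IM x) = \<zero>\<^bsub>S\<^esub>"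
  using x by (induction rule: BI_induct, (simp add: p, (simp add: ins_def sc_hom p)?)[1], simp_all add: lins table_pure(1,2) jn)
 show "VP (IM x) = \<zero>\<^bsub>BI\<^esub>"
  using x by (induction rule: BI_induct, (simp add: p, (simp add: ins_def sc_hom p)?)[1], simp_all add: lins table_pure(1,2) jn)
 show "VM (IM x) = x"
  using x by (induction rule: BI_induct, (simp add: p, (simp add: ins_def sc_hom p)?)[1], simp_all add: lins table_pure(1,2) jn)
 show "JP \<star> IP x = \<zero>\<^bsub>LL\<^esub>"
  using x by (induction rule: BI_induct, (simp add: p, (simp add: ins_def sc_hom p)?)[1], simp_all add: lins table_pure(1,2) jn)
 show "JM \<star> IM x = \<zero>\<^bsub>LL\<^esub>"
  using x by (induction rule: BI_induct, (simp add: p, (simp add: ins_def sc_hom p)?)[1], simp_all add: lins table_pure(1,2) jn)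
 show "JP \<star> IM x = IP (tn j \<otimes>\<^bsub>BI\<^esub> x)"
  using x by (induction rule: BI_induct, (simp add: p, (simp add: ins_def sc_hom p)?)[1], simp_all add: lins table_pure(1,2) jn)
 show "JM \<star> IP x = IM (tn j \<otimes>\<^bsub>BI\<^esub> x)"
  using x by (induction rule: BI_induct, (simp add: p, (simp add: ins_def sc_hom p)?)[1], simp_all add: lins table_pure(1,2) jn)
 show "tn j \<otimes>\<^bsub>BI\<^esub> (tn j \<otimes>\<^bsub>BI\<^esub> x) = sc \<mu> \<odot>\<^bsub>BI\<^esub> x"
  using x by (induction rule: BI_induct, (simp add: p, (simp add: ins_def sc_hom p)?)[1], simp_all add: lins table_pure(1,2) jn)
 show "V_op BI \<one>\<^bsub>BI\<^esub> \<one>\<^bsub>BI\<^esub> x = x"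
  using x by (induction rule: BI_induct, (simp add: p, (simp add: ins_def sc_hom p)?)[1], simp_all add: lins table_pure(1,2) jn)
qed

end

context brown_ext
begin

interpretation L0: module R L0 by (rule L0_module)

lemma ins_minus:
 "x : CB ==> in_m1 R B (\<ominus> x) = \<ominus>\<^bsub>L0\<^esub> in_m1 R B x"
 "s : skew B ==> in_m2 R B (\<ominus> s) = \<ominus>\<^bsub>L0\<^esub> in_m2 R B s"
 "D : Vs ==> in_0 R B (\<ominus>\<^bsub>EB\<^esub> D) = \<ominus>\<^bsub>L0\<^esub> in_0 R B D"
proof -
 have zz: "\<ominus> \<zero> = \<zero>" "\<ominus>\<^bsub>EB\<^esub> \<zero>\<^bsub>EB\<^esub> = \<zero>\<^bsub>EB\<^esub>" by (rule B.M.minus_equality End.M.minus_equality; simp)+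
 show "x : CB ==> in_m1 R B (\<ominus> x) = \<ominus>\<^bsub>L0\<^esub> in_m1 R B x"
  "s : skew B ==> in_m2 R B (\<ominus> s) = \<ominus>\<^bsub>L0\<^esub> in_m2 R B s"
  "D : Vs ==> in_0 R B (\<ominus>\<^bsub>EB\<^esub> D) = \<ominus>\<^bsub>L0\<^esub> in_0 R B D"
  by (simp_all add: ins_def tkk_minus tkk_ops zz)
qed

lemma in_0_diff: "D : Vs ==> E : Vs ==> in_0 R B (D \<ominus>\<^bsub>EB\<^esub> E) = in_0 R B D \<ominus>\<^bsub>L0\<^esub> in_0 R B E"
 by (simp add: a_minus_def ins_linear ins_minus V_span_closed)

lemmas jc = tn_closed[OF j_closed] table_pure(1,2)
lemmas pure = pairing_tn c_tu v_tu tu_hom tn_hom(1-6) br_table j(1) V_tn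

lemma table2:
 assumes x: "x : CI" and y: "y : CI"
 shows "CP (IP x \<star> IM y) = \<zero>\<^bsub>S\<^esub>" "CM (IP x \<star> IM y) = \<zero>\<^bsub>S\<^esub>"
  "VP (IP x \<star> IM y) = \<zero>\<^bsub>BI\<^esub>" "VM (IP x \<star> IM y) = \<zero>\<^bsub>BI\<^esub>"
  "IP x \<star> IP y = CP (IP x \<star> IP y) \<odot>\<^bsub>LL\<^esub> JP" "IM x \<star> IM y = CP (IP x \<star> IP y) \<odot>\<^bsub>LL\<^esub> JM"
  "(IP x \<star> IM y) \<star> JP = CP (IP (tn j \<otimes>\<^bsub>BI\<^esub> y) \<star> IP x) \<odot>\<^bsub>LL\<^esub> JP"
  "(IP x \<star> IM y) \<star> JM = \<ominus>\<^bsub>LL\<^esub> (CP (IP (tn j \<otimes>\<^bsub>BI\<^esub> y) \<star> IP x) \<odot>\<^bsub>LL\<^esub> JM)"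
  "CP (IP (tn j \<otimes>\<^bsub>BI\<^esub> y) \<star> IP x) = CP (IP (tn j \<otimes>\<^bsub>BI\<^esub> x) \<star> IP y)"
  "x \<otimes>\<^bsub>BI\<^esub> invol BI y \<ominus>\<^bsub>BI\<^esub> y \<otimes>\<^bsub>BI\<^esub> invol BI x = CP (IP x \<star> IP y) \<odot>\<^bsub>BI\<^esub> tn j"
proof -
 note z = tn_hom(8)[OF j_closed] tu_hom(5)[OF ins_closed(1)[OF j(1)]]
 show "CP (IP x \<star> IM y) = \<zero>\<^bsub>S\<^esub>"
  using x y by (induction rule: BI_induct2, (simp add: pure, simp add: ins_def sc_hom)[1], simp_all add: lins)
 show "CM (IP x \<star> IM y) = \<zero>\<^bsub>S\<^esub>"
  using x y by (induction rule: BI_induct2, (simp add: pure, simp add: ins_def sc_hom)[1], simp_all add: lins)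
 show "VP (IP x \<star> IM y) = \<zero>\<^bsub>BI\<^esub>"
  using x y by (induction rule: BI_induct2, (simp add: pure z, simp add: ins_def sc_hom)[1], simp_all add: lins)
 show "VM (IP x \<star> IM y) = \<zero>\<^bsub>BI\<^esub>"
  using x y by (induction rule: BI_induct2, (simp add: pure z, simp add: ins_def sc_hom)[1], simp_all add: lins)
 show "IM x \<star> IM y = CP (IP x \<star> IP y) \<odot>\<^bsub>LL\<^esub> JM"
  using x y by (induction rule: BI_induct2, (simp only: pairing_tn(3,4))[1], simp_all add: lins jc)
 \<comment> \<open>The claim contains its left-hand side on the right, so as an induction hypothesis
   it would loop as a rewrite rule. The induction shows membership in the multiples of
   \<open>JP\<close> instead, and \<open>CP\<close> then identifies the coefficient.\<close>
 define K where "K = {c \<odot>\<^bsub>LL\<^esub> JP | c. c : carrier S}"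
 have K_add: "u \<oplus>\<^bsub>LL\<^esub> v : K" if u: "u : K" and v: "v : K" for u v
 proof -
  obtain c c' where "u = c \<odot>\<^bsub>LL\<^esub> JP" "c : carrier S" "v = c' \<odot>\<^bsub>LL\<^esub> JP" "c' : carrier S" using u v by (auto simp: K_def)
  then show ?thesis unfolding K_def by (intro CollectI exI[of _ "c \<oplus>\<^bsub>S\<^esub> c'"]) (simp add: LL.smult_l_distr jc)
 qed
 have K_smult: "r \<odot>\<^bsub>LL\<^esub> u : K" if u: "u : K" and r: "r : carrier S" for u r
 proof -
  obtain c where "u = c \<odot>\<^bsub>LL\<^esub> JP" "c : carrier S" using u by (auto simp: K_def)
  then show ?thesis using r unfolding K_def by (intro CollectI exI[of _ "r \<otimes>\<^bsub>S\<^esub> c"]) (simp add: LL.smult_assoc1 jc)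
 qed
 have "IP x \<star> IP y : K"
  using x y
 proof (induction rule: BI_induct2)
  case (tens x y)
  then show ?case unfolding K_def pairing_tn(2)[OF tens] using beta(1)[OF tens] by (intro CollectI exI[of _ "sc (beta x y)"]) simp
 qed (simp_all add: IL LLb K_add K_smult)
 then obtain c where c: "c : carrier S" "IP x \<star> IP y = c \<odot>\<^bsub>LL\<^esub> JP" by (auto simp: K_def)
 then have "CP (IP x \<star> IP y) = c" by (simp add: cL jc table_pure(6))
 then show "IP x \<star> IP y = CP (IP x \<star> IP y) \<odot>\<^bsub>LL\<^esub> JP" using c by simp
 have b: "kap ((beta x y) \<odot> j) = beta x y" "beta x y \<odot> j : skew B" if "x : CB" "y : CB" for x y using that beta(1) by simp_all
 show "(IP x \<star> IM y) \<star> JP = CP (IP (tn j \<otimes>\<^bsub>BI\<^esub> y) \<star> IP x) \<odot>\<^bsub>LL\<^esub> JP"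
  using x y by (induction rule: BI_induct2, (simp add: pairing_tn(1,4) tn_hom(2), simp add: JP_def tu_hom br_table j(1) skew_act dl_V beta ins_linear)[1], simp_all add: lins jc)
 show "(IP x \<star> IM y) \<star> JM = \<ominus>\<^bsub>LL\<^esub> (CP (IP (tn j \<otimes>\<^bsub>BI\<^esub> y) \<star> IP x) \<odot>\<^bsub>LL\<^esub> JM)"
  using x y by (induction rule: BI_induct2, (simp add: pairing_tn(1,4) tn_hom(2), simp add: JM_def tu_hom br_table j(1) skew_act dl_V beta ins_linear ins_minus)[1], simp_all add: lins jc)
 show "CP (IP (tn j \<otimes>\<^bsub>BI\<^esub> y) \<star> IP x) = CP (IP (tn j \<otimes>\<^bsub>BI\<^esub> x) \<star> IP y)"
  using x y
 proof (induction rule: BI_induct2)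
  case (tens x y)
  then have "beta (j \<otimes> y) x = beta (j \<otimes> x) y"
   using d_facts(1)[of x y] by (intro j_cancel) (simp_all add: beta d_skew)
  with tens show ?case by (simp add: pairing_tn tn_hom(2))
 qed (simp_all add: lins jc)
 have "x \<otimes>\<^bsub>BI\<^esub> invol BI y = CP (IP x \<star> IP y) \<odot>\<^bsub>BI\<^esub> tn j \<oplus>\<^bsub>BI\<^esub> y \<otimes>\<^bsub>BI\<^esub> invol BI x"
  using x y
 proof (induction rule: BI_induct2)
  case (tens x y)
  then have "x \<otimes> invol B y = beta x y \<odot> j \<oplus> y \<otimes> invol B x"
   by (simp add: beta(2)[symmetric] a_minus_def B.M.a_assoc B.M.l_neg)
  then show ?case using tens by (simp add: pairing_tn(4) tn_hom beta)
 qed (simp_all add: lins jc)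
 then show "x \<otimes>\<^bsub>BI\<^esub> invol BI y \<ominus>\<^bsub>BI\<^esub> y \<otimes>\<^bsub>BI\<^esub> invol BI x = CP (IP x \<star> IP y) \<odot>\<^bsub>BI\<^esub> tn j"
  using x y by (simp add: a_minus_def BI.M.a_assoc BI.M.r_neg BIb(1) jc cL LLb(1) IL invL)
qed

lemma table3:
 assumes x: "x : CI" and y: "y : CI" and z: "z : CI"
 shows "(IP x \<star> IM y) \<star> IP z = IP (V_op BI x y z)"
  "(IP x \<star> IM y) \<star> IM z = \<ominus>\<^bsub>LL\<^esub> IM (V_op BI y x z)"
  "V_op BI y x (tn j \<otimes>\<^bsub>BI\<^esub> z) \<oplus>\<^bsub>BI\<^esub> tn j \<otimes>\<^bsub>BI\<^esub> V_op BI x y z = CP (IP (tn j \<otimes>\<^bsub>BI\<^esub> y) \<star> IP x) \<odot>\<^bsub>BI\<^esub> (tn j \<otimes>\<^bsub>BI\<^esub> z)"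
proof -
 show "(IP x \<star> IM y) \<star> IP z = IP (V_op BI x y z)"
  using x y z by (induction rule: BI_induct3, (simp add: pairing_tn V_tn, simp add: I_tn tu_hom br_table)[1], simp_all add: lins)
 show "(IP x \<star> IM y) \<star> IM z = \<ominus>\<^bsub>LL\<^esub> IM (V_op BI y x z)"
  using x y z by (induction rule: BI_induct3, (simp add: pairing_tn V_tn, simp add: I_tn tu_hom br_table ins_minus)[1], simp_all add: lins)
 \<comment> \<open>Solved for its first term, the identity is a rewrite rule and can serve as
   induction hypothesis.\<close>
 have "V_op BI y x (tn j \<otimes>\<^bsub>BI\<^esub> z) = CP (IP (tn j \<otimes>\<^bsub>BI\<^esub> y) \<star> IP x) \<odot>\<^bsub>BI\<^esub> (tn j \<otimes>\<^bsub>BI\<^esub> z) \<ominus>\<^bsub>BI\<^esub> tn j \<otimes>\<^bsub>BI\<^esub> V_op BI x y z"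
  using x y z
 proof (induction rule: BI_induct3)
  case (tens x y z)
  have "V_op B y x (j \<otimes> z) = (V_op B y x (j \<otimes> z) \<oplus> j \<otimes> V_op B x y z) \<ominus> j \<otimes> V_op B x y z"
   using tens by (simp add: a_minus_def B.M.a_assoc B.M.r_neg)
  also have "\<dots> = beta (j \<otimes> y) x \<odot> (j \<otimes> z) \<ominus> j \<otimes> V_op B x y z"
   using tens by (simp only: d_facts(2)) (simp add: d_skew bil beta)
  finally show ?case using tens by (simp add: tn_hom(2) V_tn pairing_tn(4)) (simp add: tn_hom beta)
 qed (simp_all add: lins jc)
 then show "V_op BI y x (tn j \<otimes>\<^bsub>BI\<^esub> z) \<oplus>\<^bsub>BI\<^esub> tn j \<otimes>\<^bsub>BI\<^esub> V_op BI x y z = CP (IP (tn j \<otimes>\<^bsub>BI\<^esub> y) \<star> IP x) \<odot>\<^bsub>BI\<^esub> (tn j \<otimes>\<^bsub>BI\<^esub> z)"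
  using x y z by (simp add: a_minus_def BI.M.a_assoc BI.M.l_neg VL(1) BIb(1) jc cL LLb(1) IL)
qed

lemma table4:
 assumes "x : CI" "y : CI" "z : CI" "w : CI"
 shows "(IP x \<star> IM y) \<star> (IP z \<star> IM w) = IP (V_op BI x y z) \<star> IM w \<ominus>\<^bsub>LL\<^esub> IP z \<star> IM (V_op BI y x w)"
 using assms by (induction rule: BI_induct4, (simp add: pairing_tn V_tn, simp add: tu_hom br_table V_commutator in_0_diff)[1], simp_all add: lins)

lemma LL_generated: "CL \<subseteq> lin_span S LL ({JP, JM} \<union> IP ` CI \<union> IM ` CI \<union>
    {IP x \<star> IM y | x y. x : CI \<and> y : CI})" (is "_ \<subseteq> lin_span S LL ?X")
proof
 have X: "?X \<subseteq> CL" using IL(1,4) LLb(1) jc by auto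
 define Z where "Z = lin_span S LL ?X"
 note sp = lin_span_submodule[OF LL.module_axioms X, folded Z_def]
 note f = submodule_facts[OF LL.module_axioms sp(1)]
 fix z assume "z : CL"
 then have "z : Z"
 proof (induction rule: LL_induct)
  case (tens u)
  then show ?case
  proof (induction rule: tkk_induct)
   case (gen u)
   have base: "JP : Z" "JM : Z" "!!x. x : CB ==> IP (tn x) : Z"
    "!!x. x : CB ==> IM (tn x) : Z"
    "!!x y. x : CB ==> y : CB ==> IP (tn x) \<star> IM (tn y) : Z"
    by (rule subsetD[OF sp(2)]; use tn_closed in blast)+
   have s: "tu (in_p2 R B s) = sc (kap s) \<odot>\<^bsub>LL\<^esub> JP" "tu (in_m2 R B s) = sc (kap s) \<odot>\<^bsub>LL\<^esub> JM" if "s : skew B" for s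
    using that kap[OF that] j(1) by (simp_all add: JP_def JM_def tu_hom ins_linear[symmetric])
   show ?case
    using gen base unfolding gens_def by (elim UnE CollectE exE conjE) (simp_all add: s f kap(1) I_tn[symmetric] pairing_tn(1)[symmetric])
  qed (simp_all add: tu_hom[symmetric] tu_hom(5)[OF ins_closed(1)[OF j(1)], symmetric] f)
 qed (simp_all add: f)
 then show "z : lin_span S LL ?X" by (simp only: Z_def)
qed

end

context brown_ext
begin

interpretation Sa: algebra R S by (rule S)

lemma tu_in_0_finsum:
 assumes "finite A" "!!k. k : A ==> D k : Vs"
 shows "(\<Oplus>\<^bsub>EB\<^esub>k\<in>A. D k) : Vs \<and> tu (in_0 R B (\<Oplus>\<^bsub>EB\<^esub>k\<in>A. D k)) = (\<Oplus>\<^bsub>LL\<^esub>k\<in>A. tu (in_0 R B (D k)))"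
 using assms
proof (induction A rule: finite_induct)
 case empty
 show ?case by (simp add: ins_linear tu_hom(5)[OF ins_closed(1)[OF j(1)]])
next
 case (insert a A)
 have D: "D : A \<rightarrow> carrier EB" "D a : carrier EB" using insert.prems by (auto intro: V_span_closed)
 have t: "(%k. tu (in_0 R B (D k))) : A \<rightarrow> CL" "tu (in_0 R B (D a)) : CL" using insert.prems by auto
 have IH: "finsum EB D A : Vs" "tu (in_0 R B (finsum EB D A)) = (\<Oplus>\<^bsub>LL\<^esub>k\<in>A. tu (in_0 R B (D k)))"
  using insert.IH insert.prems by auto
 show ?case
  using insert.hyps insert.prems D t IH
  by (simp add: End.M.finsum_insert LL.M.finsum_insert ins_linear V_span_closed tu_hom(1)[symmetric])
qed

text \<open>The identity is first established between operators on \<open>B\<close>, where equality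
  may be tested on vectors, and only then carried to the extended Lie algebra through
  \<open>in_0\<close> and the tensor map. The multiple of the identity operator becomes a multiple
  of the bracket of \<open>IP \<one>\<close> and \<open>IM \<one>\<close>.\<close>

lemma LL_casimir:
 obtains n :: nat and e e' where "e : {..<n} \<rightarrow> CI" "e' : {..<n} \<rightarrow> CI"
  "!!x y. x : CI ==> y : CI ==> (\<Oplus>\<^bsub>LL\<^esub>k\<in>{..<n}. IP (V_op BI x y (e k)) \<star> IM (e' k)) =
   ([(12::nat)] \<cdot>\<^bsub>S\<^esub> \<one>\<^bsub>S\<^esub>) \<odot>\<^bsub>LL\<^esub> (IP x \<star> IM y) \<oplus>\<^bsub>LL\<^esub>
   ([(8::nat)] \<cdot>\<^bsub>S\<^esub> \<one>\<^bsub>S\<^esub> \<otimes>\<^bsub>S\<^esub> CP (IP (tn j \<otimes>\<^bsub>BI\<^esub> y) \<star> IP x)) \<odot>\<^bsub>LL\<^esub> (IP \<one>\<^bsub>BI\<^esub> \<star> IM \<one>\<^bsub>BI\<^esub>)"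
proof -
 obtain n :: nat and e e' where e: "e : {..<n} \<rightarrow> CB" "e' : {..<n} \<rightarrow> CB"
  "!!x y z \<delta>. x : CB ==> y : CB ==> z : CB ==> \<delta> : carrier R ==> d x y = \<delta> \<odot> j ==>
   (\<Oplus>k\<in>{..<n}. V_op B (V_op B x y (e k)) (e' k) z) =
   ([(12::nat)] \<cdot>\<^bsub>R\<^esub> \<one>\<^bsub>R\<^esub>) \<odot> V_op B x y z \<oplus> ([(8::nat)] \<cdot>\<^bsub>R\<^esub> \<one>\<^bsub>R\<^esub> \<otimes>\<^bsub>R\<^esub> \<delta>) \<odot> z"
  using casimir_B by blast
 have ek: "e k : CB" "e' k : CB" if "k < n" for k using e(1,2) that by auto
 have one: "V_op B \<one> \<one> z = z" if z: "z : CB" for z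
 proof -
  have "invol B \<one> = \<one>"
   using B_facts(4)[of "invol B \<one>"] B_facts(8)[of "\<one>" "invol B \<one>"] B_facts(4,5,7)[of "\<one>"] B_facts(4,5,7)[of "invol B \<one>"] by simp
  then show ?thesis using z by (simp add: V_op_def B_facts a_minus_def B.M.a_assoc B.M.r_neg)
 qed
 define F where "F x y = (\<Oplus>\<^bsub>LL\<^esub>k\<in>{..<n}. IP (V_op BI x y (tn (e k))) \<star> IM (tn (e' k)))" for x y
 have Fl: "F x : lin_maps S BI LL" "(%x. F x y) : lin_maps S BI LL" if "x : CI" "y : CI" for x y
  unfolding F_def by (rule lin_maps_finsum[OF BI_module LL.module_axioms]; (rule lin_mapsI)?; use that ek in \<open>simp add: IL VL LLb\<close>)+
 note Fd = lin_mapsD[OF Fl(1)] lin_mapsD[OF Fl(2)]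
 have Ft: "F (tn x) (tn y) = ([(12::nat)] \<cdot>\<^bsub>S\<^esub> \<one>\<^bsub>S\<^esub>) \<odot>\<^bsub>LL\<^esub> (IP (tn x) \<star> IM (tn y)) \<oplus>\<^bsub>LL\<^esub>
   ([(8::nat)] \<cdot>\<^bsub>S\<^esub> \<one>\<^bsub>S\<^esub> \<otimes>\<^bsub>S\<^esub> CP (IP (tn j \<otimes>\<^bsub>BI\<^esub> tn y) \<star> IP (tn x))) \<odot>\<^bsub>LL\<^esub> (IP \<one>\<^bsub>BI\<^esub> \<star> IM \<one>\<^bsub>BI\<^esub>)"
  if x: "x : CB" and y: "y : CB" for x y
 proof -
  let ?D = "%k. V_op B (V_op B x y (e k)) (e' k)" and ?\<delta> = "beta (j \<otimes> y) x"
  let ?a = "[(12::nat)] \<cdot>\<^bsub>R\<^esub> \<one>\<^bsub>R\<^esub>" and ?b = "[(8::nat)] \<cdot>\<^bsub>R\<^esub> \<one>\<^bsub>R\<^esub> \<otimes>\<^bsub>R\<^esub> ?\<delta>"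
  have D: "?D k : Vs" if "k : {..<n}" for k using that x y ek by simp
  have \<delta>: "?\<delta> : carrier R" using x y by (simp add: beta)
  have ab: "?a : carrier R" "?b : carrier R" using \<delta> by simp_all
  note fs = tu_in_0_finsum[of "{..<n}" ?D, OF finite_lessThan D]
  have "F (tn x) (tn y) = (\<Oplus>\<^bsub>LL\<^esub>k\<in>{..<n}. tu (in_0 R B (?D k)))"
   unfolding F_def using x y ek by (intro LL.M.finsum_cong') (auto simp: V_tn pairing_tn)
  also have "\<dots> = tu (in_0 R B (\<Oplus>\<^bsub>EB\<^esub>k\<in>{..<n}. ?D k))" using fs by simp
  \<comment> \<open>An equality of functions on \<open>B\<close>: evaluation at z turns it into
    \<open>casimir_B\<close>, because \<open>V_op B \<one> \<one>\<close> is the identity.\<close>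
  also have "(\<Oplus>\<^bsub>EB\<^esub>k\<in>{..<n}. ?D k) = ?a \<odot>\<^bsub>EB\<^esub> V_op B x y \<oplus>\<^bsub>EB\<^esub> ?b \<odot>\<^bsub>EB\<^esub> V_op B \<one> \<one>"
  proof (rule End_eqI)
   show "(\<Oplus>\<^bsub>EB\<^esub>k\<in>{..<n}. ?D k) : carrier EB" using fs by (simp add: V_span_closed)
   show "?a \<odot>\<^bsub>EB\<^esub> V_op B x y \<oplus>\<^bsub>EB\<^esub> ?b \<odot>\<^bsub>EB\<^esub> V_op B \<one> \<one> : carrier EB" using x y ab by (simp add: V_linear)
   fix z assume z: "z : CB"
   have "(\<Oplus>\<^bsub>EB\<^esub>k\<in>{..<n}. ?D k) z = (\<Oplus>k\<in>{..<n}. ?D k z)"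
    using z x y ek lin_mapsD(1)[OF end_lie_lin[of _ R B] z]
    by (intro finsum_additive[where f = "%D. D z", OF End.M.abelian_group_axioms B.M.abelian_group_axioms])
     (auto simp: End_apply V_linear)
   also have "\<dots> = ?a \<odot> V_op B x y z \<oplus> ?b \<odot> z" using x y z \<delta> by (intro e(3)) (simp_all add: d_skew)
   finally show "(\<Oplus>\<^bsub>EB\<^esub>k\<in>{..<n}. ?D k) z = (?a \<odot>\<^bsub>EB\<^esub> V_op B x y \<oplus>\<^bsub>EB\<^esub> ?b \<odot>\<^bsub>EB\<^esub> V_op B \<one> \<one>) z"
    using x y z ab by (simp only: End_apply one)
  qed
  also have "tu (in_0 R B (?a \<odot>\<^bsub>EB\<^esub> V_op B x y \<oplus>\<^bsub>EB\<^esub> ?b \<odot>\<^bsub>EB\<^esub> V_op B \<one> \<one>)) =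
    sc ?a \<odot>\<^bsub>LL\<^esub> tu (in_0 R B (V_op B x y)) \<oplus>\<^bsub>LL\<^esub> sc ?b \<odot>\<^bsub>LL\<^esub> tu (in_0 R B (V_op B \<one> \<one>))"
   using x y ab by (simp add: tu_hom ins_linear V_linear module.smult_closed[OF L0_module])
  finally show ?thesis
   using x y \<delta> by (simp add: pairing_tn(1,4) tn_hom(2) tn_hom(7)[OF j_closed] sc_nat sc_hom(2))
 qed
 show thesis
 proof (rule that[of "%k. tn (e k)" n "%k. tn (e' k)"])
  show "(%k. tn (e k)) : {..<n} \<rightarrow> CI" "(%k. tn (e' k)) : {..<n} \<rightarrow> CI" using ek by auto
  fix x y assume xy: "x : CI" "y : CI"
  have nt: "[(k::nat)] \<cdot>\<^bsub>S\<^esub> \<one>\<^bsub>S\<^esub> : carrier S" for k unfolding sc_nat[symmetric] by (rule sc_closed) simp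
  have o: "IP \<one>\<^bsub>BI\<^esub> \<star> IM \<one>\<^bsub>BI\<^esub> : CL" by (simp add: tn_hom(7)[OF j_closed] IL LLb)
  have "F x y = ([(12::nat)] \<cdot>\<^bsub>S\<^esub> \<one>\<^bsub>S\<^esub>) \<odot>\<^bsub>LL\<^esub> (IP x \<star> IM y) \<oplus>\<^bsub>LL\<^esub>
   ([(8::nat)] \<cdot>\<^bsub>S\<^esub> \<one>\<^bsub>S\<^esub> \<otimes>\<^bsub>S\<^esub> CP (IP (tn j \<otimes>\<^bsub>BI\<^esub> y) \<star> IP x)) \<odot>\<^bsub>LL\<^esub> (IP \<one>\<^bsub>BI\<^esub> \<star> IM \<one>\<^bsub>BI\<^esub>)"
   using xy by (induction rule: BI_induct2) (simp_all only: Ft, simp_all add: Fd lins jc nt o)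
  then show "(\<Oplus>\<^bsub>LL\<^esub>k\<in>{..<n}. IP (V_op BI x y (tn (e k))) \<star> IM (tn (e' k))) = ([(12::nat)] \<cdot>\<^bsub>S\<^esub> \<one>\<^bsub>S\<^esub>) \<odot>\<^bsub>LL\<^esub> (IP x \<star> IM y) \<oplus>\<^bsub>LL\<^esub>
   ([(8::nat)] \<cdot>\<^bsub>S\<^esub> \<one>\<^bsub>S\<^esub> \<otimes>\<^bsub>S\<^esub> CP (IP (tn j \<otimes>\<^bsub>BI\<^esub> y) \<star> IP x)) \<odot>\<^bsub>LL\<^esub> (IP \<one>\<^bsub>BI\<^esub> \<star> IM \<one>\<^bsub>BI\<^esub>)"
   by (simp only: F_def)
 qed
qed

lemma sc_Units: "r : Units R ==> sc r : Units S" "r : Units R ==> sc (inv\<^bsub>R\<^esub> r) = inv\<^bsub>S\<^esub> sc r"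
proof -
 assume r: "r : Units R"
 note rc = B.R.Units_closed[OF r] B.R.Units_inv_closed[OF r]
 have "sc r \<otimes>\<^bsub>S\<^esub> sc (inv\<^bsub>R\<^esub> r) = sc (r \<otimes>\<^bsub>R\<^esub> inv\<^bsub>R\<^esub> r)" by (rule sc_hom(2)[OF rc, symmetric])
 then have m: "sc r \<otimes>\<^bsub>S\<^esub> sc (inv\<^bsub>R\<^esub> r) = \<one>\<^bsub>S\<^esub>" by (simp only: B.R.Units_r_inv[OF r] sc_hom(3))
 have c: "sc r : carrier S" "sc (inv\<^bsub>R\<^esub> r) : carrier S" using rc by simp_all
 then have m': "sc (inv\<^bsub>R\<^esub> r) \<otimes>\<^bsub>S\<^esub> sc r = \<one>\<^bsub>S\<^esub>" using m LL.R.m_comm by simp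
 show "sc r : Units S" unfolding Units_def using c m m' by blast
 show "sc (inv\<^bsub>R\<^esub> r) = inv\<^bsub>S\<^esub> sc r" using LL.R.inv_unique'[OF c m m'] by simp
qed

lemma model: obtains n :: nat and e e' where "tkk_model S LL BI (tn j) (sc \<mu>) JP JM IP IM CP CM VP VM n e e'"
proof -
 obtain n :: nat and e e' where e: "e : {..<n} \<rightarrow> CI" "e' : {..<n} \<rightarrow> CI"
  "!!x y. x : CI ==> y : CI ==> (\<Oplus>\<^bsub>LL\<^esub>k\<in>{..<n}. IP (V_op BI x y (e k)) \<star> IM (e' k)) =
   ([(12::nat)] \<cdot>\<^bsub>S\<^esub> \<one>\<^bsub>S\<^esub>) \<odot>\<^bsub>LL\<^esub> (IP x \<star> IM y) \<oplus>\<^bsub>LL\<^esub>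
   ([(8::nat)] \<cdot>\<^bsub>S\<^esub> \<one>\<^bsub>S\<^esub> \<otimes>\<^bsub>S\<^esub> CP (IP (tn j \<otimes>\<^bsub>BI\<^esub> y) \<star> IP x)) \<odot>\<^bsub>LL\<^esub> (IP \<one>\<^bsub>BI\<^esub> \<star> IM \<one>\<^bsub>BI\<^esub>)"
  by (rule LL_casimir) (rule that; assumption)
 have u: "[(6::nat)] \<cdot>\<^bsub>S\<^esub> \<one>\<^bsub>S\<^esub> : Units S" unfolding sc_nat[symmetric] using six by (rule sc_Units(1))
 have one: "\<one>\<^bsub>BI\<^esub> : CI" by (simp add: tn_hom(7)[OF j_closed])
 have jj: "tn j \<otimes>\<^bsub>BI\<^esub> tn j = sc \<mu> \<odot>\<^bsub>BI\<^esub> \<one>\<^bsub>BI\<^esub>" by (simp add: tn_hom(2,3) tn_hom(7)[OF j_closed] j(3))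
 have two: "CP (IP (tn j \<otimes>\<^bsub>BI\<^esub> \<one>\<^bsub>BI\<^esub>) \<star> IP \<one>\<^bsub>BI\<^esub>) = [(2::nat)] \<cdot>\<^bsub>S\<^esub> \<one>\<^bsub>S\<^esub>"
 proof -
  have i1: "invol B \<one> = \<one>"
   using B_facts(4)[of "invol B \<one>"] B_facts(8)[of "\<one>" "invol B \<one>"] B_facts(4,5,7)[of "\<one>"] B_facts(4,5,7)[of "invol B \<one>"] by simp
  \<comment> \<open>Here \<open>j\<close> and 1 are inserted into the definition of
    \<open>beta\<close>: as \<open>j\<close> is skew, the difference is j + j.\<close>
  have "beta j \<one> = [(2::nat)] \<cdot>\<^bsub>R\<^esub> \<one>\<^bsub>R\<^esub>"
  proof (rule j_cancel)
   show "beta j \<one> \<odot> j = ([(2::nat)] \<cdot>\<^bsub>R\<^esub> \<one>\<^bsub>R\<^esub>) \<odot> j"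
    by (subst beta(2)[symmetric]) (simp_all add: i1 B_facts j_invol a_minus_def numeral_2_eq_2 B.smult_l_distr)
  qed (simp_all add: beta)
  then show ?thesis
   unfolding tn_hom(7)[OF j_closed] using sc_nat[of 2] by (simp only: tn_hom(2) B_facts(5) j_closed one_closed' pairing_tn(4))
 qed
 show thesis
 proof (rule that[of n e e'], rule tkk_model.intro)
 qed (fact LL.module_axioms LL_bil BI_module BI_bil LL_antisym jc one invL(1) sc_Units(1)[OF j(2)] u I_lin c_lin v_lin table_pure
   table1 table2 table3 table4 LL_generated jj two e)+
qed

end

section \<open>The automorphism group and its action on extremal pairs\<close>

lemma lin_image_submodule:
 assumes "module R M" "module R N" "f : lin_maps R M N"
 shows "submodule (f ` carrier M) R N"
proof -
 interpret M: module R M by fact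
 note l = lin_mapsD[OF assms(3)]
 show ?thesis
  by (rule submoduleI'[OF assms(2)]) (use l(1) in \<open>auto simp: l(2,3)[symmetric]\<close>)
qed

lemma aut_groupI:
 assumes "f : lin_maps S C C" "bij_betw f (carrier C) (carrier C)"
  "!!x y. x : carrier C ==> y : carrier C ==> f (x \<otimes>\<^bsub>C\<^esub> y) = f x \<otimes>\<^bsub>C\<^esub> f y" "module S C" "bilinear_mult S C"
 shows "(\<lambda>x\<in>carrier C. f x) : carrier (aut_group S C)"
proof -
 have "(\<lambda>x\<in>carrier C. f x) : lin_maps S C C" by (rule lin_maps_cong[OF assms(1,4)]) simp
 moreover have "bij_betw (\<lambda>x\<in>carrier C. f x) (carrier C) (carrier C)" using assms(2) by simp
 ultimately show ?thesis
  using assms(3) bilinear_multD(1)[OF assms(5)] by (simp add: aut_group_def lin_autos_def)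
qed

lemma aut_group_inverse:
 assumes C: "module S C" "bilinear_mult S C" and f: "f : carrier (aut_group S C)"
 obtains g where "g : carrier (aut_group S C)" "!!x. x : carrier C ==> g (f x) = x" "!!x. x : carrier C ==> f (g x) = x"
proof -
 interpret C: module S C by (rule C(1))
 note F = aut_groupD[OF f] and l = lin_mapsD[OF aut_groupD(1)[OF f]]
 let ?h = "inv_into (carrier C) f"
 have h: "?h x : carrier C" "f (?h x) = x" "?h (f x) = x" if "x : carrier C" for x
  using that F(3) l(1)[OF that] by (auto simp: bij_betw_def inv_into_f_f intro: inv_into_into f_inv_into_f)
 have inj: "x = y" if "f x = f y" "x : carrier C" "y : carrier C" for x y
  using that F(3) by (auto simp: bij_betw_def inj_on_def)
 note b = bilinear_multD(1)[OF C(2)]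
 have "(\<lambda>x\<in>carrier C. ?h x) : carrier (aut_group S C)"
 proof (rule aut_groupI[OF _ _ _ C])
  show "?h : lin_maps S C C" by (rule lin_mapsI; (rule inj)?) (simp_all add: h l)
  show "bij_betw ?h (carrier C) (carrier C)" using F(3) by (rule bij_betw_inv_into)
  show "?h (x \<otimes>\<^bsub>C\<^esub> y) = ?h x \<otimes>\<^bsub>C\<^esub> ?h y" if "x : carrier C" "y : carrier C" for x y
   by (rule inj) (use that in \<open>simp_all add: h b F(4)\<close>)
 qed
 then show thesis by (rule that) (use h l(1) in simp_all)
qed

lemma aut_group_group:
 assumes C: "module S C" "bilinear_mult S C"
 shows "group (aut_group S C)"
proof -
 interpret C: module S C by (rule C(1))
 have mult: "mult (aut_group S C) = compose (carrier C)" and one: "\<one>\<^bsub>aut_group S C\<^esub> = (\<lambda>x\<in>carrier C. x)"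
  by (simp_all add: aut_group_def)
 note D = aut_groupD[of _ S C] and L = lin_mapsD[OF aut_groupD(1)[of _ S C]]
 show ?thesis
 proof (rule groupI; unfold mult one)
  fix f g assume f: "f : carrier (aut_group S C)" and g: "g : carrier (aut_group S C)"
  have "(\<lambda>x\<in>carrier C. f (g x)) : carrier (aut_group S C)"
   using D(4)[OF f] D(4)[OF g] L(1)[OF g] bij_betw_trans[OF D(3)[OF g] D(3)[OF f]]
   by (intro aut_groupI[OF lin_maps_comp[OF D(1)[OF g] D(1)[OF f]] _ _ C]) (simp_all add: comp_def)
  then show "compose (carrier C) f g : carrier (aut_group S C)" by (simp add: compose_def)
  fix h assume h: "h : carrier (aut_group S C)"
  show "compose (carrier C) (compose (carrier C) f g) h = compose (carrier C) f (compose (carrier C) g h)"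
   by (rule compose_assoc[symmetric]) (use L(1)[OF h] in auto)
 next
  show "(\<lambda>x\<in>carrier C. x) : carrier (aut_group S C)"
   by (rule aut_groupI[OF _ _ _ C]) (auto intro: lin_mapsI simp: bij_betw_def)
  fix f assume f: "f : carrier (aut_group S C)"
  show "compose (carrier C) (\<lambda>x\<in>carrier C. x) f = f"
   by (rule extensionalityI[OF compose_extensional D(2)[OF f]]) (simp add: compose_def L(1)[OF f])
  obtain g where "g : carrier (aut_group S C)" "!!x. x : carrier C ==> g (f x) = x"
   by (rule aut_group_inverse[OF C f]) (rule that; assumption)
  then show "\<exists>g\<in>carrier (aut_group S C). compose (carrier C) g f = (\<lambda>x\<in>carrier C. x)"
   by (intro bexI[of _ g]) (auto simp: compose_def)
 qed
qed

lemma aut_extremal: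
 assumes C: "module S C" "bilinear_mult S C" and f: "f : carrier (aut_group S C)"
  and p: "(x, y) : extremal_pairs S C"
 shows "(f x, f y) : extremal_pairs S C"
proof -
 interpret C: module S C by (rule C(1))
 note F = aut_groupD[OF f] and l = lin_mapsD[OF aut_groupD(1)[OF f]]
 note b = bilinear_multD(1)[OF C(2)]
 obtain g where g: "g : carrier (aut_group S C)" "!!x. x : carrier C ==> g (f x) = x" "!!x. x : carrier C ==> f (g x) = x"
  by (rule aut_group_inverse[OF C f]) (rule that; assumption)
 note m = lin_mapsD[OF aut_groupD(1)[OF g(1)]]
 have eq: "f x \<otimes>\<^bsub>C\<^esub> (f x \<otimes>\<^bsub>C\<^esub> f y) = r \<odot>\<^bsub>C\<^esub> f x \<longleftrightarrow> x \<otimes>\<^bsub>C\<^esub> (x \<otimes>\<^bsub>C\<^esub> y) = r \<odot>\<^bsub>C\<^esub> x"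
  if "x : carrier C" "y : carrier C" "r : carrier S" for x y r
 proof -
  have "f x \<otimes>\<^bsub>C\<^esub> (f x \<otimes>\<^bsub>C\<^esub> f y) = r \<odot>\<^bsub>C\<^esub> f x \<longleftrightarrow> f (x \<otimes>\<^bsub>C\<^esub> (x \<otimes>\<^bsub>C\<^esub> y)) = f (r \<odot>\<^bsub>C\<^esub> x)"
   using that by (simp add: F(4) l b)
  also have "\<dots> \<longleftrightarrow> x \<otimes>\<^bsub>C\<^esub> (x \<otimes>\<^bsub>C\<^esub> y) = r \<odot>\<^bsub>C\<^esub> x"
   using F(3) that by (intro inj_on_eq_iff[of f "carrier C"]) (simp_all add: bij_betw_def b)
  finally show ?thesis .
 qed
 have ex: "extremal S C (f x)" if x: "extremal S C x" for x
  unfolding extremal_def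
 proof (intro conjI ballI)
  have xc: "x : carrier C" using x by (simp add: extremal_def)
  then show "f x : carrier C" by (rule l(1))
  obtain \<alpha> where \<alpha>: "\<alpha> : lin_forms S C" "\<alpha> x = \<one>\<^bsub>S\<^esub>" using x by (auto simp: extremal_def)
  \<comment> \<open>Unimodularity of the image is witnessed by composing the given form with the
    inverse automorphism.\<close>
  have "(%z. \<alpha> (g z)) : lin_forms S C"
   using lin_maps_comp[OF aut_groupD(1)[OF g(1)] \<alpha>(1)[unfolded lin_forms_eq]] by (simp add: lin_forms_eq)
  then show "\<exists>\<alpha>\<in>lin_forms S C. \<alpha> (f x) = \<one>\<^bsub>S\<^esub>" using \<alpha>(2) g(2)[OF xc] by (intro bexI[of _ "%z. \<alpha> (g z)"]) simp_all
  fix z assume z: "z : carrier C"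
  obtain r where r: "r : carrier S" "x \<otimes>\<^bsub>C\<^esub> (x \<otimes>\<^bsub>C\<^esub> g z) = r \<odot>\<^bsub>C\<^esub> x" using x m(1)[OF z] by (auto simp: extremal_def)
  have "f x \<otimes>\<^bsub>C\<^esub> (f x \<otimes>\<^bsub>C\<^esub> f (g z)) = r \<odot>\<^bsub>C\<^esub> f x" unfolding eq[OF xc m(1)[OF z] r(1)] by (rule r(2))
  then have "f x \<otimes>\<^bsub>C\<^esub> (f x \<otimes>\<^bsub>C\<^esub> z) = r \<odot>\<^bsub>C\<^esub> f x" by (simp add: g(3)[OF z])
  then show "\<exists>r\<in>carrier S. f x \<otimes>\<^bsub>C\<^esub> (f x \<otimes>\<^bsub>C\<^esub> z) = r \<odot>\<^bsub>C\<^esub> f x" using r(1) by blast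
 qed
 have xy: "extremal S C x" "extremal S C y" "extremal_form S C x y = \<ominus>\<^bsub>S\<^esub> ([(2::nat)] \<cdot>\<^bsub>S\<^esub> \<one>\<^bsub>S\<^esub>)"
  using p by (auto simp: extremal_pairs_def)
 then have c: "x : carrier C" "y : carrier C" by (auto simp: extremal_def)
 have "extremal_form S C (f x) (f y) = extremal_form S C x y"
  unfolding extremal_form_def using eq[OF c] by (metis (no_types, lifting))
 then show ?thesis using xy ex by (simp add: extremal_pairs_def)
qed

lemma pair_action_group_action:
 assumes C: "module S C" "bilinear_mult S C"
 shows "group_action (aut_group S C) (extremal_pairs S C) (pair_action S C)"
proof -
 let ?G = "aut_group S C" and ?E = "extremal_pairs S C"
 note ae = aut_extremal[OF C]
 have Ec: "fst p : carrier C" "snd p : carrier C" if "p : ?E" for p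
  using that by (auto simp: extremal_pairs_def extremal_def)
 have mem: "(f (fst p), f (snd p)) : ?E" if "f : carrier ?G" "p : ?E" for f p using ae[OF that(1), of "fst p" "snd p"] that(2) by simp
 have Bij: "pair_action S C f : Bij ?E" if f: "f : carrier ?G" for f
 proof -
  obtain g where g: "g : carrier ?G" "!!x. x : carrier C ==> g (f x) = x" "!!x. x : carrier C ==> f (g x) = x"
   by (rule aut_group_inverse[OF C f]) (rule that; assumption)
  have "bij_betw (pair_action S C f) ?E ?E"
   by (rule bij_betw_byWitness[where f' = "pair_action S C g"])
    (auto simp: pair_action_def g(2,3)[OF Ec(1), simplified] g(2,3)[OF Ec(2), simplified] mem[OF f] mem[OF g(1)] split_beta
     intro: ae[OF f] ae[OF g(1)])
  then show ?thesis by (simp add: Bij_def pair_action_def)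
 qed
 have "pair_action S C : hom ?G (BijGroup ?E)"
 proof (rule homI)
  fix f g assume f: "f : carrier ?G" and g: "g : carrier ?G"
  show "pair_action S C f : carrier (BijGroup ?E)" using Bij[OF f] by (simp add: BijGroup_def)
  have "pair_action S C (f \<otimes>\<^bsub>?G\<^esub> g) = compose ?E (pair_action S C f) (pair_action S C g)"
   by (rule ext) (auto simp: pair_action_def aut_group_def compose_def restrict_def mem[OF g] dest: Ec)
  then show "pair_action S C (f \<otimes>\<^bsub>?G\<^esub> g) = pair_action S C f \<otimes>\<^bsub>BijGroup ?E\<^esub> pair_action S C g"
   using Bij[OF f] Bij[OF g] by (simp add: BijGroup_def)
 qed
 then show ?thesis
  by (intro group_action.intro group_hom.intro group_hom_axioms.intro aut_group_group[OF C] group_BijGroup)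
qed

section \<open>The homogeneous components and the stabilizer\<close>

context tkk_model
begin

text \<open>P subtracts the four coordinate parts. It kills the generators of nonzero degree and
  fixes the brackets \<open>V x y\<close>, so its values lie in their span; on the common kernel of
  the coordinates P is the identity.\<close>

lemma degree_0_span:
 "{z : carrier L. cp z = \<zero>\<^bsub>S\<^esub> \<and> vp z = \<zero>\<^bsub>B\<^esub> \<and> vm z = \<zero>\<^bsub>B\<^esub> \<and> cm z = \<zero>\<^bsub>S\<^esub>} =
  lin_span S L {V x y | x y. x : CB \<and> y : CB}" (is "?K = lin_span S L ?X")
proof -
 define Z where "Z = lin_span S L ?X"
 have X: "?X \<subseteq> CL" by auto
 note sp = lin_span_submodule[OF L_module X, folded Z_def]
 note f = submodule_facts[OF L_module sp(1)]
 define P where "P z = z \<ominus> ((cp z \<odot> Jp \<oplus> Ip (vp z)) \<oplus> (Im (vm z) \<oplus> cm z \<odot> Jm))" for z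
 have P: "P z : Z" if z: "z : CL" for z
  using z
 proof (induction rule: gen_induct)
  case (V x y)
  then have "V x y : Z" by (intro subsetD[OF sp(2)]) blast
  moreover have "P (V x y) = V x y"
   using V L.M.minus_equality[of "\<zero>" "\<zero>"] by (simp add: P_def zero a_minus_def)
  ultimately show ?case by simp
 next
  case (add x y)
  then have "P (x \<oplus> y) = P x \<oplus> P y"
   by (simp add: P_def linear a_minus_def L.M.minus_add L.smult_l_distr L.M.a_ac)
  with add show ?case by (simp add: f)
 next
  case (smult r x)
  then have "P (r \<odot> x) = r \<odot> P x"
   by (simp add: P_def linear a_minus_def L.M.minus_add L.smult_r_distr L.smult_r_minus L.smult_assoc1)
  with smult show ?case by (simp add: f)
 qed (simp_all add: P_def zero a_minus_def L.M.r_neg f)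
 have mz: "\<ominus> \<zero> = \<zero>" by (rule L.M.minus_equality) simp_all
 have "?K \<subseteq> Z"
 proof
  fix z assume z: "z : ?K"
  then have "P z = z" by (simp add: P_def zero a_minus_def mz)
  then show "z : Z" using P[of z] z by simp
 qed
 moreover have "Z \<subseteq> ?K"
  unfolding Z_def by (rule lin_span_subset[OF submoduleI'[OF L_module]]) (auto simp: linear zero intro!: exI[of _ "\<zero>"])
 ultimately show ?thesis by (simp add: Z_def)
qed

lemma comps_eq:
 "comps = {(%c. c \<odot> Jp) ` carrier S, Ip ` CB, lin_span S L {V x y | x y. x : CB \<and> y : CB},
  Im ` CB, (%c. c \<odot> Jm) ` carrier S}"
proof -
 have "{z : carrier L. z = cp z \<odot> Jp} = (%c. c \<odot> Jp) ` carrier S"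
  by (intro equalityI subsetI) (blast intro: c_facts(1), auto simp: c_facts)
 moreover have "{z : carrier L. z = cm z \<odot> Jm} = (%c. c \<odot> Jm) ` carrier S"
  by (intro equalityI subsetI) (blast intro: c_facts(4), auto simp: c_facts)
 moreover have "{z : carrier L. z = Ip (vp z)} = Ip ` CB"
  by (intro equalityI subsetI) (blast intro: v_facts(1), auto)
 moreover have "{z : carrier L. z = Im (vm z)} = Im ` CB"
  by (intro equalityI subsetI) (blast intro: v_facts(4), auto)
 ultimately show ?thesis unfolding comps_def degree_0_span by simp
qed

end

context brown_ext
begin

text \<open>The skew elements are the multiples of \<open>j\<close>, so after base change the
  components of degree 2 and -2 are spanned by the single elements \<open>JP\<close> and
  \<open>JM\<close>.\<close>

lemma span_degree_2:
 "lin_span S LL (tu ` in_p2 R B ` skew B) = (%c. c \<odot>\<^bsub>LL\<^esub> JP) ` carrier S"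
 "lin_span S LL (tu ` in_m2 R B ` skew B) = (%c. c \<odot>\<^bsub>LL\<^esub> JM) ` carrier S"
proof -
 have *: "lin_span S LL X = (%c. c \<odot>\<^bsub>LL\<^esub> J) ` carrier S" if J: "J : X" "X \<subseteq> (%c. c \<odot>\<^bsub>LL\<^esub> J) ` carrier S" "J : CL" for X J
 proof -
  have "(%c. c \<odot>\<^bsub>LL\<^esub> J) : lin_maps S (self_module S) LL"
   using J by (intro lin_mapsI) (simp_all add: LL.smult_l_distr LL.smult_assoc1)
  from lin_image_submodule[OF self_module[OF LS.cring_S] LL.module_axioms this]
  have N: "submodule ((%c. c \<odot>\<^bsub>LL\<^esub> J) ` carrier S) S LL" by simp
  have X: "X \<subseteq> CL" using J by auto
  note sp = lin_span_submodule[OF LL.module_axioms X]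
  show ?thesis
   using lin_span_subset[OF N J(2)] sp(2) J(1) submodule_facts(5)[OF LL.module_axioms sp(1)] by blast
 qed
 have s: "tu (in_p2 R B s) = sc (kap s) \<odot>\<^bsub>LL\<^esub> JP" "tu (in_m2 R B s) = sc (kap s) \<odot>\<^bsub>LL\<^esub> JM" if "s : skew B" for s
  using that kap[OF that] j(1) by (simp_all add: JP_def JM_def tu_hom ins_linear[symmetric])
 show "lin_span S LL (tu ` in_p2 R B ` skew B) = (%c. c \<odot>\<^bsub>LL\<^esub> JP) ` carrier S"
  by (rule *) (use j(1) jc s kap(1) sc_closed in \<open>auto simp: JP_def[symmetric] intro!: image_eqI[of JP _ "in_p2 R B j"]\<close>)
 show "lin_span S LL (tu ` in_m2 R B ` skew B) = (%c. c \<odot>\<^bsub>LL\<^esub> JM) ` carrier S"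
  by (rule *) (use j(1) jc s kap(1) sc_closed in \<open>auto simp: JM_def[symmetric] intro!: image_eqI[of JM _ "in_m2 R B j"]\<close>)
qed

lemma span_degree_1:
 "lin_span S LL (tu ` in_p1 R B ` CB) = IP ` CI" "lin_span S LL (tu ` in_m1 R B ` CB) = IM ` CI"
proof -
 have *: "lin_span S LL ((%x. f (tn x)) ` CB) = f ` CI" if f: "f : lin_maps S BI LL" for f
 proof -
  note l = lin_mapsD[OF f]
  have X: "(%x. f (tn x)) ` CB \<subseteq> CL" using l(1) by auto
  note sp = lin_span_submodule[OF LL.module_axioms X] and N = lin_image_submodule[OF BI_module LL.module_axioms f]
  have "f x : lin_span S LL ((%x. f (tn x)) ` CB)" if "x : CI" for x
   using that
  proof (induction rule: BI_induct)
   case (tens m)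
   then show ?case using sp(2) by auto
  qed (simp_all add: l submodule_facts[OF LL.module_axioms sp(1)])
  moreover have "(%x. f (tn x)) ` CB \<subseteq> f ` CI" by auto
  ultimately show ?thesis using lin_span_subset[OF N] by blast
 qed
 have "tu ` in_p1 R B ` CB = (%x. IP (tn x)) ` CB" "tu ` in_m1 R B ` CB = (%x. IM (tn x)) ` CB"
  unfolding image_image by (rule image_cong; simp add: I_tn)+
 then show "lin_span S LL (tu ` in_p1 R B ` CB) = IP ` CI" "lin_span S LL (tu ` in_m1 R B ` CB) = IM ` CI"
  using *[OF I_lin(1)] *[OF I_lin(2)] by simp_all
qed

lemma span_degree_0:
 "lin_span S LL (tu ` in_0 R B ` Vs) = lin_span S LL {IP x \<star> IM y | x y. x : CI \<and> y : CI}"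
 (is "lin_span S LL ?X = lin_span S LL ?Y")
proof -
 have X: "?X \<subseteq> CL" and Y: "?Y \<subseteq> CL" by (auto simp: IL LLb)
 define Z W where "Z = lin_span S LL ?X" "W = lin_span S LL ?Y"
 note sX = lin_span_submodule[OF LL.module_axioms X, folded Z_W_def]
 note sY = lin_span_submodule[OF LL.module_axioms Y, folded Z_W_def]
 note fX = submodule_facts[OF LL.module_axioms sX(1)] and fY = submodule_facts[OF LL.module_axioms sY(1)]
 have "tu (in_0 R B D) : W" if D: "D : Vs" for D
  using D
 proof -
  have "D : Vs \<and> tu (in_0 R B D) : W"
   using D
  proof (induction rule: lin_span_induct[OF _ End.module_axioms V_gens, folded V_span_def, consumes 1])
   fix D assume "D : {V_op B x y | x y. x : CB \<and> y : CB}"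
   then obtain x y where xy: "x : CB" "y : CB" "D = V_op B x y" by auto
   then have "tu (in_0 R B D) = IP (tn x) \<star> IM (tn y)" by (simp add: pairing_tn)
   moreover have "IP (tn x) \<star> IM (tn y) : ?Y" using xy(1,2) tn_closed by blast
   ultimately show "D : Vs \<and> tu (in_0 R B D) : W" using sY(2) xy by auto
  qed (simp_all add: ins_linear tu_hom(1,3)[symmetric] tu_hom(5)[OF ins_closed(1)[OF j(1)], symmetric] fY)
  then show ?thesis by simp
 qed
 then have 1: "Z \<subseteq> W" unfolding Z_W_def(1) by (intro lin_span_subset[OF sY(1)]) auto
 have "IP x \<star> IM y : Z" if "x : CI" "y : CI" for x y
  using that
 proof (induction rule: BI_induct2)
  case (tens x y)
  then have "tu (in_0 R B (V_op B x y)) : ?X" by simp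
  then show ?case using tens sX(2) by (simp add: pairing_tn(1) subset_iff)
 qed (simp_all add: IL LLb fX)
 then have 2: "W \<subseteq> Z" unfolding Z_W_def(2) by (intro lin_span_subset[OF sX(1)]) auto
 show ?thesis using 1 2 by (simp add: Z_W_def)
qed

theorem stabilizer_brown:
 "(JP, inv\<^bsub>S\<^esub> sc \<mu> \<odot>\<^bsub>LL\<^esub> JM) : extremal_pairs S LL"
 "{f : carrier (aut_group S LL). f JP = JP \<and> f (inv\<^bsub>S\<^esub> sc \<mu> \<odot>\<^bsub>LL\<^esub> JM) = inv\<^bsub>S\<^esub> sc \<mu> \<odot>\<^bsub>LL\<^esub> JM} =
  from_L1 R S B ` inv_triple S BI (tn j)"
proof -
 obtain n :: nat and e e' where M: "tkk_model S LL BI (tn j) (sc \<mu>) JP JM IP IM CP CM VP VM n e e'" by (rule model)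
 interpret M: tkk_model S LL BI "tn j" "sc \<mu>" JP JM IP IM CP CM VP VM n e e' by (rule M)
 show "(JP, inv\<^bsub>S\<^esub> sc \<mu> \<odot>\<^bsub>LL\<^esub> JM) : extremal_pairs S LL" by (rule M.extremal_pair)
 have comps: "tkk_components R S B = M.comps"
  unfolding tkk_components_def M.comps_eq image_insert image_empty span_degree_0 span_degree_1 span_degree_2 by blast
 have "graded_auts R S B = {f. M.graded f}" by (auto simp: graded_auts_def M.graded_def comps)
 moreover have "restrict_L1 R S B = M.restr" by (rule ext) (simp only: restrict_L1_def M.restr_def IP_def[symmetric] Let_def)
 ultimately show "{f : carrier (aut_group S LL). f JP = JP \<and> f (inv\<^bsub>S\<^esub> sc \<mu> \<odot>\<^bsub>LL\<^esub> JM) = inv\<^bsub>S\<^esub> sc \<mu> \<odot>\<^bsub>LL\<^esub> JM} =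
  from_L1 R S B ` inv_triple S BI (tn j)"
  unfolding from_L1_def M.stabilizer_eq by simp
qed

end

theorem proposition6p5:
  fixes R :: "'r ring"
    and B :: "('r, 'b) inv_algebra"
    and S :: "('r, 's) module"
    and j :: 'b and \<mu> :: 'r
  assumes "cring R"
    and "[(6::nat)] \<cdot>\<^bsub>R\<^esub> \<one>\<^bsub>R\<^esub> \<in> Units R"
    and "brown_algebra TYPE('t) R B"
    and "j \<in> skew B"
    and "\<mu> \<in> Units R"
    and "j \<otimes>\<^bsub>B\<^esub> j = \<mu> \<odot>\<^bsub>B\<^esub> \<one>\<^bsub>B\<^esub>"
    and "algebra R S"
  shows
    "let L = tkk R B;
         L\<^sub>S = base_change R S L;
         p = (tensor R S L (in_p2 R B j) \<one>\<^bsub>S\<^esub>,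
              tensor R S L (inv\<^bsub>R\<^esub> \<mu> \<odot>\<^bsub>L\<^esub> in_m2 R B j) \<one>\<^bsub>S\<^esub>)
     in group_action (aut_group S L\<^sub>S) (extremal_pairs S L\<^sub>S) (pair_action S L\<^sub>S) \<and>
        p \<in> extremal_pairs S L\<^sub>S \<and>
        stabilizer (aut_group S L\<^sub>S) (pair_action S L\<^sub>S) p =
          from_L1 R S B ` inv_triple S (inv_base_change R S B) (tensor R S B j \<one>\<^bsub>S\<^esub>)"
proof -
  obtain T :: "('r, 't) module" where T: "algebra R T" "faithfully_flat R T"
    "inv_algebra_isomorphic T (inv_base_change R T B) (split_brown T)"
    using assms(3) by (auto simp: brown_algebra_def)
  obtain h0 where h0: "h0 \<in> lin_maps T (inv_base_change R T B) (split_brown T)"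
      "bij_betw h0 (carrier (inv_base_change R T B)) (carrier (split_brown T))"
      "h0 \<one>\<^bsub>inv_base_change R T B\<^esub> = \<one>\<^bsub>split_brown T\<^esub>"
      "\<forall>x\<in>carrier (inv_base_change R T B). \<forall>y\<in>carrier (inv_base_change R T B).
         h0 (x \<otimes>\<^bsub>inv_base_change R T B\<^esub> y) = h0 x \<otimes>\<^bsub>split_brown T\<^esub> h0 y"
      "\<forall>x\<in>carrier (inv_base_change R T B). h0 (invol (inv_base_change R T B) x) = invol (split_brown T) (h0 x)"
    using T(3) by (auto simp: inv_algebra_isomorphic_def)
  interpret brown_ext R B T h0 j \<mu> S
  proof (rule brown_ext.intro[OF split_form.intro brown_ext_axioms.intro])
    show "algebra_with_involution R B" "fg_projective R B" using assms(3) by (simp_all add: brown_algebra_def)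
  qed (use T h0 assms in blast)+
  let ?L = "tkk R B" and ?LS = "base_change R S (tkk R B)"
  let ?p = "(tensor R S ?L (in_p2 R B j) \<one>\<^bsub>S\<^esub>, tensor R S ?L (inv\<^bsub>R\<^esub> \<mu> \<odot>\<^bsub>?L\<^esub> in_m2 R B j) \<one>\<^bsub>S\<^esub>)"
  \<comment> \<open>The scalar \<mu>^-1 moves from \<open>R\<close> across the tensor sign and
    becomes the inverse of the image of \<mu> in \<open>S\<close>, which is the form used by the
    model.\<close>
  have "tensor R S ?L (inv\<^bsub>R\<^esub> \<mu> \<odot>\<^bsub>?L\<^esub> in_m2 R B j) \<one>\<^bsub>S\<^esub> = inv\<^bsub>S\<^esub> sc \<mu> \<odot>\<^bsub>?LS\<^esub> JM"
    using tu_hom(3)[OF ins_closed(2)[OF j(1)] nu_closed(1)] by (simp add: tkk_simps JM_def sc_Units(2)[OF j(2)])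
  then have p: "?p = (JP, inv\<^bsub>S\<^esub> sc \<mu> \<odot>\<^bsub>?LS\<^esub> JM)" by (simp add: JP_def)
  have "stabilizer (aut_group S ?LS) (pair_action S ?LS) ?p =
      {f \<in> carrier (aut_group S ?LS). f JP = JP \<and> f (inv\<^bsub>S\<^esub> sc \<mu> \<odot>\<^bsub>?LS\<^esub> JM) = inv\<^bsub>S\<^esub> sc \<mu> \<odot>\<^bsub>?LS\<^esub> JM}"
    unfolding p using stabilizer_brown(1) by (simp add: stabilizer_def pair_action_def)
  then show ?thesis
    unfolding Let_def using pair_action_group_action[OF LL.module_axioms LL_bil] stabilizer_brown p by simp
qed

end
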